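(* The ideal of relations $\widetilde K_n\vartriangleleft\sigma\langle\widetilde X\rangle$ for $R^{GL(n)}\simeq\sigma\langle\widetilde X\rangle/\widetilde K_n$ is generated (as an ideal) by - $\sigma_{\underline t}(a_1,\ldots,a_u)=0$, where $a_i\in\langle X\rangle$ for $1\le i\le u$ and $\underline t\in\mathbb{N}^u$ ($u>1$) satisfies: $t_1\ge\cdots\ge t_u$; $t_1,\ldots,t_u\in\{1,p,p^2,p^3,\ldots\}$; and either $|\underline t|=n+1$, or $n+1<|\underline t|\le2n$ and $|\underline t|-\min\{t_i\}\le n$; - $\sigma_t(b)=0$, where $t>n$ and $b\in\langle\widetilde X\rangle$.
   Context: Let $\mathbb{F}$ be an infinite field of arbitrary characteristic $p\ge 0$ and $n>1$ an integer. Ideals are two-sided, $\mathbb{N}=\{1,2,\ldots\}$, $\mathbb{N}_0=\mathbb{N}\sqcup\{0\}$, $|\underline{t}|=t_1+\cdots+t_u$. For $p=0$ the condition $t_i\in\{1,p,p^2,\ldots\}$ with $t_i\in\mathbb{N}$ means $t_i=1$. A relation $f=h$ is identified with the element $f-h$. Matrices. $R=\mathbb{F}[x_{ij}(k)\mid 1\le i,j\le n,\ k\ge 1]$ and $X_k=(x_{ij}(k))_{1\le i,j\le n}$ are the generic matrices. For an $n\times n$ matrix $A$ define $\sigma_t(A)$ by $\det(\lambda E-A)=\sum_{t=0}^n(-1)^t\lambda^{n-t}\sigma_t(A)$. $R^{GL(n)}\subset R$ is the algebra of matrix $GL(n)$-invariants, i.e. the subalgebra generated by all $\sigma_t(A)$,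 $1\le t\le n$, $A$ a monomial in generic matrices. Words. $\langle X\rangle$ is the free semigroup (without unity) on letters $x_1,x_2,\ldots$; $\langle X\rangle^{\#}=\langle X\rangle\sqcup\{1\}$; $\mathbb{F}\langle X\rangle$ is the vector space with basis $\langle X\rangle$. $\phi_n$ is the multiplicative linear map on $\mathbb{F}\langle X\rangle$ with $x_k\mapsto X_k$. $\langle X\rangle$ carries the lexicographical linear order with $x_1>x_2>\cdots$ and $ab>a$. Words $a,b$ are cyclic equivalent if $a=a_1a_2$, $b=a_2a_1$ for some $a_1,a_2\in\langle X\rangle^{\#}$. A word $a$ is primitive if $a\ne b^l$ for all $b\in\langle X\rangle$, $l>1$. $\langle\widetilde X\rangle$ is the set of maximal representatives of the cyclic equivalence classes of primitive words. $\mathrm{mdeg}(a)=(\deg_{x_1}(a),\deg_{x_2}(a),\ldots)$. Free algebras. $\sigma\langle X\rangle$ is the commutative polynomial ring over $\mathbb{F}$ freely generated by symbols $\sigma_t(a)$, where $t\ge1$ and $a\in\mathbb{F}\langle X\rangle$ has coefficient $1$ in its highest term; put $\sigma_t(\alpha a)=\alpha^t\sigma_t(a)$ for $\alpha\in\mathbb{F}$ and $\sigma_0(a)=1$. The large free algebra $\sigma\langle\widetilde X\rangle$ is the commutative polynomial ring over $\mathbb{F}$ freely generated by symbols $\sigma_t(e)$, $t>0$, $e\in\langle\widetilde X\rangle$. Special elements. For $\underline t\in\mathbb{N}_0^u$ let $\Omega(\underline t)$ be the set of multisets $\omega$ consisting of pairwise different $e_1,\ldots,e_q\in\langle\widetilde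 X\rangle$ ($q>0$) with multiplicities $k_1,\ldots,k_q\in\mathbb{N}$ such that $\sum_i k_i\,\mathrm{mdeg}(e_i)=\underline t$; put $\sigma(\omega)=(-1)^{k_1+\cdots+k_q}\sigma_{k_1}(e_1)\cdots\sigma_{k_q}(e_q)$ and $\sigma_{\underline t}(x_1,\ldots,x_u)=(-1)^{|\underline t|}\sum_{\omega\in\Omega(\underline t)}\sigma(\omega)\in\sigma\langle X\rangle$ (equal to $1$ if $\Omega(\underline t)$ is empty). For $t>0$, $F_t(x_1,\ldots,x_u)=\sum\sigma_{\underline t}(x_1,\ldots,x_u)$ over $\underline t\in\mathbb{N}_0^u$ with $|\underline t|=t$. For $a_i\in\mathbb{F}\langle X\rangle$, $\sigma_{\underline t}(a_1,\ldots,a_u)$ and $F_t(a_1,\ldots,a_u)$ are the results of the substitutions $x_i\to a_i$. For $t\ge1$, $l\ge2$ there is a unique polynomial $P_{t,l}$ in $tl$ variables with coefficients in the image of $\mathbb{Z}$ in $\mathbb{F}$ such that $\sigma_t(A^l)=P_{t,l}(\sigma_1(A),\ldots,\sigma_{tl}(A))$ for all $m\times m$ matrices $A$ over commutative $\mathbb{F}$-algebras with $m\ge tl$; $P_{t,l}(a)=P_{t,l}(\sigma_1(a),\ldots,\sigma_{tl}(a))\in\sigma\langle X\rangle$. The map $\widetilde\pi$. By a theorem of Donkin there is a surjective homomorphism $\widetilde\pi:\sigma\langle X\rangle\to\sigma\langle\widetilde X\rangle$ with $\widetilde\pi(\sigma_t(e))=\sigma_t(e)$ for $e\in\langle\widetilde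 X\rangle$, whose kernel is the ideal generated by $\sigma_t(a_1+\cdots+a_u)-F_t(a_1,\ldots,a_u)$, $\sigma_t(a^l)-P_{t,l}(a)$, $\sigma_t(ab)-\sigma_t(ba)$, where $t>0$, $l,u>1$, $a_i\in\mathbb{F}\langle X\rangle$, $a,b\in\langle X\rangle$. Elements of $\sigma\langle X\rangle$ are regarded as elements of $\sigma\langle\widetilde X\rangle$ via $\widetilde\pi$. $\widetilde K_n$ is the kernel of the surjective homomorphism $\widetilde\Phi_n:\sigma\langle\widetilde X\rangle\to R^{GL(n)}$ with $\sigma_t(e)\mapsto\sigma_t(\phi_n(e))$ for $1\le t\le n$ and $\sigma_t(e)\mapsto0$ for $t>n$. *)

theory Defs
  imports
    "HOL-Library.Poly_Mapping"
    "HOL-Library.Multiset"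
    "HOL-Computational_Algebra.Computational_Algebra"
    "Jordan_Normal_Form.Char_Poly"
begin

section \<open>Polynomial rings and their ideals\<close>

text \<open>The commutative polynomial ring over \<open>'a\<close> freely generated by the elements of \<open>'v\<close>.\<close>
type_synonym ('v, 'a) mpoly = "('v \<Rightarrow>\<^sub>0 nat) \<Rightarrow>\<^sub>0 'a"

definition Const :: "'a::comm_ring_1 \<Rightarrow> ('v, 'a) mpoly" where
  "Const c = Poly_Mapping.single 0 c"

definition Var :: "'v \<Rightarrow> ('v, 'a::comm_ring_1) mpoly" where
  "Var v = Poly_Mapping.single (Poly_Mapping.single v 1) 1"

definition subst :: "('v \<Rightarrow> ('w, 'a::comm_ring_1) mpoly) \<Rightarrow> ('v, 'a) mpoly \<Rightarrow> ('w, 'a) mpoly" where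
  "subst g f = (\<Sum>m\<in>Poly_Mapping.keys f. Const (Poly_Mapping.lookup f m) *
     (\<Prod>v\<in>Poly_Mapping.keys m. g v ^ Poly_Mapping.lookup m v))"

definition vars :: "('v, 'a::comm_ring_1) mpoly \<Rightarrow> 'v set" where
  "vars f = (\<Union>m\<in>Poly_Mapping.keys f. Poly_Mapping.keys m)"

definition alg_hom :: "(('v, 'a::comm_ring_1) mpoly \<Rightarrow> ('w, 'a) mpoly) \<Rightarrow> bool" where
  "alg_hom h \<longleftrightarrow> (\<forall>f g. h (f + g) = h f + h g) \<and> (\<forall>f g. h (f * g) = h f * h g) \<and>
     (\<forall>c. h (Const c) = Const c)"

definition subalgebra :: "('v, 'a::comm_ring_1) mpoly set \<Rightarrow> bool" where
  "subalgebra B \<longleftrightarrow> (\<forall>c. Const c \<in> B) \<and> (\<forall>f\<in>B. \<forall>g\<in>B. f + g \<in> B \<and> f * g \<in> B)"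

definition alg_generated :: "('v, 'a::comm_ring_1) mpoly set \<Rightarrow> ('v, 'a) mpoly set" where
  "alg_generated S = \<Inter> {B. subalgebra B \<and> S \<subseteq> B}"

text \<open>An ideal of a commutative ring is a submodule of the ring over itself.\<close>
definition ideal_generated :: "'r::comm_ring_1 set \<Rightarrow> 'r set" where
  "ideal_generated S = module.span (*) S"

section \<open>Matrices\<close>

text \<open>For \<open>t \<le> n\<close> this is the coefficient defined by
  \<open>det (\<lambda>E - A) = (\<Sum>t\<le>n. (-1)^t \<lambda>^(n-t) \<sigma>\<^sub>t(A))\<close>; it is never used for \<open>t > n\<close>.\<close>
definition sigma_mat :: "nat \<Rightarrow> 'r::comm_ring_1 mat \<Rightarrow> 'r" where
  "sigma_mat t A = (- 1) ^ t * coeff (char_poly A) (dim_row A - t)"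

text \<open>The variable \<open>x\<^sub>i\<^sub>j(k)\<close> is \<open>Var (i, j, k)\<close>. All indices start at \<open>0\<close>, and indices
  \<open>i, j \<ge> n\<close> also exist in the type; they do not occur in the generic \<open>n \<times> n\<close> matrices.\<close>
type_synonym 'a gen_poly = "(nat \<times> nat \<times> nat, 'a) mpoly"

definition generic_mat :: "nat \<Rightarrow> nat \<Rightarrow> 'a::comm_ring_1 gen_poly mat" where
  "generic_mat n k = mat n n (\<lambda>(i, j). Var (i, j, k))"

text \<open>A word is a list of letters, the letter \<open>k\<close> standing for \<open>x\<^sub>k\<^sub>+\<^sub>1\<close>.\<close>
definition phi :: "nat \<Rightarrow> nat list \<Rightarrow> 'a::comm_ring_1 gen_poly mat" where
  "phi n w = foldr (\<lambda>k A. generic_mat n k * A) w (1\<^sub>m n)"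

definition R_GL :: "nat \<Rightarrow> 'a::comm_ring_1 gen_poly set" where
  "R_GL n = alg_generated {sigma_mat t (phi n w) | t w. 1 \<le> t \<and> t \<le> n \<and> w \<noteq> []}"

section \<open>Words\<close>

text \<open>Lexicographical order with \<open>x\<^sub>1 > x\<^sub>2 > \<dots>\<close> and \<open>ab > a\<close>; smaller letters have larger index.\<close>
definition word_less :: "nat list \<Rightarrow> nat list \<Rightarrow> bool" where
  "word_less u v \<longleftrightarrow> (u, v) \<in> lexord {(i, j). j < i}"

definition cyc_equiv :: "nat list \<Rightarrow> nat list \<Rightarrow> bool" where
  "cyc_equiv a b \<longleftrightarrow> (\<exists>a1 a2. a = a1 @ a2 \<and> b = a2 @ a1)"

definition primitive :: "nat list \<Rightarrow> bool" where
  "primitive a \<longleftrightarrow> a \<noteq> [] \<and> (\<forall>b l. b \<noteq> [] \<and> 1 < l \<longrightarrow> a \<noteq> concat (replicate l b))"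

definition X_tilde :: "nat list set" where
  "X_tilde = {a. primitive a \<and> (\<forall>b. cyc_equiv a b \<longrightarrow> b = a \<or> word_less b a)}"

text \<open>Words form the free monoid. It is written additively because the product on
  \<open>\<Rightarrow>\<^sub>0\<close> is the convolution with respect to addition of exponents; so
  \<open>nat list \<Rightarrow>\<^sub>0 'a\<close> is the free associative algebra with unity.\<close>
instantiation list :: (type) monoid_add
begin
definition zero_list :: "'a list" where "0 = []"
definition plus_list :: "'a list \<Rightarrow> 'a list \<Rightarrow> 'a list" where "u + v = u @ v"
instance by standard (simp_all add: zero_list_def plus_list_def)
end

type_synonym 'a nc_poly = "nat list \<Rightarrow>\<^sub>0 'a"

text \<open>The free algebra without unity.\<close>
definition FX :: "'a::field nc_poly set" where
  "FX = {a. [] \<notin> Poly_Mapping.keys a}"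

definition word :: "nat list \<Rightarrow> 'a::field nc_poly" where
  "word w = Poly_Mapping.single w 1"

definition highest_word :: "'a::field nc_poly \<Rightarrow> nat list" where
  "highest_word a = (THE w. w \<in> Poly_Mapping.keys a \<and>
     (\<forall>v\<in>Poly_Mapping.keys a. v = w \<or> word_less v w))"

definition highest_coeff :: "'a::field nc_poly \<Rightarrow> 'a" where
  "highest_coeff a = Poly_Mapping.lookup a (highest_word a)"

section \<open>The free algebras\<close>

lemma highest_coeff_word: "highest_coeff (word w :: 'a::field nc_poly) = 1"
proof -
  have "highest_word (word w :: 'a nc_poly) = w"
    unfolding highest_word_def word_def by (rule the_equality) auto
  then show ?thesis by (simp add: highest_coeff_def word_def)
qed

typedef (overloaded) 'a::field sigma_symbol =
  "{(t::nat, a::'a nc_poly). 1 \<le> t \<and> a \<in> FX \<and> a \<noteq> 0 \<and> highest_coeff a = 1}"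
proof
  have "word [0] \<noteq> (0 :: 'a nc_poly)"
    by (metis word_def lookup_single_eq lookup_zero zero_neq_one)
  then show "(1, word [0]) \<in>
      {(t::nat, a::'a nc_poly). 1 \<le> t \<and> a \<in> FX \<and> a \<noteq> 0 \<and> highest_coeff a = 1}"
    using highest_coeff_word[of "[0]", where 'a = 'a] by (simp add: FX_def word_def)
qed

type_synonym 'a sigmaX = "('a sigma_symbol, 'a) mpoly"

text \<open>\<open>sg t a\<close> is the element \<open>\<sigma>\<^sub>t(a)\<close> for an arbitrary \<open>a \<in> FX\<close>, using
  \<open>\<sigma>\<^sub>0(a) = 1\<close> and \<open>\<sigma>\<^sub>t(\<alpha>a) = \<alpha>\<^sup>t\<sigma>\<^sub>t(a)\<close> (in particular \<open>\<sigma>\<^sub>t(0) = 0\<close> for \<open>t > 0\<close>).\<close>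
definition sg :: "nat \<Rightarrow> 'a::field nc_poly \<Rightarrow> 'a sigmaX" where
  "sg t a = (if t = 0 then 1 else if a = 0 then 0 else
     Const (highest_coeff a ^ t) *
     Var (Abs_sigma_symbol (t, Poly_Mapping.single [] (inverse (highest_coeff a)) * a)))"

lemma single_letter_X_tilde: "[k] \<in> X_tilde"
proof -
  have "primitive [k]"
    unfolding primitive_def
  proof (intro conjI allI impI notI)
    fix b :: "nat list" and l :: nat
    assume b: "b \<noteq> [] \<and> 1 < l" and eq: "[k] = concat (replicate l b)"
    have "length [k] = l * length b"
      by (subst eq) (simp add: length_concat sum_list_replicate)
    with b show False by (cases b) auto
  qed simp
  moreover have "b = [k]" if "cyc_equiv [k] b" for b
    using that by (auto simp: cyc_equiv_def Cons_eq_append_conv)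
  ultimately show ?thesis by (auto simp: X_tilde_def)
qed

typedef large_symbol = "{(t::nat, e). 0 < t \<and> e \<in> X_tilde}"
  by (rule exI[of _ "(1, [0])"]) (simp add: single_letter_X_tilde)

type_synonym 'a large_sigmaX = "(large_symbol, 'a) mpoly"

definition large_sg :: "nat \<Rightarrow> nat list \<Rightarrow> 'a::field large_sigmaX" where
  "large_sg t e = Var (Abs_large_symbol (t, e))"

section \<open>Special elements\<close>

text \<open>A tuple in \<open>\<nat>\<^sub>0\<^sup>u\<close> is a list of length \<open>u\<close>; \<open>count_list e i\<close> is the degree of \<open>e\<close> in
  the letter \<open>i\<close>.\<close>
definition Omega :: "nat list \<Rightarrow> nat list multiset set" where
  "Omega ts = {\<omega>. \<omega> \<noteq> {#} \<and> set_mset \<omega> \<subseteq> X_tilde \<and>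
     (\<forall>i. (\<Sum>e\<in>set_mset \<omega>. count \<omega> e * count_list e i) = (if i < length ts then ts ! i else 0))}"

text \<open>The value of a word in the letters \<open>0, \<dots>, u - 1\<close> after replacing the \<open>i\<close>-th letter by the
  \<open>i\<close>-th entry of a list of length \<open>u\<close>.\<close>
definition word_subst :: "'a::field nc_poly list \<Rightarrow> nat list \<Rightarrow> 'a nc_poly" where
  "word_subst as e = prod_list (map (\<lambda>i. as ! i) e)"

text \<open>\<open>sigma_multi ts as\<close> is \<open>\<sigma>\<^sub>t(a\<^sub>1,\<dots>,a\<^sub>u)\<close>, i.e. \<open>\<sigma>\<^sub>t(x\<^sub>1,\<dots>,x\<^sub>u)\<close> with
  every symbol \<open>\<sigma>\<^sub>k(e)\<close> replaced by \<open>\<sigma>\<^sub>k(e(a\<^sub>1,\<dots>,a\<^sub>u))\<close>.\<close>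
definition sigma_multi :: "nat list \<Rightarrow> 'a::field nc_poly list \<Rightarrow> 'a sigmaX" where
  "sigma_multi ts as = (if Omega ts = {} then 1 else
     (- 1) ^ sum_list ts * (\<Sum>\<omega>\<in>Omega ts. (- 1) ^ size \<omega> *
       (\<Prod>e\<in>set_mset \<omega>. sg (count \<omega> e) (word_subst as e))))"

definition F_elem :: "nat \<Rightarrow> 'a::field nc_poly list \<Rightarrow> 'a sigmaX" where
  "F_elem t as = (\<Sum>ts\<in>{ts. length ts = length as \<and> sum_list ts = t}. sigma_multi ts as)"

text \<open>The universal identity is tested on all matrices over the polynomial ring with countably
  many variables over \<open>'a\<close>. This is the same as testing it over all commutative \<open>'a\<close>-algebras,
  because that ring contains a generic matrix of every size, which specialises to every matrix.\<close>
definition P_poly :: "nat \<Rightarrow> nat \<Rightarrow> (nat, 'a::field) mpoly" where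
  "P_poly t l = (THE P. vars P \<subseteq> {1..t * l} \<and> (\<forall>m. Poly_Mapping.lookup P m \<in> \<int>) \<and>
     (\<forall>m \<ge> t * l. \<forall>A \<in> carrier_mat m m.
        sigma_mat t (A ^\<^sub>m l) = subst (\<lambda>k. sigma_mat k A :: 'a gen_poly) P))"

definition P_elem :: "nat \<Rightarrow> nat \<Rightarrow> 'a::field nc_poly \<Rightarrow> 'a sigmaX" where
  "P_elem t l a = subst (\<lambda>k. sg k a) (P_poly t l)"

section \<open>The maps onto the large free algebra and onto the invariants\<close>

definition sigma_relations :: "'a::field sigmaX set" where
  "sigma_relations =
     {sg t (sum_list as) - F_elem t as | t as. 0 < t \<and> 1 < length as \<and> set as \<subseteq> FX} \<union>
     {sg t (word a ^ l) - P_elem t l (word a) | t l a. 0 < t \<and> 1 < l \<and> a \<noteq> []} \<union>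
     {sg t (word a * word b) - sg t (word b * word a) | t a b. 0 < t \<and> a \<noteq> [] \<and> b \<noteq> []}"

text \<open>The defining properties of the homomorphism of Donkin's theorem. They determine it, since
  modulo the relations every \<open>\<sigma>\<^sub>t(a)\<close> is a polynomial in the \<open>\<sigma>\<^sub>k(e)\<close> with \<open>e \<in> X_tilde\<close>.\<close>
definition is_pi_tilde :: "('a::field sigmaX \<Rightarrow> 'a large_sigmaX) \<Rightarrow> bool" where
  "is_pi_tilde \<pi> \<longleftrightarrow> alg_hom \<pi> \<and> surj \<pi> \<and>
     (\<forall>t e. 0 < t \<and> e \<in> X_tilde \<longrightarrow> \<pi> (sg t (word e)) = large_sg t e) \<and>
     {f. \<pi> f = 0} = ideal_generated sigma_relations"

definition Phi_tilde :: "nat \<Rightarrow> 'a::field large_sigmaX \<Rightarrow> 'a gen_poly" where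
  "Phi_tilde n = subst (\<lambda>s. case Rep_large_symbol s of (t, e) \<Rightarrow>
     if t \<le> n then sigma_mat t (phi n e) else 0)"

definition K_tilde :: "nat \<Rightarrow> 'a::field large_sigmaX set" where
  "K_tilde n = {f. Phi_tilde n f = 0}"

end

(*
The invariants of N x N matrices are compared for all N at once.  Amitsur's formula, together with
the faithfulness of the generic matrices of all sizes, identifies the large free algebra with the
families (F_N) generated by the coefficients of characteristic polynomials of words, and the
substitution into generic matrices factors through Donkin's map.

Every monomial in the generators is, up to sign, a coefficient of the generating determinant
det(1 + (sum_b y_{jb} x_{j'b} A_{k(b)})_{j,j'}), in which the letters b are copies of the generic
matrices A_k.  Such a coefficient is labelled by a pair of fillings, the exponents of y and of x.
Replacing one row or one letter by a sum of two relates these coefficients linearly, and an exchange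
argument straightens every label to a pair of lattice fillings.  If a row of the label is longer
than n, a Schur complement turns the coefficient into a combination of elements
sigma_t(a_1, ..., a_u) with |t| > n, which lie in the ideal.  The remaining coefficients are linearly
independent on n x n matrices: for A_k = sum_q u_{kq} w_{kq}^T their Leibniz expansions have distinct
extremal monomials.

Finally every sigma_t(a_1, ..., a_u) with |t| > n reduces to the listed elements: an exponent that is
not a power of p splits with an invertible binomial coefficient, and if t_1 + ... + t_{u-1} > n then
expanding the product of sigma_{t_1, ..., t_{u-1}}(a_1, ..., a_{u-1}) with sigma_{t_u}(a_u) expresses
sigma_t(a_1, ..., a_u) through elements with smaller |t| > n.
*)
theory Submission
 imports Defs "HOL-Combinatorics.Permutations" "HOL-Library.List_Lexorder" "HOL-Algebra.Exponent"
begin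

abbreviation "lookup == Poly_Mapping.lookup"
abbreviation "keys == Poly_Mapping.keys"
abbreviation "single == Poly_Mapping.single"
abbreviation iff_ascii (infixr "<->" 25) where "(A::bool) <-> B == A = B"
abbreviation pw :: "nat => 'a list => 'a list" where "pw k w == concat (replicate k w)"
type_synonym 'v mon = "'v \<Rightarrow>\<^sub>0 nat"
type_synonym xyvar = "bool * nat * nat"
type_synonym uvar = "bool * nat * nat * nat"

section \<open>Polynomial evaluation\<close>

definition monoval :: "('v => 'r::comm_ring_1) => ('v mon) => 'r" where
 "monoval g m = (\<Prod>v\<in>keys m. g v ^ lookup m v)"

definition ev :: "('a::comm_ring_1 => 'r::comm_ring_1) => ('v => 'r) => ('v, 'a) mpoly => 'r" where
 "ev h g f = (\<Sum>m\<in>keys f. h (lookup f m) * monoval g m)"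

lemma subst_eq_ev: "subst g = ev Const g" by (rule ext) (simp add: subst_def ev_def monoval_def)

lemma monoval_superset: assumes "finite S" "keys m <= S" shows "monoval g m = (\<Prod>v\<in>S. g v ^ lookup m v)"
 unfolding monoval_def using assms by (intro prod.mono_neutral_left) (auto simp: in_keys_iff)

lemma monoval_add: "monoval g (m + m') = monoval g m * monoval g m'"
proof -
 let ?S = "keys m Un keys m'"
 have "keys (m + m') <= ?S" by (rule keys_add)
 hence "monoval g (m + m') = (\<Prod>v\<in>?S. g v ^ lookup (m + m') v)" by (intro monoval_superset) auto
 also have "... = (\<Prod>v\<in>?S. g v ^ lookup m v) * (\<Prod>v\<in>?S. g v ^ lookup m' v)" by (simp add: lookup_add power_add prod.distrib)
 also have "... = monoval g m * monoval g m'" by (subst (1 2) monoval_superset[of ?S]) auto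
 finally show ?thesis .
qed

lemma monoval_zero [simp]: "monoval g 0 = 1" by (simp add: monoval_def)

lemma monoval_single [simp]: "monoval g (single v k) = g v ^ k" by (cases "k = 0") (auto simp: monoval_def)

lemma ev_superset: assumes "comm_ring_hom h" "finite S" "keys f <= S" shows "ev h g f = (\<Sum>m\<in>S. h (lookup f m) * monoval g m)"
proof -
 interpret comm_ring_hom h by fact
 show ?thesis unfolding ev_def using assms(2,3) by (intro sum.mono_neutral_left) (auto simp: in_keys_iff)
qed

lemma ev_add: assumes "comm_ring_hom h" shows "ev h g (f + f') = ev h g f + ev h g f'"
proof -
 interpret comm_ring_hom h by fact
 let ?S = "keys f Un keys f'"
 have k: "keys (f + f') <= ?S" by (rule keys_add)
 show ?thesis by (subst (1 2 3) ev_superset[OF assms, of ?S])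
    (use k in "auto simp: lookup_add hom_add algebra_simps sum.distrib")
qed

lemma ev_zero [simp]: "ev h g 0 = 0" by (simp add: ev_def)

lemma ev_sum: "comm_ring_hom h ==> ev h g (sum f A) = (\<Sum>a\<in>A. ev h g (f a))"
 by (induction A rule: infinite_finite_induct) (auto simp: ev_add)

lemma ev_single: assumes "comm_ring_hom h" shows "ev h g (single m c) = h c * monoval g m"
proof -
 interpret comm_ring_hom h by fact
 show ?thesis by (cases "c = 0") (auto simp: ev_def)
qed

lemma mpoly_expand: "f = (\<Sum>m\<in>keys f. single m (lookup f m))" by (rule poly_mapping_eqI)
   (auto simp: lookup_sum lookup_single when_def in_keys_iff)

lemma ev_hom: fixes h :: "'a::comm_ring_1 => 'r::comm_ring_1" assumes "comm_ring_hom h" shows "comm_ring_hom (ev h g)"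
proof -
 interpret comm_ring_hom h by fact
 have mult: "ev h g (f * f') = ev h g f * ev h g f'" for f f' proof -
  let ?s = "%f. (\<Sum>m\<in>keys f. single m (lookup f m))"
  have "ev h g (?s f * ?s f') = ev h g (?s f) * ev h g (?s f')" by (simp add: sum_product mult_single ev_sum[OF assms] ev_single[OF assms] hom_mult
     monoval_add mult_ac)
  thus ?thesis by (simp flip: mpoly_expand)
 qed
 have "ev h g (single 0 1) = 1" by (subst ev_single[OF assms]) simp
 thus ?thesis by unfold_locales (auto simp: ev_add[OF assms] mult)
qed

lemma Const_hom: "comm_ring_hom (Const :: 'a::comm_ring_1 => ('v, 'a) mpoly)"
 by unfold_locales (auto simp: Const_def single_add mult_single simp flip: single_one)

lemma subst_hom: "comm_ring_hom (subst g)" unfolding subst_eq_ev by (rule ev_hom[OF Const_hom])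

lemma comm_ring_hom_compose: "comm_ring_hom f ==> comm_ring_hom g ==> comm_ring_hom (%x. f (g x))"
proof -
 assume a: "comm_ring_hom f" "comm_ring_hom g"
 interpret f: comm_ring_hom f by fact
 interpret g: comm_ring_hom g by fact
 show ?thesis by unfold_locales (auto simp: f.hom_add g.hom_add f.hom_mult g.hom_mult)
qed

lemma comm_ring_hom_id: "comm_ring_hom (%x. x :: 'r::comm_ring_1)" by unfold_locales auto

lemma ev_Const [simp]: "comm_ring_hom h ==> ev h g (Const c) = h c" by (simp add: Const_def ev_single)

lemma ev_Var [simp]: assumes "comm_ring_hom h" shows "ev h g (Var v) = g v"
proof -
 interpret comm_ring_hom h by fact
 show ?thesis by (simp add: Var_def ev_single[OF assms])
qed

lemma subst_Const [simp]: "subst g (Const c) = Const c" and subst_Var [simp]: "subst g (Var v) = g v" by (simp_all add: subst_eq_ev Const_hom)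

lemma mpoly_eq_ev: "f = ev Const Var f"
proof -
 have [simp]: "monoval Var m = (single m 1 :: ('a,'b) mpoly)" for m :: "'a mon" proof -
  have p: "(Var v :: ('a,'b) mpoly) ^ k = single (single v k) 1" for v k
   by (induction k) (auto simp: Var_def mult_single simp flip: single_add single_one)
  have pr: "(\<Prod>a\<in>A. single (s a) (1::'b)) = single (sum s A) 1"
   if "finite A" for A and s :: "'a => ('a mon)" using that by (induction A rule: finite_induct) (auto simp: mult_single)
  show ?thesis unfolding monoval_def by (simp add: p pr flip: mpoly_expand)
 qed
 show ?thesis unfolding ev_def by (subst mpoly_expand) (simp add: Const_def mult_single)
qed

lemma hom_eqI: fixes \<phi> \<psi> :: "('v, 'a::comm_ring_1) mpoly => 'r::comm_ring_1"
 assumes "comm_ring_hom \<phi>" "comm_ring_hom \<psi>" "!!c. \<phi> (Const c) = \<psi> (Const c)" "!!v. v \<in> vars f ==> \<phi> (Var v) = \<psi> (Var v)"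
 shows "\<phi> f = \<psi> f"
proof -
 interpret p: comm_ring_hom \<phi> by fact
 interpret q: comm_ring_hom \<psi> by fact
 have e: "f = (\<Sum>m\<in>keys f. Const (lookup f m) * (\<Prod>v\<in>keys m. Var v ^ lookup m v))"
  by (subst (1) mpoly_eq_ev) (simp add: ev_def monoval_def)
 have "\<phi> (Const (lookup f m) * (\<Prod>v\<in>keys m. Var v ^ lookup m v)) = \<psi> (Const (lookup f m) * (\<Prod>v\<in>keys m. Var v ^ lookup m v))"
  if "m \<in> keys f" for m
 proof -
  have "(\<Prod>v\<in>keys m. \<phi> (Var v) ^ lookup m v) = (\<Prod>v\<in>keys m. \<psi> (Var v) ^ lookup m v)"
   using that by (intro prod.cong refl arg_cong2[of _ _ _ _ "(^)"] assms(4)) (auto simp: vars_def)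
  thus ?thesis by (simp add: p.hom_mult q.hom_mult p.hom_prod q.hom_prod p.hom_power q.hom_power assms(3))
 qed
 thus ?thesis by (subst (1 2) e) (simp add: p.hom_sum q.hom_sum)
qed

lemma lookup_Const_mult: "lookup (Const c * f) m = c * lookup f m"
proof -
 have "Const c * f = (\<Sum>m\<in>keys f. single m (c * lookup f m))" by (subst (1) mpoly_expand) (simp add: Const_def sum_distrib_left mult_single)
 thus ?thesis by (auto simp: lookup_sum lookup_single when_def in_keys_iff)
qed

lemma Const_simps: fixes a b :: "'a::comm_ring_1"
 shows "Const (a + b) = (Const a + Const b :: ('v, 'a) mpoly)" "Const (a * b) = (Const a * Const b :: ('v, 'a) mpoly)"
 "Const (0::'a) = (0 :: ('v, 'a) mpoly)" "Const (1::'a) = (1 :: ('v, 'a) mpoly)"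
 "Const (- a) = (- Const a :: ('v, 'a) mpoly)" "Const (a ^ k) = (Const a ^ k :: ('v, 'a) mpoly)"
proof -
 interpret comm_ring_hom "Const :: 'a => ('v, 'a) mpoly" by (rule Const_hom)
 show "Const (a + b) = (Const a + Const b :: ('v, 'a) mpoly)" "Const (a * b) = (Const a * Const b :: ('v, 'a) mpoly)"
 "Const (0::'a) = (0 :: ('v, 'a) mpoly)" "Const (1::'a) = (1 :: ('v, 'a) mpoly)"
 "Const (- a) = (- Const a :: ('v, 'a) mpoly)" "Const (a ^ k) = (Const a ^ k :: ('v, 'a) mpoly)"
  by (simp_all add: hom_add hom_mult hom_uminus hom_power)
qed

section \<open>Determinants over finite index sets\<close>

definition Dt :: "'i set => ('i => 'i => 'r::comm_ring_1) => 'r" where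
 "Dt I f = (\<Sum>p | p permutes I. of_int (sign p) * (\<Prod>i\<in>I. f i (p i)))"

lemma Dt_cong: "(!!i j. i \<in> I ==> j \<in> I ==> f i j = g i j) ==> Dt I f = Dt I g" unfolding Dt_def
 by (intro sum.cong refl arg_cong2[of _ _ _ _ "(*)"] prod.cong) (auto simp: permutes_in_image)

lemma Dt_hom: assumes "comm_ring_hom h" shows "h (Dt I f) = Dt I (%i j. h (f i j))"
proof -
 interpret comm_ring_hom h by fact
 have n: "h (of_nat k) = of_nat k" for k by (induction k) (auto simp: hom_add)
 have "h (of_int z) = of_int z" for z by (cases z) (auto simp: hom_uminus hom_minus n)
 thus ?thesis by (simp add: Dt_def hom_sum hom_mult hom_prod)
qed

lemma bij_betw_map_permutation: assumes "bij_betw f A B" shows "bij_betw (map_permutation A f) {p. p permutes A} {p. p permutes B}"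
proof -
 have "map_permutation A f = (%p x. if x \<in> B then f (p (inv_into A f x)) else x)"
  using assms by (auto simp: map_permutation_def restrict_id_def fun_eq_iff bij_betw_def)
 thus ?thesis using bij_betw_permutations[OF assms] by simp
qed

lemma Dt_reindex: assumes h: "bij_betw h I J" and fin: "finite I" shows "Dt J f = Dt I (%i j. f (h i) (h j))"
proof -
 have fJ: "finite J" using h fin bij_betw_finite by blast
 have "Dt J f = (\<Sum>p | p permutes I. of_int (sign (map_permutation I h p)) * (\<Prod>j\<in>J. f j (map_permutation I h p j)))"
  unfolding Dt_def by (rule sum.reindex_bij_betw[OF bij_betw_map_permutation[OF h], symmetric])
 also have "... = Dt I (%i j. f (h i) (h j))" unfolding Dt_def proof (intro sum.cong refl)
  fix p assume "p \<in> {p. p permutes I}"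
  hence p: "p permutes I" by simp
  have "(\<Prod>j\<in>J. f j (map_permutation I h p j)) = (\<Prod>i\<in>I. f (h i) (map_permutation I h p (h i)))"
   by (rule prod.reindex_bij_betw[OF h, symmetric])
  also have "... = (\<Prod>i\<in>I. f (h i) (h (p i)))" using h by (intro prod.cong refl) (auto simp: map_permutation_apply bij_betw_def)
  finally show "of_int (sign (map_permutation I h p)) * (\<Prod>j\<in>J. f j (map_permutation I h p j)) = of_int (sign p) * (\<Prod>i\<in>I. f (h i) (h (p i)))"
   using sign_map_permutation[OF _ p fin, of h] h by (simp add: bij_betw_def)
 qed
 finally show ?thesis .
qed

lemma Dt_eq_det: "Dt {0..<n} f = det (mat n n (%(i, j). f i j))" unfolding Dt_def det_def dim_row_mat dim_col_mat if_P[OF refl]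
 by (intro sum.cong refl arg_cong2[of _ _ _ _ "(*)"] prod.cong) auto

lemma ex_enum: "finite I ==> \<exists>h. bij_betw h {0..<card I} I" using ex_bij_betw_nat_finite by blast

lemma Dt_mult: assumes fin: "finite I" shows "Dt I (%i j. \<Sum>k\<in>I. f i k * g k j) = Dt I f * Dt I g"
proof -
 obtain h where h: "bij_betw h {0..<card I} I" using ex_enum[OF fin] by blast
 let ?n = "card I"
 let ?m = "%f. mat ?n ?n (%(i, j). f (h i) (h j))"
 have "Dt I (%i j. \<Sum>k\<in>I. f i k * g k j) = det (?m (%i j. \<Sum>k\<in>I. f i k * g k j))"
  by (simp add: Dt_reindex[OF h] Dt_eq_det)
 also have "?m (%i j. \<Sum>k\<in>I. f i k * g k j) = ?m f * ?m g" proof (rule eq_matI)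
  fix i j assume "i < dim_row (?m f * ?m g)" "j < dim_col (?m f * ?m g)"
  thus "?m (%i j. \<Sum>k\<in>I. f i k * g k j) $$ (i, j) = (?m f * ?m g) $$ (i, j)"
   by (simp add: scalar_prod_def sum.reindex_bij_betw[OF h, symmetric])
 qed auto
 also have "det ... = det (?m f) * det (?m g)" by (rule det_mult[of _ ?n]) auto
 also have "... = Dt I f * Dt I g" by (simp add: Dt_reindex[OF h] Dt_eq_det)
 finally show ?thesis .
qed

lemma Dt_block: assumes fin: "finite A" "finite B" and disj: "A \<inter> B = {}"
  and z: "!!i j. i \<in> B ==> j \<in> A ==> f i j = 0"
 shows "Dt (A Un B) f = Dt A f * Dt B f"
proof -
 let ?t = "%p. of_int (sign p) * (\<Prod>i\<in>A Un B. f i (p i))"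
 let ?P = "{p. p permutes A Un B & p ` B <= B}"
 have "Dt (A Un B) f = sum ?t ?P" unfolding Dt_def proof (rule sum.mono_neutral_right)
  show "finite {p. p permutes A Un B}" using fin by (simp add: finite_permutations)
  show "\<forall>p\<in>{p. p permutes A Un B} - ?P. ?t p = 0" proof
   fix p assume p: "p \<in> {p. p permutes A Un B} - ?P"
   then obtain b where b: "b \<in> B" "p b \<notin> B" by auto
   hence "p b \<in> A" using p permutes_in_image[of p "A Un B" b] by auto
   hence "f b (p b) = 0" using z b by auto
   hence "(\<Prod>i\<in>A Un B. f i (p i)) = 0" using b fin by (intro prod_zero) auto
   thus "?t p = 0" by simp
  qed
 qed auto
 also have "... = (\<Sum>(a, b)\<in>{p. p permutes A} \<times> {p. p permutes B}. (of_int (sign a) * (\<Prod>i\<in>A. f i (a i))) * (of_int (sign b) * (\<Prod>i\<in>B. f i (b i))))"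
 proof (rule sum.reindex_bij_witness[where i = "%(a, b). a \<circ> b" and j = "%p. (restrict_id p A, restrict_id p B)"])
  fix p assume "p \<in> ?P"
  hence p: "p permutes A Un B" and pB: "p ` B <= B" by auto
  have inj: "inj p" using p permutes_inj by blast
  have pBe: "p ` B = B" using pB fin inj by (metis endo_inj_surj inj_on_subset subset_UNIV)
  have pA: "p ` A <= A" proof
   fix y assume "y \<in> p ` A"
   then obtain a where a: "a \<in> A" "y = p a" by auto
   have "y \<in> A Un B" using a permutes_in_image[OF p, of a] by simp
   moreover have "y \<notin> B" proof
    assume "y \<in> B"
    then obtain b where "b \<in> B" "p b = p a" using pBe a by force
    hence "a = b" using inj by (metis injD)
    thus False using a `b \<in> B` disj by auto
   qed
   ultimately show "y \<in> A" by auto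
  qed
  have pAe: "p ` A = A" using pA fin inj by (metis endo_inj_surj inj_on_subset subset_UNIV)
  have bA: "bij_betw p A A" and bB: "bij_betw p B B" using pAe pBe inj inj_on_subset[OF inj] unfolding bij_betw_def by auto
  have ra: "restrict_id p A permutes A" using bA by (rule permutes_restrict_id)
  have rb: "restrict_id p B permutes B" using bB by (rule permutes_restrict_id)
  show e: "(case (restrict_id p A, restrict_id p B) of (a, b) => a \<circ> b) = p"
   using p pB disj by (auto simp: fun_eq_iff restrict_id_def permutes_def)
  show "(restrict_id p A, restrict_id p B) \<in> {p. p permutes A} \<times> {p. p permutes B}" using ra rb by auto
  have "sign p = sign (restrict_id p A) * sign (restrict_id p B)"
   using e sign_compose[of "restrict_id p A" "restrict_id p B"] ra rb fin permutation_permutes by (metis case_prod_conv)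
  moreover have "(\<Prod>i\<in>A Un B. f i (p i)) = (\<Prod>i\<in>A. f i (restrict_id p A i)) * (\<Prod>i\<in>B. f i (restrict_id p B i))"
   using fin disj by (subst prod.union_disjoint) auto
  ultimately show "(case (restrict_id p A, restrict_id p B) of (a, b) => (of_int (sign a) * (\<Prod>i\<in>A. f i (a i))) * (of_int (sign b) * (\<Prod>i\<in>B. f i (b i)))) = ?t p"
   by (simp add: mult_ac)
 next
  fix ab assume "ab \<in> {p. p permutes A} \<times> {p. p permutes B}"
  then obtain a b where ab: "ab = (a, b)" "a permutes A" "b permutes B" by auto
  have out: "a i = i" if "i \<notin> A" for i using ab that by (simp add: permutes_def)
  have outb: "b i = i" if "i \<notin> B" for i using ab that by (simp add: permutes_def)
  have ina: "a i \<in> A <-> i \<in> A" for i using permutes_in_image[OF ab(2)] by simp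
  have inb: "b i \<in> B <-> i \<in> B" for i using permutes_in_image[OF ab(3)] by simp
  have "a permutes A Un B" "b permutes A Un B" using ab by (auto intro: permutes_subset)
  hence "a \<circ> b permutes A Un B" by (intro permutes_compose)
  moreover have "(a \<circ> b) ` B <= B" proof (rule image_subsetI)
   fix i assume "i \<in> B"
   hence "b i \<in> B" using inb by simp
   moreover from this have "a (b i) = b i" using out disj by blast
   ultimately show "(a \<circ> b) i \<in> B" by simp
  qed
  ultimately show "(case ab of (a, b) => a \<circ> b) \<in> ?P" using ab by simp
  have "restrict_id (a \<circ> b) A i = a i" for i using out[of i] outb disjoint_iff[THEN iffD1, OF disj] by (cases "i \<in> A") auto
  moreover have "restrict_id (a \<circ> b) B i = b i" for i
   using outb out[of "b i"] inb[of i] disjoint_iff[THEN iffD1, OF disj] by (cases "i \<in> B") auto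
  ultimately show "(%p. (restrict_id p A, restrict_id p B)) (case ab of (a, b) => a \<circ> b) = ab" using ab by auto
 qed
 also have "... = Dt A f * Dt B f" by (simp add: Dt_def sum_product sum.cartesian_product)
 finally show ?thesis .
qed

lemma Dt_one: "finite I ==> Dt I (%i j. of_bool (i = j)) = (1 :: 'b::comm_ring_1)"
proof -
 assume fin: "finite I"
 have "Dt I (%i j. of_bool (i = j)) = (\<Sum>p\<in>{id}. of_int (sign p) * (\<Prod>i\<in>I. (of_bool (i = p i) :: 'b)))" unfolding Dt_def
 proof (rule sum.mono_neutral_right)
  show "\<forall>p\<in>{p. p permutes I} - {id}. of_int (sign p) * (\<Prod>i\<in>I. (of_bool (i = p i) :: 'b)) = 0" proof
   fix p assume p: "p \<in> {p. p permutes I} - {id}"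
   then obtain i where "p i ~= i" by fastforce
   moreover from this have "i \<in> I" using p by (auto simp: permutes_def)
   ultimately have "(\<Prod>i\<in>I. (of_bool (i = p i) :: 'b)) = 0" using fin by (intro prod_zero) (auto intro!: bexI[of _ i])
   thus "of_int (sign p) * (\<Prod>i\<in>I. (of_bool (i = p i) :: 'b)) = 0" by simp
  qed
 qed (use fin in "auto simp: finite_permutations permutes_id")
 thus ?thesis by simp
qed

definition D :: "'i set => ('i => 'i => 'r::comm_ring_1) => 'r" where
 "D I M = Dt I (%i j. of_bool (i = j) + M i j)"

lemma D_cong: "(!!i j. i \<in> I ==> j \<in> I ==> f i j = g i j) ==> D I f = D I g"
 unfolding D_def by (rule Dt_cong) auto

lemma D_hom: assumes "comm_ring_hom h" shows "h (D I f) = D I (%i j. h (f i j))"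
proof -
 interpret comm_ring_hom h by fact
 show ?thesis unfolding D_def Dt_hom[OF assms] by (simp add: hom_add of_bool_def if_distrib[of h] cong: if_cong)
qed

lemma D_reindex: "bij_betw h I J ==> finite I ==> D J f = D I (%i j. f (h i) (h j))"
 unfolding D_def by (subst Dt_reindex[of h I J]) (auto intro!: Dt_cong simp: bij_betw_def inj_on_eq_iff)

lemma D_zero [simp]: "finite I ==> D I (%i j. 0) = 1" by (simp add: D_def Dt_one)

lemma D_mult: assumes "finite I" shows "D I f * D I g = D I (%i j. f i j + g i j + (\<Sum>k\<in>I. f i k * g k j))"
proof -
 have "D I f * D I g = Dt I (%i j. \<Sum>k\<in>I. (of_bool (i = k) + f i k) * (of_bool (k = j) + g k j))"
  by (simp add: D_def Dt_mult[OF assms])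
 also have "... = D I (%i j. f i j + g i j + (\<Sum>k\<in>I. f i k * g k j))" unfolding D_def proof (rule Dt_cong)
  fix i j assume ij: "i \<in> I" "j \<in> I"
  have "(of_bool (i = k) + f i k) * (of_bool (k = j) + g k j) =
   (if k = i then of_bool (k = j) + g k j else 0) + (if k = j then f i k else 0) + f i k * g k j" for k by (auto simp: algebra_simps of_bool_def)
  thus "(\<Sum>k\<in>I. (of_bool (i = k) + f i k) * (of_bool (k = j) + g k j)) = of_bool (i = j) + (f i j + g i j + (\<Sum>k\<in>I. f i k * g k j))"
   using ij assms by (simp add: sum.distrib sum.delta)
 qed
 finally show ?thesis .
qed

lemma D_block: assumes "finite A" "finite B" "A \<inter> B = {}" "!!i j. i \<in> B ==> j \<in> A ==> f i j = 0"
 shows "D (A Un B) f = D A f * D B f" unfolding D_def using assms by (intro Dt_block) (auto simp: of_bool_def)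

definition schurF :: "('i => 'k => 'r::comm_ring_1) => ('k => 'i => 'r) => 'i + 'k => 'i + 'k => 'r" where
 "schurF u v a b = (case a of
   Inl i => (case b of Inl j => 0 | Inr l => - u i l)
  | Inr k => (case b of Inl j => v k j | Inr l => 0))"

lemma sum_Plus: assumes "finite I" "finite K" shows "(\<Sum>k\<in>I <+> K. f k) = (\<Sum>k\<in>I. f (Inl k)) + (\<Sum>k\<in>K. f (Inr k))"
 using assms unfolding Plus_def by (subst sum.union_disjoint) (auto simp: sum.reindex)

lemma D_Plus_mult: assumes "finite I" "finite K"
 shows "D (I <+> K) f * D (I <+> K) g = D (I <+> K) (%i j. f i j + g i j + ((\<Sum>k\<in>I. f i (Inl k) * g (Inl k) j) + (\<Sum>k\<in>K. f i (Inr k) * g (Inr k) j)))"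
 using assms by (simp add: D_mult sum_Plus)

lemma D_Plus_block: assumes "finite I" "finite K" "!!k i. k \<in> K ==> i \<in> I ==> f (Inr k) (Inl i) = 0"
 shows "D (I <+> K) f = D I (%i j. f (Inl i) (Inl j)) * D K (%i j. f (Inr i) (Inr j))"
proof -
 have "D (I <+> K) f = D (Inl ` I) f * D (Inr ` K) f" unfolding Plus_def using assms by (intro D_block) auto
 thus ?thesis using assms by (simp add: D_reindex[of Inl I "Inl ` I"] D_reindex[of Inr K "Inr ` K"] inj_on_imp_bij_betw)
qed

lemma D_Plus_block': assumes "finite I" "finite K" "!!k i. k \<in> K ==> i \<in> I ==> f (Inl i) (Inr k) = 0"
 shows "D (I <+> K) f = D I (%i j. f (Inl i) (Inl j)) * D K (%i j. f (Inr i) (Inr j))"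
proof -
 have "D (I <+> K) f = D (Inr ` K Un Inl ` I) f" by (simp add: Plus_def Un_commute)
 also have "... = D (Inr ` K) f * D (Inl ` I) f" using assms by (intro D_block) auto
 finally show ?thesis using assms by (simp add: D_reindex[of Inl I "Inl ` I"] D_reindex[of Inr K "Inr ` K"] inj_on_imp_bij_betw mult.commute)
qed

lemma D_schurF: assumes fin: "finite I" "finite K" shows "D (I <+> K) (schurF u v) = D I (%i j. \<Sum>k\<in>K. u i k * v k j)"
  and "D (I <+> K) (schurF u v) = D K (%k l. \<Sum>i\<in>I. v k i * u i l)"
proof -
 define g :: "'a + 'b => 'a + 'b => 'c" where "g = (%a b. case a of Inl i => (case b of Inl j => 0 | Inr l => u i l) | Inr k => 0)"
 define F :: "'a + 'b => 'a + 'b => 'c" where "F = (%a b. case a of Inl i => (case b of Inl j => \<Sum>k\<in>K. u i k * v k j | Inr l => 0)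
   | Inr k => (case b of Inl j => v k j | Inr l => 0))"
 define G :: "'a + 'b => 'a + 'b => 'c" where "G = (%a b. case a of Inl i => 0
   | Inr k => (case b of Inl j => v k j | Inr l => \<Sum>i\<in>I. v k i * u i l))"
 have "D (I <+> K) g = D I (%i j. g (Inl i) (Inl j)) * D K (%i j. g (Inr i) (Inr j))" by (rule D_Plus_block[OF fin]) (simp add: g_def)
 hence g: "D (I <+> K) g = 1" using fin by (simp add: g_def)
 have "D (I <+> K) (schurF u v) = D (I <+> K) g * D (I <+> K) (schurF u v)" using g by simp
 also have "... = D (I <+> K) F" unfolding D_Plus_mult[OF fin] by (rule D_cong) (auto simp: schurF_def g_def F_def)
 also have "... = D I (%i j. F (Inl i) (Inl j)) * D K (%i j. F (Inr i) (Inr j))" by (rule D_Plus_block'[OF fin]) (simp add: F_def)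
 finally show "D (I <+> K) (schurF u v) = D I (%i j. \<Sum>k\<in>K. u i k * v k j)" using fin by (simp add: F_def)
 have "D (I <+> K) (schurF u v) = D (I <+> K) (schurF u v) * D (I <+> K) g" using g by simp
 also have "... = D (I <+> K) G" unfolding D_Plus_mult[OF fin] by (rule D_cong) (auto simp: schurF_def g_def G_def)
 also have "... = D I (%i j. G (Inl i) (Inl j)) * D K (%i j. G (Inr i) (Inr j))" by (rule D_Plus_block'[OF fin]) (simp add: G_def)
 finally show "D (I <+> K) (schurF u v) = D K (%k l. \<Sum>i\<in>I. v k i * u i l)" using fin by (simp add: G_def)
qed

lemma D_sylvester: assumes "finite I" "finite K"
 shows "D I (%i j. \<Sum>k\<in>K. u i k * v k j) = D K (%k l. \<Sum>i\<in>I. v k i * u i l)"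
 by (rule trans[OF D_schurF(1)[OF assms, symmetric] D_schurF(2)[OF assms]])

lemma prod_dvd_diff: fixes f g :: "'i => 'r::comm_ring_1"
 shows "(!!i. i \<in> I ==> q dvd f i - g i) ==> q dvd prod f I - prod g I"
proof (induction I rule: infinite_finite_induct)
 case (insert x I)
 have "f x * prod f I - g x * prod g I = (f x - g x) * prod f I + g x * (prod f I - prod g I)" by (simp add: algebra_simps)
 thus ?case using insert by simp
qed auto

lemma D_dvd: assumes "!!i j. i \<in> I ==> j \<in> I ==> q dvd f i j - g i j" shows "q dvd D I f - D I g"
proof -
 have "D I f - D I g = (\<Sum>p | p permutes I. of_int (sign p) * ((\<Prod>i\<in>I. of_bool (i = p i) + f i (p i)) - (\<Prod>i\<in>I. of_bool (i = p i) + g i (p i))))"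
  unfolding D_def Dt_def by (simp add: sum_subtractf algebra_simps)
 also have "q dvd ..." proof (intro dvd_sum dvd_mult prod_dvd_diff)
  fix p i assume "p \<in> {p. p permutes I}" "i \<in> I"
  hence "p i \<in> I" by (simp add: permutes_in_image)
  thus "q dvd of_bool (i = p i) + f i (p i) - (of_bool (i = p i) + g i (p i))" using assms[OF `i \<in> I`] by (simp add: algebra_simps)
 qed
 finally show ?thesis .
qed

section \<open>Lyndon words\<close>

definition lyn :: "nat list => bool" where
 "lyn w <-> w ~= [] & (\<forall>u v. w = u @ v & u ~= [] & v ~= [] --> w < v)"

lemma append_less_iff [simp]: "u @ v < u @ w <-> v < (w :: nat list)" by (induction u) auto

lemma append_le_iff [simp]: "u @ v <= u @ w <-> v <= (w :: nat list)" by (induction u) auto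

lemma less_append: "v ~= [] ==> u < u @ (v :: nat list)" using append_less_iff[of u "[]" v] by (cases v) auto

lemma list_less_cases:
 "u < (v :: nat list) <-> (\<exists>t. t ~= [] & v = u @ t) \<or> (\<exists>p x y s t. x < y & u = p @ x # s & v = p @ y # t)"
 unfolding list_less_def lexord_def by (auto simp: neq_Nil_conv)

lemma cyc_words_eq: assumes "primitive (u @ v)" "u ~= []" "v ~= []" shows "u @ v ~= v @ u"
proof
 assume "u @ v = v @ u"
 then obtain m n zs where z: "pw m zs = u" "pw n zs = v" using comm_append_are_replicate by metis
 hence e: "u @ v = pw (m + n) zs" by (simp add: replicate_add)
 have "zs ~= []" using z assms(2) by (metis concat_replicate_trivial)
 moreover have "m ~= 0" "n ~= 0" using z assms by auto
 ultimately have "zs ~= [] & 1 < m + n" by linarith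
 thus False using assms(1) e unfolding primitive_def by blast
qed

lemma append_less_of_length:
 "length t = length u ==> u @ v < t @ w ==> u < t \<or> (u = t & v < (w :: nat list))"
 by (induction t u rule: list_induct2) auto

lemma lyn_rotation: assumes "lyn (u @ v)" "u ~= []" "v ~= []" shows "u @ v < v @ u"
proof -
 have l: "u @ v < v" using assms by (auto simp: lyn_def)
 have "~ (\<exists>t. t ~= [] & v = (u @ v) @ t)" proof
  assume "\<exists>t. t ~= [] & v = (u @ v) @ t"
  then obtain t where "v = (u @ v) @ t" by blast
  hence "length v = length ((u @ v) @ t)" by (rule arg_cong)
  thus False using assms by simp
 qed
 then obtain p x y s t where xy: "x < y" and uv: "u @ v = p @ x # s" and v: "v = p @ y # t" using l unfolding list_less_cases by blast
 have vu: "v @ u = p @ y # (t @ u)" by (subst v) simp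
 show ?thesis unfolding uv vu using xy by simp
qed

lemma lyn_primitive: assumes "lyn w" shows "primitive w" unfolding primitive_def
proof (intro conjI allI impI notI)
 show "w = [] ==> False" using assms by (simp add: lyn_def)
 fix b and l :: nat assume b: "b ~= [] & 1 < l" and w: "w = pw l b"
 define c where "c = pw (l - 1) b"
 have l: "l = Suc (l - 1)" using b by simp
 have w1: "w = b @ c" unfolding w c_def by (subst l) simp
 have "c @ b = concat (replicate (l - 1) b @ [b])" by (simp add: c_def)
 also have "... = w" unfolding w replicate_append_same by (subst (2) l) simp
 finally have w2: "c @ b = w" .
 have "c ~= []" using b by (cases "l - 1") (auto simp: c_def)
 hence "b @ c < c @ b" using assms b w1 lyn_rotation by blast
 thus False using w1 w2 by simp
qed

lemma word_less_iff: "length u = length v ==> word_less u v <-> v < u"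
 by (induction u v rule: list_induct2) (auto simp: word_less_def)

lemma X_tilde_iff_lyn: "w \<in> X_tilde <-> lyn w"
proof
 assume w: "lyn w"
 have "b = w \<or> word_less b w" if "cyc_equiv w b" for b proof -
  from that have "\<exists>u v. w = u @ v & b = v @ u" unfolding cyc_equiv_def .
  then obtain u v where uv: "w = u @ v" "b = v @ u" by (elim exE conjE)
  show ?thesis proof (cases "u = [] \<or> v = []")
   case False
   hence "u @ v < v @ u" using w lyn_rotation unfolding uv(1) by simp
   thus ?thesis unfolding uv by (simp add: word_less_iff)
  qed (use uv in auto)
 qed
 thus "w \<in> X_tilde" using lyn_primitive[OF w] by (simp add: X_tilde_def)
next
 assume w: "w \<in> X_tilde"
 hence prim: "primitive w" and m: "cyc_equiv w b ==> b = w \<or> word_less b w" for b by (auto simp: X_tilde_def)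
 have rot: "u @ v < v @ u" if "w = u @ v" "u ~= []" "v ~= []" for u v proof -
  have "cyc_equiv w (v @ u)" unfolding cyc_equiv_def using that(1) by (intro exI conjI) auto
  hence "v @ u = w \<or> word_less (v @ u) w" by (rule m)
  moreover have "v @ u ~= w" using cyc_words_eq[of u v] prim that by metis
  ultimately have "word_less (v @ u) (u @ v)" using that by simp
  thus ?thesis by (simp add: word_less_iff)
 qed
 show "lyn w" unfolding lyn_def proof (intro conjI allI impI)
  show "w ~= []" using prim by (simp add: primitive_def)
  fix u v assume uv: "w = u @ v & u ~= [] & v ~= []"
  show "w < v" proof (rule ccontr)
   assume "~ w < v"
   moreover have "w ~= v" using uv by auto
   ultimately have "v < w" by auto
   then consider t where "t ~= []" "w = v @ t" | p x y s t where "x < y" "v = p @ x # s" "w = p @ y # t" unfolding list_less_cases by blast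
   thus False proof cases
    case 1
    have "v @ t < v @ u" using rot[of u v] uv 1 by metis
    hence "t < u" by simp
    have len: "length t = length u" using 1 uv by (metis add.commute add_left_cancel length_append)
    have "u @ v < t @ v" using rot[of v t] uv 1 by metis
    hence "u <= t" using append_less_of_length[OF len, of v v] by auto
    thus False using `t < u` by auto
   next
    case 2
    have vu: "v @ u = p @ x # (s @ u)" by (subst 2(2)) simp
    have "v @ u < w" unfolding vu 2(3) using 2(1) by simp
    hence "v @ u < u @ v" using uv by simp
    thus False using rot[of u v] uv by (metis order_less_asym)
   qed
  qed
 qed
qed

lemma min_suffix: assumes "\<forall>l\<in>set ls. lyn l" "sorted_wrt (\<ge>) (ls @ [l])" "lyn l" and "concat ls @ l = a @ b" "b ~= []"
 shows "l <= b" "b = l --> a = concat ls"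
proof -
 have "l <= b & (b = l --> a = concat ls)" using assms proof (induction ls arbitrary: a)
  case Nil
  thus ?case by (cases "a = []") (auto simp: lyn_def intro: less_imp_le)
 next
  case (Cons m ls)
  show ?case proof (cases "length m <= length a")
   case True
   define a' where "a' = drop (length m) a"
   have "m = take (length m) a & concat ls @ l = a' @ b" using True Cons.prems(4) append_eq_append_conv_if[of m "concat ls @ l" a b]
    by (simp add: a'_def del: append_eq_append_conv_if)
   moreover have "a = take (length m) a @ a'" by (simp add: a'_def)
   ultimately have "a = m @ a'" "concat ls @ l = a' @ b" by auto
   thus ?thesis using Cons.IH[of a'] Cons.prems by auto
  next
   case False
   define m2 where "m2 = drop (length a) m"
   have "take (length a) m = a & m2 @ concat ls @ l = b" using False Cons.prems(4) by (simp add: append_eq_append_conv_if m2_def)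
   moreover have "m = take (length a) m @ m2" "m2 ~= []" using False by (simp_all add: m2_def)
   ultimately have m2: "m = a @ m2" "m2 ~= []" "b = m2 @ concat ls @ l" by auto
   have "m <= m2" using Cons.prems(1) m2 by (cases "a = []") (auto simp: lyn_def intro: less_imp_le)
   moreover have "l <= m" using Cons.prems by auto
   moreover have "l ~= []" using Cons.prems by (auto simp: lyn_def)
   hence "m2 < b" using m2 less_append by auto
   ultimately show ?thesis by auto
  qed
 qed
 thus "l <= b" "b = l --> a = concat ls" by auto
qed

lemma lyn_factorization_unique:
 assumes "\<forall>l\<in>set ls. lyn l" "sorted_wrt (\<ge>) ls" "\<forall>l\<in>set ms. lyn l" "sorted_wrt (\<ge>) ms" "concat ls = concat ms"
 shows "ls = ms" using assms
proof (induction ls arbitrary: ms rule: rev_induct)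
 case Nil
 thus ?case by (cases ms) (auto simp: lyn_def)
next
 case (snoc l ls)
 hence "ms ~= []" by (auto simp: lyn_def)
 then obtain m ms' where ms: "ms = ms' @ [m]" by (metis rev_exhaust)
 have ne: "l ~= []" "m ~= []" using snoc.prems ms by (auto simp: lyn_def)
 have e: "concat ls @ l = concat ms' @ m" using snoc.prems ms by simp
 have "l <= m" using min_suffix(1)[of ls l "concat ms'" m] snoc.prems e ne by auto
 moreover have "m <= l" using min_suffix(1)[of ms' m "concat ls" l] snoc.prems e ne ms by auto
 ultimately have "l = m" by simp
 thus ?case using snoc.IH[of ms'] snoc.prems ms by (auto simp: sorted_wrt_append)
qed

lemma lyn_factorization_exists:
 "\<exists>ls. concat ls = w & (\<forall>l\<in>set ls. lyn l) & sorted_wrt (\<ge>) ls"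
proof (induction "length w" arbitrary: w rule: less_induct)
 case less
 show ?case proof (cases "w = []")
  case True
  thus ?thesis by (intro exI[of _ "[]"]) auto
 next
  case False
  let ?S = "{v. v ~= [] & (\<exists>u. w = u @ v)}"
  have "?S <= (%i. drop i w) ` {..length w}" proof
   fix v assume "v \<in> ?S"
   then obtain u where "w = u @ v" by blast
   hence "v = drop (length u) w" "length u <= length w" by auto
   thus "v \<in> (%i. drop i w) ` {..length w}" by blast
  qed
  hence fin: "finite ?S" by (rule finite_subset) simp
  define l where "l = Min ?S"
  have ne: "?S ~= {}" using False by auto
  have "l \<in> ?S" unfolding l_def by (rule Min_in[OF fin ne])
  then obtain u where u: "w = u @ l" and l0: "l ~= []" by auto
  have lmin: "l <= v" if "v ~= []" "w = a @ v" for v a unfolding l_def using that by (intro Min_le[OF fin]) auto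
  have lyn: "lyn l" unfolding lyn_def proof (intro conjI allI impI)
   fix a v assume av: "l = a @ v & a ~= [] & v ~= []"
   hence "l <= v" using lmin[of v "u @ a"] u by auto
   moreover have "l ~= v" using av by auto
   ultimately show "l < v" by simp
  qed (rule l0)
  have "length u < length w" using u l0 by simp
  then obtain ls where ls: "concat ls = u" "\<forall>l\<in>set ls. lyn l" "sorted_wrt (\<ge>) ls" using less by blast
  have "l <= m" if "ls = ls' @ [m]" for m ls' proof (rule ccontr)
   assume "~ l <= m"
   hence ml: "m < l" by simp
   have m0: "m ~= []" using ls that by (auto simp: lyn_def)
   have "l <= m @ l" using lmin[of "m @ l" "concat ls'"] u ls(1) that m0 by auto
   hence "l < m @ l" using m0 by (metis append_self_conv2 order_le_imp_less_or_eq)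
   from ml consider t where "t ~= []" "l = m @ t" | p x y s t where "x < y" "m = p @ x # s" "l = p @ y # t" unfolding list_less_cases by blast
   thus False proof cases
    case 1
    hence "t < l" using `l < m @ l` by (metis append_less_iff)
    moreover have "l <= t" using lmin[of t "u @ m"] u 1 by auto
    ultimately show False by simp
   next
    case 2
    hence "m @ l < l" unfolding list_less_cases by (metis append_Cons append_assoc)
    thus False using `l < m @ l` by simp
   qed
  qed
  hence "sorted_wrt (\<ge>) (ls @ [l])" using ls(3) by (cases ls rule: rev_cases) (auto simp: sorted_wrt_append intro: order_trans)
  thus ?thesis using ls lyn u by (intro exI[of _ "ls @ [l]"]) auto
 qed
qed

section \<open>Amitsur's formula\<close>

definition cg :: "'r::comm_ring_1 => 'r => 'r => bool" where
 "cg q a b <-> q dvd a - b"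

lemma cg_refl [simp]: "cg q a a" by (simp add: cg_def)

lemma cg_sym: "cg q a b ==> cg q b a" using dvd_minus_iff[of q "a - b"] by (simp add: cg_def)

lemma cg_trans [trans]: "cg q a b ==> cg q b c ==> cg q a c" using dvd_add[of q "a - b" "b - c"] by (simp add: cg_def)

lemma cg_mult: "cg q a b ==> cg q c d ==> cg q (a * c) (b * d)"
proof -
 assume "cg q a b" "cg q c d"
 hence "q dvd (a - b) * c + b * (c - d)" unfolding cg_def by (intro dvd_add dvd_mult dvd_mult2)
 thus ?thesis unfolding cg_def by (simp add: algebra_simps)
qed

lemma cg_prod_list: "(!!i. i \<in> set I ==> cg q (f i) (g i)) ==> cg q (prod_list (map f I)) (prod_list (map g I))"
 by (induction I) (auto intro!: cg_mult)

lemma Dt_cg: "(!!i j. i \<in> I ==> j \<in> I ==> cg q (f i j) (g i j)) ==> cg q (Dt I f) (Dt I g)"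
 using D_dvd[of I q "%i j. f i j - of_bool (i = j)" "%i j. g i j - of_bool (i = j)"] by (simp add: cg_def D_def)

lemma D_cg: "(!!i j. i \<in> I ==> j \<in> I ==> cg q (f i j) (g i j)) ==> cg q (D I f) (D I g)"
 unfolding cg_def by (rule D_dvd)

primrec wmat :: "'i set => ('l => 'i => 'i => 'r::comm_ring_1) => 'l list => 'i => 'i => 'r" where
 "wmat I X [] = (%i j. of_bool (i = j))"
| "wmat I X (l # w) = (%i j. \<Sum>k\<in>I. X l i k * wmat I X w k j)"

lemma sum_of_bool_left: "finite I ==> i \<in> I ==> (\<Sum>k\<in>I. of_bool (i = k) * f k) = (f i :: 'r::comm_ring_1)"
 by (simp add: of_bool_def if_distrib[of "%x. x * _"] sum.delta cong: if_cong)

lemma sum_of_bool_right: "finite I ==> j \<in> I ==> (\<Sum>k\<in>I. f k * of_bool (k = j)) = (f j :: 'r::comm_ring_1)"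
 by (simp add: of_bool_def if_distrib[of "%x. _ * x"] sum.delta cong: if_cong)

lemma wmat_append: assumes "finite I" shows "i \<in> I ==> wmat I X (u @ v) i j = (\<Sum>k\<in>I. wmat I X u i k * wmat I X v k j)"
proof (induction u arbitrary: i)
 case Nil
 thus ?case using assms by (simp add: sum_of_bool_left)
next
 case (Cons l u)
 have "wmat I X ((l # u) @ v) i j = (\<Sum>k\<in>I. \<Sum>m\<in>I. X l i k * wmat I X u k m * wmat I X v m j)"
  using Cons.IH by (simp add: sum_distrib_left mult.assoc)
 also have "... = (\<Sum>m\<in>I. \<Sum>k\<in>I. X l i k * wmat I X u k m * wmat I X v m j)" by (rule sum.swap)
 finally show ?case by (simp add: sum_distrib_right)
qed

lemma wmat_single: "finite I ==> j \<in> I ==> wmat I X [l] i j = X l i j" by (simp add: sum_of_bool_right)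

lemma wmat_hom: assumes "comm_ring_hom h" shows "h (wmat I X w i j) = wmat I (%l i j. h (X l i j)) w i j"
proof -
 interpret comm_ring_hom h by fact
 show ?thesis by (induction w arbitrary: i) (auto simp: hom_sum hom_mult of_bool_def)
qed

lemma wmat_scale:
 "wmat I (%l i j. c l * X l i j) w i j = prod_list (map c w) * (wmat I X w i j :: 'r::comm_ring_1)"
 by (induction w arbitrary: i) (auto simp: sum_distrib_left mult_ac)

definition Wds :: "nat => nat => nat list set" where
 "Wds u r = {w. set w <= {..<u} & length w <= r}"

definition Lyn :: "nat => nat => nat list set" where
 "Lyn u r = {w \<in> Wds u r. lyn w}"

lemma finite_Wds [simp]: "finite (Wds u r)" unfolding Wds_def by (rule finite_lists_length_le) simp

lemma finite_Lyn [simp]: "finite (Lyn u r)" by (simp add: Lyn_def)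

fun Seqs :: "nat => nat list list => nat list list set" where
 "Seqs r [] = {[]}"
| "Seqs r (l # ls) = (%(k, xs). replicate k l @ xs) ` ({..r} \<times> Seqs r ls)"

lemma Seqs_finite [simp]: "finite (Seqs r ls)" by (induction ls) auto

lemma Seqs_set: "xs \<in> Seqs r ls ==> set xs <= set ls" by (induction ls arbitrary: xs) fastforce+

lemma Seqs_sorted: "sorted_wrt (>) ls ==> xs \<in> Seqs r ls ==> sorted_wrt (\<ge>) xs"
proof (induction ls arbitrary: xs)
 case (Cons l ls)
 then obtain k ys where xs: "xs = replicate k l @ ys" "ys \<in> Seqs r ls" by auto
 have "\<forall>y\<in>set ys. y < l" using Seqs_set[OF xs(2)] Cons.prems(1) by auto
 moreover have "sorted_wrt (\<ge>) (replicate k l)" by (induction k) auto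
 ultimately show ?case using Cons xs by (auto simp: sorted_wrt_append intro: less_imp_le)
qed auto

lemma SeqsI:
 "sorted_wrt (>) ls ==> sorted_wrt (\<ge>) xs ==> set xs <= set ls ==> length xs <= r ==> xs \<in> Seqs r ls"
proof (induction ls arbitrary: xs)
 case (Cons l ls)
 define k where "k = length (takeWhile (%x. x = l) xs)"
 define ys where "ys = dropWhile (%x. x = l) xs"
 have xs: "xs = replicate k l @ ys" proof -
  have "takeWhile (%x. x = l) xs = replicate k l" unfolding k_def by (rule replicate_eqI) (auto dest: set_takeWhileD)
  thus ?thesis unfolding ys_def by (metis takeWhile_dropWhile_id)
 qed
 have "l \<notin> set ys" proof
  assume l: "l \<in> set ys"
  then obtain y zs where yz: "ys = y # zs" by (cases ys) auto
  hence "y ~= l" using hd_dropWhile[of "%x. x = l" xs] unfolding ys_def by auto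
  hence "l \<in> set zs" using l yz by auto
  hence "y \<ge> l" using Cons.prems(2) xs yz by (auto simp: sorted_wrt_append)
  moreover have "y \<in> set (l # ls)" using Cons.prems(3) xs yz by auto
  ultimately show False using Cons.prems(1) `y ~= l` by auto
 qed
 hence "ys \<in> Seqs r ls" using Cons.prems xs by (intro Cons.IH) (auto simp: sorted_wrt_append)
 moreover have "k <= r" using Cons.prems(4) xs by simp
 ultimately show ?case using xs by force
qed auto

lemma Seqs_inj: "sorted_wrt (>) (l # ls) ==> inj_on (%(k, xs). replicate k l @ xs) ({..r} \<times> Seqs r ls)"
proof (rule inj_onI, clarify)
 fix k xs k' ys assume s: "sorted_wrt (>) (l # ls)" and xs: "xs \<in> Seqs r ls" and ys: "ys \<in> Seqs r ls"
  and e: "replicate k l @ xs = replicate k' l @ ys"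
 have "l \<notin> set xs" "l \<notin> set ys" using Seqs_set[OF xs] Seqs_set[OF ys] s by auto
 hence "takeWhile (%x. x = l) (replicate k l @ xs) = replicate k l"
  "takeWhile (%x. x = l) (replicate k' l @ ys) = replicate k' l"
  by (auto simp: takeWhile_append takeWhile_eq_Nil_iff dest: hd_in_set split: if_splits)
 hence "k = k'" using e by (metis length_replicate)
 thus "k = k' & xs = ys" using e by simp
qed

lemma Dt_Seqs: assumes fin: "finite I" and "sorted_wrt (>) ls"
 shows "(\<Prod>l\<leftarrow>ls. Dt I (%i j. \<Sum>k\<le>r. wmat I X (pw k l) i j)) =
  Dt I (%i j. \<Sum>xs\<in>Seqs r ls. wmat I X (concat xs) i j)"
 using assms(2) proof (induction ls)
 case Nil
 thus ?case using fin by (simp add: Dt_one)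
next
 case (Cons l ls)
 have "(\<Prod>l\<leftarrow>l # ls. Dt I (%i j. \<Sum>k\<le>r. wmat I X (pw k l) i j)) =
  Dt I (%i j. \<Sum>k\<le>r. wmat I X (pw k l) i j) * Dt I (%i j. \<Sum>xs\<in>Seqs r ls. wmat I X (concat xs) i j)"
  using Cons by simp
 also have "... = Dt I (%i j. \<Sum>m\<in>I. (\<Sum>k\<le>r. wmat I X (pw k l) i m) * (\<Sum>xs\<in>Seqs r ls. wmat I X (concat xs) m j))"
  by (rule Dt_mult[OF fin, symmetric])
 also have "... = Dt I (%i j. \<Sum>xs\<in>Seqs r (l # ls). wmat I X (concat xs) i j)" proof (rule Dt_cong)
  fix i j assume ij: "i \<in> I" "j \<in> I"
  have "(\<Sum>m\<in>I. (\<Sum>k\<le>r. wmat I X (pw k l) i m) * (\<Sum>xs\<in>Seqs r ls. wmat I X (concat xs) m j)) =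
   (\<Sum>m\<in>I. \<Sum>(k, xs)\<in>{..r} \<times> Seqs r ls. wmat I X (pw k l) i m * wmat I X (concat xs) m j)"
   by (simp add: sum_product sum.cartesian_product)
  also have "... = (\<Sum>(k, xs)\<in>{..r} \<times> Seqs r ls. \<Sum>m\<in>I. wmat I X (pw k l) i m * wmat I X (concat xs) m j)"
   by (subst sum.swap) (simp add: case_prod_unfold)
  also have "... = (\<Sum>(k, xs)\<in>{..r} \<times> Seqs r ls. wmat I X (concat (replicate k l @ xs)) i j)"
   by (intro sum.cong) (auto simp: wmat_append[OF fin ij(1)])
  also have "... = (\<Sum>xs\<in>Seqs r (l # ls). wmat I X (concat xs) i j)"
   unfolding Seqs.simps by (subst sum.reindex[OF Seqs_inj[OF Cons.prems]]) (simp add: case_prod_unfold)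
  finally show "(\<Sum>m\<in>I. (\<Sum>k\<le>r. wmat I X (pw k l) i m) * (\<Sum>xs\<in>Seqs r ls. wmat I X (concat xs) m j)) = (\<Sum>xs\<in>Seqs r (l # ls). wmat I X (concat xs) i j)" .
 qed
 finally show ?case .
qed

lemma D_minus_geometric: assumes fin: "finite I"
  and Q: "!!i j. i \<in> I ==> j \<in> I ==> cg q (\<Sum>m\<in>I. M i m * Q m j) (Q i j - of_bool (i = j))"
 shows "cg q (D I (%i j. - M i j) * Dt I Q) 1"
proof -
 have "D I (%i j. - M i j) * Dt I Q = Dt I (%i j. \<Sum>m\<in>I. (of_bool (i = m) + - M i m) * Q m j)"
  unfolding D_def by (rule Dt_mult[OF fin, symmetric])
 also have "... = Dt I (%i j. Q i j - (\<Sum>m\<in>I. M i m * Q m j))"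
  by (rule Dt_cong) (simp add: fin distrib_right left_diff_distrib sum_subtractf sum_of_bool_left)
 also have "cg q ... (Dt I (%i j. of_bool (i = j)))" proof (rule Dt_cg)
  fix i j assume "i \<in> I" "j \<in> I"
  hence "q dvd - ((\<Sum>m\<in>I. M i m * Q m j) - (Q i j - of_bool (i = j)))" using Q unfolding cg_def dvd_minus_iff by blast
  thus "cg q (Q i j - (\<Sum>m\<in>I. M i m * Q m j)) (of_bool (i = j))" unfolding cg_def by (simp add: algebra_simps)
 qed
 finally show ?thesis using fin by (simp add: Dt_one)
qed

lemma prod_list_map_one: "(\<Prod>x\<leftarrow>xs. 1) = (1 :: 'r::comm_ring_1)" by (induction xs) auto

lemma prod_list_map_mult: "(\<Prod>x\<leftarrow>xs. f x * g x) = (\<Prod>x\<leftarrow>xs. f x) * (\<Prod>x\<leftarrow>xs. g x :: 'r::comm_ring_1)"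
 by (induction xs) (auto simp: mult_ac)

text \<open>Taking determinants in the factorisation of the sum of all words into geometric series of
  Lyndon words, which is the unique factorisation of Chen, Fox and Lyndon.\<close>

theorem amitsur: fixes X :: "nat => 'i => 'i => 'r::comm_ring_1"
 assumes fin: "finite I" and q: "!!w i j. length w > r ==> q dvd wmat I X w i j"
 shows "cg q (D I (%i j. - (\<Sum>l<u. X l i j))) (\<Prod>w\<in>Lyn u r. D I (%i j. - wmat I X w i j))"
proof -
 let ?A = "D I (%i j. - (\<Sum>l<u. X l i j))"
 let ?B = "Dt I (%i j. \<Sum>w\<in>Wds u r. wmat I X w i j)"
 let ?a = "%w. D I (%i j. - wmat I X w i j)"
 let ?b = "%l. Dt I (%i j. \<Sum>k\<le>r. wmat I X (pw k l) i j)"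
 define ls where "ls = rev (sorted_list_of_set (Lyn u r))"
 have ls: "sorted_wrt (>) ls" "set ls = Lyn u r" "distinct ls" unfolding ls_def by (auto simp: sorted_wrt_rev strict_sorted_iff[symmetric])
 have AB: "cg q (?A * ?B) 1" proof (rule D_minus_geometric[OF fin])
  fix i j assume ij: "i \<in> I" "j \<in> I"
  have "(\<Sum>m\<in>I. (\<Sum>l<u. X l i m) * (\<Sum>w\<in>Wds u r. wmat I X w m j)) =
   (\<Sum>m\<in>I. \<Sum>(l, w)\<in>{..<u} \<times> Wds u r. X l i m * wmat I X w m j)" by (simp add: sum_product sum.cartesian_product)
  also have "... = (\<Sum>(l, w)\<in>{..<u} \<times> Wds u r. wmat I X (l # w) i j)" by (subst sum.swap) (simp add: case_prod_unfold)
  also have "... = (\<Sum>w\<in>(%(l, w). l # w) ` ({..<u} \<times> Wds u r). wmat I X w i j)"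
   by (subst sum.reindex) (auto intro!: inj_onI simp: case_prod_unfold)
  also have "(%(l, w). l # w) ` ({..<u} \<times> Wds u r) = {w. set w <= {..<u} & length w <= Suc r & w ~= []}"
  proof (intro equalityI subsetI)
   fix w assume "w \<in> {w. set w <= {..<u} & length w <= Suc r & w ~= []}"
   thus "w \<in> (%(l, w). l # w) ` ({..<u} \<times> Wds u r)" by (cases w) (auto simp: Wds_def image_iff)
  qed (auto simp: Wds_def)
  also have "... = (Wds u r - {[]}) Un {w. set w <= {..<u} & length w = Suc r}" (is "_ = _ Un ?E")
   by (auto simp: Wds_def)
  also have "(\<Sum>w\<in>.... wmat I X w i j) = (\<Sum>w\<in>Wds u r - {[]}. wmat I X w i j) + (\<Sum>w\<in>?E. wmat I X w i j)"
   proof (rule sum.union_disjoint)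
   show "finite (Wds u r - {[]})" by simp
   show "finite ?E" by (rule finite_lists_length_eq) simp
   show "(Wds u r - {[]}) \<inter> ?E = {}" by (auto simp: Wds_def)
  qed
  also have "(\<Sum>w\<in>Wds u r - {[]}. wmat I X w i j) = (\<Sum>w\<in>Wds u r. wmat I X w i j) - of_bool (i = j)"
   by (subst sum_diff1[OF finite_Wds]) (simp add: Wds_def)
  finally show "cg q (\<Sum>m\<in>I. (\<Sum>l<u. X l i m) * (\<Sum>w\<in>Wds u r. wmat I X w m j)) ((\<Sum>w\<in>Wds u r. wmat I X w i j) - of_bool (i = j))"
   unfolding cg_def by (auto intro!: dvd_sum q)
 qed
 have ab: "cg q (?a w * ?b w) 1" if w: "w \<in> set ls" for w proof (rule D_minus_geometric[OF fin])
  fix i j assume ij: "i \<in> I" "j \<in> I"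
  have w0: "length w > 0" using w ls(2) by (auto simp: Lyn_def lyn_def)
  have "(\<Sum>m\<in>I. wmat I X w i m * (\<Sum>k\<le>r. wmat I X (pw k w) m j)) =
   (\<Sum>k\<le>r. \<Sum>m\<in>I. wmat I X w i m * wmat I X (pw k w) m j)" by (simp add: sum_distrib_left) (rule sum.swap)
  also have "... = (\<Sum>k\<le>r. wmat I X (pw (Suc k) w) i j)" by (simp add: wmat_append[OF fin ij(1)])
  also have "... = (\<Sum>k\<le>Suc r. wmat I X (pw k w) i j) - of_bool (i = j)" by (subst sum.atMost_Suc_shift) simp
  also have "... = (\<Sum>k\<le>r. wmat I X (pw k w) i j) - of_bool (i = j) + wmat I X (pw (Suc r) w) i j" by simp
  finally have e: "(\<Sum>m\<in>I. wmat I X w i m * (\<Sum>k\<le>r. wmat I X (pw k w) m j)) = ..." .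
  have "length (pw (Suc r) w) = Suc r * length w" by (simp add: length_concat sum_list_replicate)
  also have "... > r" using w0 by (cases "length w") auto
  finally show "cg q (\<Sum>m\<in>I. wmat I X w i m * (\<Sum>k\<le>r. wmat I X (pw k w) m j)) ((\<Sum>k\<le>r. wmat I X (pw k w) i j) - of_bool (i = j))"
   unfolding e cg_def using q by simp
 qed
 have Bb: "cg q (\<Prod>l\<leftarrow>ls. ?b l) ?B" unfolding Dt_Seqs[OF fin ls(1)] proof (rule Dt_cg)
  fix i j assume ij: "i \<in> I" "j \<in> I"
  let ?S = "{xs \<in> Seqs r ls. length (concat xs) <= r}"
  have lynS: "\<forall>l\<in>set xs. lyn l" "sorted_wrt (\<ge>) xs" "set (concat xs) <= {..<u}" if "xs \<in> Seqs r ls" for xs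
   using Seqs_set[OF that] Seqs_sorted[OF ls(1) that] ls(2) by (auto simp: Lyn_def Wds_def)
  have inj: "inj_on concat ?S" using lynS by (intro inj_onI lyn_factorization_unique) auto
  have im: "concat ` ?S = Wds u r" proof (intro equalityI subsetI)
   fix w assume "w \<in> concat ` ?S"
   then obtain xs where "xs \<in> ?S" "w = concat xs" by blast
   thus "w \<in> Wds u r" using lynS(3)[of xs] by (simp add: Wds_def)
  next
   fix w assume w: "w \<in> Wds u r"
   obtain xs where xs: "concat xs = w" "\<forall>l\<in>set xs. lyn l" "sorted_wrt (\<ge>) xs" using lyn_factorization_exists by blast
   have "length xs <= length (concat xs)" using xs(2) by (induction xs) (auto simp: lyn_def Suc_le_eq neq_Nil_conv)
   moreover have "length l <= length (concat xs)" if "l \<in> set xs" for l using that by (induction xs) auto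
   ultimately have "xs \<in> Seqs r ls" using xs w ls by (intro SeqsI) (fastforce simp: Lyn_def Wds_def)+
   thus "w \<in> concat ` ?S" using xs w by (auto simp: Wds_def)
  qed
  have "Seqs r ls = ?S Un {xs \<in> Seqs r ls. length (concat xs) > r}" (is "_ = _ Un ?T") by auto
  hence "(\<Sum>xs\<in>Seqs r ls. wmat I X (concat xs) i j) = (\<Sum>xs\<in>?S Un ?T. wmat I X (concat xs) i j)" by simp
  also have "... = (\<Sum>xs\<in>?S. wmat I X (concat xs) i j) + (\<Sum>xs\<in>?T. wmat I X (concat xs) i j)" by (rule sum.union_disjoint) auto
  also have "(\<Sum>xs\<in>?S. wmat I X (concat xs) i j) = (\<Sum>w\<in>Wds u r. wmat I X w i j)"
   unfolding im[symmetric] by (subst sum.reindex[OF inj]) simp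
  finally show "cg q (\<Sum>xs\<in>Seqs r ls. wmat I X (concat xs) i j) (\<Sum>w\<in>Wds u r. wmat I X w i j)"
   unfolding cg_def by (auto intro!: dvd_sum q)
 qed
 have "cg q (\<Prod>l\<leftarrow>ls. 1) (\<Prod>l\<leftarrow>ls. ?a l * ?b l)" by (rule cg_prod_list, rule cg_sym, rule ab)
 hence "cg q (?A * 1) (?A * (\<Prod>l\<leftarrow>ls. ?a l * ?b l))" unfolding prod_list_map_one by (intro cg_mult cg_refl)
 also have "?A * (\<Prod>l\<leftarrow>ls. ?a l * ?b l) = ?A * (\<Prod>l\<leftarrow>ls. ?b l) * (\<Prod>l\<leftarrow>ls. ?a l)"
  unfolding prod_list_map_mult by (simp only: mult_ac)
 also have "cg q ... (?A * ?B * (\<Prod>l\<leftarrow>ls. ?a l))" by (intro cg_mult Bb cg_refl)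
 also have "cg q ... (1 * (\<Prod>l\<leftarrow>ls. ?a l))" by (intro cg_mult AB cg_refl)
 also have "(\<Prod>l\<leftarrow>ls. ?a l) = (\<Prod>w\<in>Lyn u r. ?a w)" using ls by (metis prod.distinct_set_conv_list)
 finally show ?thesis by simp
qed

section \<open>Coefficients of the characteristic polynomial\<close>

definition ct :: "'i set => nat => ('i => 'i => 'r::comm_ring_1) => 'r" where
 "ct I t M = coeff (D I (%i j. [:0, M i j:])) t"

lemma poly_hom: "comm_ring_hom (%p. poly p (c :: 'r::comm_ring_1))" by unfold_locales auto

lemma map_poly_hom: assumes "comm_ring_hom h" shows "comm_ring_hom (map_poly h)"
proof -
 interpret h: comm_ring_hom h by fact
 have 1: "map_poly h 1 = 1" by (rule poly_eqI) (auto simp: coeff_map_poly one_pCons coeff_pCons split: nat.split)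
 show ?thesis by unfold_locales (auto simp: 1 poly_eq_iff coeff_map_poly h.hom_add coeff_mult h.hom_sum h.hom_mult)
qed

lemma map_poly_linear: assumes "comm_ring_hom h" shows "map_poly h [:0, x:] = [:0, h x:]"
proof -
 interpret h: comm_ring_hom h by fact
 show ?thesis by (rule poly_eqI) (auto simp: coeff_map_poly coeff_pCons split: nat.split)
qed

lemma linear_poly_sum: "(\<Sum>a\<in>A. [:0, f a:]) = [:0, sum f A :: 'r::comm_ring_1:]" by (induction A rule: infinite_finite_induct) auto

lemma const_poly_hom: "comm_ring_hom (%c :: 'r::comm_ring_1. [:c:])" by unfold_locales (auto simp: one_pCons)

lemma degree_D: "finite I ==> degree (D I (%i j. [:0, M i j:])) <= card I" unfolding D_def Dt_def
proof (rule degree_sum_le)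
 fix p assume fin: "finite I"
 let ?f = "%i. of_bool (i = p i) + [:0, M i (p i):]"
 have "degree (?f i) <= 1" for i by (rule degree_add_le) (auto simp: of_bool_def)
 hence "degree (prod ?f I) <= sum (%_. 1) I"
  using degree_prod_sum_le[OF fin, of ?f] sum_mono[of I "%i. degree (?f i)" "%_. 1"] by (auto simp: o_def)
 moreover have "degree (of_int (sign p) * prod ?f I) <= degree (of_int (sign p) :: 'b poly) + degree (prod ?f I)" by (rule degree_mult_le)
 ultimately show "degree (of_int (sign p) * prod ?f I) <= card I" by simp
qed (simp add: finite_permutations)

lemma ct_eq_0: "finite I ==> card I < t ==> ct I t M = 0"
 unfolding ct_def by (rule coeff_eq_0) (use degree_D[of I M] in linarith)

lemma ct_cong: "(!!i j. i \<in> I ==> j \<in> I ==> f i j = g i j) ==> ct I t f = ct I t g"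
 unfolding ct_def by (rule arg_cong[of _ _ "%p. coeff p t"], rule D_cong) simp

lemma ct_hom: assumes "comm_ring_hom h" shows "h (ct I t M) = ct I t (%i j. h (M i j))"
proof -
 interpret h: comm_ring_hom h by fact
 have "map_poly h (D I (%i j. [:0, M i j:])) = D I (%i j. [:0, h (M i j):])"
  by (simp add: D_hom[OF map_poly_hom[OF assms]] map_poly_linear[OF assms])
 thus ?thesis unfolding ct_def by (metis coeff_map_poly h.hom_zero)
qed

lemma D_ct_bound: assumes "finite I" "card I <= B" shows "D I (%i j. c * M i j) = (\<Sum>t\<le>B. c ^ t * ct I t M)"
proof -
 let ?p = "D I (%i j. [:0, M i j:])"
 have "D I (%i j. c * M i j) = poly ?p c" by (subst D_hom[OF poly_hom]) simp
 also have "... = (\<Sum>t\<le>degree ?p. coeff ?p t * c ^ t)" by (rule poly_altdef)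
 also have "... = (\<Sum>t\<le>B. coeff ?p t * c ^ t)"
  using degree_D[OF assms(1), of M] assms(2) by (intro sum.mono_neutral_left) (auto simp: coeff_eq_0)
 finally show ?thesis by (simp add: ct_def mult.commute)
qed

lemma ct_0 [simp]: "finite I ==> ct I 0 M = 1" using D_ct_bound[of I "card I" 0 M]
 by (simp add: power_0_left if_distrib[of "%x. x * _"] cong: if_cong)

lemma ct_zero: "finite I ==> ct I t (%i j. 0) = of_bool (t = 0)" by (auto simp: ct_def one_pCons coeff_pCons split: nat.splits)

lemma ct_scale: assumes "finite I" shows "ct I t (%i j. c * M i j) = c ^ t * ct I t M"
proof -
 have h: "comm_ring_hom (%p. pcompose p [:0, c:])" by unfold_locales (auto simp: pcompose_add pcompose_mult pcompose_1)
 have "D I (%i j. [:0, c * M i j:]) = pcompose (D I (%i j. [:0, M i j:])) [:0, c:]"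
  by (subst D_hom[OF h]) (simp add: pcompose_pCons mult.commute)
 thus ?thesis by (simp add: ct_def coeff_pcompose_linear)
qed

lemma ct_sylvester: assumes "finite I" "finite K"
 shows "ct I t (%i j. \<Sum>k\<in>K. u i k * v k j) = ct K t (%k l. \<Sum>i\<in>I. v k i * u i l)"
proof -
 have "D I (%i j. [:0, \<Sum>k\<in>K. u i k * v k j:]) = D I (%i j. \<Sum>k\<in>K. [:0, u i k:] * [:v k j:])"
  by (simp add: mult.commute flip: linear_poly_sum)
 also have "... = D K (%k l. \<Sum>i\<in>I. [:v k i:] * [:0, u i l:])" by (rule D_sylvester[OF assms])
 also have "... = D K (%k l. [:0, \<Sum>i\<in>I. v k i * u i l:])" by (simp add: mult.commute flip: linear_poly_sum)
 finally show ?thesis by (simp add: ct_def)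
qed

lemma ct_reindex: "bij_betw h I J ==> finite I ==> ct J t f = ct I t (%i j. f (h i) (h j))"
 unfolding ct_def by (subst D_reindex[of h I J]) auto

subsection \<open>Homogeneous components\<close>

definition wt :: "('v => nat) => ('v mon) => nat" where
 "wt om m = (\<Sum>v\<in>keys m. om v * lookup m v)"

lemma wt_superset: "finite S ==> keys m <= S ==> wt om m = (\<Sum>v\<in>S. om v * lookup m v)"
 unfolding wt_def by (rule sum.mono_neutral_left) (auto simp: in_keys_iff)

lemma wt_add: "wt om (m + m') = wt om m + wt om m'"
proof -
 have "keys (m + m') <= keys m Un keys m'" by (rule Poly_Mapping.keys_add)
 thus ?thesis by (simp add: wt_superset[of "keys m Un keys m'"] lookup_add distrib_left sum.distrib)
qed

lemma wt_0 [simp]: "wt om 0 = 0" by (simp add: wt_def)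

lemma wt_single [simp]: "wt om (single v k) = om v * k" by (cases "k = 0") (simp_all add: wt_def)

lemma wt_sum: "wt om (sum f A) = (\<Sum>a\<in>A. wt om (f a))" by (induction A rule: infinite_finite_induct) (auto simp: wt_add)

definition mdeg :: "('v mon) => nat" where
 "mdeg m = (\<Sum>v\<in>keys m. lookup m v)"

lemma mdeg_wt: "mdeg m = wt (%_. 1) m" by (simp add: mdeg_def wt_def)

lemma mdeg_superset: "finite S ==> keys m <= S ==> mdeg m = (\<Sum>v\<in>S. lookup m v)"
 by (simp add: mdeg_wt wt_superset)

lemma mdeg_add: "mdeg (m + m') = mdeg m + mdeg m'" by (simp only: mdeg_wt wt_add)

lemma mdeg_0 [simp]: "mdeg 0 = 0" by (simp add: mdeg_def)

lemma mdeg_single [simp]: "mdeg (single v k) = k" by (simp add: mdeg_wt)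

lemma mdeg_sum: "mdeg (sum f A) = (\<Sum>a\<in>A. mdeg (f a))" by (simp only: mdeg_wt wt_sum)

lemma Const_poly_hom: "comm_ring_hom (%c :: 'r::comm_ring_1. [:Const c :: ('v, 'r) mpoly:])"
 by (rule comm_ring_hom_compose[OF const_poly_hom Const_hom])

lemma Var_power: "Var v ^ k = single (single v k) 1" by (induction k) (auto simp: Var_def mult_single simp flip: single_add single_one)

lemma prod_single: "finite A ==> (\<Prod>a\<in>A. single (s a) (f a)) = single (sum s A) (prod f A)"
 by (induction A rule: finite_induct) (auto simp: mult_single)

lemma prod_monom: "finite A ==> (\<Prod>a\<in>A. monom (f a) (k a)) = monom (prod f A) (sum k A)"
 by (induction A rule: finite_induct) (auto simp: mult_monom)

lemma poly_mapping_sum_single: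
 "m = (\<Sum>v\<in>keys m. single v (lookup m v))" by (rule poly_mapping_eqI) (auto simp: lookup_sum lookup_single when_def in_keys_iff)

lemma monoval_Var: "monoval Var m = single m 1" unfolding monoval_def by (simp add: Var_power prod_single flip: poly_mapping_sum_single)

definition wgrade :: "('v => nat) => ('v, 'r::comm_ring_1) mpoly => ('v, 'r) mpoly poly" where
 "wgrade om = ev (%c. [:Const c:]) (%v. monom (Var v) (om v))"

lemma wgrade_hom: "comm_ring_hom (wgrade om)" unfolding wgrade_def by (rule ev_hom[OF Const_poly_hom])

lemma wgrade_Const [simp]: "wgrade om (Const c) = [:Const c:]" and wgrade_Var [simp]: "wgrade om (Var v) = monom (Var v) (om v)"
 by (simp_all add: wgrade_def Const_poly_hom)

lemma lookup_wgrade: fixes f :: "('a, 'b::comm_ring_1) mpoly" shows "lookup (coeff (wgrade om f) t) m = (lookup f m when wt om m = t)"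
proof -
 have mv: "monoval (%v. monom (Var v) (om v)) m = monom (single m (1::'b)) (wt om m)" for m :: "'a mon"
  unfolding monoval_def wt_def by (simp add: monom_power prod_monom Var_power prod_single flip: poly_mapping_sum_single)
 have "wgrade om f = (\<Sum>m\<in>keys f. monom (single m (lookup f m)) (wt om m))"
  unfolding wgrade_def ev_def by (simp add: mv smult_monom Const_def mult_single)
 thus ?thesis by (auto simp: coeff_sum lookup_sum lookup_single when_def in_keys_iff if_distrib[of "%p. lookup p _"]
    sum.If_cases intro!: sum.neutral cong: if_cong)
qed

lemma wgrade_eqD: assumes "wgrade om f = wgrade om' f" "lookup f m ~= 0" shows "wt om m = wt om' m"
 using lookup_wgrade[of om f "wt om m" m] lookup_wgrade[of om' f "wt om m" m] assms by (auto simp: when_def split: if_splits)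

definition lmat :: "nat => (nat => 'i => 'i => 'r::comm_ring_1) => 'i => 'i => (nat, 'r) mpoly" where
 "lmat u X = (%i j. \<Sum>l<u. Var l * Const (X l i j))"

lemma lookup_ct_lmat: fixes X :: "nat => 'i => 'i => 'r::comm_ring_1"
 shows "lookup (ct I t (lmat u X)) m = (lookup (D I (lmat u X)) m when mdeg m = t)"
proof -
 interpret g: comm_ring_hom "wgrade (%_. Suc 0)" by (rule wgrade_hom)
 have "wgrade (%_. Suc 0) (D I (lmat u X)) = D I (%i j. [:0, lmat u X i j:])" unfolding D_hom[OF wgrade_hom]
  by (simp add: lmat_def g.hom_sum g.hom_mult mult.commute monom_Suc monom_0 flip: linear_poly_sum)
 thus ?thesis by (simp add: ct_def mdeg_wt flip: lookup_wgrade)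
qed

definition wdeg :: "nat list => (nat mon)" where
 "wdeg w = sum_list (map (%l. single l 1) w)"

lemma lookup_wdeg: "lookup (wdeg w) i = count_list w i" by (induction w) (auto simp: wdeg_def lookup_add lookup_single when_def)

lemma mdeg_wdeg [simp]: "mdeg (wdeg w) = length w" by (induction w) (auto simp: wdeg_def mdeg_add)

definition Kset :: "nat => nat => (nat mon) => (nat list => nat) set" where
 "Kset u r m = {ka \<in> Lyn u r \<rightarrow>\<^sub>E {..r}. \<forall>i. (\<Sum>w\<in>Lyn u r. ka w * count_list w i) = lookup m i}"

lemma finite_Kset [simp]: "finite (Kset u r m)"
 unfolding Kset_def by (rule finite_subset[of _ "Lyn u r \<rightarrow>\<^sub>E {..r}"]) (auto intro: finite_PiE)

lemma cg_monom_coeff: fixes p p' :: "'r::comm_ring_1 poly" assumes "cg (monom 1 (Suc r)) p p'" "k <= r" shows "coeff p k = coeff p' k"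
proof -
 obtain s where s: "p - p' = monom 1 (Suc r) * s" using assms(1) unfolding cg_def by (rule dvdE)
 have "coeff (p - p') k = 0" unfolding s coeff_monom_mult using assms(2) by simp
 thus ?thesis by simp
qed

theorem amitsur_coeff: fixes X :: "nat => 'i => 'i => 'r::comm_ring_1"
 assumes fin: "finite I" and r: "mdeg m <= r" shows "(- 1) ^ mdeg m * lookup (D I (lmat u X)) m =
  (\<Sum>ka\<in>Kset u r m. \<Prod>w\<in>Lyn u r. (- 1) ^ ka w * ct I (ka w) (wmat I X w))"
proof -
 define h :: "'r => (nat, 'r) mpoly poly" where "h = (%c. [:Const c:])"
 have hh: "comm_ring_hom h" unfolding h_def by (rule Const_poly_hom)
 define c :: "nat => (nat, 'r) mpoly poly" where "c = (%l. [:0, Var l:])"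
 define Y where "Y = (%l i j. c l * h (X l i j))"
 define B where "B = max r (card I)"
 have pc: "prod_list (map c w) = monom (single (wdeg w) 1) (length w)" for w proof (induction w)
  case (Cons l w)
  have "c l = monom (single (single l 1) 1) 1" by (simp add: c_def monom_altdef Var_def)
  thus ?case using Cons by (simp add: mult_monom mult_single wdeg_def)
 qed (simp add: wdeg_def one_pCons monom_0 flip: single_one)
 have wY: "wmat I Y w i j = prod_list (map c w) * h (wmat I X w i j)" for w i j unfolding Y_def wmat_scale wmat_hom[OF hh] ..
 let ?q = "monom 1 (Suc r) :: (nat, 'r) mpoly poly"
 let ?t = "%w k. monom (single (sum_list (replicate k (wdeg w))) ((- 1) ^ k * ct I k (wmat I X w))) (k * length w)"
 have fac: "D I (%i j. - wmat I Y w i j) = (\<Sum>k\<le>B. ?t w k)" for w proof -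
  have e: "- wmat I Y w i j = (- prod_list (map c w)) * h (wmat I X w i j)" for i j by (simp add: wY)
  have s: "single (wdeg w) (1::'r) ^ k = single (sum_list (replicate k (wdeg w))) 1" for k
   by (induction k) (auto simp: mult_single distrib_right simp flip: single_one)
  have "D I (%i j. - wmat I Y w i j) = (\<Sum>k\<le>B. (- prod_list (map c w)) ^ k * ct I k (%i j. h (wmat I X w i j)))"
   unfolding e by (rule D_ct_bound[OF fin]) (simp add: B_def)
  also have "... = (\<Sum>k\<le>B. ?t w k)" proof (rule sum.cong[OF refl])
   fix k
   have "(- prod_list (map c w)) ^ k = (- 1) ^ k * prod_list (map c w) ^ k" by (rule power_minus)
   also have "... = monom (single (sum_list (replicate k (wdeg w))) ((- 1) ^ k)) (k * length w)" unfolding pc monom_power s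
    by (cases "even k") (simp_all add: mult.commute single_uminus flip: minus_monom)
   finally show "(- prod_list (map c w)) ^ k * ct I k (%i j. h (wmat I X w i j)) = ?t w k"
    unfolding ct_hom[OF hh, symmetric] by (simp add: h_def smult_monom Const_def mult_single mult.commute)
  qed
  finally show ?thesis .
 qed
 have dv: "monom 1 k dvd (monom a l :: (nat, 'r) mpoly poly)" if "k <= l" for k l a
  using that by (metis le_add_diff_inverse mult_monom mult.left_neutral dvd_triv_left)
 have lm: "- (\<Sum>l<u. Y l i j) = (- 1) * [:0, lmat u X i j:]" for i j by (simp add: Y_def c_def h_def lmat_def mult.commute linear_poly_sum)
 have "cg ?q (D I (%i j. - (\<Sum>l<u. Y l i j))) (\<Prod>w\<in>Lyn u r. D I (%i j. - wmat I Y w i j))"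
  by (rule amitsur[OF fin]) (auto simp: wY pc intro!: dvd_mult2 dv)
 hence "cg ?q (D I (%i j. (- 1) * [:0, lmat u X i j:])) (\<Prod>w\<in>Lyn u r. \<Sum>k\<le>B. ?t w k)" by (simp only: fac lm)
 hence main: "coeff (D I (%i j. (- 1) * [:0, lmat u X i j:])) (mdeg m) = coeff (\<Prod>w\<in>Lyn u r. \<Sum>k\<le>B. ?t w k) (mdeg m)"
  by (rule cg_monom_coeff) (rule r)
 have L: "lookup (coeff (D I (%i j. (- 1) * [:0, lmat u X i j:])) (mdeg m)) m = (- 1) ^ mdeg m * lookup (D I (lmat u X)) m" proof -
  have "coeff (D I (%i j. (- 1) * [:0, lmat u X i j:])) (mdeg m) = ct I (mdeg m) (%i j. (- 1) * lmat u X i j)" by (simp add: ct_def)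
  also have "... = (- 1) ^ mdeg m * ct I (mdeg m) (lmat u X)" by (rule ct_scale[OF fin])
  also have "... = Const ((- 1) ^ mdeg m) * ct I (mdeg m) (lmat u X)" by (simp add: Const_simps)
  finally show ?thesis by (simp add: lookup_Const_mult lookup_ct_lmat)
 qed
 let ?W = "%ka. \<Sum>w\<in>Lyn u r. sum_list (replicate (ka w) (wdeg w))"
 let ?p = "%ka. \<Prod>w\<in>Lyn u r. (- 1) ^ ka w * ct I (ka w) (wmat I X w)"
 have "(\<Prod>w\<in>Lyn u r. \<Sum>k\<le>B. ?t w k) = (\<Sum>ka\<in>Lyn u r \<rightarrow>\<^sub>E {..B}. \<Prod>w\<in>Lyn u r. ?t w (ka w))"
  by (rule prod_sum_PiE) auto
 also have "... = (\<Sum>ka\<in>Lyn u r \<rightarrow>\<^sub>E {..B}. monom (single (?W ka) (?p ka)) (\<Sum>w\<in>Lyn u r. ka w * length w))"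
  by (simp add: prod_monom prod_single)
 finally have "lookup (coeff (\<Prod>w\<in>Lyn u r. \<Sum>k\<le>B. ?t w k) (mdeg m)) m =
   (\<Sum>ka\<in>Lyn u r \<rightarrow>\<^sub>E {..B}. lookup (coeff (monom (single (?W ka) (?p ka)) (\<Sum>w\<in>Lyn u r. ka w * length w)) (mdeg m)) m)"
  by (simp add: coeff_sum lookup_sum)
 also have "... = (\<Sum>ka\<in>Lyn u r \<rightarrow>\<^sub>E {..B}. if ?W ka = m then ?p ka else 0)"
 proof (rule sum.cong[OF refl])
  fix ka
  have "mdeg (sum_list (replicate k (wdeg w))) = k * length w" for k w by (induction k) (auto simp: distrib_right mdeg_add)
  hence "mdeg (?W ka) = (\<Sum>w\<in>Lyn u r. ka w * length w)" by (simp add: mdeg_sum)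
  thus "lookup (coeff (monom (single (?W ka) (?p ka)) (\<Sum>w\<in>Lyn u r. ka w * length w)) (mdeg m)) m = (if ?W ka = m then ?p ka else 0)"
   by (auto simp: lookup_single when_def)
 qed
 also have "... = (\<Sum>ka\<in>{ka \<in> Lyn u r \<rightarrow>\<^sub>E {..B}. ?W ka = m}. ?p ka)"
  by (rule sum.inter_filter[symmetric]) (auto intro: finite_PiE)
 also have "{ka \<in> Lyn u r \<rightarrow>\<^sub>E {..B}. ?W ka = m} = Kset u r m" proof -
  have lk: "lookup (sum_list (replicate k (wdeg w))) i = k * count_list w i" for k w i
   by (induction k) (auto simp: distrib_right lookup_add lookup_wdeg)
  have W: "?W ka = m <-> (\<forall>i. (\<Sum>w\<in>Lyn u r. ka w * count_list w i) = lookup m i)" for ka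
   by (auto simp: poly_mapping_eq_iff fun_eq_iff lookup_sum lk)
  have "ka w <= r" if "?W ka = m" "w \<in> Lyn u r" for ka w proof -
   have "w ~= []" using that(2) by (simp add: Lyn_def lyn_def)
   hence "ka w <= ka w * length w" by (cases w) auto
   also have "... <= (\<Sum>w\<in>Lyn u r. ka w * length w)" by (rule member_le_sum) (use that(2) in auto)
   also have "... = mdeg m" proof -
    have "mdeg (sum_list (replicate k (wdeg w))) = k * length w" for k w by (induction k) (auto simp: distrib_right mdeg_add)
    thus ?thesis unfolding that(1)[symmetric] by (simp add: mdeg_sum)
   qed
   finally show ?thesis using r by simp
  qed
  hence "ka \<in> Lyn u r \<rightarrow>\<^sub>E {..B} <-> ka \<in> Lyn u r \<rightarrow>\<^sub>E {..r}" if "?W ka = m" for ka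
   using that by (force simp: PiE_iff B_def)
  thus ?thesis unfolding Kset_def W[symmetric] by blast
 qed
 finally show ?thesis using main L by metis
qed

lemma Dt_scale: "Dt I (%i j. c * f i j) = c ^ card I * Dt I f" by (simp add: Dt_def prod.distrib sum_distrib_left mult_ac)

lemma monom_mult_cancel: "monom 1 t * p = monom 1 t * q ==> p = (q :: 'r::comm_ring_1 poly)"
proof (rule poly_eqI)
 fix n assume "monom 1 t * p = monom 1 t * q"
 hence "coeff (monom 1 t * p) (n + t) = coeff (monom 1 t * q) (n + t)" by simp
 thus "coeff p n = coeff q n" by (simp add: coeff_monom_mult)
qed

lemma sigma_mat_eq_ct: fixes A :: "'r::comm_ring_1 mat" assumes A: "A \<in> carrier_mat N N" and t: "t <= N"
 shows "sigma_mat t A = ct {..<N} t (%i j. A $$ (i, j))"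
proof -
 let ?I = "{..<N}" and ?a = "%i j. A $$ (i, j)"
 define lam :: "'r poly" where "lam = [:0, 1:]"
 define p where "p = Dt ?I (%i j. of_bool (i = j) * [:lam:] + [:0, [:?a i j:]:])"
 have lam_power: "lam ^ k = monom 1 k" for k by (simp add: lam_def monom_altdef)
 have h: "comm_ring_hom (%p. pcompose p [:0, lam:])" by unfold_locales (auto simp: pcompose_add pcompose_mult pcompose_1)
 have "pcompose p [:0, lam:] = Dt ?I (%i j. [:lam:] * (of_bool (i = j) + [:0, [:?a i j:]:]))" unfolding p_def Dt_hom[OF h]
  by (rule Dt_cong) (auto simp: pcompose_add pcompose_pCons of_bool_def mult.commute one_pCons)
 also have "... = [:lam:] ^ N * D ?I (%i j. [:0, [:?a i j:]:])" unfolding Dt_scale D_def by simp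
 finally have "coeff (pcompose p [:0, lam:]) k = coeff ([:lam ^ N:] * D ?I (%i j. [:0, [:?a i j:]:])) k" for k by (simp add: poly_const_pow)
 hence "lam ^ k * coeff p k = lam ^ N * ct ?I k (%i j. [:?a i j:])" for k by (simp add: coeff_pcompose_linear ct_def)
 hence key: "monom 1 k * coeff p k = monom 1 N * [:ct ?I k ?a:]" for k by (simp add: lam_power ct_hom[OF const_poly_hom])
 have c1: "coeff p k = monom (ct ?I k ?a) (N - k)" if "k <= N" for k proof (rule monom_mult_cancel[of k])
  show "monom 1 k * coeff p k = monom 1 k * monom (ct ?I k ?a) (N - k)" unfolding key using that by (simp add: mult_monom smult_monom)
 qed
 have c2: "coeff p k = 0" if "k > N" for k proof (rule monom_mult_cancel[of k])
  show "monom 1 k * coeff p k = monom 1 k * 0" unfolding key using that by (simp add: ct_eq_0)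
 qed
 have cp: "char_poly A = Dt ?I (%i j. of_bool (i = j) * lam + [:- ?a i j:])"
  unfolding char_poly_def char_poly_matrix_def lessThan_atLeast0 Dt_eq_det using A by (intro arg_cong[of _ _ det] eq_matI) (auto simp: lam_def)
 also have "... = poly p (- 1)" unfolding p_def Dt_hom[OF poly_hom] by (rule Dt_cong) (auto simp: of_bool_def)
 also have "... = (\<Sum>k\<le>degree p. coeff p k * (- 1) ^ k)" by (rule poly_altdef)
 also have "... = (\<Sum>k\<le>max N (degree p). coeff p k * (- 1) ^ k)" by (rule sum.mono_neutral_left) (auto simp: coeff_eq_0)
 also have "... = (\<Sum>k\<le>N. coeff p k * (- 1) ^ k)" by (rule sum.mono_neutral_right) (auto simp: c2)
 also have "... = (\<Sum>k\<le>N. monom ((- 1) ^ k * ct ?I k ?a) (N - k))" proof (rule sum.cong[OF refl])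
  fix k assume "k \<in> {..N}"
  have "(- 1 :: 'r poly) ^ k = [:(- 1) ^ k:]" by (metis one_pCons minus_pCons poly_const_pow minus_zero)
  thus "coeff p k * (- 1) ^ k = monom ((- 1) ^ k * ct ?I k ?a) (N - k)" using `k \<in> {..N}` by (simp add: c1 smult_monom)
 qed
 finally have "coeff (char_poly A) (N - t) = (\<Sum>k\<le>N. (- 1) ^ k * ct ?I k ?a * of_bool (N - k = N - t))"
  by (simp add: coeff_sum of_bool_def if_distrib[of "(*) _"] cong: if_cong)
 also have "... = (\<Sum>k\<in>{t}. (- 1) ^ k * ct ?I k ?a * of_bool (N - k = N - t))" by (rule sum.mono_neutral_right) (use t in auto)
 finally have "coeff (char_poly A) (N - t) = (- 1) ^ t * ct ?I t ?a" by simp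
 hence "sigma_mat t A = (- 1) ^ t * ((- 1) ^ t * ct ?I t ?a)" using A by (simp add: sigma_mat_def)
 thus ?thesis by (simp flip: mult.assoc power_mult_distrib)
qed

lemma D_singleton: "D {a} M = 1 + M a a"
proof -
 have "{p. p permutes {a}} = {id}" proof (intro equalityI subsetI)
  fix p assume "p \<in> {p. p permutes {a}}"
  hence p: "p permutes {a}" by simp
  have "p x = x" for x using permutes_in_image[OF p, of a] permutes_not_in[OF p, of x] by (cases "x = a") auto
  thus "p \<in> {id}" by auto
 qed (simp add: permutes_id)
 thus ?thesis by (simp add: D_def Dt_def)
qed

lemma D_triangular: fixes \<rho> :: "'i => nat"
 assumes "finite I" "!!i j. i \<in> I ==> j \<in> I ==> \<rho> j <= \<rho> i ==> M i j = 0"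
 shows "D I M = 1" using assms
proof (induction "card I" arbitrary: I)
 case 0
 thus ?case by (simp add: D_def Dt_def permutes_empty)
next
 case (Suc k)
 hence ne: "I ~= {}" by auto
 have "Max (\<rho> ` I) \<in> \<rho> ` I" using Suc.prems(1) ne by (intro Max_in) auto
 then obtain a where a: "a \<in> I" "\<rho> a = Max (\<rho> ` I)" by force
 have amax: "\<rho> j <= \<rho> a" if "j \<in> I" for j unfolding a(2) using that Suc.prems(1) by (intro Max_ge) auto
 have "D ((I - {a}) Un {a}) M = D (I - {a}) M * D {a} M" by (rule D_block) (use a amax Suc.prems in auto)
 moreover have "D (I - {a}) M = 1" using Suc a by (intro Suc.hyps(1)) auto
 moreover have "(I - {a}) Un {a} = I" using a by auto
 ultimately show ?case using Suc.prems(2)[OF a(1) a(1)] by (simp add: D_singleton)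
qed

definition comp :: "(nat => 'r::comm_ring_1) => nat => nat => 'r" where
 "comp v i j = of_bool (i = 0) * ((- 1) ^ j * v (Suc j)) + of_bool (i = Suc j)"

lemma D_comp: fixes v :: "nat => 'r::comm_ring_1" shows "D {..<J} (%i j. s * comp v i j) = 1 + (\<Sum>j<J. s ^ Suc j * v (Suc j))"
proof -
 let ?I = "{..<J}"
 define P where "P = (%i j. s * of_bool (i = Suc j))"
 define w where "w = (%j. s * ((- 1) ^ j * v (Suc j)))"
 define M where "M = (%i j. (- s) ^ i * w j)"
 have "D ?I (%i j. s * comp v i j) = D ?I (%i j. P i j + M i j + (\<Sum>k\<in>?I. P i k * M k j))" proof (rule D_cong)
  fix i j assume ij: "i \<in> ?I" "j \<in> ?I"
  have "(\<Sum>k\<in>?I. P i k * M k j) = (if i = 0 then 0 else s * M (i - 1) j)" proof (cases i)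
   case (Suc i')
   have "(\<Sum>k\<in>?I. P i k * M k j) = (\<Sum>k\<in>{i'}. P i k * M k j)"
    by (rule sum.mono_neutral_right) (use Suc ij in "auto simp: P_def")
   thus ?thesis by (simp add: Suc P_def)
  qed (simp add: P_def)
  thus "s * comp v i j = P i j + M i j + (\<Sum>k\<in>?I. P i k * M k j)" by (cases i) (simp_all add: comp_def P_def M_def w_def algebra_simps)
 qed
 also have "... = D ?I P * D ?I M" by (simp add: D_mult)
 also have "D ?I P = 1" by (rule D_triangular[where \<rho> = "%i. J - i"]) (auto simp: P_def)
 also have "D ?I M = D {()} (%_ _. \<Sum>i\<in>?I. w i * (- s) ^ i)"
  using D_sylvester[of ?I "{()}" "%i _. (- s) ^ i" "%_ j. w j"] by (simp add: M_def)
 also have "... = 1 + (\<Sum>j<J. s ^ Suc j * v (Suc j))" unfolding D_singleton w_def proof (intro arg_cong2[of _ _ _ _ "(+)"] refl sum.cong)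
  fix j
  have "s * ((- 1) ^ j * v (Suc j)) * (- s) ^ j = s * s ^ j * v (Suc j) * ((- 1) ^ j * (- 1) ^ j)" by (simp add: power_minus[of s] mult_ac)
  also have "(- 1 :: 'r) ^ j * (- 1) ^ j = 1" by (simp flip: power_mult_distrib)
  finally show "s * ((- 1) ^ j * v (Suc j)) * (- s) ^ j = s ^ Suc j * v (Suc j)" by simp
 qed
 finally show ?thesis by simp
qed

lemma ct_comp: assumes "1 <= t" shows "ct {..<J} t (comp v) = (if t <= J then v t else (0 :: 'r::comm_ring_1))"
proof -
 have e: "[:0, comp v i j:] = [:0, 1:] * comp (%k. [:v k:]) i j" for i j by (cases "even j") (auto simp: comp_def of_bool_def)
 have "D {..<J} (%i j. [:0, comp v i j:]) = 1 + (\<Sum>j<J. [:0, 1:] ^ Suc j * [:v (Suc j):])" unfolding e by (rule D_comp)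
 also have "... = 1 + (\<Sum>j<J. monom (v (Suc j)) (Suc j))" by (simp only: monom_altdef) (simp add: mult.commute)
 finally have "ct {..<J} t (comp v) = (\<Sum>j<J. v (Suc j) * of_bool (Suc j = t))"
  using assms unfolding ct_def by (auto simp: coeff_sum one_pCons coeff_pCons split: nat.split intro!: sum.cong)
 also have "... = (if t <= J then v t else 0)" proof (cases "t <= J")
  case True
  have "(\<Sum>j<J. v (Suc j) * of_bool (Suc j = t)) = (\<Sum>j\<in>{t - 1}. v (Suc j) * of_bool (Suc j = t))"
   by (rule sum.mono_neutral_right) (use True assms in auto)
  thus ?thesis using True assms by simp
 next
  case False
  thus ?thesis by (auto intro!: sum.neutral)
 qed
 finally show ?thesis .
qed

section \<open>The polynomials expressing \<open>\<sigma>\<^sub>t(A\<^sup>l)\<close>\<close>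

definition intp :: "'v set => ('v, 'a::comm_ring_1) mpoly => bool" where
 "intp V P <-> vars P <= V & (\<forall>m. lookup P m \<in> \<int>)"

lemma intp_Const: "c \<in> \<int> ==> intp V (Const c)" by (auto simp: intp_def vars_def Const_def lookup_single when_def)

lemma intp_Var: "v \<in> V ==> intp V (Var v)" by (auto simp: intp_def vars_def Var_def lookup_single when_def)

lemma intp_add: "intp V P ==> intp V Q ==> intp V (P + Q)"
proof -
 have "vars (P + Q) <= vars P Un vars Q" using keys_add[of P Q] unfolding vars_def by blast
 thus "intp V P ==> intp V Q ==> intp V (P + Q)" by (auto simp: intp_def lookup_add)
qed

lemma intp_mult: fixes P Q :: "('v, 'a::comm_ring_1) mpoly" assumes "intp V P" "intp V Q" shows "intp V (P * Q)"
proof -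
 have "vars (P * Q) <= V" proof
  fix v assume "v \<in> vars (P * Q)"
  then obtain m where m: "m \<in> keys (P * Q)" "v \<in> keys m" by (auto simp: vars_def)
  then obtain a b where ab: "m = a + b" "a \<in> keys P" "b \<in> keys Q" using keys_mult[of P Q] by blast
  hence "v \<in> keys a \<or> v \<in> keys b" using m(2) keys_add[of a b] by blast
  thus "v \<in> V" using ab assms by (auto simp: intp_def vars_def)
 qed
 moreover have "lookup (P * Q) m \<in> \<int>" for m proof -
  let ?s = "%f. (\<Sum>m\<in>keys f. single m (lookup f m))"
  have "lookup (?s P * ?s Q) m \<in> \<int>" using assms unfolding intp_def
   by (auto simp: sum_product mult_single lookup_sum lookup_single when_def intro!: Ints_sum Ints_mult)
  thus ?thesis by (simp flip: mpoly_expand)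
 qed
 ultimately show ?thesis by (simp add: intp_def)
qed

lemma intp_power: "intp V P ==> intp V (P ^ k)" using intp_Const[of 1 V] by (induction k) (auto intro: intp_mult simp: Const_simps)

lemma intp_mono: "intp V P ==> V <= V' ==> intp V' P" by (auto simp: intp_def)

definition univ :: "nat set => (nat => (nat => nat => 'a::comm_ring_1 gen_poly) => 'a gen_poly) => bool" where
 "univ V F <-> (\<exists>P. intp V P & (\<forall>N A. F N A = subst (%k. ct {..<N} k A) P))"

lemma univ_Const: "c \<in> \<int> ==> univ V (%N A. Const c)"
 unfolding univ_def by (intro exI[of _ "Const c"]) (simp add: intp_Const)

lemma univ_of_int: "univ V (%N (A :: nat => nat => 'a::comm_ring_1 gen_poly). of_int c)"
proof -
 interpret comm_ring_hom "Const :: 'a => 'a gen_poly" by (rule Const_hom)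
 have "Const (of_int c :: 'a) = (of_int c :: 'a gen_poly)" by (rule hom_of_int)
 thus ?thesis using univ_Const[of "of_int c :: 'a" V] by simp
qed

lemma univ_ct: "t \<in> V ==> univ V (%N A. ct {..<N} t A)" unfolding univ_def by (intro exI[of _ "Var t"]) (simp add: intp_Var)

lemma univ_add: "univ V F ==> univ V G ==> univ V (%N A. F N A + G N A)"
 and univ_mult: "univ V F ==> univ V G ==> univ V (%N A. F N A * G N A)"
proof -
 assume "univ V F" "univ V G"
 then obtain P Q where P: "intp V P" "!!N A. F N A = subst (%k. ct {..<N} k A) P"
  and Q: "intp V Q" "!!N A. G N A = subst (%k. ct {..<N} k A) Q" unfolding univ_def by blast
 have s: "subst g (P + Q) = subst g P + subst g Q" "subst g (P * Q) = subst g P * subst g Q" for g :: "nat => 'a gen_poly" proof -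
  interpret comm_ring_hom "subst g" by (rule subst_hom)
  show "subst g (P + Q) = subst g P + subst g Q" "subst g (P * Q) = subst g P * subst g Q" by (simp_all add: hom_add hom_mult)
 qed
 show "univ V (%N A. F N A + G N A)" unfolding univ_def using P Q by (intro exI[of _ "P + Q"]) (simp add: intp_add s)
 show "univ V (%N A. F N A * G N A)" unfolding univ_def using P Q by (intro exI[of _ "P * Q"]) (simp add: intp_mult s)
qed

lemma univ_sum: "(!!i. i \<in> S ==> univ V (F i)) ==> univ V (%N A. \<Sum>i\<in>S. F i N A)"
 using univ_of_int[of V 0] by (induction S rule: infinite_finite_induct) (auto intro: univ_add)

lemma univ_prod: "(!!i. i \<in> S ==> univ V (F i)) ==> univ V (%N A. \<Prod>i\<in>S. F i N A)"
 using univ_of_int[of V 1] by (induction S rule: infinite_finite_induct) (auto intro: univ_mult)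

lemma univ_mono: "univ V F ==> V <= V' ==> univ V' F" unfolding univ_def using intp_mono by blast

definition mp :: "nat => nat => (nat => nat => 'r::comm_ring_1) => nat => nat => 'r" where
 "mp N l A = wmat {..<N} (%_::nat. A) (replicate l 0)"

lemma wmat_const: "wmat {..<N} (%_::nat. A) w = mp N (length w) A" unfolding mp_def by (induction w) auto

lemma lyn_suffix: "lyn w ==> w = u @ v ==> u ~= [] ==> v ~= [] ==> w < v"
 unfolding lyn_def by metis

lemma one_one_lyn: assumes "lyn w" "set w <= {..<2}" "count_list w (Suc 0) = 1" shows "w = replicate (length w - 1) 0 @ [1]"
proof -
 have "Suc 0 \<in> set w" using assms(3) by (metis count_list_0_iff zero_neq_one)
 then obtain u v where w: "w = u @ Suc 0 # v" by (meson split_list)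
 have cu: "count_list u (Suc 0) = 0" "count_list v (Suc 0) = 0" using assms(3) w by auto
 have z: "x = replicate (length x) 0" if "set x <= {..<2}" "count_list x (Suc 0) = 0" for x
  using that by (intro replicate_eqI) (auto simp: count_list_0_iff less_2_cases_iff)
 have u: "u = replicate (length u) 0" and v: "v = replicate (length v) 0" using assms(2) cu w by (auto intro: z)
 have "v = []" proof (rule ccontr)
  assume v0: "v ~= []"
  have "w = (u @ [Suc 0]) @ v" using w by simp
  hence "w < v" by (rule lyn_suffix[OF assms(1)]) (use v0 in simp_all)
  moreover have "~ replicate a 0 @ Suc 0 # x < replicate b 0" for a b x proof (induction a arbitrary: b)
   case 0
   thus ?case by (cases b) auto
  next
   case (Suc a)
   thus ?case by (cases b) auto
  qed
  ultimately show False using u v w by metis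
 qed
 thus ?thesis using w u by simp
qed

lemma lyn_zeros_one: "lyn (replicate k 0 @ [1])" unfolding lyn_def
proof (intro conjI allI impI)
 fix u v assume uv: "replicate k (0::nat) @ [1] = u @ v & u ~= [] & v ~= []"
 then obtain v' where v': "v = v' @ [1]" by (metis append_butlast_last_id last_appendR last_snoc)
 hence r: "replicate k 0 = u @ v'" using uv by simp
 hence "set v' <= {0}" by (metis Un_iff set_append set_replicate_conv_if subsetI empty_iff)
 hence "v' = replicate (length v') 0" by (intro replicate_eqI) auto
 moreover have "length v' < k" using r uv by (metis length_append length_greater_0_conv length_replicate less_add_same_cancel2)
 moreover have "replicate k (0::nat) @ [1] < replicate b 0 @ [1]" if "b < k" for b
  using that by (induction b arbitrary: k) (auto simp: gr0_conv_Suc Suc_less_eq2)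
 ultimately show "replicate k 0 @ [1] < v" using v' by metis
qed simp

lemma univ_power: "1 <= l ==> univ {1..t * l} (%N A. ct {..<N} t (mp N l A) :: 'a::comm_ring_1 gen_poly)"
proof (induction "(t, l)" arbitrary: t l rule: wf_induct_rule[OF wf_lex_prod[OF wf_less_than wf_less_than]])
 case (1 t l)
 have IH: "univ {1..t' * l'} (%N A. ct {..<N} t' (mp N l' A) :: 'a gen_poly)" if "t' < t \<or> (t' = t & l' < l)" "1 <= l'" for t' l'
  using 1(1)[of t' l'] that by auto
 consider "t = 0" | "t \<ge> 1" "l = 1" | "t \<ge> 1" "l \<ge> 2" using 1(2) by linarith
 thus ?case proof cases
  case 1
  thus ?thesis using univ_of_int[of "{1..t * l}" 1] by simp
 next
  case 2
  have "ct {..<N} t (mp N 1 A) = ct {..<N} t A" for N and A :: "nat => nat => 'a gen_poly"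
   unfolding mp_def by (rule ct_cong) (simp add: sum_of_bool_right)
  thus ?thesis using univ_ct[of t "{1..t * l}"] 2 by simp
 next
  case 3
  define m where "m = single 0 (t * (l - 1)) + single (Suc 0) t"
  have m0: "lookup m 0 = t * (l - 1)" and m1: "lookup m (Suc 0) = t" by (simp_all add: m_def lookup_add lookup_single)
  have tl: "t * l = t * (l - 1) + t" using 3 by (cases l) auto
  have md: "mdeg m = t * l" by (simp add: m_def mdeg_add tl)
  define w0 where "w0 = replicate (l - 1) 0 @ [Suc 0]"
  have w0: "lyn w0" "length w0 = l" using lyn_zeros_one[of "l - 1"] 3 by (simp_all add: w0_def)
  have tl1: "l <= t * l" using 3 by simp
  have w0L: "w0 \<in> Lyn 2 (t * l)" using w0 tl1 by (auto simp: Lyn_def Wds_def w0_def)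
  have cw0: "count_list w0 i = (if i = 0 then l - 1 else if i = Suc 0 then 1 else 0)" for i proof -
   have "count_list (replicate k a) i = (if i = a then k else 0)" for k and a :: nat by (induction k) auto
   thus ?thesis by (auto simp: w0_def)
  qed
  define ka0 where "ka0 = (\<lambda>w\<in>Lyn 2 (t * l). if w = w0 then t else 0)"
  have k0: "ka0 \<in> Kset 2 (t * l) m" proof -
   have "(\<Sum>w\<in>Lyn 2 (t * l). ka0 w * count_list w i) = (\<Sum>w\<in>{w0}. ka0 w * count_list w i)" for i
    by (rule sum.mono_neutral_right) (use w0L in "auto simp: ka0_def")
   moreover have "t <= t * l" using 3 by simp
   ultimately show ?thesis using w0L unfolding Kset_def by (auto simp: ka0_def cw0 m_def lookup_add lookup_single when_def)
  qed
  have other: "ka w = 0 \<or> length w = 1 \<or> ka w < t \<or> (ka w = t & length w < l)"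
   if k: "ka \<in> Kset 2 (t * l) m" "ka ~= ka0" and w: "w \<in> Lyn 2 (t * l)" for ka w
  proof (rule ccontr)
   assume neg: "~ ?thesis"
   have lw: "lyn w" and sw: "set w <= {..<2}" using w by (auto simp: Lyn_def Wds_def)
   have s0: "(\<Sum>w\<in>Lyn 2 (t * l). ka w * count_list w 0) = t * (l - 1)"
    and s1: "(\<Sum>w\<in>Lyn 2 (t * l). ka w * count_list w (Suc 0)) = t" using k(1) m0 m1 unfolding Kset_def by simp_all
   have split: "(\<Sum>w\<in>Lyn 2 (t * l). ka w * count_list w i) = ka w * count_list w i + (\<Sum>w\<in>Lyn 2 (t * l) - {w}. ka w * count_list w i)" for i
    by (rule sum.remove) (use w in auto)
   have zero: "x = replicate (length x) 0" if "set x <= {..<2}" "count_list x (Suc 0) = 0" for x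
    using that by (intro replicate_eqI) (auto simp: count_list_0_iff less_2_cases_iff)
   have c1: "count_list x (Suc 0) ~= 0 \<or> x = [0]" if "lyn x" "set x <= {..<2}" for x proof (rule disjCI)
    assume "~ x = [0]"
    show "count_list x (Suc 0) ~= 0" proof
     assume "count_list x (Suc 0) = 0"
     define n where "n = length x"
     have x: "x = replicate n 0" unfolding n_def by (rule zero[OF that(2) `count_list x (Suc 0) = 0`])
     have "n ~= 0" using x that(1) by (auto simp: lyn_def)
     moreover have "n ~= Suc 0" using x `~ x = [0]` by auto
     ultimately obtain k where k: "n = Suc (Suc k)" by (metis not0_implies_Suc)
     have "x = [0] @ replicate (Suc k) 0" using x k by simp
     hence "x < replicate (Suc k) 0" by (rule lyn_suffix[OF that(1)]) simp_all
     moreover have "replicate (Suc k) (0::nat) < replicate (Suc k) 0 @ [0]" by (rule less_append) simp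
     moreover have "replicate (Suc k) (0::nat) @ [0] = x" unfolding x k replicate_append_same by simp
     ultimately show False by (metis order_less_asym)
    qed
   qed
   have "w ~= [0]" using neg by auto
   hence cw: "count_list w (Suc 0) \<ge> 1" using c1[OF lw sw] by linarith
   have "ka w * count_list w (Suc 0) <= t" using split[of "Suc 0"] s1 by linarith
   moreover have "ka w <= ka w * count_list w (Suc 0)" using cw by simp
   ultimately have kt: "ka w = t" using neg by linarith
   with `ka w * count_list w (Suc 0) <= t` cw 3 have cw1: "count_list w (Suc 0) = 1" by simp
   have "ka w * count_list w 0 <= t * (l - 1)" using split[of 0] s0 by (metis le_add1)
   hence "t * count_list w 0 <= t * (l - 1)" using kt by simp
   hence c0: "count_list w 0 <= l - 1" using 3 by simp
   have weq: "w = replicate (length w - 1) 0 @ [1]" by (rule one_one_lyn[OF lw sw cw1])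
   have rep: "count_list (replicate k 0) (0::nat) = k" for k by (induction k) auto
   have "count_list w 0 = length w - 1" by (subst weq) (simp add: rep)
   moreover have "length w \<ge> l" using neg kt by auto
   ultimately have lenw: "length w = l" using c0 3 by linarith
   hence ww: "w = w0" using weq by (simp add: w0_def)
   have r0: "(\<Sum>w\<in>Lyn 2 (t * l) - {w}. ka w * count_list w i) = 0" if "i = 0 \<or> i = Suc 0" for i proof -
    have "ka w * count_list w 0 = t * (l - 1)" using kt ww cw0[of 0] by simp
    hence "(\<Sum>w\<in>Lyn 2 (t * l) - {w}. ka w * count_list w 0) = 0" using split[of 0] s0 by linarith
    moreover have "ka w * count_list w (Suc 0) = t" using kt cw1 by simp
    hence "(\<Sum>w\<in>Lyn 2 (t * l) - {w}. ka w * count_list w (Suc 0)) = 0" using split[of "Suc 0"] s1 by linarith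
    ultimately show ?thesis using that by metis
   qed
   have "ka x = 0" if x: "x \<in> Lyn 2 (t * l)" "x ~= w" for x proof -
    have "x \<in> Lyn 2 (t * l) - {w}" using x by simp
    hence "ka x * count_list x 0 = 0" "ka x * count_list x (Suc 0) = 0" using r0[of 0] r0[of "Suc 0"] by (simp_all add: sum_eq_0_iff)
    moreover have "count_list x 0 ~= 0 \<or> count_list x (Suc 0) ~= 0" using c1[of x] x by (auto simp: Lyn_def Wds_def)
    ultimately show ?thesis by auto
   qed
   hence "ka = ka0" using k(1) kt ww unfolding Kset_def ka0_def by (auto simp: fun_eq_iff PiE_iff extensional_def)
   thus False using k(2) by simp
  qed
  define V where "V = {1..t * l}"
  define z where "z = lookup ((Var 0 + Var (Suc 0) :: (nat, 'a gen_poly) mpoly) ^ (t * l)) m"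
  define G where "G = (%N A. \<Sum>ka\<in>Kset 2 (t * l) m - {ka0}. \<Prod>w\<in>Lyn 2 (t * l). of_int ((- 1) ^ ka w) * (ct {..<N} (ka w) (mp N (length w) A) :: 'a gen_poly))"
  have "univ V G" unfolding G_def proof (intro univ_sum univ_prod univ_mult univ_of_int)
   fix ka w assume k: "ka \<in> Kset 2 (t * l) m - {ka0}" and w: "w \<in> Lyn 2 (t * l)"
   have w0': "1 <= length w" using w by (auto simp: Lyn_def lyn_def Suc_le_eq)
   have kl: "ka w * length w <= t * l" proof -
    have "length x = count_list x 0 + count_list x (Suc 0)" if "set x <= {..<2}" for x
     using that by (induction x) (auto simp: less_2_cases_iff)
    hence len: "length w = count_list w 0 + count_list w (Suc 0)" using w by (simp add: Lyn_def Wds_def)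
    have "ka w * count_list w i <= (\<Sum>w\<in>Lyn 2 (t * l). ka w * count_list w i)" for i by (rule member_le_sum) (use w in auto)
    hence "ka w * count_list w 0 <= t * (l - 1)" "ka w * count_list w (Suc 0) <= t"
     using k m0 m1 unfolding Kset_def by (metis (mono_tags, lifting) DiffD1 mem_Collect_eq)+
    thus ?thesis unfolding len tl by (simp add: distrib_left)
   qed
   have "univ {1..ka w * length w} (%N A. ct {..<N} (ka w) (mp N (length w) A) :: 'a gen_poly)" proof (cases "ka w = 0")
    case True
    thus ?thesis using univ_of_int[of "{1..ka w * length w}" 1] by simp
   next
    case False
    show ?thesis proof (cases "length w = 1")
     case True
     have "ct {..<N} (ka w) (mp N 1 A) = ct {..<N} (ka w) A" for N and A :: "nat => nat => 'a gen_poly"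
      unfolding mp_def by (rule ct_cong) (simp add: sum_of_bool_right)
     thus ?thesis using univ_ct[of "ka w" "{1..ka w * length w}"] False True by simp
    next
     case F: False
     show ?thesis by (rule IH) (use other[of ka w] k w False F w0' in auto)
    qed
   qed
   thus "univ V (%N A. ct {..<N} (ka w) (mp N (length w) A) :: 'a gen_poly)"
    by (rule univ_mono) (use kl in "auto simp: V_def")
  qed
  moreover obtain zi :: int where zi: "z = of_int zi" proof -
   have "intp UNIV ((Var 0 + Var (Suc 0) :: (nat, 'a gen_poly) mpoly) ^ (t * l))" by (intro intp_power intp_add intp_Var) auto
   hence "z \<in> \<int>" by (simp add: z_def intp_def)
   thus ?thesis using that by (auto elim: Ints_cases)
  qed
  moreover have "t * l \<in> V" using 3 by (auto simp: V_def)
  ultimately have "univ V (%N A. of_int ((- 1) ^ t) * (of_int ((- 1) ^ (t * l) * zi) * ct {..<N} (t * l) A + of_int (- 1) * G N A))"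
   by (intro univ_mult univ_add univ_of_int univ_ct)
  moreover have "of_int ((- 1) ^ t) * (of_int ((- 1) ^ (t * l) * zi) * ct {..<N} (t * l) A + of_int (- 1) * G N A) = ct {..<N} t (mp N l A)"
   for N and A :: "nat => nat => 'a gen_poly"
  proof -
   let ?I = "{..<N}"
   have L: "lmat 2 (%_. A) i j = (Var 0 + Var (Suc 0)) * Const (A i j)" for i j by (simp add: lmat_def numeral_2_eq_2 distrib_right)
   have "lookup (D ?I (lmat 2 (%_. A))) m = lookup (ct ?I (t * l) (lmat 2 (%_. A))) m" by (simp add: lookup_ct_lmat md)
   also have "ct ?I (t * l) (lmat 2 (%_. A)) = Const (ct ?I (t * l) A) * (Var 0 + Var (Suc 0)) ^ (t * l)"
    unfolding L ct_scale[OF finite_lessThan] ct_hom[OF Const_hom] by (rule mult.commute)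
   finally have lhs: "lookup (D ?I (lmat 2 (%_. A))) m = ct ?I (t * l) A * z" by (simp add: lookup_Const_mult z_def)
   let ?p = "%ka. \<Prod>w\<in>Lyn 2 (t * l). (- 1) ^ ka w * ct ?I (ka w) (mp N (length w) A)"
   have "(- 1) ^ (t * l) * (ct ?I (t * l) A * z) = (\<Sum>ka\<in>Kset 2 (t * l) m. ?p ka)"
    using amitsur_coeff[of ?I m "t * l" 2 "%_. A"] unfolding lhs md wmat_const by simp
   also have "... = ?p ka0 + (\<Sum>ka\<in>Kset 2 (t * l) m - {ka0}. ?p ka)" by (rule sum.remove) (use k0 in auto)
   also have "(\<Sum>ka\<in>Kset 2 (t * l) m - {ka0}. ?p ka) = G N A" by (simp add: G_def)
   also have "?p ka0 = (\<Prod>w\<in>{w0}. (- 1) ^ ka0 w * ct ?I (ka0 w) (mp N (length w) A))"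
    by (rule prod.mono_neutral_right) (use w0L in "auto simp: ka0_def")
   also have "... = (- 1) ^ t * ct ?I t (mp N l A)" using w0L w0 by (simp add: ka0_def)
   finally have "(- 1) ^ t * ct ?I t (mp N l A) = (- 1) ^ (t * l) * (ct ?I (t * l) A * z) - G N A" by simp
   hence "(- 1) ^ t * ((- 1) ^ t * ct ?I t (mp N l A)) = (- 1) ^ t * ((- 1) ^ (t * l) * (ct ?I (t * l) A * z) - G N A)" by simp
   moreover have "(- 1) ^ t * ((- 1) ^ t * x) = x" for x :: "'a gen_poly" by (simp flip: mult.assoc power_mult_distrib)
   ultimately show ?thesis by (simp add: zi mult_ac)
  qed
  ultimately show ?thesis by (simp add: V_def)
 qed
qed

lemma ct_eq_sigma_mat:
 "A \<in> carrier_mat N N ==> (!!i j. i < N ==> j < N ==> B i j = A $$ (i, j)) ==> t <= N ==> sigma_mat t A = ct {..<N} t B"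
 unfolding sigma_mat_eq_ct by (rule ct_cong) auto

lemma pow_mat_eq_mp: assumes "A \<in> carrier_mat N N" "i < N" "j < N" shows "mp N l (%i j. A $$ (i, j)) i j = (A ^\<^sub>m l) $$ (i, j)"
 using assms(2,3) proof (induction l arbitrary: i j)
 case 0
 thus ?case using assms(1) by (simp add: mp_def)
next
 case (Suc l)
 have "mp N (Suc l) (%i j. A $$ (i, j)) i j = wmat {..<N} (%_::nat. %i j. A $$ (i, j)) (replicate l 0 @ [0]) i j"
  by (simp add: mp_def replicate_append_same)
 also have "... = (\<Sum>k\<in>{..<N}. mp N l (%i j. A $$ (i, j)) i k * A $$ (k, j))"
  using Suc.prems by (subst wmat_append) (auto simp: mp_def sum_of_bool_right)
 also have "... = (\<Sum>k<N. (A ^\<^sub>m l) $$ (i, k) * A $$ (k, j))" using Suc by (intro sum.cong) auto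
 also have "... = (A ^\<^sub>m Suc l) $$ (i, j)"
  using assms(1) Suc.prems pow_carrier_mat[OF assms(1), of l] by (simp add: scalar_prod_def lessThan_atLeast0)
 finally show ?case .
qed

lemma P_poly_spec: fixes t l :: nat assumes t: "0 < t" and l: "1 < l" shows "intp {1..t * l} (P_poly t l :: (nat, 'a::field) mpoly)"
  and "!!N A. ct {..<N} t (mp N l A) = subst (%k. ct {..<N} k A :: 'a gen_poly) (P_poly t l)"
proof -
 obtain P :: "(nat, 'a) mpoly" where P: "intp {1..t * l} P"
  "!!N A. ct {..<N} t (mp N l A) = subst (%k. ct {..<N} k A :: 'a gen_poly) P"
  using univ_power[of l t] l unfolding univ_def by (metis less_imp_le)
 define good where "good = (%P :: (nat, 'a) mpoly. vars P <= {1..t * l} & (\<forall>m. lookup P m \<in> \<int>) &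
   (\<forall>m \<ge> t * l. \<forall>A \<in> carrier_mat m m.
    sigma_mat t (A ^\<^sub>m l) = subst (%k. sigma_mat k A :: 'a gen_poly) P))"
 have sub_cong: "subst g Q = subst g' Q" if "!!k. k \<in> vars Q ==> g k = g' k" for g g' :: "nat => 'a gen_poly" and Q
  by (rule hom_eqI[OF subst_hom subst_hom]) (use that in auto)
 have tl: "t <= t * l" using l by simp
 have "good P" unfolding good_def proof (intro conjI allI ballI impI)
  show "vars P <= {1..t * l}" and "lookup P m \<in> \<int>" for m using P(1) by (auto simp: intp_def)
  fix m and A :: "'a gen_poly mat" assume m: "t * l <= m" and A: "A \<in> carrier_mat m m"
  have "sigma_mat t (A ^\<^sub>m l) = ct {..<m} t (mp m l (%i j. A $$ (i, j)))"
   by (rule ct_eq_sigma_mat) (use A order_trans[OF tl m] pow_mat_eq_mp[OF A] in auto)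
  also have "... = subst (%k. ct {..<m} k (%i j. A $$ (i, j))) P" by (rule P(2))
  also have "... = subst (%k. sigma_mat k A) P"
   by (rule sub_cong) (use P(1) m sigma_mat_eq_ct[OF A] in "auto simp: intp_def")
  finally show "sigma_mat t (A ^\<^sub>m l) = subst (%k. sigma_mat k A) P" .
 qed
 moreover have "Q = P" if "good Q" for Q proof -
  define A where "A = mat (t * l) (t * l) (%(i, j). comp (%k. Var (k, 0, 0) :: 'a gen_poly) i j)"
  have A: "A \<in> carrier_mat (t * l) (t * l)" by (simp add: A_def)
  have s: "sigma_mat k A = Var (k, 0, 0)" if "k \<in> {1..t * l}" for k proof -
   have "sigma_mat k A = ct {..<t * l} k (comp (%k. Var (k, 0, 0)))"
    by (rule ct_eq_sigma_mat[OF A]) (use that in "auto simp: A_def")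
   thus ?thesis using that by (simp add: ct_comp)
  qed
  have e: "subst (%k. sigma_mat k A) R = subst (%k. Var (k, 0, 0)) R" if "good R" for R
   by (rule sub_cong) (use that s in "auto simp: good_def")
  have "subst (%k. sigma_mat k A) Q = subst (%k. sigma_mat k A) P"
   using that `good P` A unfolding good_def by (metis order_refl)
  hence "subst (%k. Var (k, 0, 0) :: 'a gen_poly) Q = subst (%k. Var (k, 0, 0)) P" using e that `good P` by simp
  hence "subst (%(k, _, _). Var k :: (nat, 'a) mpoly) (subst (%k. Var (k, 0, 0) :: 'a gen_poly) Q) = subst (%(k, _, _). Var k :: (nat, 'a) mpoly) (subst (%k. Var (k, 0, 0) :: 'a gen_poly) P)"
   by simp
  moreover have "subst (%(k, _, _). Var k :: (nat, 'a) mpoly) (subst (%k. Var (k, 0, 0) :: 'a gen_poly) R) = R" for R :: "(nat, 'a) mpoly"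
   by (rule hom_eqI[OF comm_ring_hom_compose[OF subst_hom subst_hom] comm_ring_hom_id]) auto
  ultimately show ?thesis by simp
 qed
 ultimately have "P_poly t l = P" unfolding P_poly_def good_def[symmetric] by (intro the_equality)
 thus "intp {1..t * l} (P_poly t l :: (nat, 'a::field) mpoly)"
  and "!!N A. ct {..<N} t (mp N l A) = subst (%k. ct {..<N} k A :: 'a gen_poly) (P_poly t l)" using P by auto
qed

section \<open>Evaluation at generic matrices\<close>

definition wm :: "nat => nat list => nat => nat => 'a::comm_ring_1 gen_poly" where
 "wm N = wmat {..<N} (%k i j. Var (i, j, k))"

lemma phi_carrier [simp]: "phi N w \<in> carrier_mat N N" by (induction w) (auto simp: phi_def generic_mat_def)

lemma phi_eq_wm:
 "i < N ==> j < N ==> wm N w i j = (phi N w $$ (i, j) :: 'a::comm_ring_1 gen_poly)"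
proof (induction w arbitrary: i)
 case Nil
 thus ?case by (simp add: wm_def phi_def)
next
 case (Cons k w)
 note d = carrier_matD[OF phi_carrier[of N w]]
 have "phi N (k # w) = (generic_mat N k * phi N w :: 'a gen_poly mat)" by (simp add: phi_def)
 hence "(phi N (k # w) $$ (i, j) :: 'a gen_poly) = (\<Sum>m<N. Var (i, m, k) * phi N w $$ (m, j))"
  using Cons.prems by (simp add: generic_mat_def scalar_prod_def lessThan_atLeast0 d)
 also have "... = (\<Sum>m<N. Var (i, m, k) * wm N w m j)" using Cons by (intro sum.cong) auto
 finally show ?case by (simp add: wm_def)
qed

lemma sigma_mat_phi: "t <= N ==> sigma_mat t (phi N w) = ct {..<N} t (wm N w)" by (rule ct_eq_sigma_mat) (auto simp: phi_eq_wm)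

lemma Phi_hom: "comm_ring_hom (Phi_tilde N)" unfolding Phi_tilde_def by (rule subst_hom)

lemma Phi_large_sg: assumes "0 < t" "e \<in> X_tilde" shows "Phi_tilde N (large_sg t e :: 'a::field large_sigmaX) = ct {..<N} t (wm N e)"
proof -
 have "Rep_large_symbol (Abs_large_symbol (t, e)) = (t, e)" by (rule Abs_large_symbol_inverse) (use assms in auto)
 thus ?thesis by (simp add: Phi_tilde_def large_sg_def sigma_mat_phi ct_eq_0)
qed

lemma Phi_Const [simp]: "Phi_tilde N (Const c) = Const c" by (simp add: Phi_tilde_def)

definition phN :: "nat => 'a::field nc_poly => nat => nat => 'a gen_poly" where
 "phN N a i j = (\<Sum>w\<in>keys a. Const (lookup a w) * wm N w i j)"

lemma phN_superset: "finite S ==> keys a <= S ==> phN N a i j = (\<Sum>w\<in>S. Const (lookup a w) * wm N w i j)"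
 unfolding phN_def by (intro sum.mono_neutral_left) (auto simp: in_keys_iff Const_simps)

lemma phN_add: "phN N (a + b) i j = phN N a i j + phN N b i j"
proof -
 let ?S = "keys a Un keys b"
 show ?thesis using keys_add[of a b] by (subst (1 2 3) phN_superset[of ?S]) (auto simp: lookup_add Const_simps distrib_right sum.distrib)
qed

lemma phN_0 [simp]: "phN N 0 i j = 0" by (simp add: phN_def)

lemma phN_sum: "phN N (sum f A) i j = (\<Sum>a\<in>A. phN N (f a) i j)" by (induction A rule: infinite_finite_induct) (auto simp: phN_add)

lemma phN_sum_list: "phN N (sum_list as) i j = (\<Sum>l<length as. phN N (as ! l) i j)"
 by (induction as) (auto simp: phN_add sum.lessThan_Suc_shift simp del: sum.lessThan_Suc)

lemma phN_single: "phN N (single w c) i j = Const c * wm N w i j" by (cases "c = 0") (auto simp: phN_def Const_simps)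

lemma phN_word: "phN N (word w) i j = wm N w i j" by (simp add: word_def phN_single Const_simps)

lemma phN_mult: assumes "i < N" shows "phN N (a * b) i j = (\<Sum>k<N. phN N a i k * phN N b k j)"
proof -
 let ?s = "%f. (\<Sum>m\<in>keys f. single m (lookup f m))"
 have w: "wm N (u + v) i j = (\<Sum>k<N. wm N u i k * wm N v k j)" for u v unfolding wm_def plus_list_def by (rule wmat_append) (use assms in auto)
 let ?a = "%m. Const (lookup a m)" and ?b = "%m. Const (lookup b m)"
 let ?A = "keys a" and ?B = "keys b"
 have "phN N (a * b) i j = phN N (?s a * ?s b) i j" by (simp flip: mpoly_expand)
 also have "... = (\<Sum>m\<in>?A. \<Sum>n\<in>?B. ?a m * ?b n * (\<Sum>k<N. wm N m i k * wm N n k j))"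
  unfolding sum_product phN_sum mult_single phN_single w Const_simps ..
 also have "... = (\<Sum>m\<in>?A. \<Sum>n\<in>?B. \<Sum>k<N. (?a m * wm N m i k) * (?b n * wm N n k j))" by (simp add: sum_distrib_left mult_ac)
 also have "... = (\<Sum>m\<in>?A. \<Sum>k<N. \<Sum>n\<in>?B. (?a m * wm N m i k) * (?b n * wm N n k j))" by (intro sum.cong refl sum.swap)
 also have "... = (\<Sum>k<N. \<Sum>m\<in>?A. \<Sum>n\<in>?B. (?a m * wm N m i k) * (?b n * wm N n k j))" by (rule sum.swap)
 finally show ?thesis by (simp add: phN_def sum_product)
qed

lemma phN_single_nil_mult: "i < N ==> phN N (single [] c * a) i j = Const c * phN N a i j"
 by (simp add: phN_mult phN_single wm_def mult.assoc sum_of_bool_left flip: sum_distrib_left)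

lemma phN_word_subst: "i < N ==> j < N ==> phN N (word_subst as e) i j = wmat {..<N} (%l. phN N (as ! l)) e i j"
proof (induction e arbitrary: i)
 case Nil
 have "(1 :: 'a nc_poly) = single [] 1" by (simp add: zero_list_def flip: single_one)
 hence "phN N (1 :: 'a nc_poly) i j = Const 1 * wm N [] i j" using phN_single[of N "[]" "1 :: 'a" i j] by simp
 thus ?case by (simp add: word_subst_def wm_def Const_simps)
next
 case (Cons l e)
 thus ?case by (simp add: word_subst_def phN_mult)
qed

lemma word_less_linear: "word_less u v \<or> u = v \<or> word_less v u" unfolding word_less_def by (rule lexord_linear) auto

lemma word_less_trans: "word_less u v ==> word_less v w ==> word_less u w"
 unfolding word_less_def by (rule lexord_trans) (auto intro: transI)

lemma word_less_irrefl: "~ word_less u u" unfolding word_less_def by (rule lexord_irreflexive) auto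

lemma highest_word_props: fixes a :: "'a::field nc_poly" assumes "a ~= 0"
 shows "highest_word a \<in> keys a" "v \<in> keys a ==> v = highest_word a \<or> word_less v (highest_word a)"
proof -
 have ex: "\<exists>w\<in>S. \<forall>v\<in>S. v = w \<or> word_less v w" if "finite S" "S ~= {}" for S using that
 proof (induction rule: finite_ne_induct)
  case (insert x F)
  then obtain w where "w \<in> F" "\<forall>v\<in>F. v = w \<or> word_less v w" by blast
  thus ?case using word_less_linear[of x w] word_less_trans by (metis insert_iff)
 qed auto
 have "keys a ~= {}" using assms by simp
 then obtain w where w: "w \<in> keys a" "\<forall>v\<in>keys a. v = w \<or> word_less v w" using ex[of "keys a"] by auto
 have "highest_word a = w" unfolding highest_word_def using w word_less_trans word_less_irrefl by (intro the_equality) (blast, metis)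
 thus "highest_word a \<in> keys a" "v \<in> keys a ==> v = highest_word a \<or> word_less v (highest_word a)" using w by auto
qed

lemma lookup_single_nil_mult: "lookup (single [] c * a) w = c * lookup (a :: 'a::field nc_poly) w"
proof -
 have p: "[] + m = (m :: nat list)" for m by (simp add: plus_list_def)
 have "single [] c * a = (\<Sum>m\<in>keys a. single m (c * lookup a m))" by (subst (1) mpoly_expand) (simp add: sum_distrib_left mult_single p)
 thus ?thesis by (auto simp: lookup_sum lookup_single when_def in_keys_iff)
qed

lemma normalized_symbol: fixes a :: "'a::field nc_poly" assumes a: "a \<in> FX" "a ~= 0" and t: "0 < t" shows "highest_coeff a ~= 0"
  and "Rep_sigma_symbol (Abs_sigma_symbol (t, single [] (inverse (highest_coeff a)) * a)) =
   (t, single [] (inverse (highest_coeff a)) * a)"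
proof -
 let ?c = "highest_coeff a"
 let ?b = "single [] (inverse ?c) * a"
 show c: "?c ~= 0" using highest_word_props(1)[OF a(2)] by (simp add: highest_coeff_def in_keys_iff)
 have k: "keys ?b = keys a" using c by (auto simp: in_keys_iff lookup_single_nil_mult)
 have "highest_word ?b = highest_word a" unfolding highest_word_def k ..
 hence "highest_coeff ?b = 1" using c by (simp add: highest_coeff_def lookup_single_nil_mult)
 moreover have "?b ~= 0" using k a(2) by (metis keys_eq_empty)
 ultimately show "Rep_sigma_symbol (Abs_sigma_symbol (t, ?b)) = (t, ?b)" using a(1) t k by (intro Abs_sigma_symbol_inverse) (auto simp: FX_def)
qed

definition Psi :: "nat => 'a::field sigmaX => 'a gen_poly" where
 "Psi N = subst (%s. case Rep_sigma_symbol s of (t, a) => ct {..<N} t (phN N a))"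

lemma Psi_hom: "comm_ring_hom (Psi N)" unfolding Psi_def by (rule subst_hom)

lemma Psi_sg: assumes a: "a \<in> FX" shows "Psi N (sg t a) = ct {..<N} t (phN N a)"
proof -
 interpret P: comm_ring_hom "Psi N" by (rule Psi_hom)
 consider "t = 0" | "t > 0" "a = 0" | "t > 0" "a ~= 0" by blast
 thus ?thesis proof cases
  case 1
  thus ?thesis by (simp add: sg_def)
 next
  case 2
  hence "ct {..<N} t (phN N a) = ct {..<N} t (%_ _. 0)" by (intro ct_cong) simp
  thus ?thesis using 2 by (simp add: sg_def ct_zero)
 next
  case 3
  let ?c = "highest_coeff a"
  note n = normalized_symbol[OF a 3(2,1)]
  have "Psi N (sg t a) = Const (?c ^ t) * ct {..<N} t (phN N (single [] (inverse ?c) * a))"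
   using 3 n by (simp add: sg_def P.hom_mult) (simp add: Psi_def)
  also have "ct {..<N} t (phN N (single [] (inverse ?c) * a)) = ct {..<N} t (%i j. Const (inverse ?c) * phN N a i j)"
   by (rule ct_cong) (simp add: phN_single_nil_mult)
  also have "... = Const (inverse ?c ^ t) * ct {..<N} t (phN N a)" by (simp add: ct_scale Const_simps)
  also have "Const (?c ^ t) * (Const (inverse ?c ^ t) * ct {..<N} t (phN N a)) = Const ((?c * inverse ?c) ^ t) * ct {..<N} t (phN N a)"
   by (simp add: Const_simps power_mult_distrib mult_ac)
  finally show ?thesis using n(1) by (simp add: Const_simps)
 qed
qed

lemma FX_mult: "a \<in> FX ==> a * b \<in> FX" using keys_mult[of a b] by (force simp: FX_def plus_list_def)

lemma word_FX: "w ~= [] ==> word w \<in> FX" by (simp add: FX_def word_def)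

lemma word_mult: "word u * word v = (word (u @ v) :: 'a::field nc_poly)" by (simp add: word_def mult_single plus_list_def)

lemma word_subst_FX: "set as <= FX ==> e ~= [] ==> set e <= {..<length as} ==> word_subst as e \<in> FX"
 by (cases e) (auto simp: word_subst_def intro!: FX_mult)

definition tm :: "nat list => (nat mon)" where
 "tm ts = (\<Sum>l<length ts. single l (ts ! l))"

lemma lookup_tm: "lookup (tm ts) i = (if i < length ts then ts ! i else 0)" by (auto simp: tm_def lookup_sum lookup_single when_def sum.delta)

lemma mdeg_tm: "mdeg (tm ts) = sum_list ts" by (simp add: tm_def mdeg_sum sum_list_sum_nth atLeast0LessThan)

lemma Omega_zero: assumes "\<forall>t\<in>set ts. t = 0" shows "Omega ts = {}"
proof -
 have "om \<notin> Omega ts" for om proof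
  assume w: "om \<in> Omega ts"
  then obtain e where e: "e \<in># om" by (auto simp: Omega_def)
  hence "lyn e" using w by (auto simp: Omega_def X_tilde_iff_lyn)
  then obtain i where i: "i \<in> set e" by (cases e) (auto simp: lyn_def)
  have "(\<Sum>e\<in>set_mset om. count om e * count_list e i) = 0" using w assms by (auto simp: Omega_def)
  hence "count om e * count_list e i = 0" using e by simp
  thus False using e i by (auto simp: count_list_0_iff count_eq_zero_iff)
 qed
 thus ?thesis by blast
qed

lemma Omega_Kset: assumes nz: "\<exists>t\<in>set ts. t ~= 0"
 defines "r \<equiv> sum_list ts" and "u \<equiv> length ts"
 shows "bij_betw (%om. restrict (count om) (Lyn u r)) (Omega ts) (Kset u r (tm ts))"
  and "!!om. om \<in> Omega ts ==> set_mset om <= Lyn u r"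
proof -
 let ?s = "%A om i. \<Sum>e\<in>A. count om e * count_list e i"
 show sub: "set_mset om <= Lyn u r" if w: "om \<in> Omega ts" for om proof
  fix e assume e: "e \<in># om"
  have s: "?s (set_mset om) om i = (if i < u then ts ! i else 0)" for i using w by (simp add: Omega_def u_def)
  have "lyn e" using w e by (auto simp: Omega_def X_tilde_iff_lyn)
  moreover have "set e <= {..<u}" proof
   fix i assume i: "i \<in> set e"
   show "i \<in> {..<u}" proof (rule ccontr)
    assume "i \<notin> {..<u}"
    hence "count om e * count_list e i = 0" using s[of i] e by simp
    thus False using e i by (auto simp: count_list_0_iff count_eq_zero_iff)
   qed
  qed
  moreover have "length e <= r" proof -
   have len: "length e = (\<Sum>i<u. count_list e i)" using `set e <= {..<u}` by (simp add: sum_count_set)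
   have "count_list e i <= ts ! i" if "i < u" for i proof -
    have "count_list e i <= count om e * count_list e i" using e by simp
    also have "... <= ?s (set_mset om) om i" by (rule member_le_sum) (use e in auto)
    finally show ?thesis using s[of i] that by simp
   qed
   hence "length e <= (\<Sum>i<u. ts ! i)" unfolding len by (intro sum_mono) auto
   thus ?thesis by (simp add: r_def u_def sum_list_sum_nth atLeast0LessThan)
  qed
  ultimately show "e \<in> Lyn u r" by (simp add: Lyn_def Wds_def)
 qed
 define g where "g = (%ka :: nat list => nat. \<Sum>w\<in>Lyn u r. replicate_mset (ka w) w)"
 have cg: "count (g ka) w = (if w \<in> Lyn u r then ka w else 0)" for ka w proof -
  have "count (g ka) w = (\<Sum>x\<in>Lyn u r. if x = w then ka x else 0)" unfolding g_def count_sum by (rule sum.cong) auto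
  thus ?thesis by (simp add: sum.delta)
 qed
 have sumeq: "?s (set_mset om) om i = ?s (Lyn u r) om i"
  if "set_mset om <= Lyn u r" for om i by (rule sum.mono_neutral_left) (use that in "auto simp: not_in_iff")
 show "bij_betw (%om. restrict (count om) (Lyn u r)) (Omega ts) (Kset u r (tm ts))" proof (rule bij_betwI[where g = g])
  show "(%om. restrict (count om) (Lyn u r)) \<in> Omega ts \<rightarrow> Kset u r (tm ts)" proof
   fix om assume w: "om \<in> Omega ts"
   have s: "?s (Lyn u r) om i = lookup (tm ts) i" for i using w sumeq[OF sub[OF w], of i] by (simp add: Omega_def lookup_tm)
   have "count om e <= r" if e: "e \<in> Lyn u r" for e proof -
    obtain i where i: "i \<in> set e" "i < u" using e by (cases e) (auto simp: Lyn_def lyn_def Wds_def)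
    have "count om e <= count om e * count_list e i" using i by (simp add: Suc_le_eq count_list_0_iff neq0_conv[symmetric] del: neq0_conv)
    also have "... <= ?s (Lyn u r) om i" by (rule member_le_sum) (use e in auto)
    also have "... = ts ! i" using s[of i] i by (simp add: lookup_tm u_def)
    also have "... <= r" unfolding r_def by (rule member_le_sum_list) (use i in "auto simp: u_def")
    finally show ?thesis .
   qed
   thus "restrict (count om) (Lyn u r) \<in> Kset u r (tm ts)" using s by (simp add: Kset_def)
  qed
  show "g \<in> Kset u r (tm ts) \<rightarrow> Omega ts" proof
   fix ka assume k: "ka \<in> Kset u r (tm ts)"
   have sg: "set_mset (g ka) <= Lyn u r" using cg by (metis count_eq_zero_iff subsetI)
   have s: "(\<Sum>e\<in>set_mset (g ka). count (g ka) e * count_list e i) = (if i < length ts then ts ! i else 0)" for i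
    using k unfolding sumeq[OF sg] by (simp add: cg Kset_def lookup_tm)
   moreover have "g ka ~= {#}" proof
    assume "g ka = {#}"
    hence "(if i < length ts then ts ! i else 0) = 0" for i using s[of i] by simp
    thus False using nz by (metis in_set_conv_nth)
   qed
   moreover have "set_mset (g ka) <= X_tilde" using sg by (auto simp: X_tilde_iff_lyn Lyn_def)
   ultimately show "g ka \<in> Omega ts" by (simp add: Omega_def)
  qed
  show "g (restrict (count om) (Lyn u r)) = om" if "om \<in> Omega ts" for om
   using sub[OF that] by (intro multiset_eqI) (auto simp: cg not_in_iff)
  show "restrict (count (g ka)) (Lyn u r) = ka" if "ka \<in> Kset u r (tm ts)" for ka
   using that by (auto simp: cg Kset_def fun_eq_iff PiE_iff extensional_def)
 qed
qed

lemma Psi_sigma_multi: fixes as :: "'a::field nc_poly list" assumes as: "set as <= FX" and len: "length ts = length as"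
 shows "Psi N (sigma_multi ts as) = lookup (D {..<N} (lmat (length as) (%l. phN N (as ! l)))) (tm ts)"
proof -
 interpret P: comm_ring_hom "Psi N" by (rule Psi_hom)
 let ?I = "{..<N}" and ?u = "length as" and ?r = "sum_list ts" and ?X = "%l. phN N (as ! l)"
 let ?p = "%ka. \<Prod>w\<in>Lyn ?u ?r. (- 1) ^ ka w * ct ?I (ka w) (wmat ?I ?X w)"
 let ?D = "lookup (D ?I (lmat ?u ?X)) (tm ts)" and ?K = "\<Sum>ka\<in>Kset ?u ?r (tm ts). ?p ka"
 have am: "(- 1) ^ ?r * ?D = ?K" using amitsur_coeff[of ?I "tm ts" ?r ?u ?X] by (simp add: mdeg_tm)
 have sq: "(- 1 :: 'a gen_poly) ^ k * ((- 1) ^ k * x) = x" for k x by (simp flip: mult.assoc power_mult_distrib)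
 have "?D = (- 1) ^ ?r * ((- 1) ^ ?r * ?D)" by (rule sq[symmetric])
 also have "... = (- 1) ^ ?r * ?K" unfolding am ..
 finally have L: "?D = (- 1) ^ ?r * ?K" .
 show ?thesis proof (cases "\<forall>t\<in>set ts. t = 0")
  case True
  hence r0: "?r = 0" by simp
  have "Lyn ?u 0 = {}" by (auto simp: Lyn_def Wds_def lyn_def)
  moreover from this have "Kset ?u 0 (tm ts) = {%_. undefined}" using True by (auto simp: Kset_def lookup_tm)
  ultimately have "?D = 1" unfolding L r0 by simp
  thus ?thesis using Omega_zero[OF True] by (simp add: sigma_multi_def)
 next
  case False
  hence nz: "\<exists>t\<in>set ts. t ~= 0" by blast
  note OK = Omega_Kset[OF nz, unfolded len]
  have ne: "Omega ts ~= {}" proof -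
   define om where "om = (\<Sum>i<length ts. replicate_mset (ts ! i) [i])"
   have c: "count om e = (\<Sum>i<length ts. if [i] = e then ts ! i else 0)" for e unfolding om_def count_sum by (rule sum.cong) auto
   have c1: "count om [i] = (if i < length ts then ts ! i else 0)" for i unfolding c by (simp add: sum.delta)
   have c2: "\<exists>i<length ts. e = [i]" if "e \<in># om" for e proof (rule ccontr)
    assume "~ ?thesis"
    hence "count om e = 0" unfolding c by (auto intro!: sum.neutral)
    thus False using that by (simp add: count_eq_zero_iff)
   qed
   have "(\<Sum>e\<in>set_mset om. count om e * count_list e i) = (if i < length ts then ts ! i else 0)" for i proof -
    have cl: "count_list [k] i = (if k = i then 1 else 0)" for k by simp
    have "(\<Sum>e\<in>set_mset om. count om e * count_list e i) = (\<Sum>e\<in>(%i. [i]) ` {..<length ts}. count om e * count_list e i)"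
     by (rule sum.mono_neutral_left) (use c2 in "auto simp: not_in_iff")
    also have "... = (\<Sum>k<length ts. if k = i then ts ! k else 0)"
     by (subst sum.reindex) (simp_all add: inj_on_def c1 cl if_distrib[of "(*) _"] del: count_list.simps cong: if_cong sum.cong_simp)
    finally show ?thesis by (simp add: sum.delta)
   qed
   moreover have "om ~= {#}" proof
    assume "om = {#}"
    hence "(if i < length ts then ts ! i else 0) = 0" for i using c1[of i] by simp
    thus False using nz by (metis in_set_conv_nth)
   qed
   moreover have "set_mset om <= X_tilde" using c2 single_letter_X_tilde by blast
   ultimately have "om \<in> Omega ts" unfolding Omega_def by blast
   thus ?thesis by blast
  qed
  have term_eq: "(- 1) ^ size om * (\<Prod>e\<in>set_mset om. Psi N (sg (count om e) (word_subst as e))) = ?p (restrict (count om) (Lyn ?u ?r))"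
   if w: "om \<in> Omega ts" for om
  proof -
   note sub = OK(2)[OF w]
   have "Psi N (sg (count om e) (word_subst as e)) = ct ?I (count om e) (wmat ?I ?X e)" if "e \<in># om" for e proof -
    have "word_subst as e \<in> FX" using sub that by (intro word_subst_FX as) (auto simp: Lyn_def lyn_def Wds_def)
    thus ?thesis by (simp add: Psi_sg) (rule ct_cong, simp add: phN_word_subst)
   qed
   hence "(\<Prod>e\<in>set_mset om. Psi N (sg (count om e) (word_subst as e))) = (\<Prod>e\<in>set_mset om. ct ?I (count om e) (wmat ?I ?X e))"
    by simp
   also have "... = (\<Prod>e\<in>Lyn ?u ?r. ct ?I (count om e) (wmat ?I ?X e))"
    by (rule prod.mono_neutral_left) (use sub in "auto simp: not_in_iff")
   finally have 1: "(\<Prod>e\<in>set_mset om. Psi N (sg (count om e) (word_subst as e))) = ..." .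
   have "size om = (\<Sum>e\<in>Lyn ?u ?r. count om e)"
    unfolding size_multiset_overloaded_eq by (rule sum.mono_neutral_left) (use sub in "auto simp: not_in_iff")
   thus ?thesis unfolding 1 by (simp add: power_sum prod.distrib)
  qed
  have neg: "Psi N ((- 1) ^ k * x) = (- 1) ^ k * Psi N x" for k x by (simp add: P.hom_mult P.hom_power P.hom_uminus)
  have "Psi N (sigma_multi ts as) = (- 1) ^ ?r * (\<Sum>om\<in>Omega ts. (- 1) ^ size om * (\<Prod>e\<in>set_mset om. Psi N (sg (count om e) (word_subst as e))))"
   using ne by (simp add: sigma_multi_def neg P.hom_sum P.hom_prod)
  also have "... = (- 1) ^ ?r * (\<Sum>om\<in>Omega ts. ?p (restrict (count om) (Lyn ?u ?r)))" by (simp add: term_eq)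
  also have "(\<Sum>om\<in>Omega ts. ?p (restrict (count om) (Lyn ?u ?r))) = ?K" by (rule sum.reindex_bij_betw[OF OK(1)])
  finally show ?thesis unfolding L .
 qed
qed

lemma ct_sum_lookup: fixes X :: "nat => nat => nat => 'r::comm_ring_1" assumes fin: "finite I"
 shows "ct I t (%i j. \<Sum>l<u. X l i j) = (\<Sum>ts | length ts = u & sum_list ts = t. lookup (D I (lmat u X)) (tm ts))"
proof -
 define h where "h = ev (%x::'r. x) (%_::nat. 1)"
 have hh: "comm_ring_hom h" unfolding h_def by (rule ev_hom[OF comm_ring_hom_id])
 interpret h: comm_ring_hom h by (rule hh)
 have hv: "h (Var l) = 1" "h (Const c) = c" for l c by (simp_all add: h_def comm_ring_hom_id)
 let ?c = "ct I t (lmat u X)"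
 let ?T = "{ts. length ts = u & sum_list ts = t}"
 have vars: "keys m <= {..<u}" if "m \<in> keys ?c" for m proof -
  define p where "p = subst (%l. if l < u then Var l else 0 :: (nat, 'r) mpoly)"
  have ph: "comm_ring_hom p" unfolding p_def by (rule subst_hom)
  interpret p: comm_ring_hom p by (rule ph)
  have "p ?c = ?c" unfolding ct_hom[OF ph] lmat_def p.hom_sum p.hom_mult by (intro ct_cong sum.cong refl) (auto simp: p_def)
  hence "?c = (\<Sum>m\<in>keys ?c. Const (lookup ?c m) * monoval (%l. if l < u then Var l else 0) m)" by (simp add: p_def subst_eq_ev ev_def)
  also have "... = (\<Sum>m\<in>keys ?c. if keys m <= {..<u} then single m (lookup ?c m) else 0)" proof (rule sum.cong[OF refl])
   fix m
   show "Const (lookup ?c m) * monoval (%l. if l < u then Var l else 0) m = (if keys m <= {..<u} then single m (lookup ?c m) else 0)"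
   proof (cases "keys m <= {..<u}")
    case True
    hence "monoval (%l. if l < u then Var l else (0 :: (nat, 'r) mpoly)) m = monoval Var m" unfolding monoval_def by (intro prod.cong) auto
    thus ?thesis using True by (simp add: monoval_Var Const_def mult_single)
   next
    case False
    then obtain l where l: "l \<in> keys m" "~ l < u" by auto
    hence "monoval (%l. if l < u then Var l else (0 :: (nat, 'r) mpoly)) m = 0"
     unfolding monoval_def by (intro prod_zero) (auto intro!: bexI[of _ l] simp: in_keys_iff zero_power)
    thus ?thesis using False by simp
   qed
  qed
  finally have "lookup ?c m = lookup ... m" by simp
  hence "lookup ?c m = (\<Sum>m'\<in>keys ?c. if keys m' <= {..<u} then (lookup ?c m' when m' = m) else 0)"
   by (simp add: lookup_sum if_distrib[of "%p. lookup p m"] lookup_single cong: if_cong)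
  also have "... = (\<Sum>m'\<in>keys ?c. if m' = m then (if keys m <= {..<u} then lookup ?c m else 0) else 0)"
   by (rule sum.cong) (auto simp: when_def)
  also have "... = (if keys m <= {..<u} then lookup ?c m else 0)" using that by (simp add: sum.delta)
  finally show ?thesis using that by (auto simp: in_keys_iff split: if_splits)
 qed
 have deg: "mdeg m = t" if "m \<in> keys ?c" for m using that by (auto simp: in_keys_iff lookup_ct_lmat when_def split: if_splits)
 have injt: "inj_on tm ?T" proof (rule inj_onI)
  fix xs ys assume "xs \<in> ?T" "ys \<in> ?T" "tm xs = tm ys"
  thus "xs = ys" by (intro nth_equalityI) (auto, metis lookup_tm)
 qed
 have finT: "finite ?T" proof -
  have "?T <= {ts. set ts <= {..t} & length ts = u}" using member_le_sum_list by fastforce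
  thus ?thesis by (rule finite_subset) (rule finite_lists_length_eq, simp)
 qed
 have "ct I t (%i j. \<Sum>l<u. X l i j) = h ?c" unfolding ct_hom[OF hh] by (simp add: lmat_def h.hom_sum h.hom_mult hv)
 also have "... = (\<Sum>m\<in>keys ?c. lookup ?c m)" by (simp add: h_def ev_def monoval_def)
 also have "... = (\<Sum>m\<in>tm ` ?T. lookup ?c m)" proof (rule sum.mono_neutral_left)
  show "keys ?c <= tm ` ?T" proof
   fix m assume m: "m \<in> keys ?c"
   define ts where "ts = map (lookup m) [0..<u]"
   have "tm ts = m" using vars[OF m] by (intro poly_mapping_eqI) (auto simp: lookup_tm ts_def in_keys_iff)
   moreover from this have "sum_list ts = t" using deg[OF m] mdeg_tm[of ts] by simp
   ultimately show "m \<in> tm ` ?T" by (auto simp: ts_def image_iff intro!: exI[of _ ts])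
  qed
 qed (use finT in "auto simp: in_keys_iff")
 also have "... = (\<Sum>ts\<in>?T. lookup ?c (tm ts))" by (simp add: sum.reindex[OF injt])
 also have "... = (\<Sum>ts\<in>?T. lookup (D I (lmat u X)) (tm ts))" by (rule sum.cong) (auto simp: lookup_ct_lmat mdeg_tm)
 finally show ?thesis .
qed

lemma Psi_relations: assumes "f \<in> sigma_relations" shows "Psi N (f :: 'a::field sigmaX) = 0"
proof -
 interpret P: comm_ring_hom "Psi N" by (rule Psi_hom)
 from assms consider
   t as where "f = sg t (sum_list as) - F_elem t as" "0 < t" "1 < length as" "set as <= FX"
  | t l a where "f = sg t (word a ^ l) - P_elem t l (word a)" "0 < t" "1 < l" "a ~= []"
  | t a b where "f = sg t (word a * word b) - sg t (word b * word a)" "0 < t" "a ~= []" "b ~= []" unfolding sigma_relations_def by blast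
 thus ?thesis proof cases
  case 1
  have "sum_list as \<in> FX" using 1(4) proof (induction as)
   case (Cons a as)
   thus ?case using keys_add[of a "sum_list as"] by (auto simp: FX_def)
  qed (simp add: FX_def)
  hence "Psi N (sg t (sum_list as)) = ct {..<N} t (%i j. \<Sum>l<length as. phN N (as ! l) i j)" by (simp add: Psi_sg phN_sum_list[abs_def])
  also have "... = Psi N (F_elem t as)" unfolding F_elem_def P.hom_sum ct_sum_lookup[OF finite_lessThan]
   by (rule sum.cong) (auto simp: Psi_sigma_multi 1(4))
  finally show ?thesis unfolding 1(1) by (simp add: P.hom_minus)
 next
  case 2
  have wp: "word a ^ k = (word (pw k a) :: 'a nc_poly)" for k proof (induction k)
   case 0
   show ?case by (simp add: word_def zero_list_def flip: single_one)
  qed (simp add: word_mult)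
  have ne: "pw l a ~= []" using 2 by (cases l) auto
  have wm: "wm N (pw k a) i j = (mp N k (wm N a) i j :: 'a gen_poly)" if "i < N" for k i j using that proof (induction k arbitrary: i)
   case (Suc k)
   have "wm N (a @ pw k a) i j = (\<Sum>m<N. ( wm N a i m * wm N (pw k a) m j :: 'a gen_poly))"
    unfolding wm_def by (rule wmat_append) (use Suc in auto)
   also have "... = (\<Sum>m<N. wm N a i m * mp N k (wm N a) m j)" using Suc by (intro sum.cong) auto
   finally show ?case by (simp add: mp_def)
  qed (simp add: wm_def mp_def)
  have "Psi N (sg t (word a ^ l) :: 'a sigmaX) = ct {..<N} t (phN N (word (pw l a)))" unfolding wp by (rule Psi_sg[OF word_FX[OF ne]])
  also have "... = ct {..<N} t (mp N l (wm N a))" by (rule ct_cong) (simp add: phN_word wm)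
  also have "... = subst (%k. ct {..<N} k (wm N a)) (P_poly t l)" by (rule P_poly_spec(2)) (use 2 in auto)
  also have "... = Psi N (P_elem t l (word a))" unfolding P_elem_def
  proof (rule hom_eqI[OF subst_hom comm_ring_hom_compose[OF Psi_hom subst_hom]])
   show "subst (%k. ct {..<N} k (wm N a)) (Var v) = Psi N (subst (%k. sg k (word a)) (Var v :: (nat, 'a) mpoly))" for v
    using Psi_sg[OF word_FX[OF 2(4)], of N v, where 'a = 'a] by (simp add: phN_word[abs_def])
  qed (simp add: Psi_def)
  finally show ?thesis unfolding 2(1) by (simp add: P.hom_minus)
 next
  case 3
  have "Psi N (sg t (word (x @ y)) :: 'a sigmaX) = ct {..<N} t (%i j. \<Sum>k<N. wm N x i k * wm N y k j)" if "x ~= []" for x y proof -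
   have "Psi N (sg t (word (x @ y)) :: 'a sigmaX) = ct {..<N} t (phN N (word (x @ y)))" by (rule Psi_sg[OF word_FX]) (use that in auto)
   also have "... = ct {..<N} t (%i j. \<Sum>k<N. wm N x i k * wm N y k j)" by (rule ct_cong) (simp add: phN_word wm_def wmat_append)
   finally show ?thesis .
  qed
  moreover have "ct {..<N} t (%i j. \<Sum>k<N. wm N a i k * wm N b k j) = ct {..<N} t (%i j. \<Sum>k<N. (wm N b i k * wm N a k j :: 'a gen_poly))"
   by (rule ct_sylvester) auto
  ultimately show ?thesis unfolding 3(1) by (simp add: P.hom_minus word_mult 3)
 qed
qed

lemma ideal_generated_zero: assumes "comm_ring_hom h" "!!x. x \<in> S ==> h x = 0" "f \<in> ideal_generated S" shows "h f = 0"
proof -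
 interpret h: comm_ring_hom h by fact
 interpret m: Modules.module "(*) :: 'a => 'a => 'a" by unfold_locales (auto simp: algebra_simps)
 show ?thesis using assms(3) unfolding ideal_generated_def by (induction rule: m.span_induct_alt) (auto simp: h.hom_add h.hom_mult assms(2))
qed

lemma alg_hom_comm_ring_hom: assumes "alg_hom h" shows "comm_ring_hom h"
proof -
 have 1: "h (Const 1) = Const 1" and a: "h (f + g) = h f + h g" for f g using assms unfolding alg_hom_def by blast+
 have "h 0 + h 0 = h 0" using a[of 0 0] by simp
 hence "h 0 = 0" by simp
 thus ?thesis using assms 1 unfolding alg_hom_def by unfold_locales (auto simp: Const_simps)
qed

theorem Phi_pi: fixes \<pi> :: "'a::field sigmaX => 'a large_sigmaX" assumes pi: "is_pi_tilde \<pi>"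
 shows "Phi_tilde N (\<pi> f) = Psi N f"
proof -
 have ah: "alg_hom \<pi>" and surj: "surj \<pi>" and ker: "{f. \<pi> f = 0} = ideal_generated sigma_relations"
  and e: "!!t e. 0 < t & e \<in> X_tilde ==> \<pi> (sg t (word e)) = large_sg t e" using pi unfolding is_pi_tilde_def by auto
 interpret pi: comm_ring_hom \<pi> by (rule alg_hom_comm_ring_hom[OF ah])
 interpret P: comm_ring_hom "Psi N" by (rule Psi_hom)
 interpret Ph: comm_ring_hom "Phi_tilde N :: 'a large_sigmaX => _" by (rule Phi_hom)
 have k: "Psi N f = 0" if "\<pi> f = 0" for f using that ker ideal_generated_zero[OF Psi_hom Psi_relations] by blast
 have wd: "Psi N f = Psi N g" if "\<pi> f = \<pi> g" for f g using k[of "f - g"] that by (simp add: pi.hom_minus P.hom_minus)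
 define s where "s = (%y. SOME f. \<pi> f = y)"
 have s: "\<pi> (s y) = y" for y unfolding s_def using surj by (metis (mono_tags, lifting) someI surjD)
 have piC: "\<pi> (Const c) = Const c" for c using ah by (simp add: alg_hom_def)
 define q where "q = (%y. Psi N (s y))"
 have q: "q (\<pi> f) = Psi N f" for f unfolding q_def by (rule wd) (rule s)
 have qh: "comm_ring_hom q" proof
  show "q (x + y) = q x + q y" for x y using q[of "s x + s y"] s by (simp add: q_def pi.hom_add P.hom_add)
  show "q (x * y) = q x * q y" for x y using q[of "s x * s y"] s by (simp add: q_def pi.hom_mult P.hom_mult)
  show "q 0 = 0" using q[of 0] by simp
  show "q 1 = 1" using q[of 1] by simp
 qed
 have "q y = Phi_tilde N y" for y proof (rule hom_eqI[OF qh Phi_hom])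
  show "q (Const c) = Phi_tilde N (Const c)" for c using q[of "Const c"] by (simp add: piC Psi_def)
  show "q (Var v) = Phi_tilde N (Var v)" for v proof -
   obtain t e where te: "Rep_large_symbol v = (t, e)" by (cases "Rep_large_symbol v")
   hence te': "0 < t" "e \<in> X_tilde" using Rep_large_symbol[of v] by auto
   have v: "Var v = large_sg t e" unfolding large_sg_def using te by (metis Rep_large_symbol_inverse)
   have ne: "e ~= []" using te'(2) by (auto simp: X_tilde_iff_lyn lyn_def)
   have "q (large_sg t e) = Psi N (sg t (word e))" using q[of "sg t (word e)"] e te' by simp
   thus ?thesis unfolding v Phi_large_sg[OF te'] by (simp add: Psi_sg word_FX ne phN_word[abs_def])
  qed
 qed
 thus ?thesis using q by metis
qed

section \<open>Faithfulness of the generic matrices of all sizes\<close>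

lemma lyn_rotate_less: "lyn e ==> k mod length e ~= 0 ==> e < rotate k e"
proof -
 assume e: "lyn e" and k: "k mod length e ~= 0"
 let ?m = "k mod length e"
 have len: "?m < length e" using e by (auto simp: lyn_def)
 have "take ?m e @ drop ?m e < drop ?m e @ take ?m e" by (rule lyn_rotation) (use e k len in auto)
 thus ?thesis by (simp add: rotate_drop_take)
qed

lemma lyn_rotate_eq: "lyn e ==> lyn (rotate k e) ==> rotate k e = e"
proof (rule ccontr)
 assume e: "lyn e" "lyn (rotate k e)" and ne: "rotate k e ~= e"
 have m: "k mod length e ~= 0" using ne rotate_id by blast
 hence 1: "e < rotate k e" using e lyn_rotate_less by blast
 let ?j = "length e - k mod length e"
 have "k mod length e < length e" using e by (auto simp: lyn_def)
 hence j: "?j mod length (rotate k e) ~= 0" using m by simp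
 have "rotate ?j (rotate k e) = rotate (?j + k) e" by (simp add: rotate_rotate)
 also have "... = e" proof (rule rotate_id)
  have "k mod length e < length e" using e by (auto simp: lyn_def)
  hence "(?j + k mod length e) mod length e = 0" by simp
  thus "(?j + k) mod length e = 0" by (simp add: mod_add_right_eq)
 qed
 finally have "rotate k e < e" using lyn_rotate_less[OF e(2) j] by simp
 thus False using 1 by simp
qed

definition rd :: "nat list => nat => nat list => bool" where
 "rd e p u <-> (\<forall>i<length u. u ! i = e ! ((p + i) mod length e))"

lemma rd_append: "rd e p (u @ v) <-> rd e p u & rd e ((p + length u) mod length e) v"
proof -
 have "(\<forall>i<length (u @ v). (u @ v) ! i = g i) <-> (\<forall>i<length u. u ! i = g i) & (\<forall>i<length v. v ! i = g (length u + i))"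
  for g :: "nat => nat"
 proof (intro iffI conjI allI impI)
  fix i assume L: "\<forall>i<length (u @ v). (u @ v) ! i = g i"
  show "i < length u ==> u ! i = g i" using L[rule_format, of i] by (simp add: nth_append)
  show "i < length v ==> v ! i = g (length u + i)" using L[rule_format, of "length u + i"] by simp
 next
  fix i assume R: "(\<forall>i<length u. u ! i = g i) & (\<forall>i<length v. v ! i = g (length u + i))" and i: "i < length (u @ v)"
  show "(u @ v) ! i = g i" proof (cases "i < length u")
   case False
   thus ?thesis using R[THEN conjunct2, rule_format, of "i - length u"] i by (simp add: nth_append)
  qed (use R in "simp add: nth_append")
 qed
 from this[of "%i. e ! ((p + i) mod length e)"]
 have "rd e p (u @ v) <-> rd e p u & (\<forall>i<length v. v ! i = e ! ((p + (length u + i)) mod length e))" unfolding rd_def .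
 thus ?thesis by (simp add: rd_def mod_add_left_eq add.assoc)
qed

lemma rd_power_nth: assumes "rd e p (pw n w)" "i < n * length w" shows "w ! (i mod length w) = e ! ((p + i) mod length e)" using assms
proof (induction n arbitrary: p i)
 case (Suc n)
 hence r: "rd e p w" "rd e ((p + length w) mod length e) (pw n w)" by (simp_all add: rd_append)
 show ?case proof (cases "i < length w")
  case True
  thus ?thesis using r(1) by (simp add: rd_def)
 next
  case False
  hence "w ! ((i - length w) mod length w) = e ! (((p + length w) mod length e + (i - length w)) mod length e)"
   using Suc.prems(2) by (intro Suc.IH r) auto
  moreover have "((p + length w) mod length e + (i - length w)) mod length e = (p + i) mod length e"
   unfolding mod_add_left_eq using False by (simp add: add.assoc)
  ultimately show ?thesis using False by (metis le_mod_geq linorder_not_less)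
 qed
qed simp

lemma rd_power_eq: assumes w: "lyn w" and e: "lyn e" and rd: "rd e p (pw (2 * length e) w)" shows "w = e"
proof -
 let ?v = "rotate p e"
 have pos: "0 < length w" "0 < length e" using w e by (auto simp: lyn_def)
 have G: "w ! (i mod length w) = e ! ((p + i) mod length e)" if "i < 2 * length e * length w" for i using rd_power_nth[OF rd that] .
 have ln: "length e <= length e * length w" "length w <= length e * length w" using pos by (auto simp: Suc_le_eq)
 have "w @ ?v = ?v @ w" proof (rule nth_equalityI)
  fix i assume "i < length (w @ ?v)"
  hence i: "i < length w + length e" by simp
  have b: "i < 2 * length e * length w" using i ln by linarith
  have 1: "(w @ ?v) ! i = w ! (i mod length w)" proof (cases "i < length w")
   case False
   hence "(w @ ?v) ! i = e ! ((p + (i - length w)) mod length e)" using i by (simp add: nth_append nth_rotate)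
   also have "... = w ! ((i - length w) mod length w)" by (rule G[symmetric]) (use b in linarith)
   finally show ?thesis using False by (simp add: le_mod_geq)
  qed (simp add: nth_append)
  have 2: "(?v @ w) ! i = e ! ((p + i) mod length e)" proof (cases "i < length e")
   case False
   hence "(?v @ w) ! i = w ! ((i - length e) mod length w)" using i by (simp add: nth_append)
   also have "... = e ! ((p + (i - length e)) mod length e)" by (rule G) (use b in linarith)
   also have "p + i = p + (i - length e) + length e" using False by simp
   hence "(p + (i - length e)) mod length e = (p + i) mod length e" by (metis mod_add_self2)
   finally show ?thesis .
  qed (simp add: nth_append nth_rotate)
  show "(w @ ?v) ! i = (?v @ w) ! i" unfolding 1 2 by (rule G[OF b])
 qed simp
 then obtain m n z where z: "pw m z = w" "pw n z = ?v" using comm_append_are_replicate by metis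
 have "z ~= []" using z(1) w by (auto simp: lyn_def)
 have "~ 1 < m" using lyn_primitive[OF w] z(1) `z ~= []` unfolding primitive_def by metis
 moreover have "m ~= 0" using z(1) w by (auto simp: lyn_def)
 ultimately have "m = 1" by linarith
 hence v: "?v = pw n w" using z by simp
 have "?v ~= []" using pos by simp
 hence "n ~= 0" using v by (intro notI) simp
 show ?thesis proof (cases "n = 1")
  case True
  hence "?v = w" using v by simp
  thus ?thesis using lyn_rotate_eq[OF e, of p] w by simp
 next
  case False
  with `n ~= 0` obtain k where k: "n = Suc (Suc k)" by (metis One_nat_def not0_implies_Suc)
  have v1: "?v = w @ pw (Suc k) w" using v k by simp
  have v2: "?v = pw (Suc k) w @ w" unfolding v k by (metis concat_append concat.simps append_Nil2 replicate_append_same replicate_Suc)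
  have "rotate (length w) ?v = ?v" using v1 v2 rotate_append by metis
  hence r: "rotate (length w + p) e = rotate p e" by (simp add: rotate_rotate)
  define j where "j = length e - p mod length e"
  have jp: "(j + p) mod length e = 0" proof -
   have "p mod length e < length e" using pos by simp
   hence "(j + p mod length e) mod length e = 0" by (simp add: j_def)
   thus ?thesis by (simp add: mod_add_right_eq)
  qed
  have "rotate j (rotate (length w + p) e) = rotate j (rotate p e)" using r by simp
  hence "rotate (length w) (rotate (j + p) e) = rotate (j + p) e" by (simp add: rotate_rotate add_ac)
  hence "rotate (length w) e = e" using jp by (simp add: rotate_id)
  moreover have "length w < length e" using v1 k pos by (metis length_append length_rotate less_add_same_cancel1 length_greater_0_conv concat.simps(2) replicate_Suc append_is_Nil_conv)
  ultimately show ?thesis using lyn_rotate_less[OF e, of "length w"] pos by simp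
 qed
qed

context
 fixes E :: "nat list set" and J :: nat and v :: "nat list => nat => 'r::comm_ring_1"
 assumes finE: "finite E" and lynE: "!!e. e \<in> E ==> lyn e"
begin

definition cI :: "(nat list \<times> nat \<times> nat) set" where
 "cI = {(e, p, a). e \<in> E & p < length e & a < J}"

definition cX :: "nat => nat list \<times> nat \<times> nat => nat list \<times> nat \<times> nat => 'r" where
 "cX k i j = (case i of (e, p, a) => case j of (e', p', a') =>
   if e = e' & e ! p = k & p' = Suc p mod length e then (if Suc p < length e then of_bool (a = a') else comp (v e) a a') else 0)"

lemma finite_cI: "finite cI"
proof -
 have "cI <= (\<Union>e\<in>E. {e} \<times> {..<length e} \<times> {..<J})" by (auto simp: cI_def)
 thus ?thesis by (rule finite_subset) (use finE in auto)
qed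

lemma cX_wmat_nonzero:
 "wmat cI cX u (e, p, a) (e', p', a') ~= 0 ==> e ~= [] ==> p < length e ==> e' = e & rd e p u & p' = (p + length u) mod length e"
proof (induction u arbitrary: e p a)
 case Nil
 thus ?case by (auto simp: rd_def of_bool_def split: if_splits)
next
 case (Cons l u)
 then obtain k where k: "k \<in> cI" "cX l (e, p, a) k ~= 0" "wmat cI cX u k (e', p', a') ~= 0"
  by (metis (no_types, lifting) mult_eq_0_iff sum.neutral wmat.simps(2) mult_zero_left mult_zero_right)
 obtain e1 p1 a1 where k1: "k = (e1, p1, a1)" by (cases k)
 have c: "e = e1" "e ! p = l" "p1 = Suc p mod length e" using k(2) by (auto simp: k1 cX_def split: if_splits)
 have p1: "p1 < length e" using c Cons.prems by simp
 hence r: "e' = e & rd e p1 u & p' = (p1 + length u) mod length e" using Cons.IH[of e1 p1 a1] k(3) c Cons.prems by (simp add: k1)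
 have "rd e p ([l] @ u)" unfolding rd_append using r c Cons.prems by (simp add: rd_def)
 moreover have "(p1 + length u) mod length e = (p + length (l # u)) mod length e" by (simp add: c(3) mod_add_left_eq)
 ultimately show ?case using r by simp
qed

lemma cX_wmat_drop: assumes e: "e \<in> E" and a: "a < J" "a' < J"
 shows "p < length e ==> wmat cI cX (drop p e) (e, p, a) (e, 0, a') = comp (v e) a a'"
proof (induction "length e - p" arbitrary: p)
 case (Suc m)
 have e0: "e ~= []" using lynE[OF e] by (simp add: lyn_def)
 have d: "drop p e = e ! p # drop (Suc p) e" using Suc.prems by (simp add: Cons_nth_drop_Suc)
 show ?case proof (cases "Suc p < length e")
  case True
  have "wmat cI cX (drop p e) (e, p, a) (e, 0, a') = (\<Sum>k\<in>cI. cX (e ! p) (e, p, a) k * wmat cI cX (drop (Suc p) e) k (e, 0, a'))"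
   unfolding d by simp
  also have "... = (\<Sum>k\<in>{(e, Suc p, a)}. cX (e ! p) (e, p, a) k * wmat cI cX (drop (Suc p) e) k (e, 0, a'))"
  proof (rule sum.mono_neutral_right[OF finite_cI])
   show "{(e, Suc p, a)} <= cI" using e a True by (simp add: cI_def)
   show "\<forall>k\<in>cI - {(e, Suc p, a)}. cX (e ! p) (e, p, a) k * wmat cI cX (drop (Suc p) e) k (e, 0, a') = 0"
    using True by (auto simp: cX_def of_bool_def split: if_splits)
  qed
  also have "... = comp (v e) a a'" using Suc True by (simp add: cX_def)
  finally show ?thesis .
 next
  case False
  hence p: "Suc p = length e" using Suc.prems by simp
  hence "drop p e = [e ! p]" using d by simp
  moreover have "(e, 0, a') \<in> cI" using e a e0 by (simp add: cI_def)
  ultimately have "wmat cI cX (drop p e) (e, p, a) (e, 0, a') = cX (e ! p) (e, p, a) (e, 0, a')" using wmat_single[OF finite_cI] by metis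
  thus ?thesis using p by (simp add: cX_def)
 qed
qed simp

lemma ct_cX: assumes w: "w \<in> E" shows "ct cI t (wmat cI cX w) = ct {..<J} t (comp (v w))"
proof -
 let ?M = "%i j. [:0, wmat cI cX w i j:]"
 have lw: "lyn w" using lynE[OF w] .
 have w0: "w ~= []" using lw by (simp add: lyn_def)
 define B where "B = (%a. (w, 0::nat, a)) ` {..<J}"
 define A where "A = cI - B"
 have Bsub: "B <= cI" using w w0 by (auto simp: B_def cI_def)
 have fin: "finite A" "finite B" using finite_cI by (auto simp: A_def B_def)
 define ka where "ka = (%(e, p, a :: nat). LEAST k. ~ rd e p (pw k w))"
 define L where "L = Max (insert 0 (length ` E))"
 have len: "length e <= L" if "e \<in> E" for e unfolding L_def using that finE by (intro Max_ge) auto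
 have kp: "~ rd e p (pw (ka (e, p, a)) w)" "ka (e, p, a) <= 2 * L" if "e \<in> E" "e ~= w" for e p a proof -
  have nr: "~ rd e p (pw (2 * length e) w)" using rd_power_eq[OF lw lynE[OF that(1)]] that(2) by blast
  thus "~ rd e p (pw (ka (e, p, a)) w)" unfolding ka_def by (simp, rule LeastI)
  have "ka (e, p, a) <= 2 * length e" unfolding ka_def using nr by (simp, intro Least_le)
  thus "ka (e, p, a) <= 2 * L" using len[OF that(1)] by simp
 qed
 have zero_row: "p = 0" if "rd w p w" "p < length w" for p proof -
  have "rotate p w = w" using that(1) by (intro nth_equalityI) (auto simp: rd_def nth_rotate)
  thus ?thesis using lyn_rotate_less[OF lw, of p] that(2) by (metis less_irrefl mod_less)
 qed
 have "D cI ?M = D (A Un B) ?M" using Bsub by (simp add: A_def Un_absorb1 Un_commute Un_Diff_cancel2 sup.absorb1)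
 also have "... = D A ?M * D B ?M" proof (rule D_block[OF fin])
  show "A \<inter> B = {}" by (auto simp: A_def)
  fix i j assume i: "i \<in> B" and j: "j \<in> A"
  obtain a where a: "i = (w, 0, a)" using i by (auto simp: B_def)
  obtain e' p' a' where j': "j = (e', p', a')" by (cases j)
  have "wmat cI cX w i j = 0" proof (rule ccontr)
   assume "wmat cI cX w i j ~= 0"
   hence "e' = w" "p' = 0" using cX_wmat_nonzero[of w w 0 a e' p' a'] w0 by (auto simp: a j')
   thus False using j by (auto simp: j' A_def B_def cI_def)
  qed
  thus "[:0, wmat cI cX w i j:] = 0" by simp
 qed
 also have "D A ?M = 1" proof (rule D_triangular[OF fin(1), where \<rho> = "%i. if fst i = w then 0 else 2 * L + 1 - ka i"])
  fix i j assume i: "i \<in> A" and j: "j \<in> A" and le: "(if fst j = w then 0 else 2 * L + 1 - ka j) <= (if fst i = w then 0 else 2 * L + 1 - ka i)"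
  obtain e p a where i': "i = (e, p, a)" by (cases i)
  obtain e' p' a' where j': "j = (e', p', a')" by (cases j)
  have e: "e \<in> E" "p < length e" "a < J" using i by (auto simp: i' A_def cI_def)
  have e0: "e ~= []" using e(2) by auto
  have "wmat cI cX w i j = 0" proof (rule ccontr)
   assume "wmat cI cX w i j ~= 0"
   hence r: "e' = e" "rd e p w" "p' = (p + length w) mod length e" using cX_wmat_nonzero[of w e p a e' p' a'] e e0 by (auto simp: i' j')
   show False proof (cases "e = w")
    case True
    hence "p = 0" using zero_row r e by simp
    thus False using i e True by (auto simp: i' A_def B_def)
   next
    case False
    note k1 = kp[OF e(1) False, of p a]
    have "ka i ~= 0" using k1(1) by (auto simp: i' rd_def intro: gr0I)
    then obtain k where k: "ka i = Suc k" by (metis not0_implies_Suc)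
    have "~ rd e p' (pw k w)" using k1(1) r k unfolding i' by (simp add: rd_append)
    hence "ka j <= k" unfolding ka_def by (simp add: j' r(1), intro Least_le)
    thus False using le False k k1(2) by (simp add: i' j' r(1))
   qed
  qed
  thus "[:0, wmat cI cX w i j:] = 0" by simp
 qed
 also have "D B ?M = D {..<J} (%a a'. [:0, comp (v w) a a':])" proof -
  have "bij_betw (%a. (w, 0::nat, a)) {..<J} B" unfolding B_def by (auto intro!: inj_on_imp_bij_betw inj_onI)
  hence "D B ?M = D {..<J} (%a a'. ?M (w, 0, a) (w, 0, a'))" by (rule D_reindex) simp
  also have "... = D {..<J} (%a a'. [:0, comp (v w) a a':])" by (rule D_cong) (use cX_wmat_drop[OF w, of _ _ 0] w0 in simp)
  finally show ?thesis .
 qed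
 finally show ?thesis by (simp add: ct_def)
qed

end

lemma wmat_reindex: assumes "bij_betw h K I"
 shows "i \<in> K ==> j \<in> K ==> wmat K (%l i j. X l (h i) (h j)) w i j = wmat I X w (h i) (h j)"
proof (induction w arbitrary: i)
 case Nil
 thus ?case using assms by (auto simp: bij_betw_def inj_on_eq_iff)
next
 case (Cons l w)
 have "wmat K (%l i j. X l (h i) (h j)) (l # w) i j = (\<Sum>k\<in>K. X l (h i) (h k) * wmat I X w (h k) (h j))" using Cons by simp
 also have "... = (\<Sum>k\<in>I. X l (h i) k * wmat I X w k (h j))" by (rule sum.reindex_bij_betw[OF assms])
 finally show ?case by simp
qed

theorem Phi_faithful: fixes f :: "'a::field large_sigmaX" assumes z: "!!N. Phi_tilde N f = 0" shows "f = 0"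
proof -
 define E where "E = (%s. snd (Rep_large_symbol s)) ` vars f"
 have finv: "finite (vars f)" by (auto simp: vars_def)
 have finE: "finite E" using finv by (simp add: E_def)
 have lynE: "lyn e" if e: "e \<in> E" for e proof -
  obtain s where "e = snd (Rep_large_symbol s)" using e unfolding E_def by blast
  thus ?thesis using Rep_large_symbol[of s] by (auto simp flip: X_tilde_iff_lyn)
 qed
 define J where "J = Max (insert 0 ((%s. fst (Rep_large_symbol s)) ` vars f))"
 define v :: "nat list => nat => 'a large_sigmaX" where "v = (%e t. Var (Abs_large_symbol (t, e)))"
 let ?I = "cI E J" and ?X = "cX v"
 have finI: "finite ?I" by (rule finite_cI[OF finE lynE])
 define N where "N = card ?I"
 obtain h where h: "bij_betw h {..<N} ?I" using ex_bij_betw_nat_finite[OF finI] unfolding N_def atLeast0LessThan by blast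
 define H where "H = ev Const (%(i, j, k). ?X k (h i) (h j))"
 have Hh: "comm_ring_hom H" unfolding H_def by (rule ev_hom[OF Const_hom])
 interpret H: comm_ring_hom H by (rule Hh)
 have HV: "H (Var (i, j, k)) = ?X k (h i) (h j)" "H (Const c) = Const c" for i j k c by (simp_all add: H_def Const_hom)
 have "f = H (Phi_tilde N f)" proof (rule hom_eqI[OF comm_ring_hom_id comm_ring_hom_compose[OF Hh Phi_hom]])
  show "Const c = H (Phi_tilde N (Const c))" for c by (simp add: HV)
  fix s assume s: "s \<in> vars f"
  obtain t e where te: "Rep_large_symbol s = (t, e)" by (cases "Rep_large_symbol s")
  have te': "0 < t" "e \<in> X_tilde" using Rep_large_symbol[of s] te by auto
  have sv: "Var s = large_sg t e" unfolding large_sg_def using te by (metis Rep_large_symbol_inverse)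
  have eE: "e \<in> E" using s te unfolding E_def by force
  have tJ: "t <= J" unfolding J_def using s te finv by (intro Max_ge) force+
  have "H (Phi_tilde N (large_sg t e)) = ct {..<N} t (wmat {..<N} (%k i j. ?X k (h i) (h j)) e)"
   unfolding Phi_large_sg[OF te'] wm_def ct_hom[OF Hh] wmat_hom[OF Hh] HV ..
  also have "... = ct {..<N} t (%i j. wmat ?I ?X e (h i) (h j))" by (rule ct_cong) (rule wmat_reindex[OF h])
  also have "... = ct ?I t (wmat ?I ?X e)" by (rule ct_reindex[OF h, symmetric]) simp
  also have "... = ct {..<J} t (comp (v e))" by (rule ct_cX[OF finE lynE eE])
  also have "... = large_sg t e" using te' tJ by (simp add: ct_comp v_def large_sg_def)
  finally show "Var s = H (Phi_tilde N (Var s))" unfolding sv by simp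
 qed
 thus ?thesis using z by simp
qed

section \<open>Families of invariants of matrices of all sizes\<close>

definition UI :: "'a::field large_sigmaX set => (nat => 'a gen_poly) => bool" where
 "UI S F <-> (\<exists>f\<in>ideal_generated S. \<forall>N. F N = Phi_tilde N f)"

definition UU :: "(nat => 'a::field gen_poly) => bool" where
 "UU F <-> (\<exists>f. \<forall>N. F N = Phi_tilde N f)"

lemma ideal_module: "Modules.module ((*) :: 'r::comm_ring_1 => 'r => 'r)" by unfold_locales (auto simp: algebra_simps)

lemma ideal_generated_add: "f \<in> ideal_generated S ==> g \<in> ideal_generated S ==> f + g \<in> ideal_generated S"
 unfolding ideal_generated_def by (rule module.span_add[OF ideal_module])

lemma ideal_generated_mult: "g \<in> ideal_generated S ==> f * g \<in> ideal_generated S"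
 unfolding ideal_generated_def by (rule module.span_scale[OF ideal_module])

lemma ideal_generated_0: "0 \<in> ideal_generated S" unfolding ideal_generated_def by (rule module.span_zero[OF ideal_module])

lemma ideal_generated_base: "f \<in> S ==> f \<in> ideal_generated S"
 unfolding ideal_generated_def by (rule module.span_base[OF ideal_module])

lemma UI_add: "UI S F ==> UI S G ==> UI S (%N. F N + G N)"
proof -
 interpret Ph: comm_ring_hom "Phi_tilde N :: 'a large_sigmaX => _" for N by (rule Phi_hom)
 show "UI S F ==> UI S G ==> UI S (%N. F N + G N)" unfolding UI_def by (metis Ph.hom_add ideal_generated_add)
qed

lemma UI_mult: "UU G ==> UI S F ==> UI S (%N. G N * F N)"
proof -
 interpret Ph: comm_ring_hom "Phi_tilde N :: 'a large_sigmaX => _" for N by (rule Phi_hom)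
 show "UU G ==> UI S F ==> UI S (%N. G N * F N)"
  unfolding UI_def UU_def by (metis Ph.hom_mult ideal_generated_mult)
qed

lemma UI_0: "UI S (%N. 0)"
proof -
 interpret Ph: comm_ring_hom "Phi_tilde N :: 'a large_sigmaX => _" for N by (rule Phi_hom)
 show ?thesis unfolding UI_def by (metis Ph.hom_zero ideal_generated_0)
qed

lemma UI_sum: "(!!a. a \<in> A ==> UI S (F a)) ==> UI S (%N. \<Sum>a\<in>A. F a N)"
 by (induction A rule: infinite_finite_induct) (auto intro: UI_add UI_0)

lemma UU_add: "UU F ==> UU G ==> UU (%N. F N + G N)"
 and UU_mult: "UU F ==> UU G ==> UU (%N. F N * G N)" and UU_minus: "UU F ==> UU (%N. - F N)"
 and UU_Const: "UU (%N. Const c)"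
proof -
 interpret Ph: comm_ring_hom "Phi_tilde N :: 'a large_sigmaX => _" for N by (rule Phi_hom)
 show "UU F ==> UU G ==> UU (%N. F N + G N)" "UU F ==> UU G ==> UU (%N. F N * G N)" "UU F ==> UU (%N. - F N)"
  unfolding UU_def by (metis Ph.hom_add, metis Ph.hom_mult, metis Ph.hom_uminus)
 show "UU (%N. Const c)" unfolding UU_def by (metis Phi_Const)
qed

lemma UU_0: "UU (%N. 0)" and UU_1: "UU (%N. 1)" using UU_Const[of 0] UU_Const[of 1] by (simp_all add: Const_simps)

lemma UU_sum: "(!!a. a \<in> A ==> UU (F a)) ==> UU (%N. \<Sum>a\<in>A. F a N)"
 by (induction A rule: infinite_finite_induct) (auto intro: UU_add UU_0)

lemma UU_prod: "(!!a. a \<in> A ==> UU (F a)) ==> UU (%N. \<Prod>a\<in>A. F a N)"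
 by (induction A rule: infinite_finite_induct) (auto intro: UU_mult UU_1)

lemma UU_power: "UU F ==> UU (%N. F N ^ k)" by (induction k) (auto intro: UU_mult UU_1)

definition sF :: "nat list => nat list list => nat => 'a::field gen_poly" where
 "sF ts ws N = lookup (D {..<N} (lmat (length ws) (%l. wm N (ws ! l)))) (tm ts)"

lemma subst_lmat: "subst ze (D I (lmat u X)) = D I (%i j. \<Sum>l<u. ze l * Const (X l i j))"
proof -
 interpret s: comm_ring_hom "subst ze" by (rule subst_hom)
 show ?thesis by (simp add: D_hom[OF subst_hom] lmat_def s.hom_sum s.hom_mult)
qed

lemma lookup_subst: "lookup (subst ze P) m' = (\<Sum>m\<in>keys P. lookup P m * lookup (monoval ze m) m')"
 by (simp add: subst_eq_ev ev_def lookup_sum lookup_Const_mult)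

lemma lmat_keys: fixes X :: "nat => 'i => 'i => 'r::comm_ring_1" assumes m: "m \<in> keys (D I (lmat u X))"
 shows "keys m <= {..<u}"
proof (rule ccontr)
 assume "~ ?thesis"
 then obtain l where l: "l \<in> keys m" "~ l < u" by auto
 let ?P = "D I (lmat u X)"
 let ?ze = "%l. if l < u then Var l else 0 :: (nat, 'r) mpoly"
 have sp: "subst ?ze ?P = ?P" unfolding subst_lmat by (simp add: lmat_def)
 have "lookup ?P m = lookup (subst ?ze ?P) m" by (simp only: sp)
 also have "... = (\<Sum>m'\<in>keys ?P. lookup ?P m' * lookup (monoval ?ze m') m)" by (rule lookup_subst)
 also have "... = 0" proof (intro sum.neutral ballI)
  fix m'
  have "lookup (monoval ?ze m' :: (nat, 'r) mpoly) m = 0" proof (cases "keys m' <= {..<u}")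
   case True
   hence "monoval ?ze m' = (monoval Var m' :: (nat, 'r) mpoly)" unfolding monoval_def by (intro prod.cong) auto
   thus ?thesis using True l by (auto simp: monoval_Var lookup_single when_def)
  next
   case False
   then obtain k where "k \<in> keys m'" "~ k < u" by auto
   hence "monoval ?ze m' = (0 :: (nat, 'r) mpoly)"
    unfolding monoval_def by (intro prod_zero) (auto intro!: bexI[of _ k] simp: in_keys_iff zero_power)
   thus ?thesis by simp
  qed
  thus "lookup ?P m' * lookup (monoval ?ze m') m = 0" by simp
 qed
 finally show False using m by (simp add: in_keys_iff)
qed

lemma sF_embed: assumes len: "length ts = u" "length ws = u" "length ts' = u'" "length ws' = u'"
  and g: "inj_on g {..<u}" "g ` {..<u} <= {..<u'}" and tw: "!!l. l < u ==> ts' ! g l = ts ! l & ws' ! g l = ws ! l"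
  and z: "!!j. j < u' ==> j \<notin> g ` {..<u} ==> ts' ! j = 0"
 shows "sF ts' ws' N = (sF ts ws N :: 'a::field gen_poly)"
proof -
 define ze :: "nat => (nat, 'a gen_poly) mpoly" where "ze j = (if j \<in> g ` {..<u} then Var (inv_into {..<u} g j) else 0)" for j
 have zg: "ze (g l) = Var l" if "l < u" for l using that g(1) by (simp add: ze_def inv_into_f_f)
 let ?X = "%l. wm N (ws ! l)" and ?X' = "%l. wm N (ws' ! l)"
 let ?P = "D {..<N} (lmat u' ?X') :: (nat, 'a gen_poly) mpoly"
 have "subst ze ?P = D {..<N} (lmat u ?X)" unfolding subst_lmat proof (rule D_cong)
  fix i j
  have "(\<Sum>l<u'. ze l * Const (?X' l i j)) = (\<Sum>l\<in>g ` {..<u}. ze l * Const (?X' l i j))"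
   by (rule sum.mono_neutral_right) (use g(2) in "auto simp: ze_def")
  also have "... = (\<Sum>l<u. ze (g l) * Const (?X' (g l) i j))" by (simp add: sum.reindex[OF g(1)])
  also have "... = lmat u ?X i j" unfolding lmat_def by (rule sum.cong) (simp_all add: zg tw)
  finally show "(\<Sum>l<u'. ze l * Const (?X' l i j)) = lmat u ?X i j" .
 qed
 hence "sF ts ws N = lookup (subst ze ?P) (tm ts)" by (simp add: sF_def len)
 also have "... = (\<Sum>m\<in>keys ?P. lookup ?P m * lookup (monoval ze m) (tm ts))" by (rule lookup_subst)
 also have "... = (\<Sum>m\<in>keys ?P. if m = tm ts' then lookup ?P m else 0)" proof (rule sum.cong[OF refl])
  fix m assume m: "m \<in> keys ?P"
  have mk: "keys m <= {..<u'}" by (rule lmat_keys[OF m])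
  have mtm: "m = tm ts' <-> (\<forall>j<u'. lookup m j = ts' ! j)"
   using mk by (auto simp: poly_mapping_eq_iff fun_eq_iff lookup_tm len in_keys_iff subset_iff)
  have "lookup (monoval ze m) (tm ts) = of_bool (m = tm ts')" proof (cases "keys m <= g ` {..<u}")
   case True
   have "monoval ze m = (\<Prod>j\<in>g ` {..<u}. ze j ^ lookup m j)" by (rule monoval_superset) (use True in auto)
   also have "... = (\<Prod>l<u. Var l ^ lookup m (g l))" by (simp add: prod.reindex[OF g(1)] zg)
   also have "... = single (tm (map (%l. lookup m (g l)) [0..<u])) 1" by (simp add: Var_power prod_single tm_def)
   finally have e: "monoval ze m = single (tm (map (%l. lookup m (g l)) [0..<u])) 1" .
   have "tm (map (%l. lookup m (g l)) [0..<u]) = tm ts <-> (\<forall>l<u. lookup m (g l) = ts ! l)"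
    by (auto simp: poly_mapping_eq_iff fun_eq_iff lookup_tm len)
   also have "... <-> m = tm ts'" proof -
    have "lookup m j = ts' ! j" if "\<forall>l<u. lookup m (g l) = ts ! l" "j < u'" for j proof (cases "j \<in> g ` {..<u}")
     case True
     thus ?thesis using that tw by auto
    next
     case False
     hence "j \<notin> keys m" using True by blast
     thus ?thesis using z[OF that(2) False] by (simp add: in_keys_iff)
    qed
    moreover have "lookup m (g l) = ts ! l" if "\<forall>j<u'. lookup m j = ts' ! j" "l < u" for l proof -
     have "g l < u'" using g(2) that(2) by auto
     thus ?thesis using that tw by simp
    qed
    ultimately show ?thesis unfolding mtm by blast
   qed
   finally show ?thesis unfolding e by (simp add: lookup_single when_def)
  next
   case False
   then obtain j where j: "j \<in> keys m" "j \<notin> g ` {..<u}" by auto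
   hence "monoval ze m = 0" unfolding monoval_def by (intro prod_zero) (auto intro!: bexI[of _ j] simp: in_keys_iff zero_power ze_def)
   moreover have "m ~= tm ts'" proof -
    have "j < u'" using j mk by auto
    hence "ts' ! j = 0" using z j by simp
    thus ?thesis using j `j < u'` unfolding mtm by (auto simp: in_keys_iff)
   qed
   ultimately show ?thesis by simp
  qed
  thus "lookup ?P m * lookup (monoval ze m) (tm ts) = (if m = tm ts' then lookup ?P m else 0)" by simp
 qed
 also have "... = lookup ?P (tm ts')" by (auto simp: sum.delta in_keys_iff)
 finally show ?thesis by (simp add: sF_def len)
qed

lemma Var_add_power: "(Var x + Var y) ^ k = (\<Sum>j\<le>k. single (single x j + single y (k - j)) (of_nat (k choose j)))"
proof -
 have "of_nat c * single m (1::'b) = single m (of_nat c)" for c and m :: "'a mon" proof -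
  have "(of_nat c :: ('a, 'b) mpoly) = single 0 (of_nat c)" by simp
  thus ?thesis by (metis mult_single add_0 mult.right_neutral)
 qed
 thus ?thesis by (simp add: binomial_ring Var_power mult.assoc mult_single)
qed

lemma sF_split: assumes len: "length ts = u" "length ws = u" and i: "i < u" and ti: "ts ! i = a + b"
 shows "sF (ts[i := a] @ [b]) (ws @ [ws ! i]) N = (of_nat ((a + b) choose a) * sF ts ws N :: 'a::field gen_poly)"
proof -
 define ze :: "nat => (nat, 'a gen_poly) mpoly" where "ze j = (if j = i then Var i + Var u else Var j)" for j
 let ?X = "%l. wm N (ws ! l)" and ?X' = "%l. wm N ((ws @ [ws ! i]) ! l)"
 let ?P = "D {..<N} (lmat u ?X) :: (nat, 'a gen_poly) mpoly"
 let ?ts' = "ts[i := a] @ [b]"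
 have "subst ze ?P = D {..<N} (lmat (Suc u) ?X')" unfolding subst_lmat proof (rule D_cong)
  fix p q
  have "(\<Sum>l<u. ze l * Const (?X l p q)) = (\<Sum>l<u. Var l * Const (?X l p q) + (if l = i then Var u * Const (?X l p q) else 0))"
   by (rule sum.cong) (auto simp: ze_def distrib_right)
  also have "... = lmat (Suc u) ?X' p q" using i len by (simp add: sum.distrib sum.delta lmat_def nth_append)
  finally show "(\<Sum>l<u. ze l * Const (?X l p q)) = lmat (Suc u) ?X' p q" .
 qed
 hence "sF ?ts' (ws @ [ws ! i]) N = lookup (subst ze ?P) (tm ?ts')" by (simp add: sF_def len)
 also have "... = (\<Sum>m\<in>keys ?P. lookup ?P m * lookup (monoval ze m) (tm ?ts'))" by (rule lookup_subst)
 also have "... = (\<Sum>m\<in>keys ?P. if m = tm ts then lookup ?P m * of_nat ((a + b) choose a) else 0)" proof (rule sum.cong[OF refl])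
  fix m assume m: "m \<in> keys ?P"
  have mk: "keys m <= {..<u}" by (rule lmat_keys[OF m])
  define r where "r = (\<Sum>l\<in>{..<u} - {i}. single l (lookup m l))"
  define k where "k = lookup m i"
  have lr: "lookup r l = (if l < u & l ~= i then lookup m l else 0)" for l
   by (auto simp: r_def lookup_sum lookup_single when_def sum.delta)
  have "monoval ze m = (\<Prod>l<u. ze l ^ lookup m l)" by (rule monoval_superset) (use mk in auto)
  also have "... = ze i ^ k * (\<Prod>l\<in>{..<u} - {i}. ze l ^ lookup m l)" unfolding k_def by (rule prod.remove) (use i in auto)
  also have "(\<Prod>l\<in>{..<u} - {i}. ze l ^ lookup m l) = single r 1" by (simp add: ze_def Var_power prod_single r_def)
  also have "ze i ^ k * single r 1 = (\<Sum>j\<le>k. single (single i j + single u (k - j) + r) (of_nat (k choose j)))"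
   by (simp add: ze_def Var_add_power sum_distrib_right mult_single)
  finally have e: "lookup (monoval ze m) (tm ?ts') = (\<Sum>j\<le>k. of_nat (k choose j) when single i j + single u (k - j) + r = tm ?ts')"
   by (simp add: lookup_sum lookup_single)
  have c: "single i j + single u (k - j) + r = tm ?ts' <-> j = a & k - j = b & (\<forall>l<u. l ~= i --> lookup m l = ts ! l)" for j
  proof -
   have "(single i j + single u (k - j) + r = tm ?ts') <->
    (\<forall>l. (j when i = l) + (k - j when u = l) + (if l < u & l ~= i then lookup m l else 0) = (if l < Suc u then (ts[i := a] @ [b]) ! l else 0))"
    by (simp add: poly_mapping_eq_iff fun_eq_iff lookup_add lookup_single lr lookup_tm len)
   also have "... <-> j = a & k - j = b & (\<forall>l<u. l ~= i --> lookup m l = ts ! l)" (is "?L <-> ?R")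
   proof
    assume L: ?L
    have "j = a" using L[rule_format, of i] i len by (simp add: when_def nth_append)
    moreover have "k - j = b" using L[rule_format, of u] i len by (simp add: when_def nth_append)
    moreover have "lookup m l = ts ! l" if "l < u" "l ~= i" for l using L[rule_format, of l] that i len by (simp add: when_def nth_append)
    ultimately show ?R by blast
   next
    assume ?R thus ?L using i len by (auto simp: when_def nth_append less_Suc_eq)
   qed
   finally show ?thesis .
  qed
  have mt: "m = tm ts <-> k = a + b & (\<forall>l<u. l ~= i --> lookup m l = ts ! l)" proof -
   have "m = tm ts <-> (\<forall>l<u. lookup m l = ts ! l)"
    using mk by (auto simp: poly_mapping_eq_iff fun_eq_iff lookup_tm len in_keys_iff subset_iff)
   also have "... <-> k = a + b & (\<forall>l<u. l ~= i --> lookup m l = ts ! l)"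
    using i ti unfolding k_def by metis
   finally show ?thesis .
  qed
  have "lookup (monoval ze m) (tm ?ts') = (if m = tm ts then of_nat ((a + b) choose a) else 0)" proof (cases "m = tm ts")
   case True
   hence "k = a + b" "\<forall>l<u. l ~= i --> lookup m l = ts ! l" using mt by auto
   hence "lookup (monoval ze m) (tm ?ts') = (\<Sum>j\<le>k. if j = a then of_nat (k choose j) else 0)"
    unfolding e c by (intro sum.cong) (auto simp: when_def)
   thus ?thesis using True `k = a + b` by (simp add: sum.delta)
  next
   case False
   have neg: "~ (j = a & k - j = b & (\<forall>l<u. l ~= i --> lookup m l = ts ! l))" if "j <= k" for j
    using False that unfolding mt by auto
   have "(of_nat (k choose j) when single i j + single u (k - j) + r = tm ?ts') = (0 :: 'a gen_poly)" if "j \<in> {..k}" for j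
    unfolding c using neg[of j] that by (auto simp: when_def)
   thus ?thesis using False unfolding e by simp
  qed
  thus "lookup ?P m * lookup (monoval ze m) (tm ?ts') = (if m = tm ts then lookup ?P m * of_nat ((a + b) choose a) else 0)" by simp
 qed
 also have "... = lookup ?P (tm ts) * of_nat ((a + b) choose a)" by (auto simp: sum.delta in_keys_iff)
 finally show ?thesis by (simp add: sF_def len mult.commute)
qed

lemma sF_single: "sF [t] [w] N = ct {..<N} t (wm N w)"
proof -
 let ?L = "lmat (Suc 0) (%l. wm N ([w] ! l))"
 have "sF [t] [w] N = lookup (ct {..<N} t ?L) (tm [t])" by (simp add: sF_def lookup_ct_lmat mdeg_tm)
 also have "ct {..<N} t ?L = Var 0 ^ t * Const (ct {..<N} t (wm N w))" by (simp add: lmat_def ct_scale ct_hom[OF Const_hom])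
 finally show ?thesis by (simp add: Var_power Const_def mult_single tm_def)
qed

text \<open>Comparing coefficients in \<open>D(\<Sum> z\<^sub>l a\<^sub>l) D(y b) = D(\<Sum> z\<^sub>l a\<^sub>l + \<Sum> z\<^sub>l y a\<^sub>l b + y b)\<close>.\<close>

lemma sF_mult: fixes ts :: "nat list" and ws :: "nat list list" and b :: "nat list" and k N :: nat assumes len: "length ts = u" "length ws = u"
 defines "T \<equiv> {(ss, k'). length ss = 2 * u & (\<forall>l<u. ss ! l + ss ! (u + l) = ts ! l) & k' + (\<Sum>l<u. ss ! (u + l)) = k}"
  and "ws' \<equiv> ws @ map (%w. w @ b) ws"
 shows "finite T" and "sF ts ws N * ct {..<N} k (wm N b) = (\<Sum>(ss, k')\<in>T. sF (ss @ [k']) (ws' @ [b]) N :: 'a::field gen_poly)"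
proof -
 show finT: "finite T" proof -
  have "T <= {ss. set ss <= {..sum_list ts} & length ss = 2 * u} \<times> {..k}" proof
   fix x assume x: "x \<in> T"
   obtain ss k' where sk: "x = (ss, k')" by (cases x)
   have "ss ! l <= sum_list ts" if "l < 2 * u" for l proof -
    define l' where "l' = (if l < u then l else l - u)"
    have l': "l' < u" using that by (auto simp: l'_def)
    have "ss ! l' + ss ! (u + l') = ts ! l'" using x l' by (simp add: T_def sk)
    hence "ss ! l <= ts ! l'" using that by (auto simp: l'_def split: if_splits)
    also have "... <= sum_list ts" by (rule member_le_sum_list) (use l' len in auto)
    finally show ?thesis .
   qed
   thus "x \<in> {ss. set ss <= {..sum_list ts} & length ss = 2 * u} \<times> {..k}" using x by (auto simp: T_def sk in_set_conv_nth)
  qed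
  thus ?thesis by (rule finite_subset) (auto intro: finite_lists_length_eq)
 qed
 define V where "V = 2 * u"
 define ze :: "nat => (nat, 'a gen_poly) mpoly" where "ze j = (if j < u then Var j else if j < V then Var (j - u) * Var V else Var j)" for j
 let ?I = "{..<N}"
 let ?X = "%l. wm N (ws ! l) :: nat => nat => 'a gen_poly" and ?X' = "%l. wm N ((ws' @ [b]) ! l) :: nat => nat => 'a gen_poly"
 let ?P = "D ?I (lmat (Suc V) ?X') :: (nat, 'a gen_poly) mpoly"
 let ?m = "tm ts + single V k"
 have lenw: "length ws' = V" by (simp add: ws'_def V_def len)
 have nth: "(ws' @ [b]) ! l = (if l < u then ws ! l else if l < V then ws ! (l - u) @ b else b)" if "l < Suc V" for l
  using that by (auto simp: ws'_def nth_append V_def len)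
 have wb: "wm N (w @ b) i j = (\<Sum>k\<in>?I. wm N w i k * wm N b k j)" if "i < N" for w i j
  unfolding wm_def by (rule wmat_append) (use that in auto)
 have sV: "(\<Sum>l<Suc V. f l) = (\<Sum>l<u. f l) + (\<Sum>l<u. f (u + l)) + f V" for f :: "nat => (nat, 'a gen_poly) mpoly" proof -
  have "(\<Sum>l<V. f l) = (\<Sum>l<u. f l) + (\<Sum>l\<in>{u..<u + u}. f l)"
   unfolding V_def mult_2 lessThan_atLeast0 by (rule sum.atLeastLessThan_concat[symmetric]) auto
  also have "(\<Sum>l\<in>{u..<u + u}. f l) = (\<Sum>l<u. f (u + l))"
   using sum.shift_bounds_nat_ivl[of f 0 u u] by (simp add: atLeast0LessThan add.commute)
  finally show ?thesis by simp
 qed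
 have "subst ze ?P = D ?I (lmat u ?X) * D ?I (%i j. Var V * Const (wm N b i j))" unfolding subst_lmat D_mult[OF finite_lessThan]
 proof (rule D_cong)
  fix i j assume ij: "i \<in> ?I" "j \<in> ?I"
  have "(\<Sum>k\<in>?I. lmat u ?X i k * (Var V * Const (wm N b k j :: 'a gen_poly))) = (\<Sum>l<u. Var l * Var V * Const (\<Sum>k\<in>?I. ?X l i k * wm N b k j))"
  proof -
   interpret c: comm_ring_hom "Const :: 'a gen_poly => (nat, 'a gen_poly) mpoly" by (rule Const_hom)
   have "(\<Sum>k\<in>?I. lmat u ?X i k * (Var V * Const (wm N b k j :: 'a gen_poly))) = (\<Sum>k\<in>?I. \<Sum>l<u. Var l * Var V * (Const (?X l i k) * Const (wm N b k j)))"
    by (simp add: lmat_def sum_distrib_left sum_distrib_right mult_ac)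
   also have "... = (\<Sum>l<u. \<Sum>k\<in>?I. Var l * Var V * (Const (?X l i k) * Const (wm N b k j)))" by (rule sum.swap)
   finally show ?thesis by (simp add: c.hom_sum c.hom_mult sum_distrib_left)
  qed
  also have "... = (\<Sum>l<u. Var l * Var V * Const (?X' (u + l) i j))" by (rule sum.cong) (use ij in "auto simp: nth V_def wb")
  finally show "(\<Sum>l<Suc V. ze l * Const (?X' l i j)) = lmat u ?X i j + Var V * Const (wm N b i j) + (\<Sum>k\<in>?I. lmat u ?X i k * (Var V * Const (wm N b k j :: 'a gen_poly)))"
   unfolding sV by (simp add: nth lmat_def ze_def V_def)
 qed
 hence L: "lookup (subst ze ?P) ?m = lookup (D ?I (lmat u ?X) * D ?I (%i j. Var V * Const (wm N b i j))) ?m" by simp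
 have "D ?I (%i j. Var V * Const (wm N b i j)) = (\<Sum>t\<le>max N k. Const (ct ?I t (wm N b)) * single (single V t) 1)"
  by (subst D_ct_bound[of _ "max N k"]) (simp_all add: Var_power ct_hom[OF Const_hom] mult.commute)
 also have "... = (\<Sum>t\<le>max N k. single (single V t) (ct ?I t (wm N b)))" by (simp add: Const_def mult_single)
 finally have Db: "D ?I (%i j. Var V * Const (wm N b i j)) = (\<Sum>t\<le>max N k. single (single V t) (ct ?I t (wm N b)))" .
 let ?Q = "D ?I (lmat u ?X)"
 have "lookup (?Q * D ?I (%i j. Var V * Const (wm N b i j))) ?m =
   lookup ((\<Sum>m\<in>keys ?Q. single m (lookup ?Q m)) * (\<Sum>t\<le>max N k. single (single V t) (ct ?I t (wm N b)))) ?m"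
  unfolding Db by (simp flip: mpoly_expand)
 also have "... = (\<Sum>m\<in>keys ?Q. \<Sum>t\<le>max N k. lookup ?Q m * ct ?I t (wm N b) when m + single V t = ?m)"
  by (simp add: sum_product mult_single lookup_sum lookup_single)
 also have "... = (\<Sum>m\<in>keys ?Q. \<Sum>t\<le>max N k. if m = tm ts then (if t = k then lookup ?Q m * ct ?I t (wm N b) else 0) else 0)"
 proof (intro sum.cong refl)
  fix m t assume m: "m \<in> keys ?Q"
  have "~ V < u" by (simp add: V_def)
  hence mV: "lookup m V = 0" using lmat_keys[OF m] by (auto simp: in_keys_iff)
  have tV: "lookup (tm ts) V = 0" by (simp add: lookup_tm len V_def)
  have "m + single V t = ?m <-> m = tm ts & t = k" proof
   assume e: "m + single V t = ?m"
   hence "lookup (m + single V t) V = lookup ?m V" by simp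
   hence "t = k" using mV tV by (simp add: lookup_add)
   thus "m = tm ts & t = k" using e by simp
  qed auto
  thus "(lookup ?Q m * ct ?I t (wm N b) when m + single V t = ?m) = (if m = tm ts then (if t = k then lookup ?Q m * ct ?I t (wm N b) else 0) else 0)"
   by (simp add: when_def)
 qed
 also have "... = (\<Sum>m\<in>keys ?Q. if m = tm ts then lookup ?Q m * ct ?I k (wm N b) else 0)" by (intro sum.cong refl) (simp add: sum.delta)
 also have "... = lookup ?Q (tm ts) * ct ?I k (wm N b)" by (auto simp: sum.delta in_keys_iff)
 finally have lhs: "lookup (subst ze ?P) ?m = sF ts ws N * ct ?I k (wm N b)" unfolding L by (simp add: sF_def len)
 have mv: "monoval ze m = single ((\<Sum>l<u. single l (lookup m l + lookup m (u + l))) + single V (lookup m V + (\<Sum>l<u. lookup m (u + l)))) 1"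
  if mk: "keys m <= {..<Suc V}" for m
 proof -
  have pV: "(\<Prod>l<Suc V. f l) = (\<Prod>l<u. f l) * (\<Prod>l<u. f (u + l)) * f V" for f :: "nat => (nat, 'a gen_poly) mpoly" proof -
   have "(\<Prod>l<V. f l) = (\<Prod>l<u. f l) * (\<Prod>l\<in>{u..<u + u}. f l)"
    unfolding V_def mult_2 lessThan_atLeast0 by (rule prod.atLeastLessThan_concat[symmetric]) auto
   also have "(\<Prod>l\<in>{u..<u + u}. f l) = (\<Prod>l<u. f (u + l))"
    using prod.shift_bounds_nat_ivl[of f 0 u u] by (simp add: atLeast0LessThan add.commute)
   finally show ?thesis by simp
  qed
  have "monoval ze m = (\<Prod>l<Suc V. ze l ^ lookup m l)" by (rule monoval_superset) (use mk in auto)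
  also have "... = (\<Prod>l<u. Var l ^ lookup m l) * (\<Prod>l<u. (Var l * Var V) ^ lookup m (u + l)) * Var V ^ lookup m V"
   unfolding pV by (simp add: ze_def V_def)
  also have "... = single ((\<Sum>l<u. single l (lookup m l)) + ((\<Sum>l<u. single l (lookup m (u + l))) + (\<Sum>l<u. single V (lookup m (u + l)))) + single V (lookup m V)) 1"
   by (simp add: power_mult_distrib prod.distrib Var_power prod_single mult_single sum.distrib)
  also have "(\<Sum>l<u. single l (lookup m l)) + ((\<Sum>l<u. single l (lookup m (u + l))) + (\<Sum>l<u. single V (lookup m (u + l)))) + single V (lookup m V) =
    (\<Sum>l<u. single l (lookup m l + lookup m (u + l))) + single V (lookup m V + (\<Sum>l<u. lookup m (u + l)))"
  proof -
   have "(\<Sum>l<u. single V (g l)) = single V (\<Sum>l<u. g l)" for g :: "nat => nat" by (induction u) (auto simp: single_add)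
   thus ?thesis by (simp add: single_add sum.distrib add_ac)
  qed
  finally show ?thesis .
 qed
 define cond where "cond = (%m. (\<forall>l<u. lookup m l + lookup m (u + l) = ts ! l) & lookup m V + (\<Sum>l<u. lookup m (u + l)) = k)"
 have condI: "((\<Sum>l<u. single l (lookup m l + lookup m (u + l))) + single V (lookup m V + (\<Sum>l<u. lookup m (u + l))) = ?m) <-> cond m" for m
 proof -
  have l1: "lookup (\<Sum>l<u. single l (f l)) j = (if j < u then f j else 0)" for f :: "nat => nat" and j
   by (auto simp: lookup_sum lookup_single when_def sum.delta)
  let ?L = "(\<Sum>l<u. single l (lookup m l + lookup m (u + l))) + single V (lookup m V + (\<Sum>l<u. lookup m (u + l)))"
  have uV: "~ V < u" by (simp add: V_def)
  have a: "lookup ?L j = (if j < u then lookup m j + lookup m (u + j) else if j = V then lookup m V + (\<Sum>l<u. lookup m (u + l)) else 0)" for j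
   using uV by (auto simp: lookup_add l1 lookup_single when_def)
  have b: "lookup ?m j = (if j < u then ts ! j else if j = V then k else 0)" for j
   using uV by (auto simp: lookup_add lookup_single when_def lookup_tm len)
  show ?thesis proof
   assume "?L = ?m"
   hence q: "lookup ?L j = lookup ?m j" for j by simp
   show "cond m" unfolding cond_def proof (intro conjI allI impI)
    fix l assume "l < u"
    thus "lookup m l + lookup m (u + l) = ts ! l" using q[of l] unfolding a b by simp
   next
    show "lookup m V + (\<Sum>l<u. lookup m (u + l)) = k" using q[of V] uV unfolding a b by simp
   qed
  next
   assume c: "cond m"
   show "?L = ?m" proof (rule poly_mapping_eqI)
    fix j
    show "lookup ?L j = lookup ?m j" unfolding a b using c by (simp add: cond_def)
   qed
  qed
 qed
 define enc where "enc = (%(ss, k'). tm (ss @ [k' :: nat]))"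
 have lenc: "lookup (enc (ss, k')) j = (if j < V then ss ! j else if j = V then k' else 0)" if "length ss = V" for ss k' j
  using that by (auto simp: enc_def lookup_tm nth_append)
 have inj: "inj_on enc T" proof (rule inj_onI)
  fix x y assume x: "x \<in> T" and y: "y \<in> T" and e: "enc x = enc y"
  obtain ss k1 where x': "x = (ss, k1)" by (cases x)
  obtain ss' k2 where y': "y = (ss', k2)" by (cases y)
  have l: "length ss = V" "length ss' = V" using x y by (auto simp: T_def x' y' V_def)
  have "lookup (enc (ss, k1)) j = lookup (enc (ss', k2)) j" for j using e by (simp add: x' y')
  hence q: "(if j < V then ss ! j else if j = V then k1 else 0) = (if j < V then ss' ! j else if j = V then k2 else 0)" for j
   unfolding lenc[OF l(1)] lenc[OF l(2)] .
  have "k1 = k2" using q[of V] by simp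
  moreover have "ss = ss'" using q l by (intro nth_equalityI) (auto, metis)
  ultimately show "x = y" by (simp add: x' y')
 qed
 have img: "enc ` T = {m. keys m <= {..<Suc V} & cond m}" proof (intro equalityI subsetI)
  fix m assume "m \<in> enc ` T"
  then obtain ss k' where sk: "(ss, k') \<in> T" "m = enc (ss, k')" by auto
  have l: "length ss = V" using sk(1) by (auto simp: T_def V_def)
  have "keys m <= {..<Suc V}" using lenc[OF l] by (auto simp: sk(2) in_keys_iff split: if_splits)
  moreover have "cond m" using sk(1) by (auto simp: cond_def sk(2) lenc[OF l] T_def V_def)
  ultimately show "m \<in> {m. keys m <= {..<Suc V} & cond m}" by simp
 next
  fix m assume m: "m \<in> {m. keys m <= {..<Suc V} & cond m}"
  define ss where "ss = map (lookup m) [0..<V]"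
  have l: "length ss = V" by (simp add: ss_def)
  have "m = enc (ss, lookup m V)" proof (rule poly_mapping_eqI)
   fix j
   show "lookup m j = lookup (enc (ss, lookup m V)) j"
    unfolding lenc[OF l] using m by (cases "j < V"; cases "j = V") (auto simp: ss_def in_keys_iff subset_iff)
  qed
  moreover have "(ss, lookup m V) \<in> T" using m by (auto simp: T_def ss_def cond_def V_def)
  ultimately show "m \<in> enc ` T" by blast
 qed
 have "lookup (subst ze ?P) ?m = (\<Sum>m\<in>keys ?P. lookup ?P m * lookup (monoval ze m) ?m)" by (rule lookup_subst)
 also have "... = (\<Sum>m\<in>keys ?P. if cond m then lookup ?P m else 0)"
  by (rule sum.cong[OF refl]) (simp add: mv[OF lmat_keys] lookup_single when_def condI)
 also have "... = (\<Sum>m\<in>{m \<in> keys ?P. cond m}. lookup ?P m)" by (rule sum.inter_filter[symmetric]) simp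
 also have "... = (\<Sum>m\<in>enc ` T. lookup ?P m)"
  by (rule sum.mono_neutral_left) (use finite_imageI[OF finT, of enc, unfolded img] lmat_keys[of _ ?I "Suc V" ?X'] in "auto simp: img in_keys_iff")
 also have "... = (\<Sum>x\<in>T. lookup ?P (enc x))" by (simp add: sum.reindex[OF inj])
 also have "... = (\<Sum>(ss, k')\<in>T. sF (ss @ [k']) (ws' @ [b]) N :: 'a gen_poly)" by (rule sum.cong) (auto simp: enc_def sF_def lenw)
 finally show "sF ts ws N * ct {..<N} k (wm N b) = (\<Sum>(ss, k')\<in>T. sF (ss @ [k']) (ws' @ [b]) N :: 'a gen_poly)" unfolding lhs .
qed

lemma binomial_prime_power_not_dvd: fixes p :: nat assumes p: "prime p" and c: "~ p dvd c" shows "~ p dvd (p ^ a * c choose p ^ a)"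
proof -
 have c0: "0 < c" and p0: "0 < p" using c p by (auto intro!: Nat.gr0I simp: prime_gt_0_nat)
 let ?K = "p ^ a"
 have K0: "0 < ?K" using p0 by simp
 have Kc: "?K <= ?K * c" using c0 by simp
 have "multiplicity p (?K * c - 1 choose (?K - 1)) = 0" proof (rule p_not_div_choose)
  show "?K - 1 < ?K" using K0 by simp
  show "?K - 1 <= ?K * c - 1" using Kc by (rule diff_le_mono)
  show "multiplicity p (?K * c - 1 - (?K - 1) + (?K - j)) = multiplicity p (?K - j)" if "0 < j" "j < ?K" for j proof -
   have "L - 1 - (K - 1) + (K - j) = L - j" if "K <= L" "0 < K" "j < K" for L K :: nat using that by arith
   hence "?K * c - 1 - (?K - 1) + (?K - j) = ?K * c - j" using Kc K0 that by blast
   thus ?thesis using exponent_p_a_m_k_equation[of c j p a] that c0 p0 by simp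
  qed
 qed (rule p)
 moreover have "0 < (?K * c - 1 choose (?K - 1))" using Kc by (simp add: diff_le_mono)
 ultimately have nd: "~ p dvd (?K * c - 1 choose (?K - 1))" by (metis less_not_refl multiplicity_eq_zero_iff not_prime_unit p)
 have "?K * (?K * c choose ?K) = ?K * c * (?K * c - 1 choose (?K - 1))" by (rule times_binomial_minus1_eq) (rule K0)
 hence "?K * (?K * c choose ?K) = ?K * (c * (?K * c - 1 choose (?K - 1)))" by (simp only: mult.assoc)
 hence "(?K * c choose ?K) = c * (?K * c - 1 choose (?K - 1))" by (rule nat_mult_eq_cancel1[OF K0, THEN iffD1])
 thus ?thesis using nd c p by (simp add: prime_dvd_mult_iff)
qed

lemma binomial_nonzero_in_char: assumes t: "0 < t" "\<nexists>k. t = CHAR('a) ^ k"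
 obtains a b where "t = a + b" "0 < a" "0 < b" "(of_nat (t choose a) :: 'a::field) ~= 0"
proof (cases "CHAR('a) = 0")
 case True
 have "t ~= 1" using t(2)[unfolded not_ex, rule_format, of 0] by simp
 thus ?thesis using True t by (intro that[of 1 "t - 1"]) (simp_all add: of_nat_eq_0_iff_char_dvd)
next
 case False
 hence p: "prime CHAR('a)" using prime_CHAR_semidom by auto
 define p where "p = CHAR('a)"
 obtain c where tc: "t = p ^ multiplicity p t * c" "~ p dvd c"
  using multiplicity_decompose'[of t p] t p by (metis less_not_refl not_prime_unit p_def)
 let ?a = "p ^ multiplicity p t"
 have p0: "0 < p" using False by (simp add: p_def)
 have "c ~= 1" using tc t(2) by (auto simp: p_def)
 moreover have "c ~= 0" using tc(1) t(1) by (metis mult_0_right less_irrefl)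
 ultimately have "?a * 1 < ?a * c" using p0 by (intro mult_strict_left_mono) auto
 hence "t = ?a + (t - ?a)" "0 < t - ?a" "0 < ?a" using tc(1) p0 by auto
 moreover have "(of_nat (t choose ?a) :: 'a) ~= 0"
  unfolding of_nat_eq_0_iff_char_dvd using binomial_prime_power_not_dvd[OF p[folded p_def] tc(2), of "multiplicity p t"] tc(1) by (simp flip: p_def)
 ultimately show ?thesis using that by blast
qed

lemma UI_minus: fixes F G :: "nat => 'a::field gen_poly" assumes "UI S F" "UI S G" shows "UI S (%N. F N - G N)"
 using UI_add[OF assms(1) UI_mult[OF UU_Const[of "-1"] assms(2)]] by (simp add: Const_simps)

lemma UI_cmult: fixes F :: "nat => 'a::field gen_poly" assumes "UI S (%N. of_nat c * F N)" "(of_nat c :: 'a) ~= 0"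
 shows "UI S F"
proof -
 interpret c: comm_ring_hom "Const :: 'a => 'a gen_poly" by (rule Const_hom)
 have "Const (inverse (of_nat c)) * (of_nat c * F N) = F N" for N proof -
  have "Const (inverse (of_nat c)) * (of_nat c :: 'a gen_poly) = Const (inverse (of_nat c) * of_nat c)" proof -
   have "Const (of_nat k) = (of_nat k :: 'a gen_poly)" for k by (induction k) (simp_all add: Const_simps)
   thus ?thesis by (simp add: c.hom_mult)
  qed
  thus ?thesis using assms(2) by (simp add: Const_simps flip: mult.assoc)
 qed
 thus ?thesis using UI_mult[OF UU_Const[of "inverse (of_nat c)"] assms(1)] by simp
qed

lemma UU_ct_word: fixes \<pi> :: "'a::field sigmaX => 'a large_sigmaX" assumes pi: "is_pi_tilde \<pi>" and w: "w ~= []"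
 shows "UU (%N. ct {..<N} t (wm N w) :: 'a gen_poly)"
proof -
 have "ct {..<N} t (wm N w) = Phi_tilde N (\<pi> (sg t (word w)))" for N
  unfolding Phi_pi[OF pi] Psi_sg[OF word_FX[OF w]] by (rule ct_cong) (simp add: phN_word)
 thus ?thesis unfolding UU_def by blast
qed

lemma ct_wm_rotate: "ct {..<N} t (wm N (u @ v)) = ct {..<N} t (wm N (v @ u))"
proof -
 have e: "wm N (u @ v) i j = (\<Sum>k<N. wm N u i k * wm N v k j)" if "i < N" "j < N" for i j u v
  unfolding wm_def by (rule wmat_append) (use that in auto)
 show ?thesis by (subst (1 2) ct_cong[OF e]) (auto intro!: ct_sylvester)
qed

lemma minimal_rotation_not_lyn: assumes z: "z ~= []" "!!u v. z = u @ v ==> z <= v @ u" and n: "~ lyn z"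
 shows "\<exists>c q. 1 < q & c ~= [] & z = pw q (c :: nat list)"
proof -
 obtain u v where uv: "z = u @ v" "u ~= []" "v ~= []" "~ z < v" using n z(1) unfolding lyn_def by blast
 have "z ~= v" using uv by auto
 hence "v < z" using uv(4) by (metis linorder_less_linear)
 hence vz: "v < u @ v" by (simp only: uv(1))
 have zr: "u @ v <= v @ u" using z(2)[OF uv(1)] uv(1) by simp
 obtain x where x: "u @ v = v @ x" using vz unfolding list_less_cases proof (elim disjE exE conjE)
  fix p a b s t assume h: "a < (b::nat)" "v = p @ a # s" "u @ v = p @ b # t"
  have "v @ u < u @ v" unfolding list_less_cases using h by (metis append.assoc append_Cons)
  thus thesis using zr by simp
 qed (use that in blast)
 have lx: "length x = length u" using arg_cong[OF x, of length] by simp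
 have "x <= u" using zr unfolding x by simp
 moreover have "u <= x" proof -
  have "u @ v <= x @ v" using z(2)[of v x] uv(1) x by (simp only:)
  then consider "u @ v = x @ v" | "u @ v < x @ v" unfolding order.order_iff_strict by (elim disjE)
  thus ?thesis proof cases
   case 2
   have "u < x \<or> (u = x & v < v)" by (rule append_less_of_length[OF lx 2])
   thus ?thesis by (rule disjE) (simp_all only: order.strict_implies_order order_refl)
  qed (simp only: append_same_eq order_refl)
 qed
 ultimately have "x = u" by (rule order.antisym)
 hence "u @ v = v @ u" using x by (simp only:)
 then obtain m n zs where c: "pw m zs = u" "pw n zs = v" using comm_append_are_replicate by blast
 have "m ~= 0" "n ~= 0" "zs ~= []" using c uv(2,3) by (auto simp: concat_eq_Nil_conv)
 moreover have "z = pw (m + n) zs" using uv(1) c by (simp add: replicate_add)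
 ultimately show ?thesis by (intro exI[of _ zs] exI[of _ "m + n"]) auto
qed

lemma exists_minimal_rotation: assumes "w ~= ([] :: nat list)"
 obtains u v where "w = u @ v" "!!p q. v @ u = p @ q ==> v @ u <= q @ p"
proof -
 define R where "R = (%k. rotate k w) ` {..<length w}"
 have fR: "finite R" "R ~= {}" using assms by (auto simp: R_def)
 have mn: "Min R \<in> R" "!!x. x \<in> R ==> Min R <= x" using fR by (rule Min_in, intro Min_le[OF fR(1)])
 have rR: "rotate k w \<in> R" for k
  unfolding R_def by (rule image_eqI[of _ _ "k mod length w"]) (use assms in "simp_all flip: rotate_conv_mod")
 obtain k where k: "k < length w" "Min R = rotate k w" using mn(1) unfolding R_def by auto
 have rk: "rotate k w = drop k w @ take k w" using k by (simp add: rotate_drop_take)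
 show thesis proof (rule that[of "take k w" "drop k w"])
  fix p q assume e: "drop k w @ take k w = p @ q"
  have "q @ p = rotate (length p) (rotate k w)" unfolding rk e by (rule rotate_append[symmetric])
  also have "... = rotate (length p + k) w" by (simp add: rotate_rotate)
  finally show "drop k w @ take k w <= q @ p" using mn(2)[OF rR] unfolding k(2) rk by (simp only:)
 qed simp
qed

lemma P_poly_high_monomials: assumes T: "n < T" and l: "1 < l" and m: "lookup (P_poly T l :: (nat, 'a::field) mpoly) m ~= 0"
 shows "\<exists>k\<in>keys m. n < k"
proof (rule ccontr)
 assume neg: "~ ?thesis"
 let ?P = "P_poly T l :: (nat, 'a) mpoly"
 have T0: "0 < T" using T by simp
 have in_vars: "k \<in> {1..T * l}" if "m' \<in> keys ?P" "k \<in> keys m'" for m' k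
  using P_poly_spec(1)[OF T0 l, where 'a = 'a] that unfolding intp_def vars_def by blast
 let ?ze = "%k. if k <= n then Var k else 0 :: (nat, 'a) mpoly"
 let ?v = "%k. Var (k, 0, 0) :: 'a gen_poly"
 interpret s: comm_ring_hom "subst (%(k, i, j). Var k) :: 'a gen_poly => (nat, 'a) mpoly" by (rule subst_hom)
 have "0 = subst (%(k, i, j). Var k) (ct {..<n} T (mp n l (comp ?v)) :: 'a gen_poly)" by (simp add: ct_eq_0[OF _ _] T)
 also have "... = subst (%(k, i, j). Var k) (subst (%k. ct {..<n} k (comp ?v)) ?P)" by (simp only: P_poly_spec(2)[OF T0 l])
 also have "... = subst ?ze ?P"
  unfolding subst_eq_ev[of "%k. ct {..<n} k (comp ?v)"] subst_eq_ev[of ?ze] ev_def s.hom_sum s.hom_mult subst_Const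
 proof (rule sum.cong[OF refl])
  fix m' assume m': "m' \<in> keys ?P"
  have "subst (%(k, i, j). Var k) (monoval (%k. ct {..<n} k (comp ?v)) m') = monoval ?ze m'"
   unfolding monoval_def s.hom_prod s.hom_power proof (rule prod.cong[OF refl])
   fix k assume "k \<in> keys m'"
   hence "1 <= k" using in_vars[OF m'] by auto
   thus "subst (%(k, i, j). Var k) (ct {..<n} k (comp ?v)) ^ lookup m' k = ?ze k ^ lookup m' k" by (simp add: ct_comp)
  qed
  thus "Const (lookup ?P m') * subst (%(k, i, j). Var k) (monoval (%k. ct {..<n} k (comp ?v)) m') =
    Const (lookup ?P m') * monoval ?ze m'" by simp
 qed
 finally have z: "subst ?ze ?P = 0" by simp
 have "0 = lookup (subst ?ze ?P) m" by (simp add: z)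
 also have "... = (\<Sum>m'\<in>keys ?P. lookup ?P m' * lookup (monoval ?ze m') m)" by (rule lookup_subst)
 also have "... = (\<Sum>m'\<in>keys ?P. if m' = m then lookup ?P m' else 0)" proof (rule sum.cong[OF refl])
  fix m'
  have "lookup (monoval ?ze m') m = of_bool (m' = m)" proof (cases "keys m' <= {..n}")
   case True
   hence "monoval ?ze m' = monoval Var m'" unfolding monoval_def by (intro prod.cong) auto
   thus ?thesis by (simp add: monoval_Var lookup_single when_def)
  next
   case False
   then obtain k where k: "k \<in> keys m'" "~ k <= n" by auto
   hence "monoval ?ze m' = 0" unfolding monoval_def by (intro prod_zero) (auto intro!: bexI[of _ k] simp: in_keys_iff zero_power)
   moreover have "m' ~= m" using k neg by auto
   ultimately show ?thesis by simp
  qed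
  thus "lookup ?P m' * lookup (monoval ?ze m') m = (if m' = m then lookup ?P m' else 0)" by simp
 qed
 also have "... = lookup ?P m" using m by (simp add: sum.delta in_keys_iff)
 finally show False using m by simp
qed

lemma mp_wm: "i < N ==> j < N ==> wm N (pw q c) i j = (mp N q (wm N c) i j :: 'a::comm_ring_1 gen_poly)"
proof (induction q arbitrary: i)
 case (Suc q)
 have "wm N (pw (Suc q) c) i j = (\<Sum>k<N. wm N c i k * wm N (pw q c) k j :: 'a gen_poly)"
  unfolding wm_def using Suc.prems by (simp add: wmat_append)
 also have "... = (\<Sum>k<N. wm N c i k * mp N q (wm N c) k j :: 'a gen_poly)" using Suc by (intro sum.cong) auto
 finally show ?case by (simp add: mp_def)
qed (simp add: wm_def mp_def)

lemma single_word_UI: fixes \<pi> :: "'a::field sigmaX => 'a large_sigmaX"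
 assumes pi: "is_pi_tilde \<pi>" and S: "!!t b. n < t ==> b \<in> X_tilde ==> large_sg t b \<in> S"
  and w: "w ~= []" and T: "n < T"
 shows "UI S (%N. ct {..<N} T (wm N w) :: 'a gen_poly)" using w T
proof (induction "length w" arbitrary: w T rule: less_induct)
 case less
 obtain u v where uv: "w = u @ v" and mn: "!!p q. v @ u = p @ q ==> v @ u <= q @ p"
  using exists_minimal_rotation[OF less.prems(1)] by blast
 define z where "z = v @ u"
 have ctz: "ct {..<N} T (wm N w) = (ct {..<N} T (wm N z) :: 'a gen_poly)" for N unfolding uv z_def by (rule ct_wm_rotate)
 have z0: "z ~= []" using less.prems(1) uv z_def by auto
 show ?case proof (cases "lyn z")
  case True
  hence zX: "z \<in> X_tilde" by (simp add: X_tilde_iff_lyn)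
  have "ct {..<N} T (wm N w) = (Phi_tilde N (large_sg T z) :: 'a gen_poly)" for N
   using Phi_large_sg[OF _ zX, of T N, where 'a = 'a] less.prems by (simp add: ctz)
  moreover have "large_sg T z \<in> ideal_generated S" using S[OF less.prems(2) zX] by (rule ideal_generated_base)
  ultimately show ?thesis unfolding UI_def by blast
 next
  case False
  then obtain c q where c: "1 < q" "c ~= []" "z = pw q c" using minimal_rotation_not_lyn[OF z0] mn unfolding z_def by blast
  have "length z = q * length c" by (simp add: c(3) length_concat sum_list_replicate)
  moreover have "length z = length w" by (simp add: z_def uv)
  moreover have "1 * length c < q * length c" using c(1,2) by (intro mult_less_mono1) auto
  ultimately have lc: "length c < length w" by simp
  let ?P = "P_poly T q :: (nat, 'a) mpoly"
  let ?F = "%k N. ct {..<N} k (wm N c) :: 'a gen_poly"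
  have e: "ct {..<N} T (wm N w) = (\<Sum>m\<in>keys ?P. Const (lookup ?P m) * monoval (%k. ?F k N) m)" for N proof -
   have "ct {..<N} T (wm N w) = (ct {..<N} T (mp N q (wm N c)) :: 'a gen_poly)" unfolding ctz c(3) by (rule ct_cong) (simp add: mp_wm)
   also have "... = subst (%k. ?F k N) ?P" using P_poly_spec(2)[of T q] less.prems c(1) by simp
   finally show ?thesis by (simp add: subst_eq_ev ev_def)
  qed
  show ?thesis unfolding e proof (intro UI_sum UI_mult UU_Const)
   fix m assume m: "m \<in> keys ?P"
   then obtain k where k: "k \<in> keys m" "n < k" using P_poly_high_monomials[OF less.prems(2) c(1), where 'a = 'a] by (auto simp: in_keys_iff)
   have uu: "UU (?F j)" for j by (rule UU_ct_word[OF pi c(2)])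
   have "monoval (%k. ?F k N) m = (\<Prod>j\<in>keys m - {k}. ?F j N ^ lookup m j) * ?F k N ^ (lookup m k - 1) * ?F k N" for N proof -
    have "?F k N ^ lookup m k = ?F k N ^ (lookup m k - 1) * ?F k N" using k(1) by (cases "lookup m k") (auto simp: in_keys_iff mult.commute)
    thus ?thesis unfolding monoval_def using k(1) by (simp add: prod.remove[of _ k] mult_ac)
   qed
   thus "UI S (%N. monoval (%k. ?F k N) m)" by (simp only:) (intro UI_mult UU_mult UU_prod UU_power uu less.hyps[OF lc c(2) k(2)])
  qed
 qed
qed

lemma sF_drop_zeros_perm: fixes ts :: "nat list" and ws :: "nat list list"
 assumes len: "length ts = length ws" and ms: "mset (ys @ zs) = mset (zip ts ws)" and z: "!!x. x \<in> set zs ==> fst x = 0"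
 shows "sF ts ws N = (sF (map fst ys) (map snd ys) N :: 'a::field gen_poly)"
proof -
 let ?xs = "zip ts ws"
 obtain p where p: "p permutes {..<length ?xs}" "permute_list p ?xs = ys @ zs" using mset_eq_permutation[OF ms] by blast
 have lx: "length ?xs = length ts" "length ts = length ys + length zs" using len arg_cong[OF p(2), of length] by (auto simp: permute_list_def)
 have nth: "(ys @ zs) ! l = ?xs ! p l" if "l < length ts" for l using permute_list_nth[OF p(1), of l] that p(2) lx by simp
 have pl: "p l < length ts <-> l < length ts" for l using permutes_in_image[OF p(1), of l] unfolding lx(1) by simp
 show ?thesis proof (rule sF_embed[where g = p and u = "length ys" and u' = "length ts"])
  show "inj_on p {..<length ys}" using permutes_inj[OF p(1)] by (rule inj_on_subset) simp
  show "p ` {..<length ys} <= {..<length ts}" proof (rule image_subsetI)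
   fix l assume "l \<in> {..<length ys}"
   hence "l < length ts" unfolding lx(2) by simp
   thus "p l \<in> {..<length ts}" using pl[of l] by simp
  qed
  show "ts ! p l = map fst ys ! l & ws ! p l = map snd ys ! l" if "l < length ys" for l proof -
   have l: "l < length ts" using that unfolding lx(2) by simp
   note pl = pl[of l, THEN iffD2, OF l]
   have "ys ! l = zip ts ws ! p l" using nth[OF l] that by (simp add: nth_append)
   thus ?thesis using that pl len by simp
  qed
  show "ts ! j = 0" if j: "j < length ts" "j \<notin> p ` {..<length ys}" for j proof -
   obtain l where l: "j = p l" using permutes_surj[OF p(1)] by (metis surjD)
   have ll: "l < length ts" "~ l < length ys" using j(1) pl[of l] j(2) unfolding l by auto
   hence "(ys @ zs) ! l \<in> set zs" using lx by (simp add: nth_append)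
   hence "fst ((ys @ zs) ! l) = 0" by (rule z)
   thus ?thesis using nth[OF ll(1)] j(1) len l by simp
  qed
 qed (use len in auto)
qed

theorem sF_UI: fixes \<pi> :: "'a::field sigmaX => 'a large_sigmaX"
 assumes pi: "is_pi_tilde \<pi>" and S: "!!t b. n < t ==> b \<in> X_tilde ==> large_sg t b \<in> S"
  and G: "!!ts ws. 1 < length ts ==> length ws = length ts ==> (\<forall>w\<in>set ws. w ~= []) ==> sorted_wrt (\<ge>) ts ==>
   (\<forall>t\<in>set ts. 0 < t & (\<exists>k. t = CHAR('a) ^ k)) ==>
   (sum_list ts = n + 1 \<or> n + 1 < sum_list ts & sum_list ts <= 2 * n & sum_list ts - Min (set ts) <= n) ==>
   UI S (sF ts ws :: nat => 'a gen_poly)"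
 shows "length ws = length ts ==> (\<forall>w\<in>set ws. w ~= []) ==> n < sum_list ts ==> UI S (sF ts ws :: nat => 'a gen_poly)"
proof (induction "sum_list ts" arbitrary: ts ws rule: less_induct)
 case (less ts ws)
 define s where "s = sum_list ts"
 have IH: "UI S (sF ss vs :: nat => 'a gen_poly)" if "sum_list ss < s" "n < sum_list ss" "length vs = length ss" "\<forall>w\<in>set vs. w ~= []" for ss vs
  by (rule less.hyps) (use that s_def in auto)
 have step: "UI S (sF (ss @ [k]) (vs @ [b]) :: nat => 'a gen_poly)"
  if h: "n < sum_list ss" "sum_list ss + k = s" "0 < k" "length vs = length ss" "\<forall>w\<in>set vs. w ~= []" "b ~= []" for ss vs k b
 proof -
  let ?u = "length ss"
  define T where "T = {(rs, k'). length rs = 2 * ?u & (\<forall>l<?u. rs ! l + rs ! (?u + l) = ss ! l) & k' + (\<Sum>l<?u. rs ! (?u + l)) = k}"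
  define vs' where "vs' = vs @ map (%w. w @ b) vs"
  let ?z = "ss @ replicate ?u 0"
  let ?F = "%(rs, k'). sF (rs @ [k']) (vs' @ [b]) :: nat => 'a gen_poly"
  have fT: "finite T" unfolding T_def using h(4) by (intro sF_mult(1)) auto
  have zT: "(?z, k) \<in> T" by (simp add: T_def nth_append)
  have m: "sF ss vs N * ct {..<N} k (wm N b) = (\<Sum>x\<in>T. ?F x N)" for N
   using sF_mult(2)[of ss ?u vs N k b, where 'a = 'a] h(4) by (simp add: T_def vs'_def case_prod_unfold)
  have lv: "length vs' = 2 * ?u" using h(4) by (simp add: vs'_def)
  have tot: "sum_list rs = sum_list ss" if "(rs, k') \<in> T" for rs k' proof -
   have l: "length rs = ?u + ?u" using that by (simp add: T_def)
   have "sum_list rs = (\<Sum>l\<in>{0..<?u + ?u}. rs ! l)" by (simp add: sum_list_sum_nth l)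
   also have "... = (\<Sum>l\<in>{0..<?u}. rs ! l) + (\<Sum>l\<in>{?u..<?u + ?u}. rs ! l)" by (rule sum.atLeastLessThan_concat[symmetric]) auto
   also have "(\<Sum>l\<in>{?u..<?u + ?u}. rs ! l) = (\<Sum>l\<in>{0..<?u}. rs ! (?u + l))"
    using sum.shift_bounds_nat_ivl[of "%l. rs ! l" 0 ?u ?u] by (simp add: add.commute)
   also have "(\<Sum>l\<in>{0..<?u}. rs ! l) + (\<Sum>l\<in>{0..<?u}. rs ! (?u + l)) = (\<Sum>l\<in>{0..<?u}. ss ! l)"
    unfolding sum.distrib[symmetric] using that by (intro sum.cong) (auto simp: T_def)
   finally show ?thesis by (simp add: sum_list_sum_nth)
  qed
  have other: "UI S (?F x)" if x: "x \<in> T - {(?z, k)}" for x proof -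
   obtain rs k' where rk: "x = (rs, k')" by (cases x)
   have rT: "(rs, k') \<in> T" and ne: "~ (rs = ?z & k' = k)" using x rk by auto
   have "k' ~= k" proof
    assume "k' = k"
    hence z: "rs ! (?u + l) = 0" if "l < ?u" for l using rT that by (simp add: T_def)
    have "rs = ?z" proof (rule nth_equalityI)
     fix i assume i: "i < length rs"
     have li: "length rs = ?u + ?u" using rT by (simp add: T_def)
     show "rs ! i = ?z ! i" proof (cases "i < ?u")
      case True
      have "rs ! i + rs ! (?u + i) = ss ! i" using rT True by (simp add: T_def)
      thus ?thesis using z[OF True] True by (simp add: nth_append)
     next
      case False
      thus ?thesis using z[of "i - ?u"] i li by (simp add: nth_append)
     qed
    qed (use rT in "simp add: T_def")
    thus False using ne `k' = k` by simp
   qed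
   moreover have "k' <= k" using rT by (simp add: T_def)
   ultimately have "k' < k" by simp
   have "UI S (sF (rs @ [k']) (vs' @ [b]) :: nat => 'a gen_poly)" proof (rule IH)
    show "sum_list (rs @ [k']) < s" "n < sum_list (rs @ [k'])" using tot[OF rT] h(1,2) `k' < k` by auto
    show "length (vs' @ [b]) = length (rs @ [k'])" using rT lv by (simp add: T_def)
    show "\<forall>w\<in>set (vs' @ [b]). w ~= []" using h(5,6) by (auto simp: vs'_def)
   qed
   thus ?thesis by (simp add: rk)
  qed
  have "sF (ss @ [k]) (vs @ [b]) N = ct {..<N} k (wm N b) * sF ss vs N - (\<Sum>x\<in>T - {(?z, k)}. ?F x N)" for N proof -
   have "?F (?z, k) N = sF (ss @ [k]) (vs @ [b]) N" unfolding prod.case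
   proof (rule sF_drop_zeros_perm[where ys = "zip (ss @ [k]) (vs @ [b])" and zs = "zip (replicate ?u 0) (map (%w. w @ b) vs)", THEN trans])
    show "mset (zip (ss @ [k]) (vs @ [b]) @ zip (replicate ?u 0) (map (%w. w @ b) vs)) = mset (zip (?z @ [k]) (vs' @ [b]))"
     using h(4) by (simp add: vs'_def zip_append)
   qed (use h(4) lv in "auto simp: in_set_zip simp del: zip_append")
   thus ?thesis using m[of N] sum.remove[OF fT zT, of "%x. ?F x N"] by (simp add: mult.commute)
  qed
  moreover have "UI S (%N. ct {..<N} k (wm N b) * sF ss vs N :: 'a gen_poly)" by (intro UI_mult UU_ct_word[OF pi h(6)] IH) (use h in auto)
  moreover have "UI S (%N. \<Sum>x\<in>T - {(?z, k)}. ?F x N)" by (rule UI_sum) (rule other)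
  ultimately show ?thesis using UI_minus by (metis (no_types, lifting) ext)
 qed
 have "UI S (sF ss vs :: nat => 'a gen_poly)" if "sum_list ss = s" "length vs = length ss" "\<forall>w\<in>set vs. w ~= []" for ss vs
  using that proof (induction "sum_list (map (%t. t * t) ss)" arbitrary: ss vs rule: less_induct)
  case inner: (less ss vs)
  let ?u = "length ss"
  consider i where "i < ?u" "0 < ss ! i" "\<nexists>k. ss ! i = CHAR('a) ^ k"
   | i where "i < ?u" "0 < ss ! i" "n < s - ss ! i"
   | "\<forall>i<?u. 0 < ss ! i --> (\<exists>k. ss ! i = CHAR('a) ^ k) & s - ss ! i <= n" by (meson linorder_not_less)
  thus ?case proof cases
   case (1 i)
   obtain a b where ab: "ss ! i = a + b" "0 < a" "0 < b" "(of_nat (ss ! i choose a) :: 'a) ~= 0"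
    using binomial_nonzero_in_char[OF 1(2,3)] by blast
   have e: "sF (ss[i := a] @ [b]) (vs @ [vs ! i]) N = (of_nat ((a + b) choose a) * sF ss vs N :: 'a gen_poly)" for N
    by (rule sF_split[OF refl inner.prems(2) 1(1) ab(1)])
   have su: "sum_list (ss[i := a]) + ss ! i = sum_list ss + a" and sq: "sum_list (map (%t. t * t) (ss[i := a])) + ss ! i * ss ! i = sum_list (map (%t. t * t) ss) + a * a"
    using 1(1) by (induction ss arbitrary: i) (auto split: nat.splits simp: nth_Cons add_ac)
   have "UI S (sF (ss[i := a] @ [b]) (vs @ [vs ! i]) :: nat => 'a gen_poly)" proof (rule inner.hyps)
    have "a * a + b * b < (a + b) * (a + b)" using ab by (simp add: algebra_simps)
    thus "sum_list (map (%t. t * t) (ss[i := a] @ [b])) < sum_list (map (%t. t * t) ss)" using sq ab(1) by simp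
    show "sum_list (ss[i := a] @ [b]) = s" using su ab(1) inner.prems(1) by simp
    show "\<forall>w\<in>set (vs @ [vs ! i]). w ~= []" using inner.prems 1(1) by auto
   qed (use inner.prems in simp)
   hence "UI S (%N. of_nat ((a + b) choose a) * sF ss vs N :: 'a gen_poly)" using e by (metis (no_types, lifting) ext)
   thus ?thesis using UI_cmult ab(4) ab(1) by metis
  next
   case (2 i)
   have e: "sF (ss[i := 0] @ [ss ! i]) (vs @ [vs ! i]) N = (sF ss vs N :: 'a gen_poly)" for N
    using sF_split[OF refl inner.prems(2) 2(1), of 0 "ss ! i" N, where 'a = 'a] by simp
   have su: "sum_list (ss[i := 0]) + ss ! i = sum_list ss" using 2(1) by (induction ss arbitrary: i) (auto split: nat.splits simp: nth_Cons add_ac)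
   have "UI S (sF (ss[i := 0] @ [ss ! i]) (vs @ [vs ! i]) :: nat => 'a gen_poly)" by (rule step) (use su 2 inner.prems in auto)
   thus ?thesis using e by (metis (no_types, lifting) ext)
  next
   case 3
   define ys where "ys = rev (sort_key fst (filter (%x. fst x ~= 0) (zip ss vs)))"
   define zs where "zs = filter (%x. ~ fst x ~= 0) (zip ss vs)"
   have ms: "mset (ys @ zs) = mset (zip ss vs)" by (simp add: ys_def zs_def)
   have zz: "fst x = 0" if "x \<in> set zs" for x using that by (simp add: zs_def)
   have e: "sF ss vs N = (sF (map fst ys) (map snd ys) N :: 'a gen_poly)" for N by (rule sF_drop_zeros_perm[OF inner.prems(2)[symmetric] ms zz])
   have sy: "set ys = {x \<in> set (zip ss vs). fst x ~= 0}" by (auto simp: ys_def)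
   have "sum_list (map fst (ys @ zs)) = sum_list (map fst (zip ss vs))" using ms by (metis mset_map sum_mset_sum_list)
   moreover have "sum_list (map fst zs) = 0" using zz by (induction zs) auto
   ultimately have sums: "sum_list (map fst ys) = s" using inner.prems by simp
   have part: "0 < t & (\<exists>k. t = CHAR('a) ^ k) & s - t <= n" if tin: "t \<in> set (map fst ys)" for t proof -
    obtain w where "(t, w) \<in> set ys" using tin by auto
    hence "(t, w) \<in> set (zip ss vs)" "t ~= 0" by (auto simp: sy)
    then obtain i where "i < ?u" "t = ss ! i" "t ~= 0" by (metis set_zip_leftD in_set_conv_nth)
    thus ?thesis using 3 by auto
   qed
   have ne: "\<forall>w\<in>set (map snd ys). w ~= []" using sy inner.prems(3) by (auto dest: set_zip_rightD)
   have ns: "n < s" using less.prems(3) s_def by simp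
   consider "length ys = 0" | "length ys = 1" | "1 < length ys" by linarith
   hence "UI S (sF (map fst ys) (map snd ys) :: nat => 'a gen_poly)" proof cases
    case 1
    thus ?thesis using sums ns by simp
   next
    case 2
    then obtain t w where y: "ys = [(t, w)]" by (cases ys) (auto simp: length_Suc_conv)
    have "UI S (%N. ct {..<N} t (wm N w) :: 'a gen_poly)" by (rule single_word_UI[OF pi S]) (use ne sums ns y in auto)
    moreover have "sF [t] [w] = (%N. ct {..<N} t (wm N w) :: 'a gen_poly)" by (rule ext, rule sF_single)
    ultimately show ?thesis by (simp add: y)
   next
    case y1: 3
    let ?ts = "map fst ys"
    have so: "sorted_wrt (\<ge>) ?ts" unfolding ys_def rev_map[symmetric] sorted_wrt_rev by (rule sorted_sort_key)
    have mi: "Min (set ?ts) \<in> set ?ts" using y1 by (intro Min_in) auto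
    obtain a b rest where y2: "?ts = a # b # rest" using y1 by (cases ys; cases "tl ys") auto
    have "Min (set ?ts) + Min (set ?ts) <= a + b" unfolding y2 by (intro add_mono Min_le) auto
    also have "... <= s" using sums y2 by simp
    finally have m2: "2 * Min (set ?ts) <= s" by simp
    have "s - Min (set ?ts) <= n" using part[OF mi] by simp
    hence "s = n + 1 \<or> n + 1 < s & s <= 2 * n & s - Min (set ?ts) <= n" using m2 ns by linarith
    thus ?thesis by (intro G) (use y1 ne so part sums in auto)
   qed
   thus ?thesis using e by (metis (no_types, lifting) ext)
  qed
 qed
 thus ?case using less.prems s_def by blast
qed

lemma sF_sigma_multi: fixes \<pi> :: "'a::field sigmaX => 'a large_sigmaX"
 assumes pi: "is_pi_tilde \<pi>" and len: "length ws = length ts" and w: "\<forall>w\<in>set ws. w ~= []"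
 shows "Phi_tilde N (\<pi> (sigma_multi ts (map word ws))) = sF ts ws N"
proof -
 have "set (map word ws) <= (FX :: 'a nc_poly set)" using w word_FX by auto
 hence "Psi N (sigma_multi ts (map word ws)) = (lookup (D {..<N} (lmat (length ws) (%l. phN N (map word ws ! l)))) (tm ts) :: 'a gen_poly)"
  using Psi_sigma_multi[of "map word ws" ts N] len by simp
 also have "... = sF ts ws N" unfolding sF_def by (rule arg_cong[where f = "%x. lookup x _"], rule D_cong) (simp add: lmat_def phN_word)
 finally show ?thesis by (simp add: Phi_pi[OF pi])
qed

section \<open>The generating function of pairs of tableaux\<close>

text \<open>Rows \<open>j \<in> R\<close> carry vectors of formal variables \<open>y\<^sub>j\<^sub>b\<close>, \<open>x\<^sub>j\<^sub>b\<close> indexed by letters \<open>b \<in> B\<close>, and the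
  letter \<open>b\<close> stands for a copy of the matrix \<open>A (\<kappa> b)\<close>.\<close>

definition MM :: "nat set => (nat => nat) => (nat => nat => 'r) => (nat => nat => 'r) => (nat => nat => nat => 'r) => nat \<times> nat => nat \<times> nat => 'r::comm_ring_1" where
 "MM B ka y x A = (%(j, c) (j', c'). \<Sum>b\<in>B. y j b * x j' b * A (ka b) c c')"

definition PD :: "nat set => (nat => nat) => nat set => nat => (nat => nat => 'r) => (nat => nat => 'r) => (nat => nat => nat => 'r) => 'r::comm_ring_1" where
 "PD B ka R N y x A = D (R \<times> {..<N}) (MM B ka y x A)"

lemma PD_hom: assumes "comm_ring_hom h"
 shows "h (PD B ka R N y x A) = PD B ka R N (%j b. h (y j b)) (%j b. h (x j b)) (%k c c'. h (A k c c'))"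
proof -
 interpret h: comm_ring_hom h by fact
 show ?thesis unfolding PD_def D_hom[OF assms] by (rule D_cong) (auto simp: MM_def h.hom_sum h.hom_mult)
qed

lemma PD_cong:
 assumes "!!j b. j \<in> R ==> b \<in> B ==> y j b = y' j b" "!!j b. j \<in> R ==> b \<in> B ==> x j b = x' j b"
  "!!b c c'. b \<in> B ==> c < N ==> c' < N ==> A (ka b) c c' = A' (ka b) c c'"
 shows "PD B ka R N y x A = PD B ka R N y' x' A'" unfolding PD_def by (rule D_cong) (auto simp: MM_def assms intro!: sum.cong)

lemma PD_row: assumes R: "finite R"
 shows "PD B ka R N (%j b. \<Sum>i\<in>R. C j i * y i b) x A = PD B ka R N y (%j b. \<Sum>i\<in>R. C i j * x i b) (A :: nat => nat => nat => 'r::comm_ring_1)"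
proof -
 let ?I = "R \<times> {..<N}"
 define u :: "nat \<times> nat => nat \<times> nat => 'r" where "u = (%(j, c) (i, e). C j i * of_bool (c = e))"
 have fin: "finite ?I" using R by simp
 have "PD B ka R N (%j b. \<Sum>i\<in>R. C j i * y i b) x A = D ?I (%p q. \<Sum>k\<in>?I. u p k * MM B ka y x A k q)"
  unfolding PD_def proof (rule D_cong)
  fix p q assume "p \<in> ?I" "q \<in> ?I"
  then obtain j c j' c' where pq: "p = (j, c)" "q = (j', c')" "c < N" by auto
  have "(\<Sum>k\<in>?I. u p k * MM B ka y x A k q) = (\<Sum>i\<in>R. \<Sum>e<N. of_bool (c = e) * (C j i * (\<Sum>b\<in>B. y i b * x j' b * A (ka b) e c')))"
   by (simp add: sum.cartesian_product pq u_def MM_def case_prod_unfold mult_ac)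
  also have "... = (\<Sum>i\<in>R. C j i * (\<Sum>b\<in>B. y i b * x j' b * A (ka b) c c'))"
   using pq by (intro sum.cong refl) (subst sum_of_bool_left, auto)
  also have "... = (\<Sum>i\<in>R. \<Sum>b\<in>B. C j i * (y i b * x j' b * A (ka b) c c'))" by (simp add: sum_distrib_left)
  also have "... = (\<Sum>b\<in>B. \<Sum>i\<in>R. C j i * (y i b * x j' b * A (ka b) c c'))" by (rule sum.swap)
  also have "... = MM B ka (%j b. \<Sum>i\<in>R. C j i * y i b) x A p q" by (simp add: MM_def pq sum_distrib_right mult.assoc)
  finally show "MM B ka (%j b. \<Sum>i\<in>R. C j i * y i b) x A p q = (\<Sum>k\<in>?I. u p k * MM B ka y x A k q)" ..
 qed
 also have "... = D ?I (%p q. \<Sum>k\<in>?I. MM B ka y x A p k * u k q)" by (rule D_sylvester[OF fin fin])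
 also have "... = PD B ka R N y (%j b. \<Sum>i\<in>R. C i j * x i b) A" unfolding PD_def proof (rule D_cong)
  fix p q assume "p \<in> ?I" "q \<in> ?I"
  then obtain j c j' c' where pq: "p = (j, c)" "q = (j', c')" "c' < N" by auto
  have "(\<Sum>k\<in>?I. MM B ka y x A p k * u k q) = (\<Sum>i\<in>R. \<Sum>e<N. (C i j' * (\<Sum>b\<in>B. y j b * x i b * A (ka b) c e)) * of_bool (e = c'))"
   by (simp add: sum.cartesian_product pq u_def MM_def case_prod_unfold mult_ac)
  also have "... = (\<Sum>i\<in>R. C i j' * (\<Sum>b\<in>B. y j b * x i b * A (ka b) c c'))"
   using pq by (intro sum.cong refl) (subst sum_of_bool_right, auto)
  also have "... = (\<Sum>i\<in>R. \<Sum>b\<in>B. C i j' * (y j b * x i b * A (ka b) c c'))" by (simp add: sum_distrib_left)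
  also have "... = (\<Sum>b\<in>B. \<Sum>i\<in>R. C i j' * (y j b * x i b * A (ka b) c c'))" by (rule sum.swap)
  also have "... = MM B ka y (%j b. \<Sum>i\<in>R. C i j * x i b) A p q"
   by (simp add: MM_def pq sum_distrib_right sum_distrib_left mult_ac)
  finally show "(\<Sum>k\<in>?I. MM B ka y x A p k * u k q) = MM B ka y (%j b. \<Sum>i\<in>R. C i j * x i b) A p q" .
 qed
 finally show ?thesis .
qed

lemma PD_col:
 assumes C: "!!b b'. b \<in> B ==> b' \<in> B ==> C b b' ~= 0 ==> ka b = ka b'"
 shows "PD B ka R N (%j b. \<Sum>b'\<in>B. C b b' * y j b') x A = PD B ka R N y (%j b. \<Sum>b'\<in>B. C b' b * x j b') (A :: nat => nat => nat => 'r::comm_ring_1)"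
 unfolding PD_def proof (rule D_cong)
 fix p q :: "nat \<times> nat"
 obtain j c j' c' where pq: "p = (j, c)" "q = (j', c')" by (cases p; cases q)
 have "MM B ka (%j b. \<Sum>b'\<in>B. C b b' * y j b') x A p q = (\<Sum>b\<in>B. \<Sum>b'\<in>B. C b b' * y j b' * x j' b * A (ka b) c c')"
  by (simp add: MM_def pq sum_distrib_right)
 also have "... = (\<Sum>b\<in>B. \<Sum>b'\<in>B. C b b' * y j b' * x j' b * A (ka b') c c')" proof (intro sum.cong refl)
  fix b b' assume "b \<in> B" "b' \<in> B"
  thus "C b b' * y j b' * x j' b * A (ka b) c c' = C b b' * y j b' * x j' b * A (ka b') c c'"
   using C[of b b'] by (cases "C b b' = 0") auto
 qed
 also have "... = (\<Sum>b'\<in>B. \<Sum>b\<in>B. C b b' * y j b' * x j' b * A (ka b') c c')" by (rule sum.swap)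
 also have "... = MM B ka y (%j b. \<Sum>b'\<in>B. C b' b * x j b') A p q"
  by (simp add: MM_def pq sum_distrib_right sum_distrib_left mult_ac)
 finally show "MM B ka (%j b. \<Sum>b'\<in>B. C b b' * y j b') x A p q = MM B ka y (%j b. \<Sum>b'\<in>B. C b' b * x j b') A p q" .
qed

type_synonym 'a xy_poly = "(xyvar, 'a gen_poly) mpoly"

definition gf :: "nat set => (nat => nat) => nat set => nat => 'a::field xy_poly" where
 "gf B ka R N = PD B ka R N (%j b. Var (True, j, b)) (%j b. Var (False, j, b)) (%k c c'. Const (Var (c, c', k)))"

lemma subst_gf: "subst ze (gf B ka R N) = PD B ka R N (%j b. ze (True, j, b)) (%j b. ze (False, j, b)) (%k c c'. Const (Var (c, c', k)))"
 unfolding gf_def by (subst PD_hom[OF subst_hom]) simp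

lemma wgrade_gf: "wgrade om (gf B ka R N) = PD B ka R N (%j b. monom (Var (True, j, b)) (om (True, j, b)))
   (%j b. monom (Var (False, j, b)) (om (False, j, b))) (%k c c'. [:Const (Var (c, c', k)):])"
 unfolding gf_def by (subst PD_hom[OF wgrade_hom]) simp

definition rowm :: "nat => bool => xyvar => nat" where
 "rowm j s = (%(s', j', b). of_bool (s' = s & j' = j))"

definition colm :: "nat => bool => xyvar => nat" where
 "colm b s = (%(s', j, b'). of_bool (s' = s & b' = b))"

lemma gf_keys: assumes "lookup (gf B ka R N :: 'a::field xy_poly) m ~= 0" shows "keys m <= UNIV \<times> R \<times> B"
proof -
 let ?om = "%v :: xyvar. of_bool (v \<notin> UNIV \<times> R \<times> B) :: nat"
 have "wgrade ?om (gf B ka R N) = wgrade (%v. 0) (gf B ka R N :: 'a xy_poly)" unfolding wgrade_gf by (rule PD_cong) auto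
 hence "wt ?om m = wt (%v. 0) m" using assms by (rule wgrade_eqD)
 hence "wt ?om m = 0" by (simp add: wt_def)
 thus ?thesis by (auto simp: wt_def in_keys_iff)
qed

lemma gf_row_homogeneous: assumes R: "finite R" and nz: "lookup (gf B ka R N :: 'a::field xy_poly) m ~= 0"
 shows "wt (rowm j True) m = wt (rowm j False) m"
proof -
 let ?C = "%i i'. if i = i' then (if i = j then [:0, 1:] else 1) else (0 :: 'a xy_poly poly)"
 have s: "(\<Sum>i\<in>R. ?C l i * f i) = (if l = j then [:0, 1:] else 1) * f l" "(\<Sum>i\<in>R. ?C i l * f i) = (if l = j then [:0, 1:] else 1) * f l"
  if "l \<in> R" for l and f :: "nat => 'a xy_poly poly"
  using R that by (simp_all add: if_distrib[of "%x. x * _"] sum.delta sum.delta' cong: if_cong)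
 have "wgrade (rowm j True) (gf B ka R N) = PD B ka R N (%l b. \<Sum>i\<in>R. ?C l i * [:Var (True, i, b):]) (%l b. [:Var (False, l, b):]) (%k c c'. [:Const (Var (c, c', k)) :: 'a xy_poly:])"
  unfolding wgrade_gf by (rule PD_cong) (simp_all only: s, simp_all add: rowm_def monom_Suc monom_0)
 also have "... = PD B ka R N (%l b. [:Var (True, l, b):]) (%l b. \<Sum>i\<in>R. ?C i l * [:Var (False, i, b):]) (%k c c'. [:Const (Var (c, c', k)):])"
  by (rule PD_row[OF R])
 also have "... = wgrade (rowm j False) (gf B ka R N)"
  unfolding wgrade_gf by (rule PD_cong) (simp_all only: s, simp_all add: rowm_def monom_Suc monom_0)
 finally show ?thesis using nz by (rule wgrade_eqD)
qed

lemma gf_col_homogeneous: assumes B: "finite B" and nz: "lookup (gf B ka R N :: 'a::field xy_poly) m ~= 0"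
 shows "wt (colm b True) m = wt (colm b False) m"
proof -
 let ?C = "%i i'. if i = i' then (if i = b then [:0, 1:] else 1) else (0 :: 'a xy_poly poly)"
 have s: "(\<Sum>i\<in>B. ?C l i * f i) = (if l = b then [:0, 1:] else 1) * f l" "(\<Sum>i\<in>B. ?C i l * f i) = (if l = b then [:0, 1:] else 1) * f l"
  if "l \<in> B" for l and f :: "nat => 'a xy_poly poly"
  using B that by (simp_all add: if_distrib[of "%x. x * _"] sum.delta sum.delta' cong: if_cong)
 have "wgrade (colm b True) (gf B ka R N) = PD B ka R N (%j l. \<Sum>i\<in>B. ?C l i * [:Var (True, j, i):]) (%j l. [:Var (False, j, l):]) (%k c c'. [:Const (Var (c, c', k)) :: 'a xy_poly:])"
  unfolding wgrade_gf by (rule PD_cong) (simp_all only: s, simp_all add: colm_def monom_Suc monom_0)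
 also have "... = PD B ka R N (%j l. [:Var (True, j, l):]) (%j l. \<Sum>i\<in>B. ?C i l * [:Var (False, j, i):]) (%k c c'. [:Const (Var (c, c', k)):])"
  by (rule PD_col) (auto split: if_splits)
 also have "... = wgrade (colm b False) (gf B ka R N)"
  unfolding wgrade_gf by (rule PD_cong) (simp_all only: s, simp_all add: colm_def monom_Suc monom_0)
 finally show ?thesis using nz by (rule wgrade_eqD)
qed

section \<open>Straightening\<close>

text \<open>With \<open>o = True\<close> lines are rows and positions are letters; with \<open>o = False\<close> it is the other way round.\<close>

definition ori :: "bool => xyvar => xyvar" where
 "ori o' v = (if o' then v else case v of (s, j, b) => (s, b, j))"

lemma ori_ori [simp]: "ori o' (ori o' v) = v" by (cases v) (simp add: ori_def)

lemma ori_eq_iff [simp]: "ori o' v = ori o' w <-> v = w" by (metis ori_ori)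

lemma ori_eq_iff': "ori o' v = w <-> v = ori o' w" by (metis ori_ori)

definition linem :: "bool => nat => bool => xyvar => nat" where
 "linem o' l s v = of_bool (fst (ori o' v) = s & fst (snd (ori o' v)) = l)"

lemma wt_ind: "wt (%v. of_bool (v = w)) m = lookup m w"
 unfolding wt_def by (cases "w \<in> keys m") (auto simp: of_bool_def in_keys_iff if_distrib[of "%x. x * _"] cong: if_cong)

lemma monoval_keys_rel: assumes add: "!!a b c e. Rel a b ==> Rel c e ==> Rel (a + c) (b + e)" and zero: "Rel 0 0"
  and base: "!!v k. v \<in> keys m' ==> k \<in> keys (ze v) ==> Rel (single v 1) k"
  and m: "m \<in> keys (monoval ze m' :: ('w, 'r::comm_ring_1) mpoly)"
 shows "Rel (m' :: 'v mon) m"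
proof -
 have pw: "Rel (single v n) k" if v: "v \<in> keys m'" and "k \<in> keys (ze v ^ n)" for v n k using that(2) proof (induction n arbitrary: k)
  case 0
  hence "k = 0" by (simp split: if_splits)
  thus ?case using zero by simp
 next
  case (Suc n)
  then obtain k1 k2 where "k = k1 + k2" "k1 \<in> keys (ze v)" "k2 \<in> keys (ze v ^ n)"
   using keys_mult[of "ze v" "ze v ^ n"] by auto
  hence "Rel (single v 1 + single v n) k" using add base[OF v] Suc.IH by metis
  thus ?case by (simp flip: single_add)
 qed
 have "Rel (\<Sum>v\<in>S. single v (lookup m' v)) k"
  if "finite S" "S <= keys m'" "k \<in> keys (\<Prod>v\<in>S. ze v ^ lookup m' v)" for S k using that
 proof (induction S arbitrary: k rule: finite_induct)
  case empty
  thus ?case using zero by (simp split: if_splits)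
 next
  case (insert v S)
  then obtain k1 k2 where "k = k1 + k2" "k1 \<in> keys (ze v ^ lookup m' v)" "k2 \<in> keys (\<Prod>v\<in>S. ze v ^ lookup m' v)"
   using keys_mult[of "ze v ^ lookup m' v" "\<Prod>v\<in>S. ze v ^ lookup m' v"] by auto
  thus ?case using insert add pw by simp
 qed
 from this[OF _ subset_refl] m show ?thesis unfolding monoval_def by (simp flip: poly_mapping_sum_single)
qed

definition lead :: "('v => nat) => ('v, 'r::comm_ring_1) mpoly => ('v mon) => bool" where
 "lead om p t <-> lookup p t = 1 & (\<forall>k\<in>keys p. k ~= t --> wt om k < wt om t)"

lemma lead_mult: fixes p q :: "('v, 'r::comm_ring_1) mpoly" assumes "lead om p t" "lead om q t'" shows "lead om (p * q) (t + t')"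
proof -
 have split: "\<exists>p0. p = single t 1 + p0 & (\<forall>k\<in>keys p0. wt om k < wt om t)" if "lead om p t" for p :: "('v, 'r) mpoly" and t
 proof (intro exI conjI ballI)
  let ?p0 = "p - single t 1"
  show "p = single t 1 + ?p0" by simp
  fix k assume "k \<in> keys ?p0"
  hence "lookup p k - (1 when t = k) ~= 0" by (simp add: in_keys_iff lookup_minus lookup_single)
  moreover have "k ~= t" using calculation that by (auto simp: lead_def)
  ultimately show "wt om k < wt om t" using that by (auto simp: lead_def in_keys_iff when_def)
 qed
 obtain p0 where p0: "p = single t 1 + p0" "!!k. k \<in> keys p0 ==> wt om k < wt om t" using split[OF assms(1)] by blast
 obtain q0 where q0: "q = single t' 1 + q0" "!!k. k \<in> keys q0 ==> wt om k < wt om t'" using split[OF assms(2)] by blast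
 define s where "s = single t 1 * q0 + p0 * single t' 1 + p0 * q0"
 have pq: "p * q = single (t + t') 1 + s" by (simp add: p0(1) q0(1) s_def algebra_simps mult_single)
 have ks: "wt om k < wt om (t + t')" if "k \<in> keys s" for k proof -
  have "k \<in> keys (single t (1::'r) * q0) Un keys (p0 * single t' 1) Un keys (p0 * q0)"
   using that Poly_Mapping.keys_add[of "single t 1 * q0 + p0 * single t' 1" "p0 * q0"]
    Poly_Mapping.keys_add[of "single t 1 * q0" "p0 * single t' 1"] unfolding s_def by blast
  then obtain a b where ab: "k = a + b" "(a = t & b \<in> keys q0) \<or> (a \<in> keys p0 & b = t') \<or> (a \<in> keys p0 & b \<in> keys q0)"
   using keys_mult[of "single t (1::'r)" q0] keys_mult[of p0 "single t' 1"] keys_mult[of p0 q0] by (auto split: if_splits)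
  thus ?thesis using p0(2)[of a] q0(2)[of b] by (auto simp: wt_add)
 qed
 have "lookup s (t + t') = 0" using ks[of "t + t'"] by (auto simp: in_keys_iff)
 thus ?thesis unfolding lead_def pq using ks by (auto simp: lookup_add lookup_single in_keys_iff when_def)
qed

lemma lead_monoval: fixes ze :: "'v => ('w, 'r::comm_ring_1) mpoly"
 assumes "!!v. v \<in> keys m ==> lead om (ze v) (single (tp v) 1)"
 shows "lead om (monoval ze m) (\<Sum>v\<in>keys m. single (tp v) (lookup m v))"
proof -
 have one: "lead om (1 :: ('w, 'r) mpoly) 0" by (simp add: lead_def lookup_one)
 have pw: "lead om (ze v ^ n) (single (tp v) n)" if "v \<in> keys m" for v n proof (induction n)
  case (Suc n)
  thus ?case using lead_mult[OF assms[OF that] Suc] by (simp flip: single_add)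
 qed (simp add: one)
 have "lead om (\<Prod>v\<in>S. ze v ^ lookup m v) (\<Sum>v\<in>S. single (tp v) (lookup m v))"
  if "finite S" "S <= keys m" for S using that
 proof (induction S rule: finite_induct)
  case (insert v S)
  thus ?case using lead_mult[OF pw] by simp
 qed (simp add: one)
 thus ?thesis unfolding monoval_def by simp
qed

lemma finite_monomials: assumes "finite S" shows "finite {m :: 'v mon. keys m <= S & mdeg m = r}"
proof -
 let ?M = "{m :: 'v mon. keys m <= S & mdeg m = r}"
 have "inj_on (%m. restrict (lookup m) S) ?M" proof (rule inj_onI)
  fix m m' assume m: "m \<in> ?M" "m' \<in> ?M" and e: "restrict (lookup m) S = restrict (lookup m') S"
  show "m = m'" proof (rule poly_mapping_eqI)
   fix v show "lookup m v = lookup m' v"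
   proof (cases "v \<in> S")
    case True
    thus ?thesis using fun_cong[OF e, of v] by simp
   next
    case False
    hence "v \<notin> keys m" "v \<notin> keys m'" using m by auto
    thus ?thesis by (simp add: in_keys_iff)
   qed
  qed
 qed
 moreover have "(%m. restrict (lookup m) S) ` ?M <= S \<rightarrow>\<^sub>E {..r}" proof (rule image_subsetI)
  fix m assume m: "m \<in> ?M"
  have "lookup m v <= r" for v proof (cases "v \<in> keys m")
   case True
   hence "lookup m v <= mdeg m" unfolding mdeg_def by (intro member_le_sum) auto
   thus ?thesis using m by simp
  qed (simp add: in_keys_iff)
  thus "restrict (lookup m) S \<in> S \<rightarrow>\<^sub>E {..r}" by auto
 qed
 moreover have "finite (S \<rightarrow>\<^sub>E {..r})" using assms by (intro finite_PiE) auto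
 ultimately show ?thesis using finite_imageD finite_subset by blast
qed

definition lsub :: "bool => bool => (nat => nat => bool) => nat set => xyvar => (xyvar, 'r::comm_ring_1) mpoly" where
 "lsub o' s r L v = (case ori o' v of (s', l, i) => if s' = s then \<Sum>l'\<in>{l' \<in> L. r l l'}. Var (ori o' (s, l', i)) else Var v)"

lemma lsub_gf:
 assumes fin: "finite B" "finite R" and col: "!!l l'. ~ o' ==> r l l' ==> ka l = ka l'" and L: "L = (if o' then R else B)"
 shows "subst (lsub o' s r L) (gf B ka R N) = (subst (lsub o' (~ s) (%l l'. r l' l) L) (gf B ka R N) :: 'a::field xy_poly)"
proof -
 have *: "subst (lsub o' True r L) (gf B ka R N) = (subst (lsub o' False (%l l'. r l' l) L) (gf B ka R N) :: 'a xy_poly)"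
  if col: "!!l l'. ~ o' ==> r l l' ==> ka l = ka l'" for r
 proof -
  have f: "(\<Sum>i\<in>{i \<in> L. Q i}. g i) = (\<Sum>i\<in>L. of_bool (Q i) * g i)" for Q and g :: "nat => 'a xy_poly"
   using fin L by (simp add: sum.inter_filter of_bool_def if_distrib[of "%x. x * _"] cong: if_cong)
  show ?thesis proof (cases o')
   case True
   thus ?thesis unfolding subst_gf lsub_def
    using PD_row[OF fin(2), of B ka N "%j i. of_bool (r j i)" "%j b. Var (True, j, b)" "%j b. Var (False, j, b)" "%k c c'. Const (Var (c, c', k)) :: 'a xy_poly"]
    by (simp add: ori_def f, simp add: L)
  next
   case False
   thus ?thesis unfolding subst_gf lsub_def
    using PD_col[of B "%b b'. of_bool (r b b')" ka R N "%j b. Var (True, j, b)" "%j b. Var (False, j, b)" "%k c c'. Const (Var (c, c', k)) :: 'a xy_poly"] col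
    by (simp add: ori_def f, simp add: L)
  qed
 qed
 show ?thesis proof (cases s)
  case False
  have "ka l = ka l'" if "~ o'" "r l' l" for l l' using col[OF that] by simp
  thus ?thesis using *[of "%l l'. r l' l"] False by simp
 qed (use *[of r] col in simp)
qed

lemma keys_lsub: "k \<in> keys (lsub o' s r L v :: (xyvar, 'r::comm_ring_1) mpoly) ==>
  \<exists>w. k = single w 1 & (case ori o' v of (s', l, i) => if s' = s then \<exists>l'\<in>L. r l l' & w = ori o' (s, l', i) else w = v)"
proof -
 obtain s' l i where v: "ori o' v = (s', l, i)" by (cases "ori o' v")
 assume k: "k \<in> keys (lsub o' s r L v :: (xyvar, 'r) mpoly)"
 show ?thesis proof (cases "s' = s")
  case True
  hence "k \<in> keys (\<Sum>l'\<in>{l' \<in> L. r l l'}. Var (ori o' (s, l', i)) :: (xyvar, 'r) mpoly)" using k by (simp add: lsub_def v)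
  hence "k \<in> (\<Union>l'\<in>{l' \<in> L. r l l'}. keys (Var (ori o' (s, l', i)) :: (xyvar, 'r) mpoly))"
   by (rule subsetD[OF Poly_Mapping.keys_sum])
  then obtain x where "x \<in> L" "r l x" "k = single (ori o' (s, x, i)) 1" by (auto simp: Var_def split: if_splits)
  thus ?thesis using True v by (intro exI[of _ "ori o' (s, x, i)"]) auto
 next
  case False
  thus ?thesis using k by (intro exI[of _ v]) (simp add: lsub_def v Var_def split: if_splits)
 qed
qed

lemma wt_plus: "wt (%v. f v + g v) m = wt f m + wt g m" by (simp add: wt_def distrib_right sum.distrib)

lemma wt_mono: "(!!v. f v <= g v) ==> wt f m <= wt g m" unfolding wt_def by (intro sum_mono mult_right_mono) auto

lemma wt_push: "wt \<alpha> (\<Sum>v\<in>keys m. single (tp v) (lookup m v)) = wt (%v. \<alpha> (tp v)) m"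
 by (simp add: wt_sum wt_def[of "%v. \<alpha> (tp v)"])

definition stp :: "bool => bool => (nat => nat => bool) => nat set => xyvar => xyvar => bool" where
 "stp o' s r L v w <-> (case ori o' v of (s', l, i) => if s' = s then \<exists>l'\<in>L. r l l' & w = ori o' (s, l', i) else w = v)"

context
 fixes d W :: nat
begin

definition LL :: "bool => nat set" where
 "LL o' = {..<(if o' then 1 else d) * W}"

lemma LL_simps: "LL True = {..<W}" "LL False = {..<d * W}" "finite (LL o')" by (simp_all add: LL_def)

definition VV :: "(xyvar) set" where
 "VV = UNIV \<times> {..<W} \<times> {..<d * W}"

lemma finite_VV: "finite VV" by (simp add: VV_def)

lemma ori_VV: "ori o' (s, l, i) \<in> VV <-> l \<in> LL o' & i \<in> LL (~ o')" by (auto simp: ori_def VV_def LL_def)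

definition GF :: "nat => 'a::field xy_poly" where
 "GF N = gf {..<d * W} (%b. b div W) {..<W} N"

definition EE :: "(xyvar mon) => nat => 'a::field gen_poly" where
 "EE m N = lookup (GF N) m"

definition ls :: "bool => bool => nat => (xyvar mon) => nat" where
 "ls o' s l m = wt (linem o' l s) m"

definition kap :: "bool => bool => (nat => nat => bool) => (xyvar mon) => (xyvar mon) => 'a::field gen_poly" where
 "kap o' s r m' m = lookup (monoval (lsub o' s r (LL o')) m') m"

definition admissible :: "(xyvar mon) => bool" where
 "admissible m <-> keys m <= VV & (\<forall>o' l. ls o' True l m = ls o' False l m)"

lemma EE_admissible: assumes "EE m N ~= (0 :: 'a::field gen_poly)" shows "admissible m"
proof -
 have nz: "lookup (gf {..<d * W} (%b. b div W) {..<W} N :: 'a xy_poly) m ~= 0" using assms by (simp add: EE_def GF_def)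
 have "rowm j s = linem True j s" "colm j s = linem False j s" for j s by (auto simp: rowm_def colm_def linem_def ori_def fun_eq_iff)
 hence "ls o' True l m = ls o' False l m" for o' l using gf_row_homogeneous[OF _ nz] gf_col_homogeneous[OF _ nz] by (cases o') (simp_all add: ls_def)
 thus ?thesis using gf_keys[OF nz] by (simp add: admissible_def VV_def)
qed

lemma kap_wt: assumes k: "kap o' s r m' m ~= (0 :: 'a::field gen_poly)"
 shows "(!!v w. stp o' s r (LL o') v w ==> \<alpha> w <= \<beta> v) ==> wt \<alpha> m <= wt \<beta> m'"
  and "(!!v w. stp o' s r (LL o') v w ==> \<beta> v <= \<alpha> w) ==> wt \<beta> m' <= wt \<alpha> m"
  and "(!!w. ~ stp o' s r (LL o') v w) ==> lookup m' v = 0"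
proof -
 have m: "m \<in> keys (monoval (lsub o' s r (LL o')) m' :: 'a xy_poly)" using k by (simp add: kap_def in_keys_iff)
 note * = keys_lsub[where 'r = "'a gen_poly", folded stp_def]
 show "wt \<alpha> m <= wt \<beta> m'" if "!!v w. stp o' s r (LL o') v w ==> \<alpha> w <= \<beta> v"
  by (rule monoval_keys_rel[where Rel = "%a b. wt \<alpha> b <= wt \<beta> a", OF _ _ _ m]) (use that * in "fastforce simp: wt_add")+
 show "wt \<beta> m' <= wt \<alpha> m" if "!!v w. stp o' s r (LL o') v w ==> \<beta> v <= \<alpha> w"
  by (rule monoval_keys_rel[where Rel = "%a b. wt \<beta> a <= wt \<alpha> b", OF _ _ _ m]) (use that * in "fastforce simp: wt_add")+
 show "lookup m' v = 0" if z: "!!w. ~ stp o' s r (LL o') v w" proof -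
  have "wt (%u. of_bool (u = v)) m' <= 0"
   by (rule monoval_keys_rel[where Rel = "%a b. wt (%u. of_bool (u = v)) a <= 0", OF _ _ _ m]) (use z * in "fastforce simp: wt_add")+
  thus ?thesis by (simp add: wt_ind)
 qed
qed

lemma kap_facts: assumes k: "kap o' s r m' m ~= (0 :: 'a::field gen_poly)"
 shows "mdeg m' = mdeg m" "fst w ~= s ==> lookup m' w = lookup m w"
  "ls (~ o') s' i m' = ls (~ o') s' i m" "s' ~= s ==> ls o' s' i m' = ls o' s' i m"
proof -
 have e: "wt \<alpha> m' = wt \<alpha> m" if "!!v w. stp o' s r (LL o') v w ==> \<alpha> w = \<alpha> v" for \<alpha>
  by (rule antisym; rule kap_wt[OF k]) (simp_all add: that)
 show "mdeg m' = mdeg m" unfolding mdeg_wt by (rule e) simp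
 show "lookup m' w = lookup m w" if "fst w ~= s"
  unfolding wt_ind[symmetric] by (rule e) (use that in "auto simp: stp_def ori_def split: prod.splits if_splits")
 show "ls (~ o') s' i m' = ls (~ o') s' i m"
  unfolding ls_def by (rule e) (auto simp: stp_def ori_def linem_def split: prod.splits if_splits)
 show "ls o' s' i m' = ls o' s' i m" if "s' ~= s"
  unfolding ls_def by (rule e) (use that in "auto simp: stp_def ori_def linem_def split: prod.splits if_splits")
qed

lemma kap_Const: "\<exists>c. kap o' s r m' m = Const (c :: 'a::field)"
proof -
 interpret c: comm_ring_hom "Const :: 'a => 'a gen_poly" by (rule Const_hom)
 have p: "intp UNIV (prod f S)" if "!!v. intp UNIV (f v)" for f :: "xyvar => 'a xy_poly" and S proof -
  have "intp UNIV (1 :: 'a xy_poly)" using intp_Const[of 1 UNIV] by (simp add: Const_simps)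
  thus ?thesis using that by (induction S rule: infinite_finite_induct) (simp_all add: intp_mult)
 qed
 have q: "intp UNIV (sum f S)" if "!!v. intp UNIV (f v)" for f :: "nat => 'a xy_poly" and S proof -
  have "intp UNIV (0 :: 'a xy_poly)" using intp_Const[of 0 UNIV] by (simp add: Const_simps)
  thus ?thesis using that by (induction S rule: infinite_finite_induct) (simp_all add: intp_add)
 qed
 have "intp UNIV (monoval (lsub o' s r (LL o')) m' :: 'a xy_poly)"
  unfolding monoval_def by (intro p intp_power) (auto simp: lsub_def intro!: q intp_Var split: prod.split)
 then obtain z where "kap o' s r m' m = (of_int z :: 'a gen_poly)" unfolding kap_def intp_def by (auto elim: Ints_cases)
 moreover have "(of_int z :: 'a gen_poly) = Const (of_int z)" by (rule c.hom_of_int[symmetric])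
 ultimately have "kap o' s r m' m = Const (of_int z :: 'a)" by (rule trans)
 thus ?thesis by (rule exI)
qed

definition Kf :: "nat => (xyvar mon) set" where
 "Kf r = {m. keys m <= VV & mdeg m = r}"

lemma finite_Kf [simp]: "finite (Kf r)" unfolding Kf_def by (rule finite_monomials[OF finite_VV])

lemma kap_relation: assumes col: "!!l l'. r l l' ==> l div W = l' div W"
 shows "(\<Sum>m'\<in>Kf (mdeg m). kap o' s r m' m * EE m' N) = (\<Sum>m'\<in>Kf (mdeg m). kap o' (~ s) (%l l'. r l' l) m' m * (EE m' N :: 'a::field gen_poly))"
proof -
 have *: "lookup (subst (lsub o' s r (LL o')) (GF N :: 'a xy_poly)) m = (\<Sum>m'\<in>Kf (mdeg m). kap o' s r m' m * (EE m' N :: 'a gen_poly))" for s r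
 proof -
  have "lookup (subst (lsub o' s r (LL o')) (GF N :: 'a xy_poly)) m = (\<Sum>m'\<in>keys (GF N :: 'a xy_poly). kap o' s r m' m * EE m' N)"
   by (simp add: lookup_subst kap_def EE_def mult.commute)
  also have "... = (\<Sum>m'\<in>keys (GF N :: 'a xy_poly) Un Kf (mdeg m). kap o' s r m' m * EE m' N)"
   by (rule sum.mono_neutral_left) (auto simp: EE_def in_keys_iff)
  also have "... = (\<Sum>m'\<in>Kf (mdeg m). kap o' s r m' m * EE m' N)" proof (rule sum.mono_neutral_right)
   show "\<forall>m'\<in>keys (GF N :: 'a xy_poly) Un Kf (mdeg m) - Kf (mdeg m). kap o' s r m' m * EE m' N = (0 :: 'a gen_poly)" proof
    fix m' assume m': "m' \<in> keys (GF N :: 'a xy_poly) Un Kf (mdeg m) - Kf (mdeg m)"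
    show "kap o' s r m' m * EE m' N = (0 :: 'a gen_poly)" proof (rule ccontr)
     assume "kap o' s r m' m * EE m' N ~= (0 :: 'a gen_poly)"
     hence "kap o' s r m' m ~= (0 :: 'a gen_poly)" "EE m' N ~= (0 :: 'a gen_poly)" by auto
     hence "m' \<in> Kf (mdeg m)" using EE_admissible kap_facts(1) unfolding Kf_def admissible_def by blast
     thus False using m' by simp
    qed
   qed
  qed auto
  finally show ?thesis .
 qed
 have "subst (lsub o' s r (LL o')) (GF N) = (subst (lsub o' (~ s) (%l l'. r l' l) (LL o')) (GF N) :: 'a xy_poly)"
  unfolding GF_def by (rule lsub_gf) (auto simp: LL_def col)
 thus ?thesis by (metis *)
qed

definition SP :: "'a::field large_sigmaX set => (xyvar mon) set => (nat => 'a gen_poly) => bool" where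
 "SP S X F <-> (\<exists>c G. UI S G & (\<forall>N. F N = (\<Sum>m\<in>X. Const (c m) * EE m N) + G N))"

lemma SP_UI: "UI S F ==> SP S X (F :: nat => 'a::field gen_poly)"
 unfolding SP_def by (intro exI[of _ "%_. 0"] exI[of _ F]) (simp add: Const_simps)

lemma SP_base: "finite X ==> m \<in> X ==> SP S X (EE m :: nat => 'a::field gen_poly)" unfolding SP_def
 by (intro exI[of _ "%m'. of_bool (m' = m)"] exI[of _ "%_. 0"])
   (simp add: UI_0 of_bool_def if_distrib[of Const] if_distrib[of "%x. x * _"] Const_simps cong: if_cong)

lemma SP_add: "SP S X F ==> SP S X G ==> SP S X (%N. F N + G N :: 'a::field gen_poly)"
proof -
 assume "SP S X F" "SP S X G"
 then obtain c1 G1 c2 G2 where "UI S G1" "\<forall>N. F N = (\<Sum>m\<in>X. Const (c1 m) * EE m N) + G1 N"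
  "UI S G2" "\<forall>N. G N = (\<Sum>m\<in>X. Const (c2 m) * EE m N) + G2 N" unfolding SP_def by blast
 thus ?thesis unfolding SP_def
  by (intro exI[of _ "%m. c1 m + c2 m"] exI[of _ "%N. G1 N + G2 N"]) (simp add: UI_add Const_simps distrib_right sum.distrib)
qed

lemma SP_cmult: "SP S X F ==> SP S X (%N. Const c * F N :: 'a::field gen_poly)"
proof -
 assume "SP S X F"
 then obtain c1 G1 where "UI S G1" "\<forall>N. F N = (\<Sum>m\<in>X. Const (c1 m) * EE m N) + G1 N" unfolding SP_def by blast
 thus ?thesis unfolding SP_def by (intro exI[of _ "%m. c * c1 m"] exI[of _ "%N. Const c * G1 N"])
    (simp add: UI_mult[OF UU_Const] Const_simps distrib_left sum_distrib_left mult.assoc)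
qed

lemma SP_0: "SP S X (%N. 0 :: 'a::field gen_poly)" by (rule SP_UI[OF UI_0])

lemma SP_sum: "(!!a. a \<in> A ==> SP S X (F a)) ==> SP S X (%N. \<Sum>a\<in>A. F a N :: 'a::field gen_poly)"
 by (induction A rule: infinite_finite_induct) (auto intro: SP_add SP_0)

lemma SP_relation: assumes col: "!!l l'. r l l' ==> l div W = l' div W"
  and m: "m \<in> Kf (mdeg m3)" "kap o' s r m m3 = (1 :: 'a::field gen_poly)"
  and l: "!!m'. m' \<in> Kf (mdeg m3) ==> m' ~= m ==> kap o' s r m' m3 ~= (0 :: 'a gen_poly) ==> SP S X (EE m' :: nat => 'a gen_poly)"
  and r: "!!m'. m' \<in> Kf (mdeg m3) ==> kap o' (~ s) (%l l'. r l' l) m' m3 ~= (0 :: 'a gen_poly) ==> SP S X (EE m' :: nat => 'a gen_poly)"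
 shows "SP S X (EE m :: nat => 'a gen_poly)"
proof -
 let ?K = "Kf (mdeg m3)"
 have e: "EE m N = (\<Sum>m'\<in>?K. kap o' (~ s) (%l l'. r l' l) m' m3 * EE m' N) + Const (-1) * (\<Sum>m'\<in>?K - {m}. kap o' s r m' m3 * (EE m' N :: 'a gen_poly))" for N
  using kap_relation[OF col, where m = m3 and o' = o' and s = s and N = N and 'a = 'a] sum.remove[OF finite_Kf m(1), of "%m'. kap o' s r m' m3 * (EE m' N :: 'a gen_poly)"] m(2)
  by (simp add: Const_simps)
 have t: "SP S X (%N. kap o' s r m' m3 * EE m' N :: 'a gen_poly)" if "kap o' s r m' m3 ~= (0 :: 'a gen_poly) ==> SP S X (EE m' :: nat => 'a gen_poly)" for s r m'
 proof (cases "kap o' s r m' m3 = (0 :: 'a gen_poly)")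
  case True
  thus ?thesis by (simp add: SP_0)
 next
  case False
  obtain c where c: "kap o' s r m' m3 = Const (c :: 'a)" using kap_Const by blast
  show ?thesis unfolding c by (rule SP_cmult[OF that[OF False]])
 qed
 have "SP S X (%N. (\<Sum>m'\<in>?K. kap o' (~ s) (%l l'. r l' l) m' m3 * EE m' N) + Const (-1) * (\<Sum>m'\<in>?K - {m}. kap o' s r m' m3 * (EE m' N :: 'a gen_poly)))"
  by (intro SP_add SP_cmult SP_sum t l r) auto
 thus ?thesis by (simp flip: e)
qed

definition LR :: "bool => bool => (xyvar mon) => bool" where
 "LR o' s m <-> (\<forall>l i. Suc l div W = l div W -->
   (\<Sum>i'\<le>i. lookup m (ori o' (s, Suc l, i'))) <= (\<Sum>i'<i. lookup m (ori o' (s, l, i'))))"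

definition outm :: "(xyvar mon) => nat" where
 "outm m = (\<Sum>o'\<in>UNIV. \<Sum>l\<in>LL o'. 3 ^ ls o' True l m)"

definition dism :: "(xyvar mon) => nat" where
 "dism m = (\<Sum>o'\<in>UNIV. \<Sum>l\<in>LL o'. l * ls o' True l m)"

definition potm :: "(xyvar mon) => nat" where
 "potm m = wt (%(s, l, i). l * i) m"

lemma ls_le: "ls o' s l m <= mdeg m" unfolding ls_def mdeg_wt by (rule wt_mono) (simp add: linem_def)

lemma outm_le: "outm m <= (\<Sum>o'\<in>UNIV. \<Sum>l\<in>LL o'. 3 ^ mdeg m)" unfolding outm_def by (intro sum_mono power_increasing ls_le) auto

lemma potm_le: assumes "keys m <= VV" shows "potm m <= W * (d * W) * mdeg m"
proof -
 have "potm m <= (\<Sum>v\<in>keys m. W * (d * W) * lookup m v)" unfolding potm_def wt_def using assms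
  by (intro sum_mono mult_right_mono) (auto simp: VV_def intro!: mult_mono)
 thus ?thesis by (simp add: mdeg_def sum_distrib_left)
qed

lemma ls_sum: assumes "keys m <= VV" shows "ls o' s l m = (\<Sum>i\<in>LL (~ o'). lookup m (ori o' (s, l, i)))"
proof -
 have "ls o' s l m = (\<Sum>v\<in>VV. linem o' l s v * lookup m v)" unfolding ls_def by (rule wt_superset[OF finite_VV assms])
 also have "... = (\<Sum>v\<in>(%i. ori o' (s, l, i)) ` LL (~ o'). linem o' l s v * lookup m v)" proof (rule sum.mono_neutral_cong)
  fix v assume v: "v \<in> VV - (%i. ori o' (s, l, i)) ` LL (~ o')"
  obtain s' l' i where o: "v = ori o' (s', l', i)" by (metis ori_ori prod_cases3)
  have "linem o' l s v = 0" using v by (auto simp: linem_def o ori_VV)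
  thus "linem o' l s v * lookup m v = 0" by simp
 next
  fix v assume v: "v \<in> (%i. ori o' (s, l, i)) ` LL (~ o') - VV"
  hence "v \<notin> keys m" using assms by auto
  thus "linem o' l s v * lookup m v = 0" by (simp add: in_keys_iff)
 qed (auto simp: finite_VV LL_simps)
 also have "... = (\<Sum>i\<in>LL (~ o'). lookup m (ori o' (s, l, i)))" by (subst sum.reindex) (auto simp: inj_on_def linem_def)
 finally show ?thesis .
qed

lemma ls_total: assumes "admissible m" shows "2 * (\<Sum>l\<in>LL o'. ls o' True l m) = mdeg m"
proof -
 have k: "keys m <= VV" using assms by (simp add: admissible_def)
 have "mdeg m = (\<Sum>s\<in>UNIV. \<Sum>l\<in>LL o'. ls o' s l m)" proof -
  have "(\<Sum>s\<in>UNIV. \<Sum>l\<in>LL o'. ls o' s l m) = (\<Sum>v\<in>keys m. (\<Sum>s\<in>UNIV. \<Sum>l\<in>LL o'. linem o' l s v * lookup m v))"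
   unfolding ls_def wt_def by (subst sum.swap, subst sum.swap, simp add: sum.swap[of _ "keys m"])
  also have "... = (\<Sum>v\<in>keys m. lookup m v)" proof (rule sum.cong[OF refl])
   fix v assume "v \<in> keys m"
   hence "v \<in> VV" using k by auto
   moreover obtain s' l' i where o: "v = ori o' (s', l', i)" by (metis ori_ori prod_cases3)
   ultimately have l': "l' \<in> LL o'" by (simp add: ori_VV)
   have "(\<Sum>s\<in>UNIV. \<Sum>l\<in>LL o'. linem o' l s v * lookup m v) = (\<Sum>s\<in>UNIV. if s = s' then \<Sum>l\<in>LL o'. if l = l' then lookup m v else 0 else 0)"
    by (intro sum.cong refl) (auto simp: linem_def o intro!: sum.cong)
   also have "... = lookup m v" using l' LL_simps(3) by (simp add: sum.delta)
   finally show "(\<Sum>s\<in>UNIV. \<Sum>l\<in>LL o'. linem o' l s v * lookup m v) = lookup m v" .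
  qed
  finally show ?thesis by (simp add: mdeg_def)
 qed
 thus ?thesis using assms by (simp add: UNIV_bool admissible_def)
qed

lemma last_line_empty: fixes f :: "nat => nat"
 assumes "!!i. Suc i < W ==> f (q + Suc i) <= f (q + i)" "(\<Sum>i<W. f (q + i)) < W" shows "f (q + (W - 1)) = 0"
proof (rule ccontr)
 assume nz: "f (q + (W - 1)) ~= 0"
 have mono: "f (q + (W - 1)) <= f (q + (W - 1 - k))" if "k < W" for k using that proof (induction k)
  case (Suc k)
  have "Suc (W - 1 - Suc k) = W - 1 - k" using Suc.prems by simp
  hence "f (q + (W - 1 - k)) <= f (q + (W - 1 - Suc k))" using assms(1)[of "W - 1 - Suc k"] Suc.prems by simp
  thus ?case using Suc by simp
 qed simp
 have "1 <= f (q + i)" if "i < W" for i proof -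
  have "W - 1 - i < W" "W - 1 - (W - 1 - i) = i" using that by auto
  thus ?thesis using mono[of "W - 1 - i"] nz by simp
 qed
 hence "(\<Sum>i<W. 1) <= (\<Sum>i<W. f (q + i))" by (intro sum_mono) auto
 thus False using assms(2) by simp
qed

end

abbreviation push :: "('v => 'w) => ('v mon) => ('w mon)" where
 "push tp m \<equiv> \<Sum>v\<in>keys m. single (tp v) (lookup m v)"

lemma lookup_push: "lookup (push tp m) w = wt (%v. of_bool (tp v = w)) m"
 using wt_push[of "%v. of_bool (v = w)" tp m] by (simp only: wt_ind)

lemma lead_Var: "lead om (Var w) (single w 1)" by (auto simp: lead_def Var_def)

lemma lead_Var2: assumes "om w' < om w" shows "lead om (Var w + Var w') (single w 1)"
proof -
 have "single w' (1::nat) ~= single w 1" using assms by (metis less_irrefl wt_single nat_mult_1_right)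
 thus ?thesis using assms by (auto simp: lead_def Var_def lookup_add lookup_single in_keys_iff when_def split: if_splits)
qed

lemma kap_push: assumes "!!v. v \<in> keys m ==> lead om (lsub o' s r (LL d W o') v :: 'a::field xy_poly) (single (tp v) 1)"
 shows "kap d W o' s r m (push tp m) = (1 :: 'a gen_poly)"
 using lead_monoval[of m om "lsub o' s r (LL d W o') :: _ => 'a xy_poly" tp] assms by (simp add: kap_def lead_def)

lemma sum_bool: "(\<Sum>o'\<in>UNIV. F o') = F q + (F (~ q) :: nat)" by (cases q) (simp_all add: UNIV_bool add.commute)

lemma sum_swap2: fixes F :: "nat => nat => nat"
 assumes "finite A" "l \<in> A" "Suc l \<in> A" "!!x. x ~= l ==> x ~= Suc l ==> g x = f x"
 shows "(\<Sum>x\<in>A. F x (g x)) = F l (g l) + F (Suc l) (g (Suc l)) + (\<Sum>x\<in>A - {l, Suc l}. F x (f x))"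
proof -
 have "(\<Sum>x\<in>A. F x (g x)) = F l (g l) + (F (Suc l) (g (Suc l)) + (\<Sum>x\<in>A - {l} - {Suc l}. F x (g x)))"
  using assms by (simp add: sum.remove[of A l] sum.remove[of "A - {l}" "Suc l"])
 also have "A - {l} - {Suc l} = A - {l, Suc l}" by auto
 also have "(\<Sum>x\<in>A - {l, Suc l}. F x (g x)) = (\<Sum>x\<in>A - {l, Suc l}. F x (f x))" by (rule sum.cong) (use assms in auto)
 finally show ?thesis by simp
qed

lemma SP_admissible: assumes "admissible d W m ==> SP d W S X (EE d W m :: nat => 'a::field gen_poly)"
 shows "SP d W S X (EE d W m :: nat => 'a gen_poly)"
proof (cases "admissible d W m")
 case False
 hence "EE d W m N = (0 :: 'a gen_poly)" for N using EE_admissible by blast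
 hence "EE d W m = (%N. 0 :: 'a gen_poly)" by (rule ext)
 thus ?thesis by (simp add: SP_0)
qed (rule assms)

lemma swap_step:
 assumes adm: "admissible d W m" and l: "Suc l \<in> LL d W o'" "Suc l div W = l div W" and lt: "ls o' True l m < ls o' True (Suc l) m"
  and IH: "!!m'. admissible d W m' ==> mdeg m' = mdeg m ==> outm d W m' = outm d W m ==> dism d W m' < dism d W m ==> SP d W S X (EE d W m' :: nat => 'a::field gen_poly)"
 shows "SP d W S X (EE d W m :: nat => 'a gen_poly)"
proof -
 define tr where "tr = (%x. if x = l then Suc l else if x = Suc l then l else x)"
 have trtr: "tr (tr x) = x" for x by (simp add: tr_def)
 have l0: "l \<in> LL d W o'" using l(1) by (simp add: LL_def)
 have trL: "x \<in> LL d W o' ==> tr x \<in> LL d W o'" for x using l(1) l0 by (simp add: tr_def)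
 define r where "r = (%x y. y = tr x)"
 define tp where "tp = (%v. case ori o' v of (s', x, i) => if s' then ori o' (True, tr x, i) else v)"
 let ?m3 = "push tp m"
 have k: "keys m <= VV d W" using adm by (simp add: admissible_def)
 have kap1: "kap d W o' True r m ?m3 = (1 :: 'a gen_poly)" proof (rule kap_push[where om = "%_. 0"])
  fix v assume "v \<in> keys m"
  hence v: "v \<in> VV d W" using k by auto
  obtain s x i where o: "v = ori o' (s, x, i)" by (metis ori_ori prod_cases3)
  have x: "tr x \<in> LL d W o'" using v trL by (simp add: o ori_VV)
  hence "{y \<in> LL d W o'. r x y} = {tr x}" by (auto simp: r_def)
  hence "lsub o' True r (LL d W o') v = (Var (tp v) :: 'a xy_poly)" by (cases s) (simp_all add: lsub_def tp_def o)
  thus "lead (%_. 0) (lsub o' True r (LL d W o') v :: 'a xy_poly) (single (tp v) 1)" by (simp only: lead_Var)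
 qed
 hence kap0: "kap d W o' True r m ?m3 ~= (0 :: 'a gen_poly)" by simp
 have deg: "mdeg ?m3 = mdeg m" using kap_facts(1)[OF kap0] by simp
 show ?thesis proof (rule SP_relation[where o' = o' and s = True and r = r and ?m3.0 = ?m3])
  show "r x y ==> x div W = y div W" for x y using l(2) by (auto simp: r_def tr_def split: if_splits)
  show "m \<in> Kf d W (mdeg ?m3)" using k deg by (simp add: Kf_def)
  fix m' assume "m' ~= m" and k': "kap d W o' True r m' ?m3 ~= (0 :: 'a gen_poly)"
  have "lookup m' v = lookup m v" for v proof -
   obtain s x i where o: "v = ori o' (s, x, i)" by (metis ori_ori prod_cases3)
   define w where "w = tp v"
   have wi: "tp u = w <-> u = v" for u proof -
    obtain s' x' i' where u: "u = ori o' (s', x', i')" by (metis ori_ori prod_cases3)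
    show ?thesis using trtr by (cases s; cases s') (auto simp: w_def tp_def o u, metis+)
   qed
   have st: "of_bool (w' = w) = (of_bool (u = v) :: nat)" if "stp o' True r (LL d W o') u w'" for u w' proof -
    obtain s' x' i' where u: "u = ori o' (s', x', i')" by (metis ori_ori prod_cases3)
    have "w' = tp u" using that by (cases s') (auto simp: stp_def u r_def tp_def)
    thus ?thesis using wi by simp
   qed
   have "wt (%u. of_bool (u = v)) m' = wt (%u. of_bool (u = w)) ?m3" by (rule antisym; rule kap_wt[OF k']) (simp_all add: st)
   thus ?thesis unfolding wt_ind lookup_push by (simp add: wi wt_ind)
  qed
  hence "m' = m" by (rule poly_mapping_eqI)
  thus "SP d W S X (EE d W m' :: nat => 'a gen_poly)" using `m' ~= m` by simp
 next
  fix m' assume k': "kap d W o' (~ True) (%x y. r y x) m' ?m3 ~= (0 :: 'a gen_poly)"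
  show "SP d W S X (EE d W m' :: nat => 'a gen_poly)" proof (rule SP_admissible, rule IH)
   show "mdeg m' = mdeg m" using kap_facts(1)[OF k'] deg by simp
   have li: "ls o' True x m' = ls o' True (tr x) m" for x proof -
    have "ls o' True x m' = ls o' True x ?m3" using kap_facts(4)[OF k', of True] by simp
    also have "... = ls o' True (tr x) m" unfolding ls_def wt_push proof (rule arg_cong[where f = "%om. wt om m"], rule ext)
     fix v show "linem o' x True (tp v) = linem o' (tr x) True v" using trtr by (cases "ori o' v") (auto simp: linem_def tp_def)
    qed
    finally show ?thesis .
   qed
   have lp: "ls (~ o') True i m' = ls (~ o') True i m" for i proof -
    have "ls (~ o') True i m' = ls (~ o') True i ?m3" by (rule kap_facts(3)[OF k'])
    also have "... = ls (~ o') True i m" unfolding ls_def wt_push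
     by (rule arg_cong[where f = "%om. wt om m"], rule ext) (auto simp: linem_def tp_def ori_def split: prod.splits)
    finally show ?thesis .
   qed
   note sw = sum_swap2[OF LL_simps(3) l0 l(1)]
   have "(\<Sum>x\<in>LL d W o'. 3 ^ ls o' True x m') = (\<Sum>x\<in>LL d W o'. 3 ^ ls o' True x m :: nat)"
    unfolding li by (subst (1 2) sw[of _ "%x. ls o' True x m" "%_ y. 3 ^ y"]) (auto simp: tr_def)
   thus "outm d W m' = outm d W m" by (simp add: outm_def sum_bool[of _ o'] lp)
   have "(\<Sum>x\<in>LL d W o'. x * ls o' True x m') < (\<Sum>x\<in>LL d W o'. x * ls o' True x m)"
    unfolding li by (subst (1 2) sw[of _ "%x. ls o' True x m" "%x y. x * y"]) (use lt in "auto simp: tr_def")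
   thus "dism d W m' < dism d W m" by (simp add: dism_def sum_bool[of _ o'] lp)
  qed
 qed (rule kap1)
qed

lemma seg_wt: assumes "finite I"
 shows "(\<Sum>i\<in>I. lookup m (ori o' (s, l, i))) = wt (%v. case ori o' v of (s', l', i) => of_bool (s' = s & l' = l & i \<in> I)) m"
proof -
 have "(\<Sum>i\<in>I. lookup m (ori o' (s, l, i))) = (\<Sum>i\<in>I. wt (%v. of_bool (v = ori o' (s, l, i))) m)" by (simp add: wt_ind)
 also have "... = wt (%v. \<Sum>i\<in>I. of_bool (v = ori o' (s, l, i))) m" unfolding wt_def sum_distrib_right by (rule sum.swap)
 also have "(%v. \<Sum>i\<in>I. of_bool (v = ori o' (s, l, i)) :: nat) = (%v. case ori o' v of (s', l', i) => of_bool (s' = s & l' = l & i \<in> I))"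
 proof
  fix v :: "xyvar"
  obtain s' l' i' where v: "v = ori o' (s', l', i')" by (metis ori_ori prod_cases3)
  have "(\<Sum>i\<in>I. of_bool (v = ori o' (s, l, i)) :: nat) = (\<Sum>i\<in>I. if i' = i then of_bool (s' = s & l' = l) else 0)"
   by (rule sum.cong) (auto simp: v)
  thus "(\<Sum>i\<in>I. of_bool (v = ori o' (s, l, i)) :: nat) = (case ori o' v of (s', l', i) => of_bool (s' = s & l' = l & i \<in> I))"
   using assms by (simp add: v)
 qed
 finally show ?thesis .
qed

lemma moment_positive: fixes h :: "nat => int"
 assumes fin: "finite P" and h: "!!i. i < b ==> 0 <= h i" "!!i. b < i ==> h i <= 0" and s0: "(\<Sum>i\<in>P. h i) = 0"
  and nz: "\<exists>i\<in>P. h i ~= 0"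
 shows "(\<Sum>i\<in>P. int i * h i) < 0"
proof -
 have nn: "0 <= (int b - int i) * h i" for i using h[of i] by (cases "i < b"; cases "i = b") (auto simp: mult_nonpos_nonpos)
 have e: "(\<Sum>i\<in>P. (int b - int i) * h i) = - (\<Sum>i\<in>P. int i * h i)"
  using s0 by (simp add: left_diff_distrib sum_subtractf flip: sum_distrib_left)
 have "(\<Sum>i\<in>P. (int b - int i) * h i) ~= 0" proof
  assume "(\<Sum>i\<in>P. (int b - int i) * h i) = 0"
  hence z: "\<forall>i\<in>P. (int b - int i) * h i = 0" using sum_nonneg_eq_0_iff[OF fin, of "%i. (int b - int i) * h i"] nn by blast
  hence hz: "h i = 0" if "i \<in> P" "i ~= b" for i using that by auto
  hence "(\<Sum>i\<in>P. h i) = (\<Sum>i\<in>P. if i = b then h b else 0)" by (intro sum.cong) auto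
  hence "b \<in> P ==> h b = 0" using s0 fin by (simp add: sum.delta)
  thus False using hz nz by metis
 qed
 moreover have "0 <= (\<Sum>i\<in>P. (int b - int i) * h i)" by (intro sum_nonneg nn)
 ultimately show ?thesis using e by linarith
qed

lemma potm_less: assumes k: "keys m <= VV d W" "keys m' <= VV d W" and L: "Suc l \<in> LL d W o'"
  and other: "!!s' x i. s' ~= s \<or> (x ~= l & x ~= Suc l) ==> lookup m' (ori o' (s', x, i)) = lookup m (ori o' (s', x, i))"
  and col: "!!i. lookup m' (ori o' (s, l, i)) + lookup m' (ori o' (s, Suc l, i)) = lookup m (ori o' (s, l, i)) + lookup m (ori o' (s, Suc l, i))"
  and row: "ls o' s l m' = ls o' s l m" and up: "!!i. i < b ==> lookup m (ori o' (s, l, i)) <= lookup m' (ori o' (s, l, i))"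
  and down: "!!i. b < i ==> lookup m (ori o' (s, Suc l, i)) <= lookup m' (ori o' (s, Suc l, i))" and ne: "m' ~= m"
 shows "potm m < potm m'"
proof -
 let ?P = "LL d W (~ o')" and ?p = "%(s :: bool, l :: nat, i :: nat). l * i"
 define h where "h v = int (lookup m' v) - int (lookup m v)" for v
 define g where "g i = h (ori o' (s, l, i))" for i
 have pot: "int (potm m) = (\<Sum>v\<in>VV d W. int (?p v) * int (lookup m v))" if "keys m <= VV d W" for m
  unfolding potm_def by (subst wt_superset[OF finite_VV that]) (simp add: case_prod_unfold)
 have h0: "h (ori o' (s', x, i)) = 0" if "s' ~= s \<or> (x ~= l & x ~= Suc l)" for s' x i using other[OF that] by (simp add: h_def)
 have h1: "h (ori o' (s, Suc l, i)) = - g i" for i using col[of i] by (simp add: h_def g_def)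
 have l0: "l \<in> LL d W o'" using L by (simp add: LL_def)
 have fP: "finite ?P" by (rule LL_simps)
 have pp: "?p (ori o' (s, x, i)) = x * i" for x i by (simp add: ori_def)
 let ?A = "%x. (%i. ori o' (s, x, i)) ` ?P"
 have "int (potm m') - int (potm m) = (\<Sum>v\<in>VV d W. int (?p v) * h v)"
  unfolding pot[OF k(1)] pot[OF k(2)] h_def by (simp add: sum_subtractf right_diff_distrib)
 also have "... = (\<Sum>v\<in>?A l Un ?A (Suc l). int (?p v) * h v)" proof (rule sum.mono_neutral_right[OF finite_VV])
  show "?A l Un ?A (Suc l) <= VV d W" using L l0 by (auto simp: ori_VV)
  show "\<forall>v\<in>VV d W - (?A l Un ?A (Suc l)). int (?p v) * h v = 0" proof
   fix v assume v: "v \<in> VV d W - (?A l Un ?A (Suc l))"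
   obtain s' x i where o: "v = ori o' (s', x, i)" by (metis ori_ori prod_cases3)
   have "i \<in> ?P" using v by (simp add: o ori_VV)
   hence "s' ~= s \<or> (x ~= l & x ~= Suc l)" using v by (auto simp: o)
   thus "int (?p v) * h v = 0" using h0 by (simp add: o)
  qed
 qed
 also have "... = (\<Sum>v\<in>?A l. int (?p v) * h v) + (\<Sum>v\<in>?A (Suc l). int (?p v) * h v)" by (rule sum.union_disjoint) (use fP in auto)
 also have "(\<Sum>v\<in>?A l. int (?p v) * h v) = (\<Sum>i\<in>?P. int (l * i) * g i)" by (subst sum.reindex) (simp_all add: inj_on_def g_def pp)
 also have "(\<Sum>v\<in>?A (Suc l). int (?p v) * h v) = (\<Sum>i\<in>?P. int (Suc l * i) * - g i)"
  by (subst sum.reindex) (simp_all only: inj_on_def o_def h1 pp, auto)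
 also have "(\<Sum>i\<in>?P. int (l * i) * g i) + (\<Sum>i\<in>?P. int (Suc l * i) * - g i) = - (\<Sum>i\<in>?P. int i * g i)"
  unfolding sum.distrib[symmetric] sum_negf[symmetric] by (rule sum.cong) (simp_all add: algebra_simps)
 finally have e: "int (potm m') - int (potm m) = - (\<Sum>i\<in>?P. int i * g i)" .
 have "(\<Sum>i\<in>?P. int i * g i) < 0" proof (rule moment_positive[OF fP])
  show "0 <= g i" if "i < b" for i using up[OF that] by (simp add: g_def h_def)
  show "g i <= 0" if "b < i" for i using down[OF that] h1[of i] by (simp add: h_def)
  show "(\<Sum>i\<in>?P. g i) = 0" proof -
   have "int (ls o' s l m') = int (ls o' s l m)" by (simp add: row)
   thus ?thesis unfolding ls_sum[OF k(1)] ls_sum[OF k(2)] by (simp add: g_def h_def sum_subtractf)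
  qed
  show "\<exists>i\<in>?P. g i ~= 0" proof (rule ccontr)
   assume "~ ?thesis"
   hence gz: "g i = 0" if "i \<in> ?P" for i using that by blast
   have "h v = 0" for v proof -
    obtain s' x i where o: "v = ori o' (s', x, i)" by (metis ori_ori prod_cases3)
    show ?thesis proof (cases "v \<in> VV d W")
     case True
     hence "g i = 0" using gz by (simp add: o ori_VV)
     thus ?thesis using h0[of s' x i] h1[of i] by (cases "s' = s & (x = l \<or> x = Suc l)") (auto simp: o g_def)
    next
     case False
     hence "v \<notin> keys m" "v \<notin> keys m'" using k by auto
     thus ?thesis by (simp add: h_def in_keys_iff)
    qed
   qed
   hence "m' = m" by (intro poly_mapping_eqI) (simp add: h_def)
   thus False using ne by simp
  qed
 qed
 thus ?thesis using e by linarith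
qed

text \<open>The classical exchange argument: the elements of line \<open>l\<close> in positions below \<open>b\<close> are moved to the empty line \<open>f\<close>, and those
  of line \<open>l + 1\<close> in positions up to \<open>b\<close> to line \<open>l\<close>.\<close>

lemma viol_step: assumes adm: "admissible d W m" and L: "Suc l \<in> LL d W o'" "f \<in> LL d W o'" "f ~= l" "f ~= Suc l"
  and cls: "Suc l div W = l div W" "f div W = l div W" and f0: "ls o' True f m = 0" and le: "ls o' True (Suc l) m <= ls o' True l m"
  and viol: "(\<Sum>i<b. lookup m (ori o' (s, l, i))) < (\<Sum>i\<le>b. lookup m (ori o' (s, Suc l, i)))"
  and IH1: "!!m'. admissible d W m' ==> mdeg m' = mdeg m ==> outm d W m < outm d W m' ==> SP d W S X (EE d W m' :: nat => 'a::field gen_poly)"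
  and IH2: "!!m'. admissible d W m' ==> mdeg m' = mdeg m ==> outm d W m' = outm d W m ==> dism d W m' = dism d W m ==> potm m < potm m' ==> SP d W S X (EE d W m' :: nat => 'a gen_poly)"
 shows "SP d W S X (EE d W m :: nat => 'a gen_poly)"
proof -
 let ?L = "LL d W o'"
 let ?p = "%x i. ori o' (s, x, i)"
 let ?E = "%m'. EE d W m' :: nat => 'a gen_poly"
 have l0: "l \<in> ?L" using L(1) by (simp add: LL_def)
 have k: "keys m <= VV d W" using adm by (simp add: admissible_def)
 have lsT: "ls q s x m = ls q True x m" for q x using adm by (cases s) (auto simp: admissible_def)
 have fz: "lookup m (?p f i) = 0" for i proof -
  have "lookup m (?p f i) <= ls o' s f m" unfolding wt_ind[symmetric] ls_def by (rule wt_mono) (simp add: linem_def)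
  thus ?thesis using f0 lsT by simp
 qed
 define r where "r = (%x y. if x = l then y = f \<or> y = l else if x = Suc l then y = l \<or> y = Suc l else if x = f then False else y = x)"
 define tp where "tp = (%v. case ori o' v of (s', x, i) => if s' = s & x = l & i < b then ?p f i
   else if s' = s & x = Suc l & i <= b then ?p l i else v)"
 define om :: "xyvar => nat" where "om = (%v. case ori o' v of (s', x, i) => if x = l then 1 else if x = f & i < b then 2 else if x = Suc l & i > b then 2 else 0)"
 let ?m3 = "push tp m"
 have kap1: "kap d W o' s r m ?m3 = (1 :: 'a gen_poly)" proof (rule kap_push[where om = om])
  fix v assume v: "v \<in> keys m"
  obtain s' x i where o: "v = ori o' (s', x, i)" by (metis ori_ori prod_cases3)
  have xL: "x \<in> ?L" using v k by (auto simp: o ori_VV)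
  have s1: "{y \<in> ?L. y = f \<or> y = l} = {f, l}" "{y \<in> ?L. y = l \<or> y = Suc l} = {l, Suc l}" using L l0 by auto
  consider "s' ~= s" | "s' = s" "x = l" | "s' = s" "x = Suc l" | "s' = s" "x ~= l" "x ~= Suc l" by blast
  thus "lead om (lsub o' s r ?L v :: 'a xy_poly) (single (tp v) 1)" proof cases
   case 1
   thus ?thesis using lead_Var[of om v] by (simp add: lsub_def tp_def o)
  next
   case 2
   have e: "lsub o' s r ?L v = (Var (?p f i) + Var (?p l i) :: 'a xy_poly)" using 2 L(3) by (simp add: lsub_def o r_def s1)
   show ?thesis proof (cases "i < b")
    case True
    thus ?thesis unfolding e using lead_Var2[of om "?p l i" "?p f i"] 2 L(3) by (simp add: tp_def o om_def)
   next
    case False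
    thus ?thesis unfolding e using lead_Var2[of om "?p f i" "?p l i"] 2 L(3,4) by (simp add: tp_def o om_def add.commute)
   qed
  next
   case 3
   have e: "lsub o' s r ?L v = (Var (?p l i) + Var (?p (Suc l) i) :: 'a xy_poly)" using 3 by (simp add: lsub_def o r_def s1)
   show ?thesis proof (cases "i <= b")
    case True
    thus ?thesis unfolding e using lead_Var2[of om "?p (Suc l) i" "?p l i"] 3 L(4) by (simp add: tp_def o om_def)
   next
    case False
    thus ?thesis unfolding e using lead_Var2[of om "?p l i" "?p (Suc l) i"] 3 L(4) by (simp add: tp_def o om_def add.commute)
   qed
  next
   case 4
   have "x ~= f" using v 4 fz by (auto simp: o in_keys_iff)
   hence "{y \<in> ?L. r x y} = {x}" using xL 4 by (auto simp: r_def)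
   thus ?thesis using 4 lead_Var[of om v] by (simp add: lsub_def tp_def o)
  qed
 qed
 hence kap0: "kap d W o' s r m ?m3 ~= (0 :: 'a gen_poly)" by simp
 have deg: "mdeg ?m3 = mdeg m" using kap_facts(1)[OF kap0] by simp
 show ?thesis proof (rule SP_relation[where o' = o' and s = s and r = r and ?m3.0 = ?m3])
  show "r x y ==> x div W = y div W" for x y using cls by (auto simp: r_def split: if_splits)
  show "m \<in> Kf d W (mdeg ?m3)" using k deg by (simp add: Kf_def)
  fix m' assume m': "m' \<in> Kf d W (mdeg ?m3)" "m' ~= m" and k': "kap d W o' s r m' ?m3 ~= (0 :: 'a gen_poly)"
  have kv: "keys m' <= VV d W" using m' by (simp add: Kf_def)
  have st: "(case ori o' u of (s', x, i) => case ori o' w of (s'', y, i') => s'' = s' & i' = i & (if s' = s then r x y else y = x))" if "stp o' s r ?L u w" for u w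
   using that by (auto simp: stp_def split: prod.splits if_splits)
  have stb: "of_bool (w = ?p y i) <= (of_bool (u = ?p x i) :: nat)"
   if "stp o' s r ?L u w" "!!x'. r x' y ==> x' = x" for u w x y i
   using st[OF that(1)] that(2) by (cases u; cases w) (auto simp: ori_def of_bool_def split: if_splits)
  show "SP d W S X (?E m')" proof (rule SP_admissible)
   assume adm': "admissible d W m'"
   have lsT': "ls q s x m' = ls q True x m'" "ls q (~ s) x m' = ls q True x m'" for q x using adm' by (cases s; auto simp: admissible_def)+
   have lsN: "ls q (~ s) x m = ls q True x m" for q x using adm by (cases s) (auto simp: admissible_def)
   have lp: "ls (~ o') True i m' = ls (~ o') True i m" for i using kap_facts(3)[OF k', of True i] kap_facts(3)[OF kap0, of True i] by simp
   have li: "ls o' True x m' = ls o' True x m" for x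
    using kap_facts(4)[OF k', of "~ s" x] kap_facts(4)[OF kap0, of "~ s" x] lsT'(2) lsN by simp
   have oth: "lookup m' (ori o' (s', x, i)) = lookup m (ori o' (s', x, i))"
    if h: "s' ~= s \<or> (x ~= l & x ~= Suc l)" for s' x i
   proof (cases "s' = s")
    case False
    have "fst (ori o' (s', x, i)) ~= s" using False by (simp add: ori_def)
    thus ?thesis using kap_facts(2)[OF k'] kap_facts(2)[OF kap0] by simp
   next
    case True
    show ?thesis proof (cases "x = f")
     case True
     have "lookup m' (?p f i) = 0" by (rule kap_wt(3)[OF k']) (use L in "auto simp: stp_def r_def")
     thus ?thesis using fz True `s' = s` by simp
    next
     case False
     let ?v = "?p x i"
     have q: "of_bool (w = ?v) = (of_bool (u = ?v) :: nat)" if "stp o' s r ?L u w" for u w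
      using st[OF that] h `s' = s` False by (auto simp: r_def ori_eq_iff' split: prod.splits if_splits)
     have "wt (%u. of_bool (u = ?v)) m'' = wt (%u. of_bool (u = ?v)) ?m3" if "kap d W o' s r m'' ?m3 ~= (0 :: 'a gen_poly)" for m''
      by (rule antisym; rule kap_wt[OF that]) (simp_all add: q)
     thus ?thesis using k' kap0 `s' = s` unfolding wt_ind by simp
    qed
   qed
   show ?thesis proof (rule IH2[OF adm'])
    show "mdeg m' = mdeg m" using kap_facts(1)[OF k'] deg by simp
    show "outm d W m' = outm d W m" by (simp add: outm_def sum_bool[of _ o'] lp li)
    show "dism d W m' = dism d W m" by (simp add: dism_def sum_bool[of _ o'] lp li)
    show "potm m < potm m'" proof (rule potm_less[OF k kv L(1), where s = s and b = b])
     show "lookup m' (?p l i) + lookup m' (?p (Suc l) i) =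
      lookup m (?p l i) + lookup m (?p (Suc l) i)" for i
     proof -
      let ?c = "%v. of_bool (v = ?p l i) + of_bool (v = ?p (Suc l) i) + of_bool (v = ?p f i) :: nat"
      have q: "?c w = ?c u" if "stp o' s r ?L u w" for u w using st[OF that] L(3,4) by (auto simp: r_def ori_eq_iff' split: prod.splits if_splits)
      have "wt ?c m'' = wt ?c ?m3" if "kap d W o' s r m'' ?m3 ~= (0 :: 'a gen_poly)" for m''
       by (rule antisym; rule kap_wt[OF that]) (simp_all only: q order_refl)
      hence "wt ?c m' = wt ?c m" using k' kap0 by simp
      thus ?thesis using oth[of s f i] L(3,4) fz unfolding wt_plus wt_ind by simp
     qed
     show "ls o' s l m' = ls o' s l m" using li lsT lsT' by simp
     show "lookup m (?p l i) <= lookup m' (?p l i)" if "i < b" for i proof -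
      have "lookup m (?p l i) <= lookup ?m3 (?p f i)"
       unfolding lookup_push wt_ind[of "?p l i" m, symmetric] by (rule wt_mono) (simp add: tp_def that)
      also have "... <= lookup m' (?p l i)" proof -
       have "wt (%u. of_bool (u = ?p f i)) ?m3 <= wt (%u. of_bool (u = ?p l i)) m'"
        by (rule kap_wt(1)[OF k']) (rule stb, auto simp: r_def L(3,4) split: if_splits)
       thus ?thesis unfolding wt_ind .
      qed
      finally show ?thesis .
     qed
     show "lookup m (?p (Suc l) i) <= lookup m' (?p (Suc l) i)" if "b < i" for i proof -
      have "lookup m (?p (Suc l) i) <= lookup ?m3 (?p (Suc l) i)"
       unfolding lookup_push wt_ind[of "?p (Suc l) i" m, symmetric] by (rule wt_mono) (use that in "simp add: tp_def")
      also have "... <= lookup m' (?p (Suc l) i)" proof -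
       have "wt (%u. of_bool (u = ?p (Suc l) i)) ?m3 <= wt (%u. of_bool (u = ?p (Suc l) i)) m'"
        by (rule kap_wt(1)[OF k']) (rule stb, auto simp: r_def L(3,4) split: if_splits)
       thus ?thesis unfolding wt_ind .
      qed
      finally show ?thesis .
     qed
    qed (use oth m'(2) in auto)
   qed
  qed
 next
  fix m' assume k': "kap d W o' (~ s) (%x y. r y x) m' ?m3 ~= (0 :: 'a gen_poly)"
  show "SP d W S X (?E m')" proof (rule SP_admissible, rule IH1)
   assume adm': "admissible d W m'"
   show "mdeg m' = mdeg m" using kap_facts(1)[OF k'] deg by simp
   have lp: "ls (~ o') True i m' = ls (~ o') True i m" for i using kap_facts(3)[OF k', of True i] kap_facts(3)[OF kap0, of True i] by simp
   have li: "ls o' True x m' = wt (%v. linem o' x s (tp v)) m" for x proof -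
    have "ls o' True x m' = ls o' s x m'" using adm' by (cases s) (auto simp: admissible_def)
    also have "... = ls o' s x ?m3" using kap_facts(4)[OF k', of s] by simp
    finally show ?thesis unfolding ls_def wt_push .
   qed
   have rest: "ls o' True x m' = ls o' True x m" if "x ~= l" "x ~= Suc l" "x ~= f" for x proof -
    have "linem o' x s (tp v) = linem o' x s v" for v using that by (cases "ori o' v") (auto simp: linem_def tp_def)
    thus ?thesis unfolding li using lsT[unfolded ls_def, of o' x] by (simp add: ls_def)
   qed
   have big: "ls o' True l m < ls o' True l m'" proof -
    let ?a = "%v. case ori o' v of (s', l', i) => (of_bool (s' = s & l' = l & i \<in> {..<b}) :: nat)"
    let ?c = "%v. case ori o' v of (s', l', i) => (of_bool (s' = s & l' = Suc l & i \<in> {..b}) :: nat)"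
    have "linem o' l s (tp v) + ?a v = linem o' l s v + ?c v" for v using L(3,4) by (cases "ori o' v") (auto simp: linem_def tp_def)
    hence "wt (%v. linem o' l s (tp v) + ?a v) m = wt (%v. linem o' l s v + ?c v) m" by (simp only:)
    hence "ls o' True l m' + wt ?a m = ls o' True l m + wt ?c m" unfolding li wt_plus using lsT[unfolded ls_def, of o' l] by (simp only: ls_def)
    moreover have "wt ?a m < wt ?c m" using viol unfolding seg_wt[OF finite_lessThan] seg_wt[OF finite_atMost] .
    ultimately show ?thesis by linarith
   qed
   have sp: "(\<Sum>x\<in>?L. g x) = g l + g (Suc l) + g f + (\<Sum>x\<in>?L - {l, Suc l, f}. g x)" for g :: "nat => nat" proof -
    have "(\<Sum>x\<in>?L. g x) = (\<Sum>x\<in>{l, Suc l, f}. g x) + (\<Sum>x\<in>?L - {l, Suc l, f}. g x)"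
     using L l0 LL_simps(3) by (subst add.commute, intro sum.subset_diff) auto
    thus ?thesis using L(3,4) by auto
   qed
   have "3 * (3::nat) ^ ls o' True l m <= 3 ^ ls o' True l m'"
    using power_increasing[of "Suc (ls o' True l m)" "ls o' True l m'" "3::nat"] big by simp
   moreover have "(3::nat) ^ ls o' True (Suc l) m <= 3 ^ ls o' True l m" using le by (intro power_increasing) auto
   moreover have "(1::nat) <= 3 ^ ls o' True l m" by simp
   moreover have "(0::nat) < 3 ^ ls o' True (Suc l) m'" by simp
   moreover have "(3::nat) ^ ls o' True f m = 1" by (simp add: f0)
   moreover have "(\<Sum>x\<in>?L - {l, Suc l, f}. 3 ^ ls o' True x m') = (\<Sum>x\<in>?L - {l, Suc l, f}. 3 ^ ls o' True x m :: nat)"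
    by (rule sum.cong) (simp_all add: rest)
   ultimately have "(\<Sum>x\<in>?L. 3 ^ ls o' True x m) < (\<Sum>x\<in>?L. 3 ^ ls o' True x m' :: nat)"
    unfolding sp[of "%x. 3 ^ ls o' True x m"] sp[of "%x. 3 ^ ls o' True x m'"] by linarith
   thus "outm d W m < outm d W m'" by (simp add: outm_def sum_bool[of _ o'] lp)
  qed
 qed (rule kap1)
qed

theorem straighten: assumes r: "r < W" and m: "mdeg m = 2 * r"
  and H: "!!m j. n < ls True True j m ==> UI S (EE d W m :: nat => 'a::field gen_poly)"
 shows "SP d W S {m \<in> Kf d W (2 * r). admissible d W m & (\<forall>o' s. LR W o' s m) & (\<forall>j. ls True True j m <= n)} (EE d W m :: nat => 'a gen_poly)"
  (is "SP d W S ?X _")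
 using m
proof (induction m rule: wf_induct_rule[OF wf_measures[of "[%m. (\<Sum>o'\<in>UNIV. \<Sum>l\<in>LL d W o'. 3 ^ (2 * r)) - outm d W m, %m. dism d W m, %m. W * (d * W) * (2 * r) - potm m]"]])
 case (1 m)
 have IHo: "SP d W S ?X (EE d W m' :: nat => 'a gen_poly)" if "mdeg m' = mdeg m" "outm d W m < outm d W m'" for m' proof (rule 1(1))
  show "mdeg m' = 2 * r" using that 1(2) by simp
  thus "(m', m) \<in> measures [%m. (\<Sum>o'\<in>UNIV. \<Sum>l\<in>LL d W o'. 3 ^ (2 * r)) - outm d W m, %m. dism d W m, %m. W * (d * W) * (2 * r) - potm m]"
   using that outm_le[of d W m'] by (auto simp: in_measures)
 qed
 have IHd: "SP d W S ?X (EE d W m' :: nat => 'a gen_poly)" if "mdeg m' = mdeg m" "outm d W m' = outm d W m" "dism d W m' < dism d W m" for m'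
  by (rule 1(1)) (use that 1(2) in "auto simp: in_measures")
 have IHp: "SP d W S ?X (EE d W m' :: nat => 'a gen_poly)"
  if "admissible d W m'" "mdeg m' = mdeg m" "outm d W m' = outm d W m" "dism d W m' = dism d W m" "potm m < potm m'" for m'
 proof (rule 1(1))
  show "mdeg m' = 2 * r" using that 1(2) by simp
  hence "potm m' <= W * (d * W) * (2 * r)" using potm_le[of m' d W] that(1) by (simp add: admissible_def)
  thus "(m', m) \<in> measures [%m. (\<Sum>o'\<in>UNIV. \<Sum>l\<in>LL d W o'. 3 ^ (2 * r)) - outm d W m, %m. dism d W m, %m. W * (d * W) * (2 * r) - potm m]"
   using that by (auto simp: in_measures)
 qed
 show ?case proof (rule SP_admissible)
  assume adm: "admissible d W m"
  have k: "keys m <= VV d W" using adm by (simp add: admissible_def)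
  consider (big) j where "n < ls True True j m"
   | (swap) o' l where "Suc l \<in> LL d W o'" "Suc l div W = l div W" "ls o' True l m < ls o' True (Suc l) m"
   | (viol) o' s where "~ LR W o' s m" "!!o' l. Suc l \<in> LL d W o' ==> Suc l div W = l div W ==> ls o' True (Suc l) m <= ls o' True l m"
   | (ok) "\<forall>o' s. LR W o' s m" "\<forall>j. ls True True j m <= n" by (meson not_le)
  thus "SP d W S ?X (EE d W m :: nat => 'a gen_poly)" proof cases
   case big
   thus ?thesis by (intro SP_UI H)
  next
   case swap
   show ?thesis by (rule swap_step[OF adm swap]) (rule IHd)
  next
   case ok
   have "finite ?X" by (rule finite_subset[OF _ finite_Kf[of d W "2 * r"]]) auto
   thus ?thesis by (rule SP_base) (use ok adm 1(2) k in "auto simp: Kf_def")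
  next
   case viol
   then obtain l b where v: "Suc l div W = l div W"
    "(\<Sum>i<b. lookup m (ori o' (s, l, i))) < (\<Sum>i\<le>b. lookup m (ori o' (s, Suc l, i)))" unfolding LR_def by (auto simp: not_le)
   have lsT: "ls q s x m = ls q True x m" for q x using adm by (cases s) (auto simp: admissible_def)
   have "\<exists>i\<le>b. lookup m (ori o' (s, Suc l, i)) ~= 0" using v(2) by (metis (no_types, lifting) atMost_iff gr_implies_not0 sum.neutral)
   then obtain i where i: "lookup m (ori o' (s, Suc l, i)) ~= 0" by blast
   hence "ori o' (s, Suc l, i) \<in> VV d W" using k by (auto simp: in_keys_iff)
   hence SL: "Suc l \<in> LL d W o'" by (simp add: ori_VV)
   have "lookup m (ori o' (s, Suc l, i)) <= ls o' s (Suc l) m" unfolding wt_ind[symmetric] ls_def by (rule wt_mono) (simp add: linem_def)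
   hence pos: "0 < ls o' True (Suc l) m" using i lsT by simp
   have srt: "ls o' True (Suc l) m <= ls o' True l m" by (rule viol(2)[OF SL v(1)])
   have W0: "0 < W" using r by simp
   define K where "K = (if o' then 1 else d)"
   have LK: "x \<in> LL d W o' <-> x < K * W" for x by (simp add: LL_def K_def)
   define q where "q = l div W * W"
   define f where "f = q + (W - 1)"
   have "l div W < K" using SL W0 by (simp add: LK div_less_iff_less_mult)
   hence "(l div W + 1) * W <= K * W" by (intro mult_le_mono1) simp
   hence qW: "q + W <= K * W" by (simp add: q_def)
   have qd: "(q + i) div W = l div W" if "i < W" for i using that by (simp add: q_def)
   have fL: "f \<in> LL d W o'" using qW W0 by (simp add: LK f_def)
   have fd: "f div W = l div W" unfolding f_def by (rule qd) (use W0 in simp)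
   have f0: "ls o' True f m = 0" unfolding f_def proof (rule last_line_empty)
    show "ls o' True (q + Suc i) m <= ls o' True (q + i) m" if "Suc i < W" for i
     using viol(2)[of "q + i" o'] qd[of i] qd[of "Suc i"] that qW by (simp add: LK)
    have "(\<Sum>i<W. ls o' True (q + i) m) = (\<Sum>x\<in>(%i. q + i) ` {..<W}. ls o' True x m)" by (subst sum.reindex) auto
    also have "... <= (\<Sum>x\<in>LL d W o'. ls o' True x m)" by (rule sum_mono2) (use qW LL_simps(3) in "auto simp: LK")
    also have "... = r" using ls_total[OF adm, of o'] 1(2) by simp
    finally show "(\<Sum>i<W. ls o' True (q + i) m) < W" using r by simp
   qed
   show ?thesis by (rule viol_step[OF adm SL fL _ _ v(1) fd f0 srt v(2)]) (use pos srt f0 IHo IHp in auto)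
  qed
 qed
qed

section \<open>Coefficients of the generating function as invariants\<close>

definition lift :: "('v, 'a::comm_ring_1) mpoly => ('v, 'a gen_poly) mpoly" where
 "lift = ev (%c. Const (Const c)) Var"

lemma lift_hom: "comm_ring_hom lift" unfolding lift_def by (rule ev_hom[OF comm_ring_hom_compose[OF Const_hom Const_hom]])

lemma lift_Var [simp]: "lift (Var v) = Var v" unfolding lift_def by (rule ev_Var[OF comm_ring_hom_compose[OF Const_hom Const_hom]])

lemma lookup_lift: "lookup (lift p) m = Const (lookup p m)"
proof -
 have "lift p = (\<Sum>m\<in>keys p. single m (Const (lookup p m)))" unfolding lift_def ev_def monoval_Var by (simp add: Const_def mult_single)
 thus ?thesis by (auto simp: lookup_sum lookup_single when_def in_keys_iff Const_simps)
qed

text \<open>Families of matrices that are linear combinations of words in the generic matrices, with coefficients of \<open>\<omega>\<close>-weight \<open>k\<close>.\<close>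

definition WF :: "('v => nat) => nat => (nat => nat => nat => ('v, 'a::comm_ring_1 gen_poly) mpoly) => bool" where
 "WF om k F <-> (\<exists>zs. (\<forall>(ze, w)\<in>set zs. w ~= [] & (\<forall>m\<in>keys ze. wt om m = k)) &
   (\<forall>N c c'. c < N --> c' < N --> F N c c' = (\<Sum>(ze, w)\<leftarrow>zs. lift ze * Const (wm N w c c'))))"

lemma WF_0: "WF om k (%N c c'. 0)" unfolding WF_def by (rule exI[of _ "[]"]) simp

lemma WF_add: "WF om k F ==> WF om k G ==> WF om k (%N c c'. F N c c' + G N c c')"
 unfolding WF_def proof (elim exE conjE)
 fix zs ys
 assume "\<forall>(ze, w)\<in>set zs. w ~= [] & (\<forall>m\<in>keys ze. wt om m = k)" "\<forall>(ze, w)\<in>set ys. w ~= [] & (\<forall>m\<in>keys ze. wt om m = k)"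
  "\<forall>N c c'. c < N --> c' < N --> F N c c' = (\<Sum>(ze, w)\<leftarrow>zs. lift ze * Const (wm N w c c'))"
  "\<forall>N c c'. c < N --> c' < N --> G N c c' = (\<Sum>(ze, w)\<leftarrow>ys. lift ze * Const (wm N w c c'))"
 thus "\<exists>zs. (\<forall>(ze, w)\<in>set zs. w ~= [] & (\<forall>m\<in>keys ze. wt om m = k)) &
   (\<forall>N c c'. c < N --> c' < N --> F N c c' + G N c c' = (\<Sum>(ze, w)\<leftarrow>zs. lift ze * Const (wm N w c c')))"
  by (intro exI[of _ "zs @ ys"]) auto
qed

lemma WF_sum: "(!!i. i \<in> I ==> WF om k (F i)) ==> WF om k (%N c c'. \<Sum>i\<in>I. F i N c c')"
 by (induction I rule: infinite_finite_induct) (auto intro: WF_add WF_0)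

lemma WF_mult: assumes "WF om k F" "WF om l G" shows "WF om (k + l) (%N c c'. \<Sum>e<N. F N c e * G N e c')"
proof -
 obtain zs where zs: "\<forall>(ze, w)\<in>set zs. w ~= [] & (\<forall>m\<in>keys ze. wt om m = k)"
  "!!N c c'. c < N ==> c' < N ==> F N c c' = (\<Sum>(ze, w)\<leftarrow>zs. lift ze * Const (wm N w c c'))"
  using assms(1) unfolding WF_def by blast
 obtain ys where ys: "\<forall>(ze, w)\<in>set ys. w ~= [] & (\<forall>m\<in>keys ze. wt om m = l)"
  "!!N c c'. c < N ==> c' < N ==> G N c c' = (\<Sum>(ze, w)\<leftarrow>ys. lift ze * Const (wm N w c c'))"
  using assms(2) unfolding WF_def by blast
 interpret c: comm_ring_hom "Const :: 'b gen_poly => ('a, 'b gen_poly) mpoly" by (rule Const_hom)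
 interpret li: comm_ring_hom "lift :: ('a, 'b) mpoly => _" by (rule lift_hom)
 define xs where "xs = concat (map (%(ze, w). map (%(ze', w'). (ze * ze', w @ w')) ys) zs)"
 show ?thesis unfolding WF_def proof (intro exI[of _ xs] conjI allI impI)
  show "\<forall>(ze, w)\<in>set xs. w ~= [] & (\<forall>m\<in>keys ze. wt om m = k + l)"
  proof (clarify, intro conjI ballI)
   fix ze w assume "(ze, w) \<in> set xs"
   then obtain ze1 w1 ze2 w2 where e: "(ze1, w1) \<in> set zs" "(ze2, w2) \<in> set ys" "ze = ze1 * ze2" "w = w1 @ w2" unfolding xs_def by auto
   show "w ~= []" using e zs(1) by auto
   fix m assume "m \<in> keys ze"
   then obtain m1 m2 where "m = m1 + m2" "m1 \<in> keys ze1" "m2 \<in> keys ze2" using keys_mult[of ze1 ze2] e by auto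
   thus "wt om m = k + l" using bspec[OF zs(1) e(1)] bspec[OF ys(1) e(2)] by (simp add: wt_add)
  qed
  fix N c c' assume cN: "c < N" "c' < (N :: nat)"
  have "(\<Sum>e<N. F N c e * G N e c') = (\<Sum>e<N. \<Sum>(ze, w)\<leftarrow>zs. \<Sum>(ze', w')\<leftarrow>ys. lift (ze * ze') * Const (wm N w c e * wm N w' e c'))"
  proof (rule sum.cong[OF refl])
   fix e assume "e \<in> {..<N}"
   thus "F N c e * G N e c' = (\<Sum>(ze, w)\<leftarrow>zs. \<Sum>(ze', w')\<leftarrow>ys. lift (ze * ze') * Const (wm N w c e * wm N w' e c'))"
    using cN by (simp only: zs(2) ys(2) sum_list_mult_const[symmetric] lessThan_iff)
     (simp add: sum_list_const_mult[symmetric] case_prod_unfold li.hom_mult c.hom_mult mult_ac)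
  qed
  also have "... = (\<Sum>(ze, w)\<leftarrow>zs. \<Sum>(ze', w')\<leftarrow>ys. lift (ze * ze') * Const (\<Sum>e<N. wm N w c e * wm N w' e c'))"
  proof -
   have sl: "(\<Sum>e<N. \<Sum>x\<leftarrow>xs. f e x) = (\<Sum>x\<leftarrow>xs. \<Sum>e<N. f e x)" for xs :: "'x list" and f :: "nat => 'x => ('a, 'b gen_poly) mpoly"
    by (induction xs) (simp_all add: sum.distrib)
   show ?thesis by (simp add: sl case_prod_unfold c.hom_sum sum_distrib_left)
  qed
  also have "... = (\<Sum>(ze, w)\<leftarrow>zs. \<Sum>(ze', w')\<leftarrow>ys. lift (ze * ze') * Const (wm N (w @ w') c c'))"
   using cN by (simp add: wm_def wmat_append)
  also have "... = (\<Sum>(ze, w)\<leftarrow>xs. lift ze * Const (wm N w c c'))"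
   unfolding xs_def by (induction zs) (auto simp: case_prod_unfold o_def)
  finally show "(\<Sum>e<N. F N c e * G N e c') = (\<Sum>(ze, w)\<leftarrow>xs. lift ze * Const (wm N w c c'))" .
 qed
qed

lemma WF_minus: "WF om k F ==> WF om k (%N c c'. - F N c c')" unfolding WF_def
proof (elim exE conjE)
 fix zs
 interpret li: comm_ring_hom "lift :: ('a, 'b) mpoly => _" by (rule lift_hom)
 assume "\<forall>(ze, w)\<in>set zs. w ~= [] & (\<forall>m\<in>keys ze. wt om m = k)"
  and e: "\<forall>N c c'. c < N --> c' < N --> F N c c' = (\<Sum>(ze, w)\<leftarrow>zs. lift ze * Const (wm N w c c'))"
 moreover have "- (\<Sum>(ze, w)\<leftarrow>zs. lift ze * Const (wm N w c c')) = (\<Sum>(ze, w)\<leftarrow>map (%(ze, w). (- ze, w)) zs. lift ze * Const (wm N w c c') :: ('a, 'b gen_poly) mpoly)" for N c c'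
  by (induction zs) (auto simp: li.hom_uminus)
 ultimately show "\<exists>zs. (\<forall>(ze, w)\<in>set zs. w ~= [] & (\<forall>m\<in>keys ze. wt om m = k)) &
   (\<forall>N c c'. c < N --> c' < N --> - F N c c' = (\<Sum>(ze, w)\<leftarrow>zs. lift ze * Const (wm N w c c')))"
  by (intro exI[of _ "map (%(ze, w). (- ze, w)) zs"] conjI) auto
qed

lemma WF_D_coeff: fixes F :: "nat => nat => nat => ('v, 'a::field gen_poly) mpoly" assumes F: "WF om 1 F"
  and sF: "!!ts ws. length ws = length ts ==> (\<forall>w\<in>set ws. w ~= []) ==> sum_list ts = wt om m ==> UI S (sF ts ws :: nat => 'a gen_poly)"
 shows "UI S (%N. lookup (D {..<N} (F N)) m)"
proof -
 obtain zs where zs: "\<forall>(ze, w)\<in>set zs. w ~= [] & (\<forall>m\<in>keys ze. wt om m = 1)"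
  "!!N c c'. c < N ==> c' < N ==> F N c c' = (\<Sum>(ze, w)\<leftarrow>zs. lift ze * Const (wm N w c c'))"
  using F unfolding WF_def by blast
 interpret li: comm_ring_hom "lift :: ('v, 'a) mpoly => _" by (rule lift_hom)
 let ?u = "length zs" and ?ws = "map snd zs"
 let ?ze = "%l. fst (zs ! l)"
 let ?z = "%t. lookup (monoval ?ze t) m"
 let ?L = "%N. D {..<N} (lmat ?u (%l. wm N (?ws ! l))) :: (nat, 'a gen_poly) mpoly"
 define T where "T = {t :: nat mon. keys t <= {..<?u} & mdeg t = wt om m}"
 have fT: "finite T" unfolding T_def by (rule finite_monomials) simp
 have lifted: "monoval (%l. lift (?ze l)) t = lift (monoval ?ze t)" for t
  unfolding monoval_def by (simp add: li.hom_prod li.hom_power)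
 have e: "lookup (D {..<N} (F N)) m = (\<Sum>t\<in>T. Const (?z t) * sF (map (lookup t) [0..<?u]) ?ws N)" for N proof -
  define h where "h = ev (Const :: 'a gen_poly => ('v, 'a gen_poly) mpoly) (%l. lift (?ze l))"
  have hh: "comm_ring_hom h" unfolding h_def by (rule ev_hom[OF Const_hom])
  interpret h: comm_ring_hom h by (rule hh)
  have hv: "h (Var l) = lift (?ze l)" "h (Const c) = Const c" for l c by (simp_all add: h_def Const_hom)
  have "h (?L N) = D {..<N} (F N)" unfolding D_hom[OF hh] proof (rule D_cong)
   fix i j assume "i \<in> {..<N}" "j \<in> {..<N}"
   thus "h (lmat ?u (%l. wm N (?ws ! l)) i j) = F N i j"
    by (simp add: zs(2) lmat_def h.hom_sum h.hom_mult hv sum_list_sum_nth atLeast0LessThan case_prod_unfold)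
  qed
  hence "lookup (D {..<N} (F N)) m = lookup (h (?L N)) m" by simp
  also have "... = (\<Sum>t\<in>keys (?L N). Const (?z t) * lookup (?L N) t)"
   unfolding h_def ev_def lookup_sum lookup_Const_mult lifted lookup_lift by (intro sum.cong refl mult.commute)
  also have "... = (\<Sum>t\<in>keys (?L N) Un T. Const (?z t) * lookup (?L N) t)"
   by (rule sum.mono_neutral_left) (use fT in "auto simp: in_keys_iff")
  also have "... = (\<Sum>t\<in>T. Const (?z t) * lookup (?L N) t)" proof (rule sum.mono_neutral_right)
   show "\<forall>t\<in>keys (?L N) Un T - T. Const (?z t) * lookup (?L N) t = 0" proof
    fix t assume t: "t \<in> keys (?L N) Un T - T"
    hence tk: "keys t <= {..<?u}" using lmat_keys[of t "{..<N}" ?u] by auto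
    have "?z t = 0" proof (rule ccontr)
     assume "?z t ~= 0"
     hence mk: "m \<in> keys (monoval ?ze t)" by (simp add: in_keys_iff)
     have "wt om m = mdeg t" proof (rule monoval_keys_rel[where Rel = "%a b. wt om b = mdeg a", OF _ _ _ mk])
      fix v k assume v: "v \<in> keys t" and k: "k \<in> keys (?ze v)"
      have "zs ! v \<in> set zs" using v tk by auto
      thus "wt om k = mdeg (single v 1)" using zs(1) k by (auto simp: case_prod_unfold)
     qed (auto simp: wt_add mdeg_add)
     thus False using t tk by (simp add: T_def)
    qed
    thus "Const (?z t) * lookup (?L N) t = 0" by (simp add: Const_simps)
   qed
  qed (use fT in auto)
  also have "... = (\<Sum>t\<in>T. Const (?z t) * sF (map (lookup t) [0..<?u]) ?ws N)" proof (rule sum.cong[OF refl])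
   fix t assume "t \<in> T"
   hence "tm (map (lookup t) [0..<?u]) = t" by (intro poly_mapping_eqI) (auto simp: lookup_tm T_def in_keys_iff subset_iff)
   thus "Const (?z t) * lookup (?L N) t =
    Const (?z t) * sF (map (lookup t) [0..<?u]) ?ws N" by (simp add: sF_def)
  qed
  finally show ?thesis .
 qed
 show ?thesis unfolding e proof (intro UI_sum UI_mult[OF UU_Const] sF)
  fix t assume t: "t \<in> T"
  show "\<forall>w\<in>set ?ws. w ~= []" using zs(1) by auto
  show "sum_list (map (lookup t) [0..<?u]) = wt om m"
   using t mdeg_superset[of "{..<?u}" t] by (simp add: T_def sum_list_sum_nth atLeast0LessThan)
 qed simp
qed

lemma lookup_mult_finite: fixes p q :: "('v, 'r::comm_ring_1) mpoly"
 defines "T \<equiv> %m :: 'v mon. {m'. keys m' <= keys m & mdeg m' <= mdeg m}" shows "finite (T m)"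
  and "lookup (p * q) m = (\<Sum>a\<in>T m. \<Sum>b\<in>T m. if a + b = m then lookup p a * lookup q b else 0)"
proof -
 have "T m = (\<Union>r\<in>{..mdeg m}. {m'. keys m' <= keys m & mdeg m' = r})" by (auto simp: T_def)
 thus f: "finite (T m)" using finite_monomials[of "keys m"] by simp
 have ab: "a \<in> T m & b \<in> T m" if "a + b = m" for a b proof -
  have "keys a <= keys m" "keys b <= keys m" using that[symmetric] by (auto simp: in_keys_iff lookup_add)
  moreover have "mdeg m = mdeg a + mdeg b" using that mdeg_add by metis
  ultimately show ?thesis by (simp add: T_def)
 qed
 let ?f = "%a b. if a + b = m then lookup p a * lookup q b else 0"
 have "p * q = (\<Sum>a\<in>keys p. single a (lookup p a)) * (\<Sum>b\<in>keys q. single b (lookup q b))" by (simp flip: mpoly_expand)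
 hence "lookup (p * q) m = (\<Sum>a\<in>keys p. \<Sum>b\<in>keys q. ?f a b)" by (simp add: sum_product mult_single lookup_sum lookup_single when_def)
 also have "... = (\<Sum>a\<in>keys p Un T m. \<Sum>b\<in>keys q. ?f a b)"
  by (rule sum.mono_neutral_left) (use f in "auto simp: in_keys_iff intro!: sum.neutral")
 also have "... = (\<Sum>a\<in>T m. \<Sum>b\<in>keys q. ?f a b)"
  by (rule sum.mono_neutral_right) (use f ab in "auto intro!: sum.neutral")
 also have "... = (\<Sum>a\<in>T m. \<Sum>b\<in>T m. ?f a b)" proof (rule sum.cong[OF refl])
  fix a
  have "(\<Sum>b\<in>keys q. ?f a b) = (\<Sum>b\<in>keys q Un T m. ?f a b)"
   by (rule sum.mono_neutral_left) (use f in "auto simp: in_keys_iff")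
  also have "... = (\<Sum>b\<in>T m. ?f a b)" by (rule sum.mono_neutral_right) (use f ab in auto)
  finally show "(\<Sum>b\<in>keys q. ?f a b) = (\<Sum>b\<in>T m. ?f a b)" .
 qed
 finally show "lookup (p * q) m = (\<Sum>a\<in>T m. \<Sum>b\<in>T m. ?f a b)" .
qed

text \<open>\<open>SV A M i\<close> is \<open>P\<^sup>i v\<close>, where \<open>P\<close> and \<open>v\<close> are the blocks of \<open>M\<close> with rows in \<open>A\<close>; eliminating \<open>v\<close> by column
  operations uses the truncated geometric series \<open>\<Sum> (-P)\<^sup>i v\<close>.\<close>

primrec SV :: "'i set => ('i => 'i => 'r::comm_ring_1) => nat => 'i => 'i => 'r" where
 "SV A M 0 = M"
| "SV A M (Suc i) = (%p q. \<Sum>k\<in>A. M p k * SV A M i k q)"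

lemma schur_step: fixes M :: "'i => 'i => ('v, 'r::comm_ring_1) mpoly"
 assumes fin: "finite A" "finite J" "A \<inter> J = {}" and M: "!!p q. p \<in> A Un J ==> q \<in> A Un J ==> [:0, 1:] dvd wgrade (%_. 1) (M p q)"
  and m: "mdeg m <= r"
 shows "lookup (D (A Un J) M) m =
  lookup (D A M * D J (%p q. M p q + (\<Sum>k\<in>A. M p k * - (\<Sum>i\<le>r. (- 1) ^ i * SV A M i k q)))) m"
proof -
 let ?I = "A Un J"
 let ?S = "%p q. - (\<Sum>i\<le>r. (- 1) ^ i * SV A M i p q)"
 define G where "G p q = (if p \<in> A & q \<in> J then ?S p q else 0)" for p q
 define H where "H p q = (if p \<in> A & q \<in> J then (- 1) ^ Suc r * SV A M (Suc r) p q else if q \<in> J then M p q + (\<Sum>k\<in>A. M p k * ?S k q) else M p q)" for p q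
 define H' where "H' p q = (if p \<in> A & q \<in> J then 0 else H p q)" for p q
 have fI: "finite ?I" using fin by simp
 have "D ?I G = D A G * D J G" by (rule D_block[OF fin]) (use fin in "auto simp: G_def")
 also have "D A G = D A (%_ _. 0)" by (rule D_cong) (use fin in "auto simp: G_def")
 also have "D J G = D J (%_ _. 0)" by (rule D_cong) (use fin in "auto simp: G_def")
 finally have "D ?I G = 1" using fin by simp
 hence "D ?I M = D ?I M * D ?I G" by simp
 also have "... = D ?I H" unfolding D_mult[OF fI] proof (rule D_cong)
  fix p q assume p: "p \<in> ?I" and q: "q \<in> ?I"
  have s: "(\<Sum>k\<in>?I. M p k * G k q) = (if q \<in> J then \<Sum>k\<in>A. M p k * ?S k q else 0)" proof -
   have "(\<Sum>k\<in>?I. M p k * G k q) = (\<Sum>k\<in>A. M p k * G k q)"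
    by (rule sum.mono_neutral_right) (use fI fin in "auto simp: G_def")
   thus ?thesis by (auto simp: G_def intro!: sum.cong sum.neutral)
  qed
  show "M p q + G p q + (\<Sum>k\<in>?I. M p k * G k q) = H p q" proof (cases "p \<in> A & q \<in> J")
   case True
   have "(\<Sum>k\<in>A. M p k * ?S k q) = (\<Sum>i\<le>r. (- 1) ^ Suc i * SV A M (Suc i) p q)" proof -
    have "(\<Sum>k\<in>A. M p k * ?S k q) = (\<Sum>k\<in>A. \<Sum>i\<le>r. (- 1) ^ Suc i * (M p k * SV A M i k q))"
     by (simp add: sum_distrib_left sum_negf mult_ac)
    also have "... = (\<Sum>i\<le>r. \<Sum>k\<in>A. (- 1) ^ Suc i * (M p k * SV A M i k q))" by (rule sum.swap)
    finally show ?thesis by (simp only: SV.simps sum_distrib_left)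
   qed
   also have "... = (\<Sum>i\<le>Suc r. (- 1) ^ i * SV A M i p q) - M p q" by (subst sum.atMost_Suc_shift) simp
   finally have "(\<Sum>k\<in>A. M p k * ?S k q) = (\<Sum>i\<le>r. (- 1) ^ i * SV A M i p q) + (- 1) ^ Suc r * SV A M (Suc r) p q - M p q"
    by (simp only: sum.atMost_Suc)
   thus ?thesis using True unfolding s by (simp add: G_def H_def)
  next
   case False
   thus ?thesis unfolding s by (auto simp: G_def H_def)
  qed
 qed
 finally have DH: "D ?I M = D ?I H" .
 have "D ?I H' = D (J Un A) H'" by (simp add: Un_commute)
 also have "... = D J H' * D A H'" by (rule D_block) (use fin in "auto simp: H'_def")
 also have "D J H' = D J (%p q. M p q + (\<Sum>k\<in>A. M p k * ?S k q))" by (rule D_cong) (use fin in "auto simp: H'_def H_def")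
 also have "D A H' = D A M" by (rule D_cong) (use fin in "auto simp: H'_def H_def")
 finally have DH': "D ?I H' = D A M * D J (%p q. M p q + (\<Sum>k\<in>A. M p k * ?S k q))" by (simp add: mult.commute)
 let ?g = "wgrade (%_. 1) :: ('v, 'r) mpoly => _"
 interpret g: comm_ring_hom ?g by (rule wgrade_hom)
 have SVd: "[:0, 1:] ^ Suc i dvd ?g (SV A M i p q)" if "p \<in> A" "q \<in> J" for i p q using that(1) proof (induction i arbitrary: p)
  case 0
  thus ?case using M that by simp
 next
  case (Suc i)
  show ?case unfolding SV.simps g.hom_sum g.hom_mult proof (rule dvd_sum)
   fix k assume "k \<in> A"
   hence "[:0, 1:] dvd ?g (M p k)" "[:0, 1:] ^ Suc i dvd ?g (SV A M i k q)" using M Suc by auto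
   thus "[:0, 1:] ^ Suc (Suc i) dvd ?g (M p k) * ?g (SV A M i k q)" unfolding power_Suc[of _ "Suc i"] by (rule mult_dvd_mono)
  qed
 qed
 have sm: "([:0, 1:] :: ('v, 'r) mpoly poly) ^ k = monom 1 k" for k by (simp add: monom_altdef)
 have "cg (monom 1 (Suc r)) (?g (D ?I H)) (?g (D ?I H'))" unfolding D_hom[OF wgrade_hom] proof (rule D_cg)
  fix p q assume "p \<in> ?I" "q \<in> ?I"
  show "cg (monom 1 (Suc r)) (?g (H p q)) (?g (H' p q))" proof (cases "p \<in> A & q \<in> J")
   case True
   have "[:0, 1:] ^ Suc r dvd ?g (SV A M (Suc r) p q)" using SVd[of p q "Suc r"] True by (meson dvd_trans le_imp_power_dvd le_SucI order_refl)
   hence "[:0, 1:] ^ Suc r dvd ?g ((- 1) ^ Suc r * SV A M (Suc r) p q)" unfolding g.hom_mult by (rule dvd_mult)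
   moreover have "?g (H p q) - ?g (H' p q) = ?g ((- 1) ^ Suc r * SV A M (Suc r) p q)"
    using True by (simp only: H_def H'_def if_True g.hom_zero diff_zero simp_thms)
   ultimately show ?thesis by (simp only: cg_def sm)
  next
   case False
   hence "H' p q = H p q" by (auto simp: H'_def)
   thus ?thesis by (simp only: cg_refl)
  qed
 qed
 hence "coeff (?g (D ?I H)) (mdeg m) = coeff (?g (D ?I H')) (mdeg m)" by (rule cg_monom_coeff) (rule m)
 hence "lookup (coeff (?g (D ?I H)) (mdeg m)) m = lookup (coeff (?g (D ?I H')) (mdeg m)) m" by simp
 thus ?thesis unfolding lookup_wgrade DH DH' by (simp add: mdeg_wt)
qed

lemma gf_schur: assumes fin: "finite B" "finite R" and j: "j \<notin> R"
 obtains F :: "nat => nat => nat => 'a::field xy_poly" where "WF (rowm j False) 1 F"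
  "!!N. lookup (gf B ka (insert j R) N) m = lookup (gf B ka R N * D {..<N} (F N)) m"
proof -
 let ?om = "rowm j False"
 let ?M = "MM B ka (%j b. Var (True, j, b)) (%j b. Var (False, j, b)) (%k c c'. Const (Var (c, c', k))) :: _ => _ => 'a xy_poly"
 let ?A = "%N :: nat. R \<times> {..<N}"
 let ?r = "mdeg m"
 define F where "F N c c' = ?M (j, c) (j, c') + (\<Sum>i\<in>R. \<Sum>e<N. ?M (j, c) (i, e) * - (\<Sum>t\<le>?r. (- 1) ^ t * SV (?A N) ?M t (i, e) (j, c')))" for N c c'
 have WM: "WF ?om (of_bool (i' = j)) (%N c c'. ?M (i, c) (i', c'))" for i i' proof -
  have base: "WF ?om (of_bool (i' = j)) (%N c c'. Var (True, i, b) * Var (False, i', b) * Const (Var (c, c', ka b)) :: 'a xy_poly)" for b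
   unfolding WF_def proof (intro exI[of _ "[(Var (True, i, b) * Var (False, i', b), [ka b])]"] conjI allI impI)
   interpret li: comm_ring_hom "lift :: (xyvar, 'a) mpoly => _" by (rule lift_hom)
   show "\<forall>(ze, w)\<in>set [(Var (True, i, b) * Var (False, i', b), [ka b])]. w ~= [] & (\<forall>m\<in>keys ze. wt ?om m = of_bool (i' = j))"
    by (auto simp: Var_def mult_single wt_add rowm_def split: if_splits)
   fix N c c' assume "c < N" "c' < (N :: nat)"
   thus "Var (True, i, b) * Var (False, i', b) * Const (Var (c, c', ka b)) = (\<Sum>(ze, w)\<leftarrow>[(Var (True, i, b) * Var (False, i', b), [ka b])]. lift ze * Const (wm N w c c') :: 'a xy_poly)"
    by (simp add: li.hom_mult wm_def wmat_single del: wmat.simps)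
  qed
  show ?thesis unfolding MM_def prod.case by (rule WF_sum) (rule base)
 qed
 have mult: "WF ?om 1 (%N c c'. \<Sum>k\<in>?A N. ?M (i, c) k * X N k (j, c'))" if X: "!!i'. i' \<in> R ==> WF ?om 1 (%N c c'. X N (i', c) (j, c'))" for i and X :: "nat => nat \<times> nat => nat \<times> nat => 'a xy_poly"
 proof -
  have "WF ?om 1 (%N c c'. \<Sum>i'\<in>R. \<Sum>e<N. ?M (i, c) (i', e) * X N (i', e) (j, c'))" proof (rule WF_sum)
   fix i' assume i': "i' \<in> R"
   hence "i' ~= j" using j by auto
   thus "WF ?om 1 (%N c c'. \<Sum>e<N. ?M (i, c) (i', e) * X N (i', e) (j, c'))" using WF_mult[OF WM[of i' i] X[OF i']] by simp
  qed
  thus ?thesis by (simp add: sum.cartesian_product case_prod_unfold)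
 qed
 have WS: "WF ?om 1 (%N c c'. SV (?A N) ?M t (i, c) (j, c'))" for t i proof (induction t arbitrary: i)
  case 0
  thus ?case using WM[of j i] by simp
 next
  case (Suc t)
  show ?case unfolding SV.simps by (rule mult) (rule Suc)
 qed
 have "WF ?om 1 (%N c c'. - (\<Sum>t\<le>?r. (- 1) ^ t * SV (?A N) ?M t (i, c) (j, c')))" for i proof (intro WF_minus WF_sum)
  fix t
  show "WF ?om 1 (%N c c'. (- 1) ^ t * SV (?A N) ?M t (i, c) (j, c'))"
   using WS[of t i] WF_minus[OF WS[of t i]] by (cases "even t") simp_all
 qed
 note W2 = mult[of "%N k q. - (\<Sum>t\<le>?r. (- 1) ^ t * SV (?A N) ?M t k q)", OF this]
 show thesis proof (rule that)
  show "WF ?om 1 F" unfolding F_def using WF_add[OF _ W2[of j], of "%N c c'. ?M (j, c) (j, c')"] WM[of j j]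
   by (simp add: sum.cartesian_product case_prod_unfold)
  fix N :: nat
  let ?J = "{j} \<times> {..<N}"
  have I: "insert j R \<times> {..<N} = ?A N Un ?J" by auto
  interpret g: comm_ring_hom "wgrade (%_. 1) :: 'a xy_poly => _" by (rule wgrade_hom)
  have "lookup (gf B ka (insert j R) N) m = lookup (D (?A N) ?M * D ?J (%p q. ?M p q + (\<Sum>k\<in>?A N. ?M p k * - (\<Sum>i\<le>?r. (- 1) ^ i * SV (?A N) ?M i k q)))) m"
   unfolding gf_def PD_def I proof (rule schur_step)
   fix p q
   show "[:0, 1:] dvd wgrade (%_. 1) (?M p q)" proof -
    have "[:0, 1:] dvd wgrade (%_. 1) (Var v :: 'a xy_poly)" for v by (rule dvdI[of _ _ "[:Var v:]"]) (simp add: monom_Suc monom_0)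
    thus ?thesis unfolding MM_def case_prod_unfold g.hom_sum g.hom_mult by (intro dvd_sum dvd_mult2)
   qed
  qed (use fin j in auto)
  also have "D ?J (%p q. ?M p q + (\<Sum>k\<in>?A N. ?M p k * - (\<Sum>i\<le>?r. (- 1) ^ i * SV (?A N) ?M i k q))) = D {..<N} (F N)" proof -
   have "bij_betw (%c. (j, c)) {..<N} ?J" by (auto simp: bij_betw_def inj_on_def)
   note D_reindex[OF this finite_lessThan, of "%p q. ?M p q + (\<Sum>k\<in>?A N. ?M p k * - (\<Sum>i\<le>?r. (- 1) ^ i * SV (?A N) ?M i k q))"]
   also have "D {..<N} (%c c'. ?M (j, c) (j, c') + (\<Sum>k\<in>?A N. ?M (j, c) k * - (\<Sum>i\<le>?r. (- 1) ^ i * SV (?A N) ?M i k (j, c')))) = D {..<N} (F N)"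
    by (rule D_cong) (simp add: F_def sum.cartesian_product case_prod_unfold)
   finally show ?thesis .
  qed
  finally show "lookup (gf B ka (insert j R) N) m = lookup (gf B ka R N * D {..<N} (F N)) m" by (simp add: gf_def PD_def)
 qed
qed

lemma UU_iff_UI: "UU F <-> UI UNIV F" unfolding UU_def UI_def using ideal_generated_base[of _ UNIV] by blast

lemma gf_UU: assumes fin: "finite B" "finite R"
  and sF: "!!ts ws. length ws = length ts ==> (\<forall>w\<in>set ws. w ~= []) ==> UU (sF ts ws :: nat => 'a::field gen_poly)"
 shows "UU (%N. lookup (gf B ka R N) m :: 'a gen_poly)" using fin(2)
proof (induction R arbitrary: m rule: finite_induct)
 case empty
 have "(%N. lookup (gf B ka {} N) m :: 'a gen_poly) = (%N. Const (of_bool (m = 0)))"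
  by (auto simp: gf_def PD_def D_def Dt_one lookup_one Const_simps when_def Dt_def)
 thus ?case by (simp only: UU_Const)
next
 case (insert j R)
 obtain F :: "nat => nat => nat => 'a xy_poly" where F: "WF (rowm j False) 1 F"
  "!!N. lookup (gf B ka (insert j R) N) m = lookup (gf B ka R N * D {..<N} (F N)) m"
  using gf_schur[OF fin(1) insert(1,2), of ka m] by blast
 show ?case unfolding F(2) lookup_mult_finite(2) proof (intro UU_sum)
  fix a b
  show "UU (%N. if a + b = m then lookup (gf B ka R N) a * lookup (D {..<N} (F N)) b else 0)" proof (cases "a + b = m")
   case True
   have "UU (%N. lookup (D {..<N} (F N)) b)" unfolding UU_iff_UI by (rule WF_D_coeff[OF F(1)]) (simp add: sF flip: UU_iff_UI)
   thus ?thesis using True insert(3) by (simp add: UU_mult)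
  qed (simp add: UU_0)
 qed
qed

lemma gf_UI: assumes fin: "finite B" "finite R"
  and sF: "!!ts ws. length ws = length ts ==> (\<forall>w\<in>set ws. w ~= []) ==> UU (sF ts ws :: nat => 'a::field gen_poly)"
  and sI: "!!ts ws. length ws = length ts ==> (\<forall>w\<in>set ws. w ~= []) ==> n < sum_list ts ==> UI S (sF ts ws :: nat => 'a::field gen_poly)"
  and big: "n < wt (rowm j False) m"
 shows "UI S (%N. lookup (gf B ka R N) m :: 'a gen_poly)"
proof (cases "j \<in> R")
 case False
 have z: "lookup (gf B ka R N) m = (0 :: 'a gen_poly)" for N proof (rule ccontr)
  assume "lookup (gf B ka R N) m ~= (0 :: 'a gen_poly)"
  hence "keys m <= UNIV \<times> R \<times> B" by (rule gf_keys)
  hence "wt (rowm j False) m = 0" using False unfolding wt_def by (intro sum.neutral) (auto simp: rowm_def)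
  thus False using big by simp
 qed
 show ?thesis unfolding z by (rule UI_0)
next
 case True
 define Q where "Q = R - {j}"
 have Q: "R = insert j Q" "finite Q" "j \<notin> Q" using True fin by (auto simp: Q_def)
 obtain F :: "nat => nat => nat => 'a xy_poly" where F: "WF (rowm j False) 1 F"
  "!!N. lookup (gf B ka (insert j Q) N) m = lookup (gf B ka Q N * D {..<N} (F N)) m"
  using gf_schur[OF fin(1) Q(2,3), of ka m] by blast
 show ?thesis unfolding Q(1) F(2) lookup_mult_finite(2) proof (intro UI_sum)
  fix a b
  show "UI S (%N. if a + b = m then lookup (gf B ka Q N) a * lookup (D {..<N} (F N)) b else 0)"
  proof (cases "a + b = m & wt (rowm j False) a = 0")
   case True
   hence "wt (rowm j False) b = wt (rowm j False) m" using wt_add[of "rowm j False" a b] by simp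
   hence "UI S (%N. lookup (D {..<N} (F N)) b)" using big by (intro WF_D_coeff[OF F(1)] sI) auto
   thus ?thesis using True by (simp add: UI_mult gf_UU[OF fin(1) Q(2) sF])
  next
   case False
   have "a + b = m ==> lookup (gf B ka Q N) a = (0 :: 'a gen_poly)" for N proof (rule ccontr)
    assume "a + b = m" "lookup (gf B ka Q N) a ~= (0 :: 'a gen_poly)"
    hence "keys a <= UNIV \<times> Q \<times> B" by (intro gf_keys)
    hence "wt (rowm j False) a = 0" using Q(3) unfolding wt_def by (intro sum.neutral) (auto simp: rowm_def)
    thus False using False `a + b = m` by simp
   qed
   hence "(%N. if a + b = m then lookup (gf B ka Q N) a * lookup (D {..<N} (F N)) b else 0) = (%N. 0)" by auto
   thus ?thesis by (simp only: UI_0)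
  qed
 qed
qed

section \<open>Monomials in the generators as coefficients of the generating function\<close>

text \<open>The entries \<open>X p\<close>, \<open>p < L - 1\<close>, form a unitriangular matrix \<open>1 + U\<close>; dividing by it concentrates the remaining entry in
  the first block column.\<close>

lemma D_cycle: fixes X :: "nat => nat => nat => 'r::comm_ring_1" assumes L: "0 < L"
 shows "D ({..<L} \<times> {..<N}) (%(p, c) (p', c'). of_bool (p' = Suc p mod L) * X p c c') =
  D {..<N} (%c c'. (- 1) ^ (L - 1) * wmat {..<N} X [0..<L] c c')"
proof -
 let ?I = "{..<L} \<times> {..<N}"
 define U :: "nat \<times> nat => nat \<times> nat => 'r" where "U = (%(p, c) (p', c'). of_bool (p' = Suc p) * X p c c')"
 define G :: "nat \<times> nat => nat \<times> nat => 'r" where "G = (%(p, c) (p', c'). of_bool (p' = 0) * ((- 1) ^ (L - 1 - p) * wmat {..<N} X [p..<L] c c'))"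
 have fI: "finite ?I" by simp
 have "D ?I U = 1" by (rule D_triangular[OF fI, of fst]) (auto simp: U_def)
 hence "D ?I G = D ?I U * D ?I G" by simp
 also have "... = D ?I (%(p, c) (p', c'). of_bool (p' = Suc p mod L) * X p c c')" unfolding D_mult[OF fI] proof (rule D_cong)
  fix x y assume "x \<in> ?I" "y \<in> ?I"
  then obtain p c p' c' where xy: "x = (p, c)" "y = (p', c')" "p < L" "c < N" "p' < L" "c' < N" by auto
  have "(\<Sum>k\<in>?I. U x k * G k y) = (\<Sum>i<L. \<Sum>e<N. U x (i, e) * G (i, e) y)"
   by (simp only: sum.cartesian_product case_prod_unfold prod.collapse)
  also have "... = (\<Sum>i<L. \<Sum>e<N. of_bool (i = Suc p) * (X p c e * G (i, e) y))" by (simp only: U_def xy prod.case mult.assoc)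
  also have "... = (\<Sum>i<L. of_bool (i = Suc p) * (\<Sum>e<N. X p c e * G (i, e) y))" by (simp add: sum_distrib_left)
  also have "... = (if Suc p < L then \<Sum>e<N. X p c e * G (Suc p, e) y else 0)"
   by (simp add: of_bool_def if_distrib[of "%x. x * _"] cong: if_cong)
  finally have s: "(\<Sum>k\<in>?I. U x k * G k y) = (if Suc p < L then \<Sum>e<N. X p c e * G (Suc p, e) y else 0)" .
  show "U x y + G x y + (\<Sum>k\<in>?I. U x k * G k y) = (case x of (p, c) => %(p', c'). of_bool (p' = Suc p mod L) * X p c c') y"
  proof (cases "Suc p < L")
   case True
   have e: "(- 1) ^ (L - Suc p) = - ((- 1) ^ (L - Suc (Suc p)) :: 'r)" proof -
    have "L - Suc p = Suc (L - Suc (Suc p))" using True by simp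
    thus ?thesis by simp
   qed
   have "wmat {..<N} X [p..<L] c c' = (\<Sum>e<N. X p c e * wmat {..<N} X [Suc p..<L] e c')" using True by (simp add: upt_conv_Cons)
   hence "p' = 0 ==> G x y + (\<Sum>e<N. X p c e * G (Suc p, e) y) = 0" by (simp add: G_def xy e sum_distrib_left mult_ac sum_negf)
   thus ?thesis unfolding s using True by (cases "p' = 0") (auto simp: U_def xy, simp add: G_def)
  next
   case False
   hence p: "p = L - 1" "Suc p = L" using xy by auto
   hence "[p..<L] = [p]" using L by (simp add: upt_conv_Cons)
   thus ?thesis unfolding s using False p xy by (auto simp: U_def G_def wmat_single simp del: wmat.simps)
  qed
 qed
 finally have "D ?I (%(p, c) (p', c'). of_bool (p' = Suc p mod L) * X p c c') = D ?I G" ..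
 also have "D ?I G = D (({1..<L} \<times> {..<N}) Un ({0} \<times> {..<N})) G" proof -
  have "?I = ({1..<L} \<times> {..<N}) Un ({0} \<times> {..<N})" using L by auto
  thus ?thesis by (simp only:)
 qed
 also have "... = D ({1..<L} \<times> {..<N}) G * D ({0} \<times> {..<N}) G" by (rule D_block) (auto simp: G_def)
 also have "D ({1..<L} \<times> {..<N}) G = D ({1..<L} \<times> {..<N}) (%_ _. 0)" by (rule D_cong) (auto simp: G_def)
 also have "D ({0} \<times> {..<N}) G = D {..<N} (%c c'. G (0, c) (0, c'))" by (rule D_reindex) (auto simp: bij_betw_def inj_on_def)
 finally show ?thesis by (simp add: G_def)
qed

lemma D_blocks:
 assumes "finite I" "!!i. i \<in> I ==> finite (B i)" "!!i j. i \<in> I ==> j \<in> I ==> i ~= j ==> B i \<inter> B j = {}"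
  "!!i j x y. i \<in> I ==> j \<in> I ==> i ~= j ==> x \<in> B i ==> y \<in> B j ==> f x y = 0"
 shows "D (\<Union>i\<in>I. B i) f = (\<Prod>i\<in>I. D (B i) f)" using assms
proof (induction I rule: finite_induct)
 case empty
 show ?case by (simp add: D_def Dt_def)
next
 case (insert i I)
 have "D (B i Un (\<Union>i\<in>I. B i)) f = D (B i) f * D (\<Union>i\<in>I. B i) f" proof (rule D_block)
  show "B i \<inter> (\<Union>i\<in>I. B i) = {}" using insert.prems(2)[of i] insert.hyps by blast
  show "f x y = 0" if "x \<in> (\<Union>i\<in>I. B i)" "y \<in> B i" for x y using that insert.prems(3) insert.hyps by blast
 qed (use insert in auto)
 moreover have "D (\<Union>i\<in>I. B i) f = (\<Prod>i\<in>I. D (B i) f)" proof (rule insert.IH)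
  show "f x y = 0" if "i \<in> I" "j \<in> I" "i ~= j" "x \<in> B i" "y \<in> B j" for i j x y
   by (rule insert.prems(3)[of i j]) (use that in auto)
 qed (use insert.prems(1,2) in auto)
 ultimately show ?case using insert.hyps by simp
qed

lemma lookup_restrict_vars: fixes P :: "('v, 'r::comm_ring_1) mpoly" assumes "keys m <= V"
 shows "lookup (subst (%v. if v \<in> V then Var v else 0) P) m = lookup P m"
proof -
 let ?ze = "%v. if v \<in> V then Var v else 0 :: ('v, 'r) mpoly"
 have "lookup (subst ?ze P) m = (\<Sum>m'\<in>keys P. lookup P m' * lookup (monoval ?ze m') m)"
  by (simp add: subst_eq_ev ev_def lookup_sum lookup_Const_mult)
 also have "... = (\<Sum>m'\<in>keys P. if m' = m then lookup P m' else 0)" proof (rule sum.cong[OF refl])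
  fix m'
  have "lookup (monoval ?ze m') m = of_bool (m' = m)" proof (cases "keys m' <= V")
   case True
   hence "monoval ?ze m' = monoval Var m'" unfolding monoval_def by (intro prod.cong) auto
   thus ?thesis by (simp add: monoval_Var lookup_single when_def)
  next
   case False
   then obtain k where k: "k \<in> keys m'" "k \<notin> V" by auto
   hence "monoval ?ze m' = 0" unfolding monoval_def by (intro prod_zero) (auto intro!: bexI[of _ k] simp: in_keys_iff zero_power)
   moreover have "m' ~= m" using k assms by auto
   ultimately show ?thesis by simp
  qed
  thus "lookup P m' * lookup (monoval ?ze m') m = (if m' = m then lookup P m' else 0)" by simp
 qed
 also have "... = lookup P m" by (auto simp: sum.delta in_keys_iff)
 finally show ?thesis .
qed

lemma single_mult_sum: "single (\<Sum>v\<in>A. single v (k::nat)) (1::'r::comm_ring_1) = (single (\<Sum>v\<in>A. single v 1) 1) ^ k"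
proof (induction k)
 case (Suc k)
 have "(\<Sum>v\<in>A. single v (Suc k)) = (\<Sum>v\<in>A. single v 1) + (\<Sum>v\<in>A. single v k)" by (simp flip: sum.distrib single_add)
 hence "single (\<Sum>v\<in>A. single v (Suc k)) (1::'r) = single (\<Sum>v\<in>A. single v 1) 1 * single (\<Sum>v\<in>A. single v k) 1"
  by (simp only: mult_single mult_1)
 thus ?case by (simp only: Suc power_Suc)
qed (simp add: single_one)

theorem cycle_monomial: fixes es :: "nat => nat list" and ks :: "nat => nat"
 assumes e: "!!i. i < h ==> es i ~= []" "!!i. i < h ==> set (es i) <= {..<d}" and W: "(\<Sum>i<h. length (es i)) <= W"
 shows "\<exists>m c. mdeg m = 2 * (\<Sum>i<h. ks i * length (es i)) &
  (\<forall>N. (\<Prod>i<h. ct {..<N} (ks i) (wm N (es i))) = Const c * (EE d W m N :: 'a::field gen_poly))"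
proof -
 define C where "C = (SIGMA i:{..<h}. {..<length (es i)})"
 have fC: "finite C" by (simp add: C_def)
 have "card C = (\<Sum>i<h. length (es i))" by (simp add: C_def)
 hence "card C <= card {..<W}" using W by simp
 then obtain \<rho> where \<rho>: "inj_on \<rho> C" "\<rho> ` C <= {..<W}" using inj_on_iff_card_le[OF fC, of "{..<W}"] by auto
 define \<beta> where "\<beta> i p = (es i ! p) * W + \<rho> (i, p)" for i p
 define nx where "nx i p = Suc p mod length (es i)" for i p
 have Cn: "(i, nx i p) \<in> C" if "(i, p) \<in> C" for i p using that e(1)[of i] by (auto simp: C_def nx_def)
 have rW: "\<rho> x < W" if "x \<in> C" for x using \<rho> that by auto
 have rinj: "\<rho> (i, p) = \<rho> (i', p') <-> i = i' & p = p'" if "(i, p) \<in> C" "(i', p') \<in> C" for i p i' p'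
  using inj_on_eq_iff[OF \<rho>(1) that] by simp
 have \<beta>d: "\<beta> i p div W = es i ! p" if "(i, p) \<in> C" for i p using rW[OF that] by (simp add: \<beta>_def)
 have \<beta>m: "\<beta> i p mod W = \<rho> (i, p)" if "(i, p) \<in> C" for i p using rW[OF that] by (simp add: \<beta>_def)
 have \<beta>B: "\<beta> i p < d * W" if "(i, p) \<in> C" for i p proof -
  have "es i ! p < d" using that e(2) by (force simp: C_def)
  hence "(es i ! p + 1) * W <= d * W" by (intro mult_le_mono1) simp
  thus ?thesis using rW[OF that] by (simp add: \<beta>_def)
 qed
 have \<beta>inj: "\<beta> i p = \<beta> i' p' <-> i = i' & p = p'" if "(i, p) \<in> C" "(i', p') \<in> C" for i p i' p'
  using \<beta>m[OF that(1)] \<beta>m[OF that(2)] rinj[OF that] by metis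
 define Y where "Y i p = (True, \<rho> (i, p), \<beta> i p)" for i p
 define X where "X i p = (False, \<rho> (i, nx i p), \<beta> i p)" for i p
 define V where "V = (%(i, p). Y i p) ` C Un (%(i, p). X i p) ` C"
 define Vi where "Vi i = Y i ` {..<length (es i)} Un X i ` {..<length (es i)}" for i
 define m where "m = (\<Sum>i<h. \<Sum>v\<in>Vi i. single v (ks i))"
 have Vk: "Vi i <= V" if "i < h" for i using that by (force simp: Vi_def V_def C_def)
 have keysm: "keys m <= V" proof -
  have "keys m <= (\<Union>i\<in>{..<h}. \<Union>v\<in>Vi i. keys (single v (ks i)))"
   unfolding m_def by (rule order_trans[OF Poly_Mapping.keys_sum UN_mono[OF subset_refl Poly_Mapping.keys_sum]])
  also have "... <= V" using Vk by (auto split: if_splits)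
  finally show ?thesis .
 qed
 have inC: "(i, p) \<in> C" if "i < h" "p < length (es i)" for i p using that by (simp add: C_def)
 have Yinj: "inj_on (Y i) {..<length (es i)}" and Xinj: "inj_on (X i) {..<length (es i)}" if "i < h" for i
  using that \<beta>inj by (auto simp: inj_on_def Y_def X_def inC)
 have card: "card (Vi i) = 2 * length (es i)" if "i < h" for i proof -
  have "card (Vi i) = card (Y i ` {..<length (es i)}) + card (X i ` {..<length (es i)})"
   unfolding Vi_def by (rule card_Un_disjoint) (auto simp: Y_def X_def)
  thus ?thesis by (simp add: card_image Yinj[OF that] Xinj[OF that])
 qed
 have deg: "mdeg m = 2 * (\<Sum>i<h. ks i * length (es i))" by (simp add: m_def mdeg_sum card sum_distrib_left mult_ac)
 define \<sigma> :: "nat => 'a gen_poly" where "\<sigma> i = (- 1) ^ (length (es i) - 1)" for i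
 have val: "EE d W m N = (\<Prod>i<h. \<sigma> i ^ ks i * ct {..<N} (ks i) (wm N (es i)))" for N proof -
  let ?c = "%t i. ct {..<N} t (wm N (es i))"
  let ?s = "%g. \<Sum>i<h. \<Sum>v\<in>Vi i. single v (g i :: nat)"
  let ?P = "Pi\<^sub>E {..<h} (%i. {..max N (ks i)})"
  let ?p = "%g. \<Prod>i<h. \<sigma> i ^ g i * ?c (g i) i"
  let ?ze = "%v. if v \<in> V then Var v else 0 :: 'a xy_poly"
  let ?M = "MM {..<d * W} (%b. b div W) (%j b. ?ze (True, j, b)) (%j b. ?ze (False, j, b)) (%k c c'. Const (Var (c, c', k)))"
  define Bl where "Bl i = (%(p, c). (\<rho> (i, p), c)) ` ({..<length (es i)} \<times> {..<N})" for i
  define Rest where "Rest = {..<W} \<times> {..<N} - (\<Union>i<h. Bl i)"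
  define Z where "Z i p = (Var (Y i p) * Var (X i p) :: 'a xy_poly)" for i p
  have ent: "?M (\<rho> (i, p), c) (j', c') = of_bool (j' = \<rho> (i, nx i p)) * (Z i p * Const (Var (c, c', es i ! p)))"
   if ip: "(i, p) \<in> C" for i p c j' c'
  proof -
   have y: "(True, \<rho> (i, p), b) \<in> V <-> b = \<beta> i p" for b using ip rinj by (fastforce simp: V_def Y_def X_def)
   have x: "(False, j', \<beta> i p) \<in> V <-> j' = \<rho> (i, nx i p)" using ip \<beta>inj by (fastforce simp: V_def Y_def X_def)
   have "?M (\<rho> (i, p), c) (j', c') = (\<Sum>b<d * W. if b = \<beta> i p then Var (True, \<rho> (i, p), b) * ?ze (False, j', b) * Const (Var (c, c', b div W)) else 0)"
    unfolding MM_def prod.case y by (rule sum.cong) auto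
   also have "... = Var (True, \<rho> (i, p), \<beta> i p) * ?ze (False, j', \<beta> i p) * Const (Var (c, c', \<beta> i p div W))"
    using \<beta>B[OF ip] by (simp add: sum.delta)
   finally show ?thesis unfolding x \<beta>d[OF ip] by (auto simp: Z_def Y_def X_def)
  qed
  have zero: "?M (j, c) q = 0" if "j \<notin> \<rho> ` C" for j c q proof -
   have "(True, j, b) \<notin> V" for b using that by (auto simp: V_def Y_def X_def)
   thus ?thesis by (simp add: MM_def case_prod_unfold)
  qed
  have BlR: "Bl i <= {..<W} \<times> {..<N}" if "i < h" for i using that rW inC by (auto simp: Bl_def)
  have "EE d W m N = lookup (subst ?ze (GF d W N)) m" unfolding EE_def by (rule lookup_restrict_vars[OF keysm, symmetric])
  also have "subst ?ze (GF d W N) = D ({..<W} \<times> {..<N}) ?M" unfolding GF_def subst_gf PD_def ..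
  also have "{..<W} \<times> {..<N} = (\<Union>i<h. Bl i) Un Rest" using BlR by (auto simp: Rest_def)
  also have "D ... ?M = D (\<Union>i<h. Bl i) ?M * D Rest ?M" proof (rule D_block)
   fix x y assume "x \<in> Rest"
   hence "fst x \<notin> \<rho> ` C" by (cases x) (force simp: Rest_def Bl_def C_def)
   thus "?M x y = 0" using zero[of "fst x" "snd x" y] by simp
  qed (auto simp: Rest_def Bl_def)
  also have "D Rest ?M = D Rest (%_ _. 0)" proof (rule D_cong)
   fix x y assume "x \<in> Rest"
   hence "fst x \<notin> \<rho> ` C" by (cases x) (force simp: Rest_def Bl_def C_def)
   thus "?M x y = 0" using zero[of "fst x" "snd x" y] by simp
  qed
  also have "... = 1" by (rule D_zero) (simp add: Rest_def)
  also have "D (\<Union>i<h. Bl i) ?M = (\<Prod>i<h. D (Bl i) ?M)" proof (rule D_blocks)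
   fix i j assume ij: "i \<in> {..<h}" "j \<in> {..<h}" "i ~= j"
   thus "Bl i \<inter> Bl j = {}" using rinj inC by (fastforce simp: Bl_def)
   fix x y assume "x \<in> Bl i" "y \<in> Bl j"
   then obtain p c p' c' where xy: "x = (\<rho> (i, p), c)" "p < length (es i)" "y = (\<rho> (j, p'), c')" "p' < length (es j)" by (auto simp: Bl_def)
   have "\<rho> (j, p') ~= \<rho> (i, nx i p)" using rinj[OF inC Cn[OF inC]] ij xy by auto
   thus "?M x y = 0" unfolding xy using ent[OF inC, of i p c "\<rho> (j, p')" c'] ij xy by simp
  qed (auto simp: Bl_def)
  also have "(\<Prod>i<h. D (Bl i) ?M) = (\<Prod>i<h. \<Sum>t\<le>max N (ks i). single (\<Sum>v\<in>Vi i. single v t) (\<sigma> i ^ t * ?c t i))"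
  proof (rule prod.cong[OF refl])
   fix i assume "i \<in> {..<h}"
   hence i: "i < h" by simp
   let ?L = "length (es i)"
   interpret c: comm_ring_hom "Const :: 'a gen_poly => 'a xy_poly" by (rule Const_hom)
   have "bij_betw (%(p, c). (\<rho> (i, p), c)) ({..<?L} \<times> {..<N}) (Bl i)"
    unfolding Bl_def using rinj inC i by (intro inj_on_imp_bij_betw) (auto simp: inj_on_def)
   hence "D (Bl i) ?M = D ({..<?L} \<times> {..<N}) (%x y. ?M ((%(p, c). (\<rho> (i, p), c)) x) ((%(p, c). (\<rho> (i, p), c)) y))"
    by (rule D_reindex) simp
   also have "... = D ({..<?L} \<times> {..<N}) (%(p, c) (p', c'). of_bool (p' = Suc p mod ?L) * (Z i p * Const (Var (c, c', es i ! p))))"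
   proof (rule D_cong)
    fix x y assume "x \<in> {..<?L} \<times> {..<N}" "y \<in> {..<?L} \<times> {..<N}"
    then obtain p c p' c' where xy: "x = (p, c)" "y = (p', c')" "p < ?L" "p' < ?L" by auto
    have "\<rho> (i, p') = \<rho> (i, nx i p) <-> p' = Suc p mod ?L" using rinj[OF inC Cn[OF inC]] i xy by (simp add: nx_def)
    thus "?M (case x of (p, c) => (\<rho> (i, p), c)) (case y of (p, c) => (\<rho> (i, p), c)) = (case x of (p, c) => %(p', c'). of_bool (p' = Suc p mod ?L) * (Z i p * Const (Var (c, c', es i ! p)))) y"
     unfolding xy prod.case using ent[OF inC[OF i xy(3)]] by simp
   qed
   also have "... = D {..<N} (%c c'. (- 1) ^ (?L - 1) * wmat {..<N} (%p c c'. Z i p * Const (Var (c, c', es i ! p))) [0..<?L] c c')"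
    by (rule D_cycle) (use e(1)[OF i] in simp)
   also have "... = D {..<N} (%c c'. single (\<Sum>v\<in>Vi i. single v 1) 1 * Const (\<sigma> i * wm N (es i) c c'))" proof (rule D_cong)
    fix c c' assume cc: "c \<in> {..<N}" "c' \<in> {..<N}"
    have "prod_list (map (Z i) [0..<?L]) = (\<Prod>p<?L. Z i p)"
     by (metis atLeast0LessThan interv_sum_list_conv_sum_set_nat prod.distinct_set_conv_list distinct_upt set_upt)
    also have "... = (\<Prod>v\<in>Y i ` {..<?L}. Var v) * (\<Prod>v\<in>X i ` {..<?L}. Var v)"
     using Yinj[OF i] Xinj[OF i] by (simp add: Z_def prod.distrib prod.reindex)
    also have "... = (\<Prod>v\<in>Vi i. Var v)" unfolding Vi_def by (rule prod.union_disjoint[symmetric]) (auto simp: Y_def X_def)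
    also have "... = single (\<Sum>v\<in>Vi i. single v 1) 1" by (simp add: Var_def prod_single Vi_def)
    finally have pz: "prod_list (map (Z i) [0..<?L]) = single (\<Sum>v\<in>Vi i. single v 1) 1" .
    have "wmat {..<N} (%p c c'. Const (Var (c, c', es i ! p)) :: 'a xy_poly) xs c c' = wmat {..<N} (%k c c'. Const (Var (c, c', k))) (map ((!) (es i)) xs) c c'" for xs c c'
     by (induction xs arbitrary: c) auto
    hence "wmat {..<N} (%p c c'. Const (Var (c, c', es i ! p)) :: 'a xy_poly) [0..<?L] c c' = Const (wm N (es i) c c')"
     unfolding wm_def by (simp add: map_nth wmat_hom[OF Const_hom])
    thus "(- 1) ^ (?L - 1) * wmat {..<N} (%p c c'. Z i p * Const (Var (c, c', es i ! p))) [0..<?L] c c' = single (\<Sum>v\<in>Vi i. single v 1) 1 * Const (\<sigma> i * wm N (es i) c c')"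
     unfolding wmat_scale pz by (simp add: \<sigma>_def Const_simps c.hom_mult mult_ac)
   qed
   also have "... = (\<Sum>t\<le>max N (ks i). single (\<Sum>v\<in>Vi i. single v 1) 1 ^ t * ct {..<N} t (%c c'. Const (\<sigma> i * wm N (es i) c c')))"
    by (rule D_ct_bound) simp_all
   also have "... = (\<Sum>t\<le>max N (ks i). single (\<Sum>v\<in>Vi i. single v t) (\<sigma> i ^ t * ?c t i))" proof (rule sum.cong[OF refl])
    fix t
    have "ct {..<N} t (%c c'. Const (\<sigma> i * wm N (es i) c c') :: 'a xy_poly) = Const (\<sigma> i ^ t * ?c t i)"
     by (simp add: ct_hom[OF Const_hom, symmetric] ct_scale)
    thus "single (\<Sum>v\<in>Vi i. single v 1) 1 ^ t * ct {..<N} t (%c c'. Const (\<sigma> i * wm N (es i) c c')) =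
     (single (\<Sum>v\<in>Vi i. single v t) (\<sigma> i ^ t * ?c t i) :: 'a xy_poly)"
     unfolding single_mult_sum[symmetric] by (simp add: Const_def mult_single)
   qed
   finally show "D (Bl i) ?M = (\<Sum>t\<le>max N (ks i). single (\<Sum>v\<in>Vi i. single v t) (\<sigma> i ^ t * ?c t i))" .
  qed
  also have "... = (\<Sum>g\<in>?P. single (?s g) (?p g))" by (subst prod_sum_PiE) (simp_all add: prod_single)
  finally have E: "EE d W m N = (\<Sum>g\<in>?P. (?p g) when (?s g) = m)" by (simp add: lookup_sum lookup_single)
  have uniq: "(?s g) = m <-> (\<forall>i<h. g i = ks i)" for g proof
   assume eq: "(?s g) = m"
   have l: "lookup (?s g) (Y j 0) = g j" if j: "j < h" for g j proof -
    have l0: "0 < length (es j)" using e(1)[OF j] by simp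
    have mem: "Y j 0 \<in> Vi i <-> i = j" if "i < h" for i using that j l0 rinj[OF inC inC] by (auto simp: Vi_def Y_def X_def)
    have fV: "finite (Vi i)" for i by (simp add: Vi_def)
    have "lookup (?s g) (Y j 0) = (\<Sum>i<h. if i = j then g i else 0)"
     unfolding lookup_sum lookup_single by (rule sum.cong) (use mem fV in "auto simp: when_def sum.delta")
    thus ?thesis using j by (simp add: sum.delta)
   qed
   show "\<forall>i<h. g i = ks i" proof (intro allI impI)
    fix i assume i: "i < h"
    have "g i = lookup m (Y i 0)" by (simp only: l[OF i, of g, symmetric] eq)
    also have "... = ks i" unfolding m_def by (rule l[OF i])
    finally show "g i = ks i" .
   qed
  qed (simp add: m_def)
  have "EE d W m N = (\<Sum>g\<in>?P. if g = restrict ks {..<h} then \<Prod>i<h. \<sigma> i ^ ks i * ct {..<N} (ks i) (wm N (es i)) else 0)"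
   unfolding E uniq proof (rule sum.cong[OF refl])
   fix g assume g: "g \<in> ?P"
   have "g = restrict ks {..<h} <-> (\<forall>i<h. g i = ks i)" using g by (auto simp: fun_eq_iff PiE_iff extensional_def)
   thus "((?p g) when (\<forall>i<h. g i = ks i)) = (if g = restrict ks {..<h} then \<Prod>i<h. \<sigma> i ^ ks i * ct {..<N} (ks i) (wm N (es i)) else 0)"
    by (auto simp: when_def)
  qed
  moreover have "restrict ks {..<h} \<in> ?P" by auto
  moreover have "finite (?P)" by (intro finite_PiE) auto
  ultimately show ?thesis by (simp add: sum.delta)
 qed
 interpret c: comm_ring_hom "Const :: 'a => 'a gen_poly" by (rule Const_hom)
 have "(\<Prod>i<h. ct {..<N} (ks i) (wm N (es i))) = Const (\<Prod>i<h. ((- 1) ^ (length (es i) - 1)) ^ ks i :: 'a) * EE d W m N" for N proof -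
  have "Const (\<Prod>i<h. ((- 1) ^ (length (es i) - 1)) ^ ks i :: 'a) = (\<Prod>i<h. \<sigma> i ^ ks i)"
   by (simp add: \<sigma>_def c.hom_prod Const_simps)
  moreover have "\<sigma> i ^ ks i * (\<sigma> i ^ ks i * x) = x" for i x proof -
   have "\<sigma> i ^ ks i * \<sigma> i ^ ks i = ((\<sigma> i)^2) ^ ks i" by (simp add: power2_eq_square power_mult_distrib)
   also have "(\<sigma> i)^2 = 1" by (simp add: \<sigma>_def flip: power_mult)
   finally show ?thesis by (simp flip: mult.assoc)
  qed
  ultimately show ?thesis unfolding val by (simp add: prod.distrib[symmetric])
 qed
 thus ?thesis using deg by blast
qed

section \<open>Canonical fillings\<close>

definition cm :: "(nat => nat => nat) => nat => nat => nat" where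
 "cm T j b = (\<Sum>b'<b. T j b')"

definition lt :: "(nat => nat => nat) => nat => nat => nat => bool" where
 "lt T j c b <-> cm T j b <= c & c < cm T j (Suc b)"

lemma cm_mono: "b <= b' ==> cm T j b <= cm T j b'" unfolding cm_def by (rule sum_mono2) auto

lemma lt_unique: "lt T j c b ==> lt T j c b' ==> b = b'"
proof (rule ccontr)
 assume h: "lt T j c b" "lt T j c b'" "b ~= b'"
 then consider "Suc b <= b'" | "Suc b' <= b" by linarith
 thus False using h cm_mono[of "Suc b" b' T j] cm_mono[of "Suc b'" b T j] by cases (auto simp: lt_def)
qed

lemma lt_exists_iff: "(\<exists>b'<b. lt T j c b') <-> c < cm T j b"
proof
 assume "\<exists>b'<b. lt T j c b'"
 then obtain b' where b': "b' < b" "lt T j c b'" by blast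
 thus "c < cm T j b" using cm_mono[of "Suc b'" b T j] by (auto simp: lt_def)
next
 assume "c < cm T j b"
 thus "\<exists>b'<b. lt T j c b'" proof (induction b)
  case (Suc b)
  show ?case proof (cases "c < cm T j b")
   case True
   thus ?thesis using Suc.IH less_SucI by blast
  next
   case False
   hence "lt T j c b" using Suc.prems by (simp add: lt_def)
   thus ?thesis by blast
  qed
 qed (simp add: cm_def)
qed

lemma sum_lt: "(\<Sum>b'<b. of_bool (lt T j c b')) = (of_bool (c < cm T j b) :: nat)"
proof (cases "c < cm T j b")
 case True
 then obtain b0 where b0: "b0 < b" "lt T j c b0" unfolding lt_exists_iff[symmetric] by blast
 have "(\<Sum>b'<b. of_bool (lt T j c b') :: nat) = (\<Sum>b'<b. if b' = b0 then 1 else 0)" by (rule sum.cong) (use b0 lt_unique in auto)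
 thus ?thesis using b0 True by (simp add: sum.delta)
next
 case False
 hence "~ lt T j c b'" if "b' < b" for b' using that lt_exists_iff[of b T j c] by blast
 thus ?thesis using False by simp
qed

lemma lattice_sequences: fixes a e g :: "nat => nat"
 assumes ae: "!!j. a j <= e j" and eg: "!!j. e j <= g j" and r1: "!!j. e (Suc j) <= a j" and r2: "!!j. g (Suc j) <= e j"
  and col: "!!j. (\<Sum>i\<le>j. g i - e i) <= (\<Sum>i<j. e i - a i)"
 shows "(\<Sum>j<W. g j - max (e j) C) <= (\<Sum>j<W. e j - max (a j) C)"
proof (cases "\<exists>j<W. C < g j")
 case False
 hence "(\<Sum>j<W. g j - max (e j) C) = 0" by auto
 thus ?thesis by simp
next
 case True
 define J where "J = Max {j. j < W & C < g j}"
 have fin: "finite {j. j < W & C < g j}" by simp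
 have J: "J < W" "C < g J" using Max_in[OF fin] True by (auto simp: J_def)
 have Jmax: "g j <= C" if "J < j" "j < W" for j proof (rule ccontr)
  assume "~ g j <= C"
  hence "j <= J" unfolding J_def using that by (intro Max_ge[OF fin]) auto
  thus False using that by simp
 qed
 have gdec: "g j <= g i" if "i <= j" for i j using that proof (induction j)
  case (Suc j)
  thus ?case using r2[of j] eg[of j] by (cases "i = Suc j") (auto intro: order_trans)
 qed simp
 have eC: "C < e i" if "i < J" for i using r2[of i] gdec[of "Suc i" J] that J by linarith
 have aC: "C < a i" if "Suc i < J" for i using r1[of i] eC[of "Suc i"] that by linarith
 have "(\<Sum>j<W. g j - max (e j) C) = (\<Sum>j<Suc J. g j - max (e j) C)" proof (rule sum.mono_neutral_right)
  show "\<forall>i\<in>{..<W} - {..<Suc J}. g i - max (e i) C = 0" proof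
   fix i assume "i \<in> {..<W} - {..<Suc J}"
   hence "g i <= C" by (intro Jmax) auto
   thus "g i - max (e i) C = 0" by simp
  qed
 qed (use J in auto)
 also have "... = (\<Sum>j<J. g j - e j) + (g J - max (e J) C)" using eC by (simp add: max_def) (intro sum.cong refl, auto dest: eC)
 finally have B: "(\<Sum>j<W. g j - max (e j) C) = (\<Sum>j<J. g j - e j) + (g J - max (e J) C)" .
 have A: "(\<Sum>j<J. e j - max (a j) C) <= (\<Sum>j<W. e j - max (a j) C)" by (rule sum_mono2) (use J in auto)
 show ?thesis proof (cases "J = 0 \<or> C <= a (J - 1)")
  case True
  have "C <= a j" if "j < J" for j using True that aC[of j] by (cases "Suc j = J") auto
  hence "(\<Sum>j<J. e j - max (a j) C) = (\<Sum>j<J. e j - a j)" by (intro sum.cong) (auto simp: max_absorb1)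
  moreover have "(\<Sum>j<J. g j - e j) + (g J - max (e J) C) <= (\<Sum>j\<le>J. g j - e j)" by (simp flip: lessThan_Suc_atMost)
  ultimately show ?thesis using A B col[of J] by linarith
 next
  case False
  then obtain J' where J': "J = Suc J'" "a J' < C" by (cases J) auto
  have eJ: "e J < C" using r1[of J'] J' by simp
  have "(\<Sum>j<J'. e j - max (a j) C) = (\<Sum>j<J'. e j - a j)" by (intro sum.cong refl) (use aC J' in "force simp: max_def")
  hence "(\<Sum>j<J. e j - max (a j) C) = (\<Sum>j<J'. e j - a j) + (e J' - C)" using J' by (simp add: max_def)
  moreover have "(\<Sum>j<J. g j - e j) = (\<Sum>j\<le>J'. g j - e j)" by (simp add: J'(1) lessThan_Suc_atMost)
  moreover have "g J - max (e J) C <= e J' - C" using eJ r2[of J'] J' by (simp add: max_def)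
  ultimately show ?thesis using A B col[of J'] by linarith
 qed
qed

context
 fixes d W n :: nat
begin

definition MT :: "(nat => nat => nat) => nat => nat => nat" where
 "MT T b C = (\<Sum>j<W. cm T j (Suc b) - max (cm T j b) C)"

definition LRT :: "(nat => nat => nat) => bool" where
 "LRT T <-> (\<forall>j b. W <= j \<or> d * W <= b --> T j b = 0) & (\<forall>j b. cm T (Suc j) (Suc b) <= cm T j b) &
   (\<forall>b j. Suc b div W = b div W --> (\<Sum>i\<le>j. T i (Suc b)) <= (\<Sum>i<j. T i b)) & (\<forall>j. cm T j (d * W) <= n)"

definition can :: "(nat => nat => nat) => nat => nat => (nat \<times> nat) option" where
 "can T j c = (if \<exists>b. lt T j c b then Some (THE b. lt T j c b, MT T (THE b. lt T j c b) (Suc c)) else None)"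

lemma can_lt: "can T j c = Some (b, q) <-> lt T j c b & q = MT T b (Suc c)"
proof -
 have "(THE b. lt T j c b) = b" if "lt T j c b" for b by (rule the_equality) (use that lt_unique in auto)
 thus ?thesis unfolding can_def by auto
qed

lemma MT_step: "MT T b C = MT T b (Suc C) + (\<Sum>j<W. of_bool (lt T j C b))"
proof -
 have "cm T j (Suc b) - max (cm T j b) C = (cm T j (Suc b) - max (cm T j b) (Suc C)) + of_bool (lt T j C b)" for j by (auto simp: lt_def max_def)
 thus ?thesis unfolding MT_def by (simp add: sum.distrib)
qed

lemma MT_antimono: "C <= C' ==> MT T b C' <= MT T b C" unfolding MT_def by (rule sum_mono) auto

lemma MT_0: "MT T b 0 = (\<Sum>j<W. T j b)" by (simp add: MT_def cm_def)

definition colset :: "(nat => nat => nat) => nat => nat => bool" where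
 "colset T c b <-> (\<exists>j<W. lt T j c b)"

context
 fixes T :: "nat => nat => nat" assumes T: "LRT T"
begin

lemma T_zero: "W <= j \<or> d * W <= b ==> T j b = 0" and T_row: "cm T (Suc j) (Suc b) <= cm T j b"
 and T_col: "Suc b div W = b div W ==> (\<Sum>i\<le>j. T i (Suc b)) <= (\<Sum>i<j. T i b)" and T_n: "cm T j (d * W) <= n"
 using T unfolding LRT_def by blast+

lemma lt_bounds: assumes "lt T j c b" shows "j < W" "b < d * W" "c < n"
proof -
 have "T j b ~= 0" using assms by (auto simp: lt_def cm_def)
 thus "j < W" "b < d * W" using T_zero by (meson not_le)+
 hence "cm T j (Suc b) <= cm T j (d * W)" by (intro cm_mono) simp
 thus "c < n" using assms T_n[of j] by (simp add: lt_def)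
qed

lemma T_strict: "i < j ==> cm T j (Suc b) <= cm T i b"
proof (induction j)
 case (Suc j)
 thus ?case using T_row[of j b] cm_mono[of b "Suc b" T j] by (cases "i = j") auto
qed simp

lemma lt_row_unique: "lt T i c b ==> lt T j c b ==> i = j"
proof (rule ccontr)
 assume h: "lt T i c b" "lt T j c b" "i ~= j"
 then consider "i < j" | "j < i" by linarith
 thus False using h T_strict[of i j b] T_strict[of j i b] by cases (auto simp: lt_def)
qed

lemma lt_column_less: "lt T i c b ==> lt T j c b' ==> b < b' ==> i < j"
proof (rule ccontr)
 assume h: "lt T i c b" "lt T j c b'" "b < b'" "~ i < j"
 have "cm T i (Suc b) <= cm T j b'" proof (cases "i = j")
  case True
  thus ?thesis using h cm_mono[of "Suc b" b' T j] by simp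
 next
  case False
  thus ?thesis using h T_strict[of j i b] cm_mono[of b b' T j] by simp
 qed
 thus False using h by (simp add: lt_def)
qed

lemma sum_lt_rows: "(\<Sum>j<W. of_bool (lt T j c b)) = (of_bool (colset T c b) :: nat)"
proof (cases "colset T c b")
 case True
 then obtain j where j: "j < W" "lt T j c b" by (auto simp: colset_def)
 have "(\<Sum>j<W. of_bool (lt T j c b) :: nat) = (\<Sum>i<W. if i = j then 1 else 0)" by (rule sum.cong) (use j lt_row_unique in auto)
 thus ?thesis using j True by (simp add: sum.delta)
qed (auto simp: colset_def)

lemma MT_colset: "MT T b c = MT T b (Suc c) + of_bool (colset T c b)" unfolding MT_step[of T b c] sum_lt_rows ..

lemma MT_n: "n <= C ==> MT T b C = 0"
proof (cases "b < d * W")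
 case True
 assume C: "n <= C"
 have "cm T j (Suc b) <= C" for j using cm_mono[of "Suc b" "d * W" T j] T_n[of j] True C by linarith
 hence "cm T j (Suc b) - max (cm T j b) C = 0" for j by (simp add: le_max_iff_disj)
 thus ?thesis by (simp add: MT_def)
next
 case False
 thus ?thesis using T_zero by (simp add: MT_def cm_def)
qed

lemma MT_le: "MT T b C <= W * n"
proof -
 have "MT T b C <= (\<Sum>j<W. n)" unfolding MT_def proof (rule sum_mono)
  fix j
  have "cm T j (Suc b) - cm T j b <= n" proof (cases "b < d * W")
   case True
   thus ?thesis using cm_mono[of "Suc b" "d * W" T j] T_n[of j] by linarith
  qed (simp add: cm_def T_zero)
  thus "cm T j (Suc b) - max (cm T j b) C <= n" by linarith
 qed
 thus ?thesis by simp
qed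

lemma lattice_step: "Suc b div W = b div W ==> MT T (Suc b) C <= MT T b C" unfolding MT_def
proof (rule lattice_sequences)
 assume cl: "Suc b div W = b div W"
 show "(\<Sum>i\<le>j. cm T i (Suc (Suc b)) - cm T i (Suc b)) <= (\<Sum>i<j. cm T i (Suc b) - cm T i b)" for j
  using T_col[OF cl, of j] by (simp add: cm_def)
qed (auto simp: T_row intro: cm_mono)

lemma lattice: "b <= b' ==> b div W = b' div W ==> MT T b' C <= MT T b C"
proof (induction b')
 case (Suc b')
 show ?case proof (cases "b = Suc b'")
  case False
  hence le: "b <= b'" using Suc.prems by simp
  hence "b div W <= b' div W" "b' div W <= Suc b' div W" by (simp_all add: div_le_mono)
  hence "b div W = b' div W" "Suc b' div W = b' div W" using Suc.prems by simp_all
  thus ?thesis using Suc.IH[OF le] lattice_step[of b' C] by simp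
 qed simp
qed simp

lemma can_injective: assumes "can T j c = Some x" "can T j' c' = Some x" shows "j = j' & c = c'"
proof -
 obtain b q where x: "x = (b, q)" by (cases x)
 have h: "lt T j c b" "lt T j' c' b" "MT T b (Suc c) = MT T b (Suc c')" using assms by (auto simp: x can_lt)
 have lt: "MT T b (Suc c2) < MT T b (Suc c1)" if "c1 < c2" "lt T i c2 b" for c1 c2 i proof -
  have "colset T c2 b" using that(2) lt_bounds(1)[OF that(2)] by (auto simp: colset_def)
  hence "MT T b c2 = Suc (MT T b (Suc c2))" by (simp add: MT_colset[of b c2])
  moreover have "MT T b c2 <= MT T b (Suc c1)" using that(1) by (intro MT_antimono) simp
  ultimately show ?thesis by simp
 qed
 have "c = c'" using lt[of c c' j'] lt[of c' c j] h by (metis linorder_neqE_nat less_irrefl)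
 thus ?thesis using h lt_row_unique by blast
qed

lemma can_label_exists: assumes "q < MT T b C" shows "\<exists>c j. C <= c & can T j c = Some (b, q)"
proof -
 have "\<exists>c\<ge>C. MT T b (Suc c) <= q & q < MT T b c" proof (rule ccontr)
  assume neg: "~ ?thesis"
  have "q < MT T b (C + k)" for k proof (induction k)
   case (Suc k)
   thus ?case using neg by (metis add_Suc_right le_add1 not_le)
  qed (use assms in simp)
  hence "q < MT T b (C + n)" .
  thus False using MT_n[of "C + n" b] by simp
 qed
 then obtain c where c: "C <= c" "MT T b (Suc c) <= q" "q < MT T b c" by blast
 hence "colset T c b" "q = MT T b (Suc c)" using MT_colset[of b c] by (auto split: if_splits simp: of_bool_def)
 thus ?thesis using c(1) by (auto simp: colset_def can_lt)
qed

lemma can_label_bound: "can T j c = Some (b, q) ==> q < MT T b 0"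
proof -
 assume "can T j c = Some (b, q)"
 hence h: "lt T j c b" "q = MT T b (Suc c)" by (auto simp: can_lt)
 hence "colset T c b" using lt_bounds(1) by (auto simp: colset_def)
 hence "q < MT T b c" using h MT_colset[of b c] by simp
 thus ?thesis using MT_antimono[of 0 c T b] by simp
qed

lemma T_count: "(\<Sum>c<n. of_bool (lt T j c b)) = T j b"
proof -
 have "{c \<in> {..<n}. lt T j c b} = {cm T j b..<cm T j (Suc b)}" using lt_bounds(3) by (auto simp: lt_def)
 hence "card {c \<in> {..<n}. lt T j c b} = T j b" by (simp add: cm_def)
 thus ?thesis by (simp add: sum.inter_filter[symmetric] of_bool_def)
qed

lemma rank_column: assumes "lt T j c b" shows "(\<Sum>b'<b. of_bool (colset T c b')) = j"
proof -
 have "(\<Sum>b'<b. of_bool (colset T c b') :: nat) = (\<Sum>b'<b. \<Sum>i<W. of_bool (lt T i c b'))" by (simp only: sum_lt_rows)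
 also have "... = (\<Sum>i<W. \<Sum>b'<b. of_bool (lt T i c b'))" by (rule sum.swap)
 also have "... = (\<Sum>i<W. of_bool (i < j))" proof (rule sum.cong[OF refl])
  fix i
  have "c < cm T i b <-> i < j" proof
   assume "i < j"
   thus "c < cm T i b" using T_strict[of i j b] assms by (simp add: lt_def)
  next
   assume "c < cm T i b"
   show "i < j" proof (rule ccontr)
    assume "~ i < j"
    hence "cm T i b <= cm T j b" using T_strict[of j i b] cm_mono[of b "Suc b" T i] by (cases "i = j") auto
    thus False using `c < cm T i b` assms by (simp add: lt_def)
   qed
  qed
  thus "(\<Sum>b'<b. of_bool (lt T i c b')) = (of_bool (i < j) :: nat)" unfolding sum_lt by simp
 qed
 also have "... = card {i \<in> {..<W}. i < j}" by (simp add: sum.inter_filter[symmetric] of_bool_def)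
 also have "{i \<in> {..<W}. i < j} = {..<j}" using lt_bounds(1)[OF assms] by auto
 finally show ?thesis by simp
qed

end

definition cst :: "(nat \<times> nat) option => nat" where
 "cst x = (case x of None => 0 | Some (b, q) => q + Suc (W * n) * (d - b div W))"

definition filling :: "(nat => nat => nat) => (nat => nat => (nat \<times> nat) option) => bool" where
 "filling T f <-> (\<forall>j j' c c' x. j < W --> j' < W --> c < n --> c' < n --> f j c = Some x --> f j' c' = Some x --> j = j' & c = c') &
   (\<forall>j b. j < W --> (\<Sum>c<n. of_bool (\<exists>q. f j c = Some (b, q))) = T j b) & (\<forall>j c b q. j < W --> c < n --> f j c = Some (b, q) --> b < d * W)"

lemma column_cost: assumes T: "LRT T" and f: "filling T f" and c: "c < n"
  and agree: "!!j c'. j < W ==> c < c' ==> c' < n ==> f j c' = can T j c'"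
  and ne: "\<exists>j<W. f j c ~= can T j c"
 shows "(\<Sum>j<W. cst (can T j c)) < (\<Sum>j<W. cst (f j c))"
proof -
 let ?h = "%j c b. \<exists>q. f j c = Some (b, q)"
 have inj: "j = j' & c1 = c2" if "j < W" "j' < W" "c1 < n" "c2 < n" "f j c1 = Some x" "f j' c2 = Some x" for j j' c1 c2 x
  using f that unfolding filling_def by blast
 have cnt: "(\<Sum>c<n. of_bool (?h j c b)) = T j b" if "j < W" for j b using f that unfolding filling_def by blast
 have fB: "b < d * W" if "j < W" "c < n" "f j c = Some (b, q)" for j c b q using f that unfolding filling_def by blast
 have cl: "(\<exists>q. can T j c' = Some (b, q)) <-> lt T j c' b" for j c' b by (auto simp: can_lt)
 have cnt': "(\<Sum>c'\<le>c. of_bool (?h j c' b)) = (\<Sum>c'\<le>c. of_bool (lt T j c' b) :: nat)" if j: "j < W" for j b proof -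
  have sp: "(\<Sum>c'<n. h c') = (\<Sum>c'\<le>c. h c') + (\<Sum>c'\<in>{Suc c..<n}. h c')" for h :: "nat => nat" proof -
   have e: "{..<n} = {..c} Un {Suc c..<n}" using c by auto
   show ?thesis unfolding e by (rule sum.union_disjoint) auto
  qed
  have "(\<Sum>c'\<in>{Suc c..<n}. of_bool (?h j c' b)) = (\<Sum>c'\<in>{Suc c..<n}. of_bool (lt T j c' b) :: nat)"
   by (rule sum.cong) (use agree[OF j] cl in "simp_all add: Suc_le_eq")
  thus ?thesis using cnt[OF j, of b] T_count[OF T, of j b] unfolding sp[of "%c. of_bool (?h j c b)"] sp[of "%c. of_bool (lt T j c b)"] by linarith
 qed
 have low: "MT T b (Suc c) <= q" if "j < W" "f j c = Some (b, q)" for j b q proof (rule ccontr)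
  assume "~ MT T b (Suc c) <= q"
  hence "q < MT T b (Suc c)" by simp
  then obtain c1 j1 where c1: "Suc c <= c1" "can T j1 c1 = Some (b, q)" using can_label_exists[OF T, of q b "Suc c"] by blast
  have bd: "j1 < W" "c1 < n" using c1(2) lt_bounds[OF T, of j1 c1 b] by (auto simp: can_lt)
  hence "f j1 c1 = Some (b, q)" using agree[of j1 c1] c1 by simp
  thus False using inj[OF that(1) bd(1) c bd(2) that(2)] c1(1) by auto
 qed
 have row: "\<exists>b' q'. f j c = Some (b', q') & b' <= b" if j: "j < W" and b: "lt T j c b" for j b proof -
  have fc: "f j c ~= None" proof
   assume N: "f j c = None"
   have one: "(\<Sum>b<d * W. of_bool (?h j c' b)) <= (of_bool (c' ~= c) :: nat)" for c' proof (cases "f j c'")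
    case (Some x)
    obtain b0 q0 where x: "x = (b0, q0)" by (cases x)
    have "(\<Sum>b<d * W. of_bool (?h j c' b) :: nat) = (\<Sum>b<d * W. if b = b0 then 1 else 0)" by (rule sum.cong) (auto simp: Some x)
    also have "... <= 1" by (simp add: sum.delta)
    finally show ?thesis using Some N by auto
   qed simp
   have "(\<Sum>b<d * W. \<Sum>c'\<le>c. of_bool (?h j c' b) :: nat) = (\<Sum>c'\<le>c. \<Sum>b<d * W. of_bool (?h j c' b))" by (rule sum.swap)
   also have "... <= (\<Sum>c'\<le>c. of_bool (c' ~= c))" by (rule sum_mono) (rule one)
   also have "... = card {c' \<in> {..c}. c' ~= c}" by (simp add: sum.inter_filter[symmetric] of_bool_def)
   also have "{c' \<in> {..c}. c' ~= c} = {..<c}" by auto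
   finally have le: "(\<Sum>b<d * W. \<Sum>c'\<le>c. of_bool (?h j c' b) :: nat) <= c" by simp
   have "(\<Sum>b<d * W. \<Sum>c'\<le>c. of_bool (?h j c' b) :: nat) = (\<Sum>b<d * W. \<Sum>c'\<le>c. of_bool (lt T j c' b))"
    by (simp only: cnt'[OF j])
   also have "... = (\<Sum>c'\<le>c. \<Sum>b<d * W. of_bool (lt T j c' b))" by (rule sum.swap)
   also have "... = (\<Sum>c'\<le>c. 1)" proof (rule sum.cong[OF refl])
    fix c' assume "c' \<in> {..c}"
    moreover have "c < cm T j (d * W)" using b lt_bounds(2)[OF T b] cm_mono[of "Suc b" "d * W" T j] by (simp add: lt_def)
    ultimately show "(\<Sum>b<d * W. of_bool (lt T j c' b)) = (1 :: nat)" unfolding sum_lt by simp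
   qed
   finally show False using le by simp
  qed
  then obtain b' q' where f': "f j c = Some (b', q')" by auto
  have "1 <= (\<Sum>c'\<le>c. of_bool (\<exists>q. f j c' = Some (b', q)) :: nat)"
   using member_le_sum[of c "{..c}" "%c'. of_bool (\<exists>q. f j c' = Some (b', q)) :: nat"] f' by simp
  hence s0: "(\<Sum>c'\<le>c. of_bool (lt T j c' b') :: nat) ~= 0" using cnt'[OF j, of b'] by linarith
  have "\<exists>c'\<le>c. lt T j c' b'" proof (rule ccontr)
   assume "~ ?thesis"
   hence "(\<Sum>c'\<le>c. of_bool (lt T j c' b') :: nat) = 0" by (intro sum.neutral) auto
   thus False by (rule notE[OF s0])
  qed
  then obtain c' where "c' <= c" "lt T j c' b'" by blast
  hence "cm T j b' <= c" by (simp add: lt_def)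
  hence "b' <= b" using b cm_mono[of "Suc b" b' T j] by (cases "b' <= b") (auto simp: lt_def)
  thus ?thesis using f' by blast
 qed
 have kd: "b div W < d" if "b < d * W" for b using that by (metis less_mult_imp_div_less)
 have trm: "cst (can T j c) <= cst (f j c) & (cst (can T j c) = cst (f j c) --> (case can T j c of None => f j c = None
   | Some (b, q) => \<exists>b'. f j c = Some (b', MT T b' (Suc c)) & b' <= b & b' div W = b div W & MT T b' (Suc c) = MT T b (Suc c)))" if j: "j < W" for j
 proof (cases "can T j c")
  case None
  have "f j c = None" if z: "cst (f j c) = 0" proof (cases "f j c")
   case (Some x)
   obtain b q where x: "x = (b, q)" by (cases x)
   hence "b div W < d" using fB[OF j c] Some kd by blast
   thus ?thesis using z by (simp add: Some x cst_def)
  qed simp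
  thus ?thesis using None by (auto simp: cst_def)
 next
  case (Some x)
  obtain b q where x: "x = (b, q)" by (cases x)
  have b: "lt T j c b" "q = MT T b (Suc c)" using Some by (auto simp: x can_lt)
  obtain b' q' where f': "f j c = Some (b', q')" "b' <= b" using row[OF j b(1)] by blast
  have q': "MT T b' (Suc c) <= q'" by (rule low[OF j f'(1)])
  have qs: "q <= W * n" unfolding b(2) by (rule MT_le[OF T])
  have le: "b' div W <= b div W" using f'(2) by (rule div_le_mono)
  have bd: "b div W < d" by (rule kd[OF lt_bounds(2)[OF T b(1)]])
  show ?thesis proof (cases "b' div W = b div W")
   case True
   have "q <= MT T b' (Suc c)" unfolding b(2) by (rule lattice[OF T f'(2) True])
   thus ?thesis using q' True f' b by (auto simp: Some x cst_def)
  next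
   case False
   hence "Suc (d - b div W) <= d - b' div W" using le bd by linarith
   hence "Suc (W * n) * Suc (d - b div W) <= Suc (W * n) * (d - b' div W)" by (rule mult_le_mono2)
   hence "q + Suc (W * n) * (d - b div W) < q' + Suc (W * n) * (d - b' div W)" using qs by simp
   thus ?thesis unfolding Some x f'(1) cst_def by simp
  qed
 qed
 show ?thesis proof (rule ccontr)
  assume "~ ?thesis"
  hence ge: "(\<Sum>j<W. cst (f j c)) <= (\<Sum>j<W. cst (can T j c))" by simp
  have eq: "cst (can T j c) = cst (f j c)" if j: "j < W" for j proof (rule ccontr)
   assume "cst (can T j c) ~= cst (f j c)"
   hence "cst (can T j c) < cst (f j c)" using trm[OF j] by simp
   hence "(\<Sum>j<W. cst (can T j c)) < (\<Sum>j<W. cst (f j c))" by (intro sum_strict_mono_ex1) (use trm j in auto)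
   thus False using ge by simp
  qed
  have "f j c = can T j c" if "j < W" for j using that proof (induction j rule: less_induct)
   case (less j)
   show ?case proof (cases "can T j c")
    case None
    thus ?thesis using trm[OF less.prems] eq[OF less.prems] by simp
   next
    case (Some x)
    obtain b q where x: "x = (b, q)" by (cases x)
    have b: "lt T j c b" "q = MT T b (Suc c)" using Some by (auto simp: x can_lt)
    obtain b' where b': "f j c = Some (b', MT T b' (Suc c))" "b' <= b" "b' div W = b div W" "MT T b' (Suc c) = MT T b (Suc c)"
     using trm[OF less.prems] eq[OF less.prems] by (auto simp: Some x)
    have "b' = b" proof (rule ccontr)
     assume nb: "b' ~= b"
     have "colset T c b" using b less.prems by (auto simp: colset_def)
     hence "MT T b c = Suc (MT T b (Suc c))" using MT_colset[OF T, of b c] by simp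
     moreover have "MT T b c <= MT T b' c" by (rule lattice[OF T b'(2,3)])
     ultimately have "colset T c b'" using MT_colset[OF T, of b' c] b'(4) by (auto simp: of_bool_def split: if_splits)
     then obtain i where i: "i < W" "lt T i c b'" by (auto simp: colset_def)
     have ij: "i < j" by (rule lt_column_less[OF T i(2) b(1)]) (use nb b'(2) in simp)
     have "can T i c = Some (b', MT T b' (Suc c))" using i by (simp add: can_lt)
     hence "f i c = f j c" using less.IH[OF ij i(1)] b'(1) by simp
     thus False using inj[OF i(1) less.prems c c, of "(b', MT T b' (Suc c))"] b'(1) ij by simp
    qed
    thus ?thesis using b'(1) Some x b(2) by simp
   qed
  qed
  thus False using ne by blast
 qed
qed

definition keyl :: "(nat => nat => (nat \<times> nat) option) => nat list" where
 "keyl f = map (%c. \<Sum>j<W. cst (f j c)) (rev [0..<n])"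

lemma keyl_less: assumes T: "LRT T" and f: "filling T f" and ne: "\<exists>j<W. \<exists>c<n. f j c ~= can T j c" shows "keyl (can T) < keyl f"
proof -
 define Df where "Df = {c. c < n & (\<exists>j<W. f j c ~= can T j c)}"
 have fD: "finite Df" "Df ~= {}" using ne by (auto simp: Df_def)
 define c where "c = Max Df"
 have c: "c < n" "\<exists>j<W. f j c ~= can T j c" using Max_in[OF fD] by (auto simp: c_def Df_def)
 have ag: "f j c' = can T j c'" if "j < W" "c < c'" "c' < n" for j c' proof (rule ccontr)
  assume "f j c' ~= can T j c'"
  hence "c' \<in> Df" using that by (auto simp: Df_def)
  thus False using Max_ge[OF fD(1), of c'] that by (simp add: c_def)
 qed
 have lt: "(\<Sum>j<W. cst (can T j c)) < (\<Sum>j<W. cst (f j c))" by (rule column_cost[OF T f c(1) ag c(2)])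
 have sp: "rev [0..<n] = rev [Suc c..<n] @ c # rev [0..<c]" proof -
  have "[0..<n] = [0..<c] @ [c] @ [Suc c..<n]" using c(1) upt_add_eq_append[of 0 c "n - c"] by (simp add: upt_conv_Cons)
  thus ?thesis by simp
 qed
 have "map (%c. \<Sum>j<W. cst (can T j c)) (rev [Suc c..<n]) = map (%c. \<Sum>j<W. cst (f j c)) (rev [Suc c..<n])"
  by (rule map_cong[OF refl]) (auto intro!: sum.cong simp: ag)
 thus ?thesis unfolding keyl_def sp map_append list.map by (simp only: append_less_iff) (simp add: lt)
qed

lemma downclosed_eq: assumes "finite P" "finite P'" "card P = card P'" "P <= Lv" "P' <= Lv"
  "!!b b'. b \<in> P ==> b' \<in> Lv ==> b' < b ==> b' \<in> P" "!!b b'. b \<in> P' ==> b' \<in> Lv ==> b' < (b::nat) ==> b' \<in> P'"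
 shows "P = P'"
proof -
 have "P <= P' \<or> P' <= P" proof (rule ccontr)
  assume "~ ?thesis"
  then obtain b b' where "b \<in> P" "b \<notin> P'" "b' \<in> P'" "b' \<notin> P" by blast
  thus False using assms(4-7) by (metis in_mono linorder_neqE_nat)
 qed
 thus ?thesis using assms(1-3) card_subset_eq by metis
qed

lemma can_determines: assumes T: "LRT T" and T': "LRT T'"
  and eq: "!!k q c. c < n ==> (\<Sum>j<W. of_bool (\<exists>b. can T j c = Some (b, q) & b div W = k)) = (\<Sum>j<W. of_bool (\<exists>b. can T' j c = Some (b, q) & b div W = k) :: nat)"
 shows "T = T'"
proof -
 let ?e = "%T c k q b. b div W = k & MT T b (Suc c) = q"
 let ?h = "%T c k q j. \<exists>b. can T j c = Some (b, q) & b div W = k"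
 have cnt: "(\<Sum>j<W. of_bool (?h T c k q j)) = card {b. b < d * W & colset T c b & b div W = k & MT T b (Suc c) = q}"
  if T: "LRT T" for T k q c
 proof -
  have "of_bool (?h T c k q j) = (\<Sum>b<d * W. of_bool (lt T j c b) * of_bool (?e T c k q b) :: nat)" for j proof (cases "\<exists>b. lt T j c b")
   case True
   then obtain b0 where b0: "lt T j c b0" by blast
   have "(\<Sum>b<d * W. of_bool (lt T j c b) * of_bool (?e T c k q b) :: nat) = (\<Sum>b<d * W. if b = b0 then of_bool (b0 div W = k & MT T b0 (Suc c) = q) else 0)"
    by (rule sum.cong) (use b0 lt_unique in auto)
   also have "... = of_bool (b0 div W = k & MT T b0 (Suc c) = q)" using lt_bounds(2)[OF T b0] by (simp add: sum.delta)
   moreover have "lt T j c b <-> b = b0" for b using b0 lt_unique by blast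
   ultimately show ?thesis by (auto simp: can_lt)
  qed (auto simp: can_lt)
  hence "(\<Sum>j<W. of_bool (?h T c k q j)) = (\<Sum>j<W. \<Sum>b<d * W. of_bool (lt T j c b) * of_bool (?e T c k q b) :: nat)" by simp
  also have "... = (\<Sum>b<d * W. (\<Sum>j<W. of_bool (lt T j c b)) * of_bool (?e T c k q b))" unfolding sum_distrib_right by (rule sum.swap)
  also have "... = (\<Sum>b<d * W. of_bool (colset T c b & b div W = k & MT T b (Suc c) = q))"
   unfolding sum_lt_rows[OF T] by (rule sum.cong) auto
  also have "... = card {b \<in> {..<d * W}. colset T c b & b div W = k & MT T b (Suc c) = q}" by (simp add: sum.inter_filter[symmetric] of_bool_def)
  finally show ?thesis by simp
 qed
 have dc: "colset T c b'" if T: "LRT T" and "b < d * W" "colset T c b" "b' < b" "b' div W = b div W" "MT T b' (Suc c) = MT T b (Suc c)" for T b b' c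
 proof -
  have "MT T b c <= MT T b' c" using that by (intro lattice[OF T]) auto
  thus ?thesis using MT_colset[OF T, of b c] MT_colset[OF T, of b' c] that by (auto simp: of_bool_def split: if_splits)
 qed
 have step: "(\<forall>b. colset T c b = colset T' c b)" if h: "!!b. MT T b (Suc c) = MT T' b (Suc c)" and c: "c < n" for c proof
  fix b
  show "colset T c b = colset T' c b" proof (cases "b < d * W")
   case True
   let ?k = "b div W" and ?q = "MT T b (Suc c)"
   let ?P = "%T. {b. b < d * W & colset T c b & b div W = ?k & MT T b (Suc c) = ?q}"
   have "?P T = ?P T'" proof (rule downclosed_eq[where Lv = "{b. b < d * W & b div W = ?k & MT T b (Suc c) = ?q}"])
    show "card (?P T) = card (?P T')" using eq[OF c, of ?q ?k] unfolding cnt[OF T] cnt[OF T'] .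
    show "b' \<in> ?P T" if "b \<in> ?P T" "b' \<in> {b. b < d * W & b div W = ?k & MT T b (Suc c) = ?q}" "b' < b" for b b' using that dc[OF T, of b c b'] by auto
    show "b' \<in> ?P T'" if "b \<in> ?P T'" "b' \<in> {b. b < d * W & b div W = ?k & MT T b (Suc c) = ?q}" "b' < b" for b b' using that dc[OF T', of b c b'] h by auto
   qed (use h in auto)
   hence "b \<in> ?P T <-> b \<in> ?P T'" by (rule arg_cong)
   thus ?thesis using True h by auto
  next
   case False
   thus ?thesis using lt_bounds(2)[OF T] lt_bounds(2)[OF T'] by (auto simp: colset_def)
  qed
 qed
 have MTeq: "k <= n ==> MT T b (n - k) = MT T' b (n - k)" for k b proof (induction k arbitrary: b)
  case 0
  thus ?case using MT_n[OF T] MT_n[OF T'] by simp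
 next
  case (Suc k)
  have s: "Suc (n - Suc k) = n - k" using Suc.prems by simp
  have "MT T b (Suc (n - Suc k)) = MT T' b (Suc (n - Suc k))" for b unfolding s using Suc by simp
  thus ?case using step[of "n - Suc k"] Suc.prems MT_colset[OF T, of b "n - Suc k"] MT_colset[OF T', of b "n - Suc k"] by simp
 qed
 have col: "colset T c b = colset T' c b" if "c < n" for c b proof -
  have "MT T b (Suc c) = MT T' b (Suc c)" for b using MTeq[of "n - Suc c" b] that by simp
  thus ?thesis using step that by blast
 qed
 have half: "lt T' j c b" if T: "LRT T" and T': "LRT T'" and col: "!!c b. c < n ==> colset T c b = colset T' c b" and l: "lt T j c b" for T T' j c b
 proof -
  have c: "c < n" by (rule lt_bounds(3)[OF T l])
  have "colset T c b" using l lt_bounds(1)[OF T l] by (auto simp: colset_def)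
  then obtain j' where j': "lt T' j' c b" using col[OF c] by (auto simp: colset_def)
  have "j' = j" using rank_column[OF T l] rank_column[OF T' j'] col[OF c] by simp
  thus ?thesis using j' by simp
 qed
 have leq: "lt T j c b = lt T' j c b" for j c b using half[OF T T' col] half[OF T' T col[symmetric]] by blast
 show ?thesis proof (intro ext)
  fix j b
  have "T j b = (\<Sum>c<n. of_bool (lt T j c b))" by (rule T_count[OF T, symmetric])
  also have "... = (\<Sum>c<n. of_bool (lt T' j c b))" by (simp only: leq)
  also have "... = T' j b" by (rule T_count[OF T'])
  finally show "T j b = T' j b" .
 qed
qed

end

section \<open>Linear independence\<close>

lemma append_less_same_length: fixes u u' v v' :: "nat list" assumes "u < u'" "length u = length u'" shows "u @ v < u' @ v'"
proof -
 obtain p x y s t where "x < y" "u = p @ x # s" "u' = p @ y # t" using assms(1) unfolding list_less_cases using assms(2) by auto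
 hence "x < y" "u @ v = p @ x # (s @ v)" "u' @ v' = p @ y # (t @ v')" by simp_all
 thus ?thesis unfolding list_less_cases by blast
qed

lemma lookup_ev_Const: assumes "comm_ring_hom \<theta>" shows "lookup (ev (%x. Const (\<theta> x)) Var P) m = \<theta> (lookup P m)"
proof -
 interpret t: comm_ring_hom \<theta> by fact
 have "ev (%x. Const (\<theta> x)) Var P = (\<Sum>m\<in>keys P. single m (\<theta> (lookup P m)))"
  unfolding ev_def monoval_Var by (simp add: Const_def mult_single)
 thus ?thesis by (auto simp: lookup_sum lookup_single when_def in_keys_iff)
qed

text \<open>Positions in the Leibniz expansion: \<open>Inl (j, c)\<close> is a cell and \<open>Inr (b, q)\<close> the \<open>q\<close>-th copy of the letter \<open>b\<close>.\<close>

type_synonym pos = "(nat \<times> nat) + (nat \<times> nat)"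

definition kk :: "(bool => nat => nat => nat => nat => 'm::comm_monoid_add) => pos => pos => 'm" where
 "kk F z w = (case z of Inl (j, c) => (case w of Inr (b, q) => F True j c b q | Inl _ => 0)
   | Inr (b, q) => (case w of Inl (j, c) => F False j c b q | Inr _ => 0))"

definition sgc :: "pos => pos => 'a::comm_ring_1" where
 "sgc z w = (case z of Inl i => (case w of Inl i' => of_bool (i = i') | Inr _ => - 1)
   | Inr k => (case w of Inl _ => 1 | Inr k' => of_bool (k = k')))"

definition pT :: "(pos => pos) => nat => nat => (nat \<times> nat) option" where
 "pT p j c = (case p (Inl (j, c)) of Inr x => Some x | Inl _ => None)"

lemma pT_Some: "pT p j c = Some x <-> p (Inl (j, c)) = Inr x" by (auto simp: pT_def split: sum.splits)

definition Fx :: "nat => bool => nat => nat => nat => nat => (xyvar mon)" where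
 "Fx W s j c b q = single (s, j, b) 1"

definition Fu :: "nat => bool => nat => nat => nat => nat => (uvar mon)" where
 "Fu W s j c b q = single (s, b div W, q, c) 1"

context
 fixes d W n :: nat
begin

definition AA :: "(bool => nat => nat => nat => nat => 'm::comm_monoid_add) => bool => (nat => nat => (nat \<times> nat) option) => 'm" where
 "AA F s f = (\<Sum>j<W. \<Sum>c<n. case f j c of None => 0 | Some (b, q) => F s j c b q)"

definition ZZ :: "pos set" where
 "ZZ = ({..<W} \<times> {..<n}) <+> ({..<d * W} \<times> {..<W})"

lemma finite_ZZ: "finite ZZ" by (simp add: ZZ_def)

lemma sum_kk: assumes p: "p permutes ZZ" shows "(\<Sum>z\<in>ZZ. kk F z (p z)) = AA F True (pT p) + AA F False (pT (inv_into UNIV p))"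
proof -
 let ?I = "{..<W} \<times> {..<n}" and ?K = "{..<d * W} \<times> {..<W}"
 have fin: "finite ?I" "finite ?K" by auto
 define F0 where "F0 s = (%s'. if s' = s then F s' else (%_ _ _ _. 0))" for s
 have "(\<Sum>z\<in>ZZ. kk F z (p z)) = (\<Sum>z\<in>ZZ. kk (F0 True) z (p z)) + (\<Sum>z\<in>ZZ. kk (F0 False) z (p z))"
  unfolding sum.distrib[symmetric] by (rule sum.cong) (auto simp: kk_def F0_def split: sum.split)
 also have "(\<Sum>z\<in>ZZ. kk (F0 True) z (p z)) = AA F True (pT p)" proof -
  have "(\<Sum>k\<in>?I. kk (F0 True) (Inl k) (p (Inl k))) = AA F True (pT p)"
   unfolding AA_def sum.cartesian_product by (rule sum.cong) (auto simp: kk_def F0_def pT_def split: sum.splits)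
  moreover have "(\<Sum>k\<in>?K. kk (F0 True) (Inr k) (p (Inr k))) = 0" by (rule sum.neutral) (auto simp: kk_def F0_def split: sum.splits)
  ultimately show ?thesis unfolding ZZ_def sum_Plus[OF fin] by simp
 qed
 also have "(\<Sum>z\<in>ZZ. kk (F0 False) z (p z)) = (\<Sum>w\<in>ZZ. kk (F0 False) (inv_into UNIV p w) w)"
  using sum.permute[OF p, of "%w. kk (F0 False) (inv_into UNIV p w) w"] by (simp add: permutes_inverses[OF p] o_def)
 also have "... = AA F False (pT (inv_into UNIV p))" proof -
  have "(\<Sum>k\<in>?I. kk (F0 False) (inv_into UNIV p (Inl k)) (Inl k)) = AA F False (pT (inv_into UNIV p))"
   unfolding AA_def sum.cartesian_product by (rule sum.cong) (auto simp: kk_def F0_def pT_def split: sum.splits)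
  moreover have "(\<Sum>k\<in>?K. kk (F0 False) (inv_into UNIV p (Inr k)) (Inr k)) = 0"
   by (rule sum.neutral) (auto simp: kk_def F0_def split: sum.splits)
  ultimately show ?thesis unfolding ZZ_def sum_Plus[OF fin] by simp
 qed
 finally show ?thesis .
qed

lemma lookup_AA_Fx: assumes "j < W"
 shows "lookup (AA (Fx W) s' f) (s, j, b) = (if s' = s then \<Sum>c<n. of_bool (\<exists>q. f j c = Some (b, q)) else 0)"
proof -
 have "lookup (AA (Fx W) s' f) (s, j, b) = (\<Sum>j'<W. \<Sum>c<n. if j' = j then of_bool (s' = s & (\<exists>q. f j c = Some (b, q))) else 0)"
  unfolding AA_def lookup_sum by (intro sum.cong refl) (auto simp: Fx_def lookup_single when_def split: option.split)
 also have "... = (\<Sum>j'<W. if j' = j then \<Sum>c<n. of_bool (s' = s & (\<exists>q. f j c = Some (b, q))) else 0)"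
  by (rule sum.cong) auto
 also have "... = (\<Sum>c<n. of_bool (s' = s & (\<exists>q. f j c = Some (b, q))))" using assms by (simp add: sum.delta)
 finally show ?thesis by auto
qed

lemma lookup_AA_Fu: assumes "c < n"
 shows "lookup (AA (Fu W) s' f) (s, k, q, c) = (if s' = s then \<Sum>j<W. of_bool (\<exists>b. f j c = Some (b, q) & b div W = k) else 0)"
proof -
 have "lookup (AA (Fu W) s' f) (s, k, q, c) = (\<Sum>j<W. \<Sum>c'<n. if c' = c then of_bool (s' = s & (\<exists>b. f j c = Some (b, q) & b div W = k)) else 0)"
  unfolding AA_def lookup_sum by (intro sum.cong refl) (auto simp: Fu_def lookup_single when_def split: option.split)
 also have "... = (\<Sum>j<W. of_bool (s' = s & (\<exists>b. f j c = Some (b, q) & b div W = k)))" using assms by (simp add: sum.delta)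
 finally show ?thesis by auto
qed

lemma keyl_wt:
 "keyl d W n f = map (%c. wt (%(s', k, q, c'). of_bool (s' = s & c' = c) * (q + Suc (W * n) * (d - k))) (AA (Fu W) s f)) (rev [0..<n])"
proof -
 have "(\<Sum>j<W. cst d W n (f j c)) = wt (%(s', k, q, c'). of_bool (s' = s & c' = c) * (q + Suc (W * n) * (d - k))) (AA (Fu W) s f)" if c: "c < n" for c
 proof -
  have "wt (%(s', k, q, c'). of_bool (s' = s & c' = c) * (q + Suc (W * n) * (d - k))) (AA (Fu W) s f) = (\<Sum>j<W. \<Sum>c'<n. if c' = c then cst d W n (f j c) else 0)"
   unfolding AA_def wt_sum by (intro sum.cong refl) (auto simp: Fu_def cst_def split: option.split)
  thus ?thesis using c by (simp add: sum.delta)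
 qed
 thus ?thesis unfolding keyl_def by simp
qed

lemma wt_AA_other: "s' ~= s ==> wt (%(s'', k, q, c'). of_bool (s'' = s & c' = c) * g k q) (AA (Fu W) s' f) = 0"
 unfolding AA_def wt_sum by (intro sum.neutral ballI) (auto simp: Fu_def split: option.split)

lemma keyl_eq: assumes "AA (Fu W) True f + AA (Fu W) False g = AA (Fu W) True f' + AA (Fu W) False g'"
 shows "keyl d W n f = keyl d W n f'" "keyl d W n g = keyl d W n g'"
proof -
 have e: "wt om (AA (Fu W) True f) + wt om (AA (Fu W) False g) = wt om (AA (Fu W) True f') + wt om (AA (Fu W) False g')" for om
  unfolding wt_add[symmetric] assms ..
 note o = wt_AA_other[of _ _ _ "%k q. q + Suc (W * n) * (d - k)"]
 have "wt (%(s', k, q, c'). of_bool (s' = True & c' = c) * (q + Suc (W * n) * (d - k))) (AA (Fu W) True f) = wt (%(s', k, q, c'). of_bool (s' = True & c' = c) * (q + Suc (W * n) * (d - k))) (AA (Fu W) True f')" for c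
  using e[of "%(s', k, q, c'). of_bool (s' = True & c' = c) * (q + Suc (W * n) * (d - k))"] o[of False True c g] o[of False True c g'] by simp
 thus "keyl d W n f = keyl d W n f'" unfolding keyl_wt[of _ True] by simp
 have "wt (%(s', k, q, c'). of_bool (s' = False & c' = c) * (q + Suc (W * n) * (d - k))) (AA (Fu W) False g) = wt (%(s', k, q, c'). of_bool (s' = False & c' = c) * (q + Suc (W * n) * (d - k))) (AA (Fu W) False g')" for c
  using e[of "%(s', k, q, c'). of_bool (s' = False & c' = c) * (q + Suc (W * n) * (d - k))"] o[of True False c f] o[of True False c f'] by simp
 thus "keyl d W n g = keyl d W n g'" unfolding keyl_wt[of _ False] by simp
qed

lemma filling_pT: assumes p: "p permutes ZZ" and T: "!!j b. j < W ==> lookup (AA (Fx W) s (pT p)) (s, j, b) = T j b"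
 shows "filling d W n T (pT p)" unfolding filling_def
proof (intro conjI allI impI)
 fix j j' c c' x assume "pT p j c = Some x" "pT p j' c' = Some x"
 hence "p (Inl (j, c)) = p (Inl (j', c'))" by (simp add: pT_Some)
 hence "Inl (j, c) = (Inl (j', c') :: pos)" using permutes_inj[OF p] by (simp add: inj_eq)
 thus "j = j'" "c = c'" by auto
next
 fix j b assume j: "j < W"
 show "(\<Sum>c<n. of_bool (\<exists>q. pT p j c = Some (b, q))) = T j b" using T[OF j, of b] lookup_AA_Fx[OF j, of s "pT p" s b] by simp
next
 fix j c b q assume "j < W" "c < n" "pT p j c = Some (b, q)"
 hence "Inl (j, c) \<in> ZZ" "p (Inl (j, c)) = Inr (b, q)" by (auto simp: ZZ_def pT_Some)
 hence "Inr (b, q) \<in> ZZ" using permutes_in_image[OF p, of "Inl (j, c)"] by simp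
 thus "b < d * W" by (auto simp: ZZ_def)
qed

lemma perm_unique:
 assumes p: "p permutes ZZ" "p' permutes ZZ" and v: "!!z. z \<in> ZZ ==> sgc z (p z) ~= (0 :: 'a::comm_ring_1)" "!!z. z \<in> ZZ ==> sgc z (p' z) ~= (0 :: 'a)"
  and f: "!!j c. j < W ==> c < n ==> pT p j c = pT p' j c" and g: "!!j c. j < W ==> c < n ==> pT (inv_into UNIV p) j c = pT (inv_into UNIV p') j c"
 shows "p = p'"
proof
 fix z
 have half: "p z = p' z" if z: "z \<in> ZZ" "isl z <-> isl (p z)" and p: "p permutes ZZ" "p' permutes ZZ"
  and v: "!!z. z \<in> ZZ ==> sgc z (p z) ~= (0 :: 'a)" "!!z. z \<in> ZZ ==> sgc z (p' z) ~= (0 :: 'a)"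
  and f: "!!j c. j < W ==> c < n ==> pT p j c = pT p' j c" and g: "!!j c. j < W ==> c < n ==> pT (inv_into UNIV p) j c = pT (inv_into UNIV p') j c" for p p'
 proof -
  have pz: "p z = z" using v(1)[OF z(1)] z(2) by (auto simp: sgc_def split: sum.splits)
  have "isl (p' z) <-> isl z" proof (cases z)
   case (Inl i)
   hence "pT p (fst i) (snd i) = None" using pz by (simp add: pT_def)
   hence "pT p' (fst i) (snd i) = None" using f[of "fst i" "snd i"] z(1) Inl by (auto simp: ZZ_def)
   thus ?thesis using Inl by (auto simp: pT_def split: sum.splits)
  next
   case (Inr k)
   show ?thesis proof (rule ccontr)
    assume "isl (p' z) ~= isl z"
    then obtain i where i: "p' z = Inl i" using Inr by (cases "p' z") auto
    hence iZ: "Inl i \<in> ZZ" using permutes_in_image[OF p(2), of z] z(1) by simp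
    have "inv_into UNIV p' (Inl i) = z" using permutes_inverses(2)[OF p(2), of z] i by simp
    hence "pT (inv_into UNIV p') (fst i) (snd i) = Some k" by (simp add: pT_Some Inr)
    hence "pT (inv_into UNIV p) (fst i) (snd i) = Some k" using g[of "fst i" "snd i"] iZ by (cases i) (auto simp: ZZ_def)
    hence "inv_into UNIV p (Inl i) = Inr k" by (simp add: pT_Some)
    hence "p z = Inl i" using permutes_inverses(1)[OF p(1), of "Inl i"] Inr by simp
    thus False using pz Inr by simp
   qed
  qed
  hence "p' z = z" using v(2)[OF z(1)] by (auto simp: sgc_def split: sum.splits)
  thus ?thesis using pz by simp
 qed
 show "p z = p' z" proof (cases "z \<in> ZZ")
  case False
  thus ?thesis using p by (simp add: permutes_def)
 next
  case True
  consider "isl z <-> isl (p z)" | "isl z <-> isl (p' z)" | "isl z ~= isl (p z)" "isl z ~= isl (p' z)" by blast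
  thus ?thesis proof cases
   case 1
   thus ?thesis using half[OF True, of p p'] p v f g by blast
  next
   case 2
   thus ?thesis using half[OF True, of p' p] p v f g by metis
  next
   case 3
   show ?thesis proof (cases z)
    case (Inl i)
    then obtain k where k: "p z = Inr k" using 3 by (cases "p z") auto
    hence "pT p (fst i) (snd i) = Some k" using Inl by (simp add: pT_Some)
    hence "pT p' (fst i) (snd i) = Some k" using f[of "fst i" "snd i"] True Inl by (auto simp: ZZ_def)
    thus ?thesis using k Inl by (simp add: pT_Some)
   next
    case (Inr k)
    then obtain i where i: "p z = Inl i" using 3 by (cases "p z") auto
    hence iZ: "Inl i \<in> ZZ" using permutes_in_image[OF p(1), of z] True by simp
    have "inv_into UNIV p (Inl i) = z" using permutes_inverses(2)[OF p(1), of z] i by simp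
    hence "pT (inv_into UNIV p) (fst i) (snd i) = Some k" by (simp add: pT_Some Inr)
    hence "pT (inv_into UNIV p') (fst i) (snd i) = Some k" using g[of "fst i" "snd i"] iZ by (cases i) (auto simp: ZZ_def)
    hence "inv_into UNIV p' (Inl i) = Inr k" by (simp add: pT_Some)
    hence "p' z = Inl i" using permutes_inverses(1)[OF p(2), of "Inl i"] Inr by simp
    thus ?thesis using i by simp
   qed
  qed
 qed
qed

lemma perm_exists: assumes T: "LRT d W n T" and S: "LRT d W n S" and row: "!!j. cm T j (d * W) = cm S j (d * W)"
  and col: "!!b. MT W T b 0 = MT W S b 0" and small: "!!b. MT W T b 0 < W"
 obtains p where "p permutes ZZ" "!!z. sgc z (p z) ~= (0 :: 'a::field)" "pT p = can W T" "pT (inv_into UNIV p) = can W S"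
proof -
 have dom: "can W T j c = None <-> can W S j c = None" for j c proof -
  have "can W T j c = None <-> ~ c < cm T j (d * W)" if T: "LRT d W n T" for T proof -
   have "can W T j c = None <-> ~ (\<exists>b. lt T j c b)" by (auto simp: can_def)
   thus ?thesis unfolding lt_exists_iff[symmetric] using lt_bounds(2)[OF T] by blast
  qed
  from this[OF T] this[OF S] show ?thesis using row by simp
 qed
 have im: "(\<exists>j c. can W T j c = Some (b, q)) <-> q < MT W T b 0" if "LRT d W n T" for T b q
  using can_label_exists[OF that, of q b 0] can_label_bound[OF that] by blast
 have imS: "(\<exists>j c. can W T j c = Some k) <-> (\<exists>j c. can W S j c = Some k)" for k
  using im[OF T, of "fst k" "snd k"] im[OF S, of "fst k" "snd k"] col by simp
 have range: "j < W & c < n & b < d * W & q < W" if T: "LRT d W n T" and "!!b. MT W T b 0 < W" "can W T j c = Some (b, q)" for T j c b q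
 proof -
  have "lt T j c b" using that(3) by (simp add: can_lt)
  thus ?thesis using lt_bounds[OF T] can_label_bound[OF T that(3)] that(2)[of b] by (meson order_less_trans)
 qed
 have small': "MT W S b 0 < W" for b using small col by simp
 define p :: "pos => pos" where "p z = (case z of Inl (j, c) => (case can W T j c of Some x => Inr x | None => Inl (j, c))
  | Inr k => (if \<exists>j c. can W S j c = Some k then Inl (SOME (j, c). can W S j c = Some k) else Inr k))" for z
 have pl: "p (Inl (j, c)) = (case can W T j c of Some x => Inr x | None => Inl (j, c))" for j c by (simp add: p_def)
 have pr: "p (Inr k) = Inl (j, c)" if "can W S j c = Some k" for j c k proof -
  have "(SOME (j, c). can W S j c = Some k) = (j, c)" proof (rule some_equality)
   show "case (j, c) of (j, c) => can W S j c = Some k" using that by simp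
   fix x assume "case x of (j, c) => can W S j c = Some k"
   thus "x = (j, c)" using can_injective[OF S that] by (cases x) auto
  qed
  thus ?thesis using that by (auto simp: p_def)
 qed
 have pr0: "p (Inr k) = Inr k" if "!!j c. can W S j c ~= Some k" for k using that by (simp add: p_def)
 have id: "p z = z" if "z \<notin> ZZ" for z proof (cases z)
  case (Inl i)
  obtain j c where i: "i = (j, c)" by (cases i)
  have "can W T j c = None" using that range[OF T small] by (cases "can W T j c") (fastforce simp: Inl i ZZ_def)+
  thus ?thesis by (simp add: Inl i pl)
 next
  case (Inr k)
  have "can W S j c ~= Some k" for j c using that range[OF S small', of j c "fst k" "snd k"] by (cases k) (auto simp: Inr ZZ_def)
  thus ?thesis unfolding Inr by (rule pr0)
 qed
 have maps: "p z \<in> ZZ" if "z \<in> ZZ" for z proof (cases z)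
  case (Inl i)
  obtain j c where i: "i = (j, c)" by (cases i)
  show ?thesis proof (cases "can W T j c")
   case None
   thus ?thesis using that by (simp add: Inl i pl)
  next
   case (Some x)
   thus ?thesis using range[OF T small, of j c "fst x" "snd x"] by (cases x) (auto simp: Inl i pl ZZ_def)
  qed
 next
  case (Inr k)
  show ?thesis proof (cases "\<exists>j c. can W S j c = Some k")
   case True
   then obtain j c where "can W S j c = Some k" by blast
   thus ?thesis using range[OF S small', of j c "fst k" "snd k"] pr by (auto simp: Inr ZZ_def)
  next
   case False
   thus ?thesis using pr0 that by (simp add: Inr)
  qed
 qed
 have inj: "inj p" proof (rule injI)
  fix z w assume e: "p z = p w"
  have main: "z = w" if e: "p z = p w" and l: "isl z" for z w proof -
   obtain j c where z: "z = Inl (j, c)" using l by (cases z) auto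
   show ?thesis proof (cases "can W T j c")
    case None
    hence pw: "p w = Inl (j, c)" using e by (simp add: z pl)
    show ?thesis proof (cases w)
     case (Inl i)
     thus ?thesis using pw z by (cases i) (auto simp: pl split: option.splits)
    next
     case (Inr k)
     then obtain j' c' where jc: "can W S j' c' = Some k" using pw pr0[of k] by (metis Inl_Inr_False)
     hence "j' = j" "c' = c" using pr[OF jc] pw Inr by auto
     thus ?thesis using jc None dom by simp
    qed
   next
    case (Some x)
    hence pw: "p w = Inr x" using e by (simp add: z pl)
    show ?thesis proof (cases w)
     case (Inl i)
     obtain j' c' where i: "i = (j', c')" by (cases i)
     hence "can W T j' c' = Some x" using pw Inl by (auto simp: pl split: option.splits)
     thus ?thesis using can_injective[OF T Some] Inl i z by simp
    next
     case (Inr k)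
     have kn: "~ (\<exists>j c. can W S j c = Some k)" proof
      assume "\<exists>j c. can W S j c = Some k"
      then obtain j' c' where "can W S j' c' = Some k" by blast
      thus False using pr[of j' c' k] pw Inr by simp
     qed
     hence "k = x" using pr0[of k] pw Inr by auto
     thus ?thesis using kn imS Some by blast
    qed
   qed
  qed
  show "z = w" proof (cases "isl z \<or> isl w")
   case True
   thus ?thesis using main[OF e] main[OF e[symmetric]] by metis
  next
   case False
   then obtain k k' where k: "z = Inr k" "w = Inr k'" by (cases z; cases w) auto
   show ?thesis proof (cases "\<exists>j c. can W S j c = Some k")
    case True
    then obtain j c where jc: "can W S j c = Some k" by blast
    hence "p (Inr k') = Inl (j, c)" using pr e k by simp
    then obtain j' c' where jc': "can W S j' c' = Some k'" using pr0[of k'] by (metis Inl_Inr_False)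
    hence "j' = j" "c' = c" using pr[OF jc'] `p (Inr k') = Inl (j, c)` by auto
    thus ?thesis using jc jc' k by simp
   next
    case False
    hence "p (Inr k') = Inr k" using pr0[of k] e k by simp
    hence "~ (\<exists>j c. can W S j c = Some k')" using pr by fastforce
    thus ?thesis using pr0[of k'] `p (Inr k') = Inr k` k by simp
   qed
  qed
 qed
 have pp: "p permutes ZZ" proof (rule bij_imp_permutes)
  have "inj_on p ZZ" using inj by (rule inj_on_subset) simp
  moreover have "p ` ZZ = ZZ" by (rule endo_inj_surj[OF finite_ZZ]) (use maps calculation in auto)
  ultimately show "bij_betw p ZZ ZZ" by (simp add: bij_betw_def)
 qed (rule id)
 have sg: "sgc z (p z) ~= (0 :: 'a)" for z proof (cases z)
  case (Inl i)
  thus ?thesis by (cases i) (auto simp: pl sgc_def split: option.split)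
 next
  case (Inr k)
  show ?thesis proof (cases "\<exists>j c. can W S j c = Some k")
   case True
   then obtain j c where "can W S j c = Some k" by blast
   thus ?thesis using pr[of j c k] by (simp add: Inr sgc_def)
  next
   case False
   thus ?thesis using pr0[of k] by (simp add: Inr sgc_def)
  qed
 qed
 have fT: "pT p = can W T" by (intro ext) (simp add: pT_def pl split: option.split)
 have gS: "pT (inv_into UNIV p) = can W S" proof (intro ext)
  fix j c
  show "pT (inv_into UNIV p) j c = can W S j c" proof (cases "can W S j c")
   case None
   hence "can W T j c = None" using dom by blast
   hence "p (Inl (j, c)) = Inl (j, c)" by (simp add: pl)
   hence "inv_into UNIV p (Inl (j, c)) = Inl (j, c)" using permutes_inverses(2)[OF pp, of "Inl (j, c)"] by simp
   thus ?thesis using None by (simp add: pT_def)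
  next
   case (Some k)
   hence "inv_into UNIV p (Inl (j, c)) = Inr k" using permutes_inverses(2)[OF pp, of "Inr k"] pr by simp
   thus ?thesis using Some by (simp add: pT_def)
  qed
 qed
 show thesis using that pp sg fT gS by blast
qed

text \<open>Substituting \<open>A\<^sub>k = \<Sum>\<^sub>q u\<^sub>k\<^sub>q w\<^sub>k\<^sub>q\<^sup>T\<close> turns the generating function into a determinant whose Leibniz terms are monomials.\<close>

type_synonym 'a xu_poly = "(xyvar, (uvar, 'a) mpoly) mpoly"

definition rk :: "'a::field gen_poly => (uvar, 'a) mpoly" where
 "rk = subst (%(c, c', k). \<Sum>q<W. Var (True, k, q, c) * Var (False, k, q, c'))"

lemma rk_hom: "comm_ring_hom rk" unfolding rk_def by (rule subst_hom)

lemma rk_EE: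
 "lookup (rk (EE d W m n :: 'a::field gen_poly)) \<mu> =
  (\<Sum>p | p permutes ZZ. if (\<Sum>z\<in>ZZ. kk (Fx W) z (p z)) = m & (\<Sum>z\<in>ZZ. kk (Fu W) z (p z)) = \<mu> then of_int (sign p) * (\<Prod>z\<in>ZZ. sgc z (p z)) else 0)"
proof -
 let ?I = "{..<W} \<times> {..<n}" and ?K = "{..<d * W} \<times> {..<W}"
 let ?h = "ev (%x. Const (rk x)) Var :: 'a xy_poly => 'a xu_poly"
 have hc: "comm_ring_hom (%x :: 'a gen_poly. Const (rk x) :: 'a xu_poly)" by (rule comm_ring_hom_compose[OF Const_hom rk_hom])
 have hh: "comm_ring_hom ?h" by (rule ev_hom[OF hc])
 interpret c: comm_ring_hom "Const :: (uvar, 'a) mpoly => 'a xu_poly" by (rule Const_hom)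
 define U where "U = (%(j, c) (b, q). Var (True, j, b) * Const (Var (True, b div W, q, c :: nat)) :: 'a xu_poly)"
 define V where "V = (%(b, q) (j, c). Var (False, j, b) * Const (Var (False, b div W, q, c :: nat)) :: 'a xu_poly)"
 have "?h (GF d W n) = PD {..<d * W} (%b. b div W) {..<W} n (%j b. Var (True, j, b)) (%j b. Var (False, j, b)) (%k c c'. Const (rk (Var (c, c', k))))"
  unfolding GF_def gf_def by (subst PD_hom[OF hh]) (simp add: hc)
 also have "... = D ?I (%i j. \<Sum>k\<in>?K. U i k * V k j)" unfolding PD_def proof (rule D_cong)
  fix x y :: "nat \<times> nat"
  obtain j c j' c' where xy: "x = (j, c)" "y = (j', c')" by (cases x; cases y)
  show "MM {..<d * W} (%b. b div W) (%j b. Var (True, j, b)) (%j b. Var (False, j, b)) (%k c c'. Const (rk (Var (c, c', k)))) x y = (\<Sum>k\<in>?K. U x k * V k y)"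
   by (simp add: xy MM_def U_def V_def rk_def c.hom_sum c.hom_mult sum_distrib_left sum.cartesian_product case_prod_unfold mult_ac)
 qed
 also have "... = D ZZ (schurF U V)" unfolding ZZ_def by (rule D_schurF(1)[symmetric]) simp_all
 also have "... = (\<Sum>p | p permutes ZZ. of_int (sign p) * (\<Prod>z\<in>ZZ. single (kk (Fx W) z (p z)) (single (kk (Fu W) z (p z)) (sgc z (p z)))))"
 proof -
  have "of_bool (z = w) + schurF U V z w = single (kk (Fx W) z w) (single (kk (Fu W) z w) (sgc z w))" for z w
   by (cases z; cases w) (auto simp: schurF_def kk_def sgc_def U_def V_def Fx_def Fu_def Var_def Const_def mult_single single_uminus split: prod.splits)
  thus ?thesis unfolding D_def Dt_def by simp
 qed
 also have "... = (\<Sum>p | p permutes ZZ. single (\<Sum>z\<in>ZZ. kk (Fx W) z (p z)) (single (\<Sum>z\<in>ZZ. kk (Fu W) z (p z)) (of_int (sign p) * (\<Prod>z\<in>ZZ. sgc z (p z)))))"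
 proof (rule sum.cong[OF refl])
  fix p :: "pos => pos"
  have "sign p = 1 \<or> sign p = - 1" by (simp add: sign_def)
  thus "of_int (sign p) * (\<Prod>z\<in>ZZ. single (kk (Fx W) z (p z)) (single (kk (Fu W) z (p z)) (sgc z (p z) :: 'a))) =
   single (\<Sum>z\<in>ZZ. kk (Fx W) z (p z)) (single (\<Sum>z\<in>ZZ. kk (Fu W) z (p z)) (of_int (sign p) * (\<Prod>z\<in>ZZ. sgc z (p z))))"
   by (auto simp: prod_single[OF finite_ZZ] single_uminus)
 qed
 finally have e: "?h (GF d W n) = (\<Sum>p | p permutes ZZ. single (\<Sum>z\<in>ZZ. kk (Fx W) z (p z)) (single (\<Sum>z\<in>ZZ. kk (Fu W) z (p z)) (of_int (sign p) * (\<Prod>z\<in>ZZ. sgc z (p z)))))" .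
 have "rk (EE d W m n) = lookup (?h (GF d W n)) m" unfolding EE_def by (rule lookup_ev_Const[OF rk_hom, symmetric])
 thus ?thesis unfolding e by (auto simp: lookup_sum lookup_single when_def intro!: sum.cong)
qed

lemma LRT_of_LR: assumes adm: "admissible d W m" and lr: "!!o' s. LR W o' s m" and n: "!!j. ls True True j m <= n"
 shows "LRT d W n (%j b. lookup m (s, j, b))" "cm (%j b. lookup m (s, j, b)) j (d * W) = ls True True j m"
  "MT W (%j b. lookup m (s, j, b)) b 0 = ls False True b m"
proof -
 let ?T = "%j b. lookup m (s, j, b)"
 have k: "keys m <= VV d W" using adm by (simp add: admissible_def)
 have lsT: "ls q s x m = ls q True x m" for q x using adm by (cases s) (auto simp: admissible_def)
 have z: "?T j b = 0" if "W <= j \<or> d * W <= b" for j b proof -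
  have "(s, j, b) \<notin> keys m" using that k by (auto simp: VV_def)
  thus ?thesis by (simp add: in_keys_iff)
 qed
 show row: "cm ?T j (d * W) = ls True True j m" for j using ls_sum[OF k, of True s j] by (simp add: cm_def LL_simps ori_def lsT)
 show "MT W ?T b 0 = ls False True b m" for b using ls_sum[OF k, of False s b] by (simp add: MT_0 LL_simps ori_def lsT)
 show "LRT d W n ?T" unfolding LRT_def proof (intro conjI allI impI)
  show "cm ?T (Suc j) (Suc b) <= cm ?T j b" for j b proof (cases "Suc j < W")
   case True
   hence "Suc j div W = j div W" by simp
   thus ?thesis using lr[of True s] unfolding LR_def cm_def by (auto simp: ori_def lessThan_Suc_atMost)
  qed (simp add: cm_def z)
  show "(\<Sum>i\<le>j. ?T i (Suc b)) <= (\<Sum>i<j. ?T i b)" if "Suc b div W = b div W" for b j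
   using lr[of False s] that unfolding LR_def by (auto simp: ori_def)
  show "cm ?T j (d * W) <= n" for j unfolding row by (rule n)
 qed (use z in auto)
qed

theorem EE_independent: fixes a :: "_ => 'a::field"
 assumes fX: "finite X" and X: "!!m. m \<in> X ==> admissible d W m & (\<forall>o' s. LR W o' s m) & (\<forall>j. ls True True j m <= n) & mdeg m < 2 * W"
  and z: "(\<Sum>m\<in>X. Const (a m) * EE d W m n) = (0 :: 'a gen_poly)" and m: "m \<in> X"
 shows "a m = 0"
proof (rule ccontr)
 assume am: "a m ~= 0"
 define TT where "TT s m = (%j b. lookup m (s, j, b))" for s and m :: "xyvar mon"
 have LT: "LRT d W n (TT s m)" if "m \<in> X" for s m using LRT_of_LR(1)[of m s] X[OF that] unfolding TT_def by blast
 define key where "key m = keyl d W n (can W (TT True m)) @ keyl d W n (can W (TT False m))" for m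
 define Y where "Y = {m \<in> X. a m ~= 0}"
 have Y: "finite Y" "Y ~= {}" using fX am m by (auto simp: Y_def)
 hence "Min (key ` Y) \<in> key ` Y" by (intro Min_in) auto
 then obtain m0 where m0: "m0 \<in> Y" "key m0 = Min (key ` Y)" by auto
 have mn: "key m0 <= key m" if "m \<in> Y" for m unfolding m0(2) using Y that by (intro Min_le) auto
 have m0X: "m0 \<in> X" "a m0 ~= 0" using m0 by (auto simp: Y_def)
 define \<mu> where "\<mu> = AA (Fu W) True (can W (TT True m0)) + AA (Fu W) False (can W (TT False m0))"
 have main: "m = m0 & (\<forall>j<W. \<forall>c<n. pT p j c = can W (TT True m0) j c) & (\<forall>j<W. \<forall>c<n. pT (inv_into UNIV p) j c = can W (TT False m0) j c)"
  if m: "m \<in> Y" and p: "p permutes ZZ" and x: "(\<Sum>z\<in>ZZ. kk (Fx W) z (p z)) = m" and u: "(\<Sum>z\<in>ZZ. kk (Fu W) z (p z)) = \<mu>" for m p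
 proof -
  have mX: "m \<in> X" using m by (simp add: Y_def)
  let ?f = "pT p" and ?g = "pT (inv_into UNIV p)"
  have x': "AA (Fx W) True ?f + AA (Fx W) False ?g = m" using x unfolding sum_kk[OF p] .
  have u': "AA (Fu W) True ?f + AA (Fu W) False ?g = AA (Fu W) True (can W (TT True m0)) + AA (Fu W) False (can W (TT False m0))"
   using u unfolding sum_kk[OF p] \<mu>_def .
  have f: "filling d W n (TT True m) ?f" by (rule filling_pT[OF p, where s = True]) (simp add: TT_def x'[symmetric] lookup_add lookup_AA_Fx)
  have g: "filling d W n (TT False m) ?g"
   by (rule filling_pT[OF permutes_inv[OF p], where s = False]) (simp add: TT_def x'[symmetric] lookup_add lookup_AA_Fx)
  have kf: "keyl d W n ?f = keyl d W n (can W (TT True m0))" "keyl d W n ?g = keyl d W n (can W (TT False m0))" using keyl_eq[OF u'] by auto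
  have len: "length (keyl d W n h) = n" for h by (simp add: keyl_def)
  have le1: "keyl d W n (can W (TT True m)) <= keyl d W n (can W (TT True m0))"
   if "\<exists>j<W. \<exists>c<n. ?f j c ~= can W (TT True m) j c" using keyl_less[OF LT[OF mX] f that] kf by simp
  have eqf: "keyl d W n (can W T) = keyl d W n ?f" if "!!j c. j < W ==> c < n ==> ?f j c = can W T j c" for T
   unfolding keyl_def by (intro map_cong refl sum.cong) (use that in auto)
  have eqg: "keyl d W n (can W T) = keyl d W n ?g" if "!!j c. j < W ==> c < n ==> ?g j c = can W T j c" for T
   unfolding keyl_def by (intro map_cong refl sum.cong) (use that in auto)
  have fc: "?f j c = can W (TT True m) j c" if jc: "j < W" "c < n" for j c proof (rule ccontr)
   assume "?f j c ~= can W (TT True m) j c"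
   hence "keyl d W n (can W (TT True m)) < keyl d W n (can W (TT True m0))" using keyl_less[OF LT[OF mX] f] kf jc by auto
   hence "key m < key m0" unfolding key_def by (rule append_less_same_length) (simp add: len)
   thus False using mn[OF m] by simp
  qed
  have k1: "keyl d W n (can W (TT True m)) = keyl d W n (can W (TT True m0))" using eqf[of "TT True m"] fc kf by simp
  have gc: "?g j c = can W (TT False m) j c" if jc: "j < W" "c < n" for j c proof (rule ccontr)
   assume "?g j c ~= can W (TT False m) j c"
   hence "keyl d W n (can W (TT False m)) < keyl d W n (can W (TT False m0))" using keyl_less[OF LT[OF mX] g] kf jc by auto
   hence "key m < key m0" unfolding key_def k1 by (simp only: append_less_iff)
   thus False using mn[OF m] by simp
  qed
  have sums: "lookup (AA (Fu W) True ?f + AA (Fu W) False ?g) v = lookup (AA (Fu W) True (can W (TT True m0)) + AA (Fu W) False (can W (TT False m0))) v" for v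
   by (simp only: u')
  have "TT True m = TT True m0" proof (rule can_determines[OF LT[OF mX] LT[OF m0X(1)]])
   fix k q c assume c: "c < n"
   have "(\<Sum>j<W. of_bool (\<exists>b. can W (TT True m) j c = Some (b, q) & b div W = k)) = (\<Sum>j<W. of_bool (\<exists>b. ?f j c = Some (b, q) & b div W = k) :: nat)"
    by (rule sum.cong) (simp_all add: fc c)
   also have "... = (\<Sum>j<W. of_bool (\<exists>b. can W (TT True m0) j c = Some (b, q) & b div W = k))"
    using sums[of "(True, k, q, c)"] by (simp add: lookup_add lookup_AA_Fu[OF c])
   finally show "(\<Sum>j<W. of_bool (\<exists>b. can W (TT True m) j c = Some (b, q) & b div W = k)) = (\<Sum>j<W. of_bool (\<exists>b. can W (TT True m0) j c = Some (b, q) & b div W = k) :: nat)" .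
  qed
  moreover have "TT False m = TT False m0" proof (rule can_determines[OF LT[OF mX] LT[OF m0X(1)]])
   fix k q c assume c: "c < n"
   have "(\<Sum>j<W. of_bool (\<exists>b. can W (TT False m) j c = Some (b, q) & b div W = k)) = (\<Sum>j<W. of_bool (\<exists>b. ?g j c = Some (b, q) & b div W = k) :: nat)"
    by (rule sum.cong) (simp_all add: gc c)
   also have "... = (\<Sum>j<W. of_bool (\<exists>b. can W (TT False m0) j c = Some (b, q) & b div W = k))"
    using sums[of "(False, k, q, c)"] by (simp add: lookup_add lookup_AA_Fu[OF c])
   finally show "(\<Sum>j<W. of_bool (\<exists>b. can W (TT False m) j c = Some (b, q) & b div W = k)) = (\<Sum>j<W. of_bool (\<exists>b. can W (TT False m0) j c = Some (b, q) & b div W = k) :: nat)" .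
  qed
  ultimately have t: "TT s m = TT s m0" for s by (cases s) auto
  have "m = m0" proof (rule poly_mapping_eqI)
   fix v :: "xyvar"
   obtain s j b where v: "v = (s, j, b)" by (cases v)
   show "lookup m v = lookup m0 v" using fun_cong[OF fun_cong[OF t[of s], of j], of b] by (simp add: TT_def v)
  qed
  thus ?thesis using fc gc by auto
 qed
 let ?A = "%m p. (\<Sum>z\<in>ZZ. kk (Fx W) z (p z)) = m & (\<Sum>z\<in>ZZ. kk (Fu W) z (p z)) = \<mu>"
 let ?t = "%p. of_int (sign p) * (\<Prod>z\<in>ZZ. sgc z (p z)) :: 'a"
 have adm: "admissible d W m0" "!!o' s. LR W o' s m0" "!!j. ls True True j m0 <= n" "mdeg m0 < 2 * W" using X[OF m0X(1)] by blast+
 have small: "ls False True b m0 < W" for b proof (cases "b < d * W")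
  case True
  have "ls False True b m0 <= (\<Sum>l\<in>LL d W False. ls False True l m0)" by (rule member_le_sum) (use True in "auto simp: LL_simps")
  thus ?thesis using ls_total[OF adm(1), of False] adm(4) by linarith
 next
  case False
  have "keys m0 <= VV d W" using adm(1) by (simp add: admissible_def)
  hence "lookup m0 (s, j, b) = 0" for s j using False by (auto simp: VV_def in_keys_iff)
  hence "ls False True b m0 = 0" using ls_sum[of m0 d W False True b] `keys m0 <= VV d W` by (simp add: ori_def)
  thus ?thesis using adm(4) by simp
 qed
 note L = LRT_of_LR[OF adm(1-3), folded TT_def]
 obtain p0 where p0: "p0 permutes ZZ" "!!z. sgc z (p0 z) ~= (0 :: 'a)" "pT p0 = can W (TT True m0)" "pT (inv_into UNIV p0) = can W (TT False m0)"
  using perm_exists[OF L(1)[of True] L(1)[of False]] L(2,3) small by metis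
 have A0: "?A m0 p0" proof
  show "(\<Sum>z\<in>ZZ. kk (Fu W) z (p0 z)) = \<mu>" unfolding sum_kk[OF p0(1)] p0(3,4) \<mu>_def ..
  show "(\<Sum>z\<in>ZZ. kk (Fx W) z (p0 z)) = m0" proof (rule poly_mapping_eqI)
   fix v :: "xyvar"
   obtain s j b where v: "v = (s, j, b)" by (cases v)
   have c: "(\<Sum>c<n. of_bool (\<exists>q. can W (TT s m0) j c = Some (b, q))) = TT s m0 j b"
    using T_count[OF L(1)[of s], of j b] by (simp add: can_lt)
   show "lookup (\<Sum>z\<in>ZZ. kk (Fx W) z (p0 z)) v = lookup m0 v" proof (cases "j < W")
    case True
    show ?thesis unfolding sum_kk[OF p0(1)] p0(3,4) v lookup_add lookup_AA_Fx[OF True] using c by (cases s) (auto simp: TT_def)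
   next
    case False
    have "lookup (AA (Fx W) s' f) v = 0" for s' f
     unfolding AA_def lookup_sum by (intro sum.neutral ballI) (use False in "auto simp: Fx_def v lookup_single when_def split: option.split")
    moreover have "lookup m0 v = 0" using T_zero[OF L(1)[of s], of j b] False by (simp add: TT_def v)
    ultimately show ?thesis unfolding sum_kk[OF p0(1)] by (simp add: lookup_add)
   qed
  qed
 qed
 have other: "(if ?A m p then ?t p else 0) = (if m = m0 & p = p0 then ?t p0 else 0)" if "m \<in> Y" "p permutes ZZ" for m p
 proof (cases "?A m p")
  case True
  note mm = main[OF that, OF True[THEN conjunct1] True[THEN conjunct2]]
  show ?thesis proof (cases "\<forall>z\<in>ZZ. sgc z (p z) ~= (0 :: 'a)")
   case v: True
   have "p = p0" by (rule perm_unique[OF that(2) p0(1)]) (use v p0 mm in auto)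
   thus ?thesis using True mm by simp
  next
   case v: False
   hence "(\<Prod>z\<in>ZZ. sgc z (p z)) = (0 :: 'a)" using finite_ZZ by (simp add: prod_zero_iff)
   moreover have "p ~= p0" using v p0(2) by auto
   ultimately show ?thesis by simp
  qed
 next
  case False
  thus ?thesis using A0 by auto
 qed
 have fP: "finite {p. p permutes ZZ}" by (rule finite_permutations[OF finite_ZZ])
 interpret r: comm_ring_hom "rk :: 'a gen_poly => _" by (rule rk_hom)
 have "0 = lookup (rk (\<Sum>m\<in>X. Const (a m) * EE d W m n)) \<mu>" by (simp add: z)
 also have "... = (\<Sum>m\<in>X. a m * lookup (rk (EE d W m n :: 'a gen_poly)) \<mu>)" proof -
  have "rk (Const c :: 'a gen_poly) = Const c" for c by (simp add: rk_def)
  thus ?thesis by (simp add: r.hom_sum r.hom_mult lookup_sum lookup_Const_mult)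
 qed
 also have "... = (\<Sum>m\<in>Y. a m * lookup (rk (EE d W m n :: 'a gen_poly)) \<mu>)"
  unfolding Y_def by (rule sum.mono_neutral_right) (use fX in auto)
 also have "... = (\<Sum>m\<in>Y. if m = m0 then a m0 * ?t p0 else 0)" proof (rule sum.cong[OF refl])
  fix m assume m: "m \<in> Y"
  have "lookup (rk (EE d W m n :: 'a gen_poly)) \<mu> = (\<Sum>p | p permutes ZZ. if m = m0 & p = p0 then ?t p0 else 0)"
   unfolding rk_EE by (rule sum.cong[OF refl]) (rule other[OF m], simp)
  also have "... = (if m = m0 then ?t p0 else 0)" by (cases "m = m0") (use p0(1) fP in "simp_all add: sum.delta")
  finally show "a m * lookup (rk (EE d W m n :: 'a gen_poly)) \<mu> = (if m = m0 then a m0 * ?t p0 else 0)" by simp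
 qed
 also have "... = a m0 * ?t p0" using Y m0(1) by (simp add: sum.delta)
 finally have "a m0 * ?t p0 = 0" by simp
 moreover have "?t p0 ~= 0" proof -
  have "(of_int (sign p0) :: 'a) ~= 0" by (simp add: sign_def)
  thus ?thesis using p0(2) finite_ZZ by (simp add: prod_zero_iff)
 qed
 ultimately show False using m0X(2) by simp
qed

end

section \<open>The ideal of relations\<close>

lemma SP_mono: assumes "SP d W S X F" "X <= Y" "finite Y" shows "SP d W S Y (F :: nat => 'a::field gen_poly)"
proof -
 obtain c G where c: "UI S G" "!!N. F N = (\<Sum>m\<in>X. Const (c m) * EE d W m N) + G N" using assms(1) unfolding SP_def by blast
 have "(\<Sum>m\<in>X. Const (c m) * EE d W m N :: 'a gen_poly) = (\<Sum>m\<in>Y. Const (if m \<in> X then c m else 0) * EE d W m N)" for N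
  by (rule sum.mono_neutral_cong_left) (use assms in "auto simp: Const_simps")
 thus ?thesis unfolding SP_def using c by (intro exI[of _ "%m. if m \<in> X then c m else 0"] exI[of _ G]) simp
qed

lemma monoval_list:
 obtains xs where "set xs = keys m" "!!\<phi> :: 'v => 'r::comm_ring_1. monoval \<phi> m = (\<Prod>i<length xs. \<phi> (xs ! i))"
proof -
 obtain l where l: "set l = keys m" "distinct l" using finite_distinct_list[of "keys m"] by auto
 let ?xs = "concat (map (%s. replicate (lookup m s) s) l)"
 have "monoval \<phi> m = (\<Prod>i<length ?xs. \<phi> (?xs ! i))" for \<phi> :: "'v => 'r" proof -
  have "(\<Prod>i<length ?xs. \<phi> (?xs ! i)) = prod_list (map \<phi> ?xs)" by (simp add: prod.list_conv_set_nth atLeast0LessThan)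
  also have "... = prod_list (map (%s. \<phi> s ^ lookup m s) l)" by (induction l) auto
  also have "... = monoval \<phi> m" unfolding monoval_def l(1)[symmetric] using l(2) by (simp add: prod.distinct_set_conv_list)
  finally show ?thesis ..
 qed
 moreover have "set ?xs = keys m" using l(1) by (auto simp: in_keys_iff)
 ultimately show thesis using that by blast
qed

lemma Phi_expand: fixes f :: "'a::field large_sigmaX" shows "Phi_tilde N f = (\<Sum>\<mu>\<in>keys f. Const (lookup f \<mu>) *
   monoval (%s. ct {..<N} (fst (Rep_large_symbol s)) (wm N (snd (Rep_large_symbol s)))) \<mu>)"
proof -
 have "(case Rep_large_symbol s of (t, e) => if t <= N then sigma_mat t (phi N e) else 0) = (ct {..<N} (fst (Rep_large_symbol s)) (wm N (snd (Rep_large_symbol s))) :: 'a gen_poly)" for s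
 proof -
  obtain t e where s: "Rep_large_symbol s = (t, e)" by (cases "Rep_large_symbol s")
  thus ?thesis by (simp add: sigma_mat_phi ct_eq_0)
 qed
 thus ?thesis unfolding Phi_tilde_def subst_eq_ev ev_def by simp
qed

lemma R_GL_eq_range: fixes \<pi> :: "'a::field sigmaX => 'a large_sigmaX" assumes pi: "is_pi_tilde \<pi>"
 shows "range (Phi_tilde n :: 'a large_sigmaX => 'a gen_poly) = R_GL n"
proof
 let ?R = "range (Phi_tilde n :: 'a large_sigmaX => 'a gen_poly)"
 interpret Ph: comm_ring_hom "Phi_tilde n :: 'a large_sigmaX => _" by (rule Phi_hom)
 let ?G = "{sigma_mat t (phi n w) | t w. 1 <= t & t <= n & w ~= []} :: 'a gen_poly set"
 show "?R <= R_GL n" unfolding R_GL_def alg_generated_def proof (intro subsetI InterI, elim imageE)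
  fix x B and f :: "'a large_sigmaX" assume B: "B \<in> {B. subalgebra B & ?G <= B}" and x: "x = Phi_tilde n f"
  have cl: "Const c \<in> B" "u \<in> B ==> v \<in> B ==> u + v \<in> B" "u \<in> B ==> v \<in> B ==> u * v \<in> B" for c u v
   using B by (auto simp: subalgebra_def)
  have B01: "0 \<in> B" "1 \<in> B" using cl(1)[of 0] cl(1)[of 1] by (simp_all add: Const_simps)
  have pw: "u ^ k \<in> B" if "u \<in> B" for u k using that by (induction k) (auto intro: cl B01)
  have pr: "prod h A \<in> B" if "!!a. a \<in> A ==> h a \<in> B" for h and A :: "large_symbol set"
   using that by (induction A rule: infinite_finite_induct) (auto intro: cl B01)
  have sm: "sum h A \<in> B" if "!!a. a \<in> A ==> h a \<in> B" for h and A :: "(large_symbol mon) set"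
   using that by (induction A rule: infinite_finite_induct) (auto intro: cl B01)
  have base: "(case Rep_large_symbol s of (t, e) => if t <= n then sigma_mat t (phi n e) else 0) \<in> B" for s proof -
   obtain t e where s: "Rep_large_symbol s = (t, e)" by (cases "Rep_large_symbol s")
   hence te: "0 < t" "e \<in> X_tilde" using Rep_large_symbol[of s] by auto
   hence "e ~= []" by (auto simp: X_tilde_def primitive_def)
   show ?thesis proof (cases "t <= n")
    case True
    hence "sigma_mat t (phi n e) \<in> ?G" using te `e ~= []` by (intro CollectI exI[of _ t] exI[of _ e]) auto
    thus ?thesis using B True by (auto simp: s)
   qed (simp add: s B01)
  qed
  show "x \<in> B" unfolding x Phi_tilde_def subst_def by (intro sm cl pr pw base)
 qed
 have "subalgebra (?R)" unfolding subalgebra_def proof (intro conjI allI ballI)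
  show "Const c \<in> ?R" for c using Phi_Const[of n c] by (metis rangeI)
  fix u v assume "u \<in> ?R" "v \<in> ?R"
  then obtain f g :: "'a large_sigmaX" where "u = Phi_tilde n f" "v = Phi_tilde n g" by auto
  thus "u + v \<in> ?R" "u * v \<in> ?R" by (simp_all flip: Ph.hom_add Ph.hom_mult)
 qed
 moreover have "?G <= ?R" proof
  fix x assume "x \<in> ?G"
  then obtain t w where tw: "x = sigma_mat t (phi n w)" "1 <= t" "t <= n" "w ~= []" by blast
  have "x = ct {..<n} t (wm n w)" using tw by (simp add: sigma_mat_phi)
  also have "... = Psi n (sg t (word w))" unfolding Psi_sg[OF word_FX[OF tw(4)]] by (rule ct_cong) (simp add: phN_word)
  also have "... = Phi_tilde n (\<pi> (sg t (word w)))" by (rule Phi_pi[OF pi, symmetric])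
  finally show "x \<in> ?R" by simp
 qed
 ultimately show "R_GL n <= ?R" unfolding R_GL_def alg_generated_def by blast
qed

lemma sF_eq_0: "length ws = length ts ==> n < sum_list ts ==> sF ts ws n = 0"
 using lookup_ct_lmat[of "{..<n}" "sum_list ts" "length ws" "%l. wm n (ws ! l)" "tm ts"] by (simp add: sF_def mdeg_tm ct_eq_0)

theorem kernel_in_ideal: fixes \<pi> :: "'a::field sigmaX => 'a large_sigmaX"
 assumes pi: "is_pi_tilde \<pi>" and S: "!!t b. n < t ==> b \<in> X_tilde ==> large_sg t b \<in> S"
  and G: "!!ts ws. 1 < length ts ==> length ws = length ts ==> (\<forall>w\<in>set ws. w ~= []) ==> sorted_wrt (\<ge>) ts ==>
   (\<forall>t\<in>set ts. 0 < t & (\<exists>k. t = CHAR('a) ^ k)) ==>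
   (sum_list ts = n + 1 \<or> n + 1 < sum_list ts & sum_list ts <= 2 * n & sum_list ts - Min (set ts) <= n) ==>
   \<pi> (sigma_multi ts (map word ws)) \<in> S"
  and K: "!!g. g \<in> ideal_generated S ==> Phi_tilde n g = 0" and f: "Phi_tilde n f = 0"
 shows "f \<in> ideal_generated S"
proof -
 have UU: "UU (sF ts ws :: nat => 'a gen_poly)" if "length ws = length ts" "\<forall>w\<in>set ws. w ~= []" for ts ws
  unfolding UU_def using sF_sigma_multi[OF pi that] by metis
 have UI: "UI S (sF ts ws :: nat => 'a gen_poly)" if "length ws = length ts" "\<forall>w\<in>set ws. w ~= []" "n < sum_list ts" for ts ws
 proof (rule sF_UI[OF pi S _ that])
  fix ts :: "nat list" and ws :: "nat list list"
  assume h: "1 < length ts" "length ws = length ts" "\<forall>w\<in>set ws. w ~= []" "sorted_wrt (\<ge>) ts" "\<forall>t\<in>set ts. 0 < t & (\<exists>k. t = CHAR('a) ^ k)"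
   "sum_list ts = n + 1 \<or> n + 1 < sum_list ts & sum_list ts <= 2 * n & sum_list ts - Min (set ts) <= n"
  show "UI S (sF ts ws :: nat => 'a gen_poly)" unfolding UI_def
   by (rule bexI[of _ "\<pi> (sigma_multi ts (map word ws))"]) (simp_all add: sF_sigma_multi[OF pi h(2,3)] ideal_generated_base[OF G[OF h]])
 qed
 have H: "UI S (EE d W m :: nat => 'a gen_poly)" if "n < ls True True j m" for d W j m proof (cases "admissible d W m")
  case True
  have "rowm j False = linem True j False" by (auto simp: rowm_def linem_def ori_def fun_eq_iff)
  hence "n < wt (rowm j False) m" using that True by (simp add: admissible_def ls_def)
  hence "UI S (%N. lookup (gf {..<d * W} (%b. b div W) {..<W} N) m :: 'a gen_poly)" by (intro gf_UI[OF _ _ UU UI]) auto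
  thus ?thesis unfolding EE_def GF_def .
 next
  case False
  hence "EE d W m = (%N. 0 :: 'a gen_poly)" using EE_admissible by blast
  thus ?thesis by (simp add: UI_0)
 qed
 define E where "E s = snd (Rep_large_symbol s)" for s
 define t where "t s = fst (Rep_large_symbol s)" for s
 have te: "0 < t s" "E s \<in> X_tilde" for s using Rep_large_symbol[of s] by (auto simp: t_def E_def case_prod_unfold)
 have E0: "E s ~= []" for s using te(2)[of s] by (auto simp: X_tilde_def primitive_def)
 have "finite (\<Union>\<mu>\<in>keys f. \<Union>s\<in>keys \<mu>. set (E s))" by simp
 then obtain d where d: "(\<Union>\<mu>\<in>keys f. \<Union>s\<in>keys \<mu>. set (E s)) <= {..<d}" using finite_nat_iff_bounded by blast
 have "\<exists>xs. set xs = keys \<mu> & (\<forall>\<phi> :: large_symbol => 'a gen_poly. monoval \<phi> \<mu> = (\<Prod>i<length xs. \<phi> (xs ! i)))" for \<mu> :: "large_symbol mon"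
  using monoval_list[of \<mu>, where 'r = "'a gen_poly"] by metis
 then obtain xs where xs: "!!\<mu>. set (xs \<mu>) = keys \<mu>" "!!\<mu> (\<phi> :: large_symbol => 'a gen_poly). monoval \<phi> \<mu> = (\<Prod>i<length (xs \<mu>). \<phi> (xs \<mu> ! i))"
  by metis
 define rr where "rr \<mu> = (\<Sum>i<length (xs \<mu>). t (xs \<mu> ! i) * length (E (xs \<mu> ! i)))" for \<mu>
 have "finite (rr ` keys f)" by simp
 then obtain W where W: "rr ` keys f <= {..<W}" using finite_nat_iff_bounded by blast
 define X where "X = {m. keys m <= VV d W & mdeg m < 2 * W & admissible d W m & (\<forall>o' s. LR W o' s m) & (\<forall>j. ls True True j m <= n)}"
 have fX: "finite X" proof (rule finite_subset)
  show "X <= (\<Union>r<2 * W. Kf d W r)" by (auto simp: X_def Kf_def)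
 qed simp
 have mon: "SP d W S X (%N. monoval (%s. ct {..<N} (t s) (wm N (E s)) :: 'a gen_poly) \<mu>)" if \<mu>: "\<mu> \<in> keys f" for \<mu>
 proof -
  let ?h = "length (xs \<mu>)" and ?es = "%i. E (xs \<mu> ! i)" and ?ks = "%i. t (xs \<mu> ! i)"
  have rW: "rr \<mu> < W" using W \<mu> by auto
  have "(\<Sum>i<?h. length (?es i)) <= rr \<mu>" unfolding rr_def by (rule sum_mono) (use te(1) in "simp add: Suc_leI")
  hence le: "(\<Sum>i<?h. length (?es i)) <= W" using rW by simp
  have sd: "set (?es i) <= {..<d}" if "i < ?h" for i proof -
   have "xs \<mu> ! i \<in> keys \<mu>" using nth_mem[OF that] xs(1) by simp
   thus ?thesis using d \<mu> by blast
  qed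
  obtain m c where m: "mdeg m = 2 * rr \<mu>" "!!N. (\<Prod>i<?h. ct {..<N} (?ks i) (wm N (?es i))) = Const c * (EE d W m N :: 'a gen_poly)"
   using cycle_monomial[of ?h ?es d W ?ks, OF E0 sd le, where 'a = 'a] unfolding rr_def by blast
  have "SP d W S {m \<in> Kf d W (2 * rr \<mu>). admissible d W m & (\<forall>o' s. LR W o' s m) & (\<forall>j. ls True True j m <= n)} (EE d W m :: nat => 'a gen_poly)"
   by (rule straighten[OF rW m(1) H])
  hence "SP d W S X (EE d W m :: nat => 'a gen_poly)" by (rule SP_mono) (use fX rW in "auto simp: X_def Kf_def")
  thus ?thesis unfolding xs(2) m(2) by (rule SP_cmult)
 qed
 have "SP d W S X (%N. Phi_tilde N f)" unfolding Phi_expand t_def[symmetric] E_def[symmetric] by (intro SP_sum SP_cmult mon)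
 then obtain a F where aF: "UI S F" "!!N. Phi_tilde N f = (\<Sum>m\<in>X. Const (a m) * EE d W m N) + F N" unfolding SP_def by blast
 obtain g where g: "g \<in> ideal_generated S" "!!N. F N = Phi_tilde N g" using aF(1) unfolding UI_def by blast
 have z0: "(\<Sum>m\<in>X. Const (a m) * EE d W m n) = (0 :: 'a gen_poly)" using aF(2)[of n] f g K by simp
 have a0: "a m = 0" if "m \<in> X" for m by (rule EE_independent[OF fX _ z0 that]) (auto simp: X_def)
 interpret Ph: comm_ring_hom "Phi_tilde N :: 'a large_sigmaX => _" for N by (rule Phi_hom)
 have "Phi_tilde N (f - g) = 0" for N using aF(2)[of N] g(2) a0 by (simp add: Ph.hom_minus Const_simps)
 hence "f - g = 0" using Phi_faithful by blast
 thus ?thesis using g(1) by simp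
qed

theorem mainTheorem4:
  fixes n :: nat and \<pi> :: "'a::field sigmaX \<Rightarrow> 'a large_sigmaX"
  assumes "infinite (UNIV :: 'a set)"
    and "1 < n"
    and "is_pi_tilde \<pi>"
  shows "range (Phi_tilde n :: 'a large_sigmaX \<Rightarrow> 'a gen_poly) = R_GL n \<and>
    (K_tilde n :: 'a large_sigmaX set) = ideal_generated
      ({\<pi> (sigma_multi ts (map word as)) | ts as.
          1 < length ts \<and> length as = length ts \<and> (\<forall>a\<in>set as. a \<noteq> []) \<and>
          sorted_wrt (\<ge>) ts \<and>
          (\<forall>t\<in>set ts. 0 < t \<and> (\<exists>k. t = CHAR('a) ^ k)) \<and>
          (sum_list ts = n + 1 \<or>
           n + 1 < sum_list ts \<and> sum_list ts \<le> 2 * n \<and> sum_list ts - Min (set ts) \<le> n)} \<union>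
       {large_sg t b | t b. n < t \<and> b \<in> X_tilde})"
    (is "_ \<and> _ = ideal_generated (?S1 \<union> ?S2)")
proof
 let ?S = "?S1 Un ?S2"
 have K: "Phi_tilde n g = 0" if "g \<in> ideal_generated ?S" for g proof (rule ideal_generated_zero[OF Phi_hom _ that])
  fix s assume "s \<in> ?S"
  then consider ts as where "s = \<pi> (sigma_multi ts (map word as))" "length as = length ts" "\<forall>a\<in>set as. a ~= []" "n < sum_list ts"
   | t b where "s = large_sg t b" "n < t" "b \<in> X_tilde" by fastforce
  thus "Phi_tilde n s = 0" proof cases
   case 1
   thus ?thesis by (simp add: sF_sigma_multi[OF assms(3)] sF_eq_0)
  next
   case 2
   thus ?thesis by (simp add: Phi_large_sg ct_eq_0)
  qed
 qed
 show "range (Phi_tilde n :: 'a large_sigmaX => 'a gen_poly) = R_GL n" by (rule R_GL_eq_range[OF assms(3)])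
 show "K_tilde n = ideal_generated ?S" proof (intro equalityI subsetI)
  fix f :: "'a large_sigmaX" assume "f \<in> K_tilde n"
  hence f0: "Phi_tilde n f = 0" by (simp add: K_tilde_def)
  show "f \<in> ideal_generated ?S" proof (rule kernel_in_ideal[OF assms(3) _ _ K f0])
   show "large_sg t b \<in> ?S" if "n < t" "b \<in> X_tilde" for t b using that by blast
  qed blast
 qed (simp add: K_tilde_def K)
qed

end
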